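(* Let $n\ge 2$, $\lambda\ge 1$, $\Lambda>0$, and let $g(x)=\{g_{ij}(x)\}_{i,j=1}^n$, $x\in\mathbb{R}^n$, be a real symmetric matrix-valued function such that $$\lambda^{-1}|\xi|_n^2\le g_{ij}(x)\xi_i\xi_j\le \lambda|\xi|_n^2\quad\text{for all }x,\xi\in\mathbb{R}^n,\qquad \sum_{i,j=1}^n|g_{ij}(x)-g_{ij}(y)|\le\Lambda|x-y|_n\quad\text{for all }x,y\in\mathbb{R}^n .$$ Let $\Omega\subset\mathbb{R}^n$ be a bounded open set and let $\phi\in C^2(\overline{\Omega})$ be real-valued with $\nabla\phi(x)\ne 0$ for every $x\in\overline{\Omega}$. Assume that there is a constant $c_0>0$ such that, for almost every $x\in\Omega$ and all $\xi\in\mathbb{R}^n$, $\tau\in\mathbb{R}$, writing $\zeta=\xi+\mathrm{i}\tau\nabla\phi(x)$, $$P(x,\zeta)=0\ \text{ and }\ \zeta\neq 0\quad\Longrightarrow\quad Q(x,\xi,\tau)\ge c_0|\zeta|^2 .$$ Then there exist $C>0$ and $\tau_0>0$ such that for every $u\in C_0^\infty(\Omega)$ and every $\tau\ge\tau_0$ $$\tau\int_\Omega\left(|\nabla_g u|^2+\tau^2u^2\right)e^{2\tau\phi}\,dx\le C\int_\Omega|\Delta_g u|^2e^{2\tau\phi}\,dx .$$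
   Context: Summation over repeated indices is used. $|\cdot|_n$ is the Euclidean norm on $\mathbb{R}^n$; $\{g^{ij}(x)\}$ is the inverse matrix of $g(x)=\{g_{ij}(x)\}$. For real vectors $\xi,\eta$ at $x$, $\langle\xi,\eta\rangle=g_{ij}(x)\xi_i\eta_j$ and $|\xi|^2=\langle\xi,\xi\rangle$; for $\zeta=\xi+\mathrm{i}\eta$ with $\xi,\eta$ real, $|\zeta|^2=|\xi|^2+|\eta|^2$. Functions $u$ are real-valued. $\nabla_g f=g^{-1}\nabla f$, so $|\nabla_g u|^2=g^{ij}\partial_iu\,\partial_ju$, and $\Delta_g u=\operatorname{div}(\nabla_g u)=\partial_i(g^{ij}\partial_iu)$ understood as $\partial_i(g^{ij}\partial_ju)$. For $\zeta\in\mathbb{C}^n$ put $P(x,\zeta)=g^{jk}(x)\zeta_j\zeta_k$ (no conjugation), $P^{(l)}(x,\zeta)=2g^{lk}(x)\zeta_k$ and $P_{(s)}(x,\zeta)=\partial_sg^{jk}(x)\,\zeta_j\zeta_k$ for $l,s=1,\dots,n$ (the derivatives $\partial_s g^{jk}$ exist almost everywhere since $g$ is Lipschitz). For $\xi\in\mathbb{R}^n$, $\tau\in\mathbb{R}\setminus\{0\}$ and $\zeta=\xi+\mathrm{i}\tau\nabla\phi(x)$, define $$Q(x,\xi,\tau)=\partial^2_{jk}\phi(x)\,P^{(j)}(x,\zeta)\,\overline{P^{(k)}(x,\zeta)}+\tau^{-1}\operatorname{Im}\left(P_{(k)}(x,\zeta)\,\overline{P^{(k)}(x,\zeta)}\right),$$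 and extend $Q$ to $\tau=0$ by continuity in $\tau$. *)

theory Defs
  imports "HOL-Analysis.Analysis"
begin

text \<open>
  The \<open>s\<close>-th partial derivative. At points where it does not exist the value is an
  unspecified real; below it is only applied to functions that are locally Lipschitz, for which
  this happens on a Lebesgue null set.
\<close>
definition pdiff :: "'n::finite \<Rightarrow> (real^'n \<Rightarrow> real) \<Rightarrow> real^'n \<Rightarrow> real"
  where "pdiff s f x = deriv (\<lambda>t. f (x + t *\<^sub>R axis s 1)) 0"

definition grad :: "(real^'n::finite \<Rightarrow> real) \<Rightarrow> real^'n \<Rightarrow> real^'n"
  where "grad f x = (\<chi> i. pdiff i f x)"

definition divergence :: "(real^'n::finite \<Rightarrow> real^'n) \<Rightarrow> real^'n \<Rightarrow> real"
  where "divergence F x = (\<Sum>i\<in>UNIV. pdiff i (\<lambda>y. F y $ i) x)"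

text \<open>
  Every iterated partial derivative is everywhere (totally) differentiable, hence continuous.
\<close>
definition smooth :: "(real^'n::finite \<Rightarrow> real) \<Rightarrow> bool"
  where "smooth u \<longleftrightarrow> (\<forall>is. foldr pdiff is u differentiable_on UNIV)"

text \<open>
  The elements of \<open>C\<^sub>0\<^sup>\<infinity>(\<Omega>)\<close> are represented by their extensions by zero to the whole space.
\<close>
definition test_function :: "(real^'n::finite) set \<Rightarrow> (real^'n \<Rightarrow> real) \<Rightarrow> bool"
  where "test_function \<Omega> u \<longleftrightarrow>
    smooth u \<and> compact (closure {x. u x \<noteq> 0}) \<and> closure {x. u x \<noteq> 0} \<subseteq> \<Omega>"

text \<open>
  \<open>\<phi> \<in> C\<^sup>2(closure \<Omega>)\<close>: \<open>\<phi>\<close> is twice continuously differentiable in the open set \<open>\<Omega>\<close>, and it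
  and its derivatives of order at most two extend continuously to the closure. The fields
  \<open>d\<phi>\<close> and \<open>d2\<phi>\<close> are the gradient and the Hessian together with these extensions; their values
  on the closure are uniquely determined by \<open>\<phi>\<close>.
\<close>
definition C2_closure ::
  "(real^'n::finite) set \<Rightarrow> (real^'n \<Rightarrow> real) \<Rightarrow> (real^'n \<Rightarrow> real^'n) \<Rightarrow> (real^'n \<Rightarrow> real^'n^'n) \<Rightarrow> bool"
  where "C2_closure \<Omega> \<phi> d\<phi> d2\<phi> \<longleftrightarrow>
    continuous_on (closure \<Omega>) \<phi> \<and> continuous_on (closure \<Omega>) d\<phi> \<and> continuous_on (closure \<Omega>) d2\<phi> \<and>
    (\<forall>x\<in>\<Omega>. GDERIV \<phi> x :> d\<phi> x \<and> (d\<phi> has_derivative (\<lambda>h. d2\<phi> x *v h)) (at x))"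

definition inner_g :: "(real^'n::finite \<Rightarrow> real^'n^'n) \<Rightarrow> real^'n \<Rightarrow> real^'n \<Rightarrow> real^'n \<Rightarrow> real"
  where "inner_g g x \<xi> \<eta> = (\<Sum>i\<in>UNIV. \<Sum>j\<in>UNIV. g x $ i $ j * \<xi> $ i * \<eta> $ j)"

definition g_inv :: "(real^'n::finite \<Rightarrow> real^'n^'n) \<Rightarrow> real^'n \<Rightarrow> real^'n^'n"
  where "g_inv g x = matrix_inv (g x)"

definition grad_g :: "(real^'n::finite \<Rightarrow> real^'n^'n) \<Rightarrow> (real^'n \<Rightarrow> real) \<Rightarrow> real^'n \<Rightarrow> real^'n"
  where "grad_g g f x = g_inv g x *v grad f x"

definition laplace_g :: "(real^'n::finite \<Rightarrow> real^'n^'n) \<Rightarrow> (real^'n \<Rightarrow> real) \<Rightarrow> real^'n \<Rightarrow> real"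
  where "laplace_g g u = divergence (grad_g g u)"

text \<open>The square of \<open>|\<zeta>|\<close>; it is taken with respect to \<open>g x\<close>, not the Euclidean metric.\<close>
definition cnorm_sq_g :: "(real^'n::finite \<Rightarrow> real^'n^'n) \<Rightarrow> real^'n \<Rightarrow> complex^'n \<Rightarrow> real"
  where "cnorm_sq_g g x \<zeta> =
    inner_g g x (\<chi> j. Re (\<zeta> $ j)) (\<chi> j. Re (\<zeta> $ j)) + inner_g g x (\<chi> j. Im (\<zeta> $ j)) (\<chi> j. Im (\<zeta> $ j))"

definition P_symb :: "(real^'n::finite \<Rightarrow> real^'n^'n) \<Rightarrow> real^'n \<Rightarrow> complex^'n \<Rightarrow> complex"
  where "P_symb g x \<zeta> = (\<Sum>j\<in>UNIV. \<Sum>k\<in>UNIV. of_real (g_inv g x $ j $ k) * \<zeta> $ j * \<zeta> $ k)"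

text \<open>\<open>P\<^sup>(\<^sup>l\<^sup>)\<close> and \<open>P\<^sub>(\<^sub>s\<^sub>)\<close>, the derivatives of the symbol in \<open>\<zeta>\<close> and in \<open>x\<close>.\<close>
definition P_up :: "(real^'n::finite \<Rightarrow> real^'n^'n) \<Rightarrow> 'n \<Rightarrow> real^'n \<Rightarrow> complex^'n \<Rightarrow> complex"
  where "P_up g l x \<zeta> = 2 * (\<Sum>k\<in>UNIV. of_real (g_inv g x $ l $ k) * \<zeta> $ k)"

definition P_low :: "(real^'n::finite \<Rightarrow> real^'n^'n) \<Rightarrow> 'n \<Rightarrow> real^'n \<Rightarrow> complex^'n \<Rightarrow> complex"
  where "P_low g s x \<zeta> =
    (\<Sum>j\<in>UNIV. \<Sum>k\<in>UNIV. of_real (pdiff s (\<lambda>y. g_inv g y $ j $ k) x) * \<zeta> $ j * \<zeta> $ k)"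

text \<open>\<open>\<xi> + \<i> \<tau> \<nabla>\<phi>(x)\<close>, where \<open>d\<phi>\<close> is the gradient field of \<open>\<phi>\<close>.\<close>
definition zeta_vec ::
  "(real^'n::finite \<Rightarrow> real^'n) \<Rightarrow> real^'n \<Rightarrow> real^'n \<Rightarrow> real \<Rightarrow> complex^'n"
  where "zeta_vec d\<phi> x \<xi> \<tau> = (\<chi> j. Complex (\<xi> $ j) (\<tau> * d\<phi> x $ j))"

text \<open>
  The formula for \<open>Q\<close> when \<open>\<tau> \<noteq> 0\<close>. The Hermitian sum is real because the Hessian is
  symmetric, so \<open>Re\<close> is only a coercion to the reals.
\<close>
definition Q_nz ::
  "(real^'n::finite \<Rightarrow> real^'n^'n) \<Rightarrow> (real^'n \<Rightarrow> real^'n) \<Rightarrow> (real^'n \<Rightarrow> real^'n^'n) \<Rightarrow>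
    real^'n \<Rightarrow> real^'n \<Rightarrow> real \<Rightarrow> real"
  where "Q_nz g d\<phi> d2\<phi> x \<xi> \<tau> =
    (let \<zeta> = zeta_vec d\<phi> x \<xi> \<tau> in
      Re (\<Sum>j\<in>UNIV. \<Sum>k\<in>UNIV. of_real (d2\<phi> x $ j $ k) * P_up g j x \<zeta> * cnj (P_up g k x \<zeta>))
      + inverse \<tau> * Im (\<Sum>k\<in>UNIV. P_low g k x \<zeta> * cnj (P_up g k x \<zeta>)))"

definition Q_form ::
  "(real^'n::finite \<Rightarrow> real^'n^'n) \<Rightarrow> (real^'n \<Rightarrow> real^'n) \<Rightarrow> (real^'n \<Rightarrow> real^'n^'n) \<Rightarrow>
    real^'n \<Rightarrow> real^'n \<Rightarrow> real \<Rightarrow> real"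
  where "Q_form g d\<phi> d2\<phi> x \<xi> \<tau> =
    (if \<tau> = 0 then Lim (at 0) (Q_nz g d\<phi> d2\<phi> x \<xi>) else Q_nz g d\<phi> d2\<phi> x \<xi> \<tau>)"

end

theory Submission imports Defs "HOL-Probability.Distributions" "HOL-Computational_Algebra.Polynomial" begin
text \<open>
Write \<open>A\<close> for the inverse metric, \<open>p\<close> for the gradient of the weight, and conjugate: \<open>v = exp (tau phi) u\<close>. If \<open>A\<close>
is replaced by a smooth matrix \<open>a\<close>, the conjugated operator is \<open>S + T\<close> up to lower order terms, with
\<open>S v = a : D^2 v + tau^2 (p . a p) v\<close> and \<open>T v = - 2 tau p . a grad v\<close>. An integration by parts
(\<open>commutator_identity\<close>) shows that the cross term of \<open>|S v + T v|^2\<close> is \<open>2 tau\<close> times the integral of a quadratic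
form \<open>jf\<close> in \<open>(grad v, tau v)\<close> that contains only first derivatives of \<open>a\<close>. Pseudoconvexity controls \<open>jf\<close> only on a cone, and the cone is
enlarged to all vectors at the price of two terms: \<open>w (grad v . a grad v - tau^2 (p . a p) v^2)\<close> with a bounded function
\<open>w\<close>, and a multiple of \<open>(p . a grad v)^2\<close>. The second is part of \<open>|T v|^2\<close>, and the first becomes
\<open>- w v S v\<close> plus terms with \<open>grad w\<close> after an integration by parts.

Neither \<open>A\<close> nor \<open>w\<close> is differentiable, so both are averaged over balls of radius \<open>eps = M / tau\<close>. Then
\<open>|a - A| = O(M / tau)\<close>, which together with a weighted estimate of second derivatives makes the error of replacing \<open>A\<close>
lower order, while \<open>|grad w| = O(tau / M)\<close> is absorbed for large \<open>M\<close>. The lower bound for the form survives the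
averaging because the form is affine in \<open>w\<close> and in the derivatives of \<open>A\<close>, the only data that are not
continuous (\<open>averaged_lower_bound\<close>).

One loss remains. The ball around a point near the boundary leaves \<open>Om\<close>, and nothing is assumed there. The loss is a multiple
of the energy weighted with the fraction \<open>ext_density\<close> of the ball that lies outside. It is small since \<open>v\<close>
vanishes on that fraction: on the scale \<open>1 / tau\<close> the coefficients are almost constant and \<open>S v = 0\<close> is an elliptic
equation with constant coefficients, whose solutions are analytic with uniform bounds, so that a solution vanishing on a definite
part of a ball is small at the centre (\<open>vanishing_set_bound\<close>, \<open>mass_near_exterior\<close>). Together these give
\<open>carleman_estimate\<close>, from which the theorem follows by expressing metric and symbol through \<open>A\<close>, \<open>G\<close> and \<open>p\<close>.
\<close>

text \<open>In the names below \<open>LI\<close> and \<open>NI\<close> are the Bochner and the nonnegative integral over the whole space,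
and \<open>*.\<close> is scalar multiplication.\<close>

abbreviation lborel_integral :: "('a::euclidean_space => 'b::{banach,second_countable_topology}) => 'b" (binder "LI " 10)
 where "lborel_integral f == integral\<^sup>L lborel f"
abbreviation lborel_nn_integral :: "('a::euclidean_space => ennreal) => ennreal" (binder "NI " 10)
 where "lborel_nn_integral f == integral\<^sup>N lborel f"
abbreviation gauss :: "real => 'a::real_inner => real" where "gauss b z == exp (- b * (z \<bullet> z))"
abbreviation borel_fun :: "('a::topological_space => 'b::topological_space) set" where "borel_fun == borel_measurable borel"
lemmas real_vector_deriv = has_real_derivative_iff_has_vector_derivative
lemmas linear_vector_deriv = bounded_linear.has_vector_derivative
lemmas borel_cont = borel_measurable_continuous_onI
lemmas mv_linear = matrix_vector_mul_linear
lemmas cauchy_schwarz = Cauchy_Schwarz_ineq2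
notation scaleR (infixr "*." 75)
lemmas lint_nonneg = Bochner_Integration.integral_nonneg
lemmas on_UNIV = continuous_on_subset[OF _ subset_UNIV]

section \<open>Lipschitz functions are differentiable along almost every line\<close>

text \<open>Vitali covering: disjoint short intervals of slope at most \<open>p\<close>, taken inside an open set of almost the
same measure as \<open>E\<close>, cover \<open>E\<close> up to a null set. Monotonicity turns their images into
intervals of at most \<open>p\<close> times their length, and the Lipschitz bound disposes of the null set.\<close>

lemma emeasure_image_le_of_small_slopes:
 fixes F Fi :: "real => real"
 assumes mono: "strict_mono F" and inv: "!!x. Fi (F x) = x" "!!y. F (Fi y) = y"
  and cFi: "continuous_on UNIV Fi"
  and lip: "!!x y. \<bar>F x - F y\<bar> <= C * \<bar>x - y\<bar>"
  and E: "E \<in> sets borel" and p: "p >= 0"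
  and cov: "!!x d. x \<in> E ==> d > 0 ==> \<exists>a b. a < x & x < b & b - a < d & F b - F a <= p * (b - a)"
 shows "emeasure lborel (F ` E) <= ennreal p * emeasure lborel E"
proof -
 have Fim: "F ` X = Fi -` X" for X
  using inv by (auto simp: image_iff) metis
 have Fiborel: "F ` X \<in> sets borel" if "X \<in> sets borel" for X
  unfolding Fim by (rule measurable_sets_borel[OF borel_cont[OF cFi] that])
 have bound: "emeasure lborel (F ` E) <= ennreal p * (emeasure lborel E + ennreal eta)" if eta: "eta > 0" for eta :: real
 proof -
  obtain U where U: "open U" "E <= U" "emeasure lborel (U - E) < ennreal eta"
   using outer_regular_lborel[OF E eta] by blast
  define K where "K = {(a,b). a < b & {a..b} <= U & F b - F a <= p * (b - a)}"
  define c where "c = (%(a::real,b). (a+b)/2)"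
  define r where "r = (%(a::real,b). (b-a)/2)"
  have cb: "cball (c i) (r i) = {fst i..snd i}" if "i \<in> K" for i
   using that unfolding K_def c_def r_def
   by (cases i) (auto simp: cball_def dist_real_def abs_le_iff field_simps)
  obtain \<C> where \<C>: "countable \<C>" "\<C> <= K"
    "pairwise (%i j. disjnt (cball (c i) (r i)) (cball (c j) (r j))) \<C>"
    "negligible (E - (\<Union>i \<in> \<C>. cball (c i) (r i)))"
  proof (rule Vitali_covering_theorem_cballs[of K r E c])
   show "0 < r i" if "i \<in> K" for i using that by (auto simp: K_def r_def)
   show "\<exists>i. i \<in> K & x \<in> cball (c i) (r i) & r i < d" if x: "x \<in> E" and d: "0 < d" for x d
   proof -
    obtain e where e: "e > 0" "ball x e <= U" using U x by (meson open_contains_ball subsetD)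
    obtain a b where ab: "a < x" "x < b" "b - a < min d e" "F b - F a <= p * (b - a)"
     using cov[OF x, of "min d e"] d e by auto
    have "{a..b} <= ball x e" using ab by (auto simp: dist_real_def)
    then have "(a,b) \<in> K" using ab e by (auto simp: K_def)
    then show ?thesis using ab d cb[of "(a,b)"] by (intro exI[of _ "(a,b)"]) (auto simp: r_def)
   qed
  qed auto
  define I where "I = (%i::real\<times>real. {fst i..snd i})"
  have disj: "disjoint_family_on I \<C>"
   unfolding disjoint_family_on_def I_def
   using \<C>(2,3) cb unfolding pairwise_def disjnt_def by (metis subsetD)
  have UnI: "(\<Union>i \<in> \<C>. cball (c i) (r i)) = (\<Union>i\<in>\<C>. I i)"
   by (rule SUP_cong[OF refl]) (use \<C>(2) cb in "auto simp: I_def")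
  have IB: "I i \<in> sets borel" for i by (auto simp: I_def)
  have UB: "(\<Union>i\<in>\<C>. I i) \<in> sets borel" using \<C>(1) IB by blast
  have "negligible (F ` (E - (\<Union>i\<in>\<C>. I i)))"
  proof (rule negligible_locally_Lipschitz_image)
   show "negligible (E - (\<Union>i\<in>\<C>. I i))" using \<C>(4) UnI by simp
   fix x assume "x \<in> E - (\<Union>i\<in>\<C>. I i)"
   show "\<exists>T B. open T & x \<in> T & (\<forall>y\<in>(E - (\<Union>i\<in>\<C>. I i)) \<inter> T. norm (F y - F x) <= B * norm (y - x))"
    by (rule exI[of _ UNIV], rule exI[of _ C]) (use lip in auto)
  qed simp
  then have "F ` (E - (\<Union>i\<in>\<C>. I i)) \<in> null_sets lebesgue" by (simp add: negligible_iff_null_sets)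
  then have n0: "emeasure lborel (F ` (E - (\<Union>i\<in>\<C>. I i))) = 0"
   using Fiborel[of "E - (\<Union>i\<in>\<C>. I i)"] E UB by (simp add: null_sets_def)
  have lenF: "emeasure lborel (F ` I i) <= ennreal p * emeasure lborel (I i)" if i: "i \<in> \<C>" for i
  proof -
   obtain a b where ab: "i = (a,b)" by (cases i)
   have K: "a < b" "F b - F a <= p * (b - a)" using \<C>(2) i ab by (auto simp: K_def)
   have "F ` I i <= {F a..F b}" using ab strict_mono_mono[OF mono] by (auto simp: I_def mono_def)
   then have "emeasure lborel (F ` I i) <= emeasure lborel {F a..F b}" by (intro emeasure_mono) auto
   also have "... = ennreal (F b - F a)"
    using K mono by (simp add: strict_mono_less_eq less_imp_le)
   also have "... <= ennreal (p * (b - a))" using K by (simp add: ennreal_leI)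
   also have "... = ennreal p * emeasure lborel (I i)"
    using K ab p by (simp add: I_def ennreal_mult)
   finally show ?thesis .
  qed
  have "emeasure lborel (F ` E) <= emeasure lborel (F ` (E - (\<Union>i\<in>\<C>. I i)) \<union> F ` (\<Union>i\<in>\<C>. I i))"
   by (intro emeasure_mono) (use Fiborel E UB in auto)
  also have "... <= emeasure lborel (F ` (E - (\<Union>i\<in>\<C>. I i))) + emeasure lborel (F ` (\<Union>i\<in>\<C>. I i))"
   by (rule emeasure_subadditive) (use Fiborel E UB in auto)
  also have "... = emeasure lborel (\<Union>i\<in>\<C>. F ` I i)" using n0 by (simp add: image_UN)
  also have "... = (\<integral>\<^sup>+i. emeasure lborel (F ` I i) \<partial>count_space \<C>)"
  proof (rule emeasure_UN_countable)
   show "disjoint_family_on (%i. F ` I i) \<C>"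
    using disj unfolding disjoint_family_on_def
    by (metis image_Int image_empty strict_mono_imp_inj_on[OF mono])
  qed (use Fiborel IB \<C> in auto)
  also have "... <= (\<integral>\<^sup>+i. ennreal p * emeasure lborel (I i) \<partial>count_space \<C>)"
   by (intro nn_integral_mono) (use lenF in auto)
  also have "... = ennreal p * (\<integral>\<^sup>+i. emeasure lborel (I i) \<partial>count_space \<C>)"
   by (rule nn_integral_cmult) auto
  also have "(\<integral>\<^sup>+i. emeasure lborel (I i) \<partial>count_space \<C>) = emeasure lborel (\<Union>i\<in>\<C>. I i)"
   by (rule emeasure_UN_countable[symmetric]) (use IB \<C> disj in auto)
  also have "emeasure lborel (\<Union>i\<in>\<C>. I i) <= emeasure lborel U"
   proof (intro emeasure_mono UN_least)
   show "I i <= U" if "i \<in> \<C>" for i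
    using \<C>(2) that by (cases i) (auto simp: K_def I_def)
  qed (use U(1) in auto)
  also have "emeasure lborel U <= emeasure lborel E + emeasure lborel (U - E)"
   using emeasure_subadditive[of E lborel "U - E"] U E by (simp add: Un_absorb1)
  also have "... <= emeasure lborel E + ennreal eta" using U(3) by (intro add_left_mono) auto
  finally show ?thesis by (simp add: mult_left_mono)
 qed
 have "emeasure lborel (F ` E) <= ennreal p * emeasure lborel E + ennreal eps" if "eps > 0" for eps
 proof -
  have "emeasure lborel (F ` E) <= ennreal p * (emeasure lborel E + ennreal (eps/(p+1)))"
   using bound p that by simp
  also have "... = ennreal p * emeasure lborel E + ennreal (p * (eps/(p+1)))"
   using p that by (simp add: distrib_left ennreal_mult[symmetric])
  also have "ennreal (p * (eps/(p+1))) <= ennreal eps"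
   using p that by (intro ennreal_leI) (simp add: field_simps)
  finally show ?thesis by (simp add: add_left_mono)
 qed
 then show ?thesis by (rule ennreal_le_epsilon)
qed

text \<open>At a point of \<open>E\<close> the difference quotients oscillate between \<open>p\<close> and \<open>q\<close>.
Adding a large multiple of the identity makes \<open>f\<close> strictly increasing with Lipschitz inverse. The
previous lemma bounds the measure of the image of \<open>E\<close> by the smaller slope from above and, applied to the
inverse, by the larger slope from below.\<close>

lemma null_set_between_slopes:
 fixes f :: "real => real"
 assumes lip: "!!x y. \<bar>f x - f y\<bar> <= L * \<bar>x - y\<bar>" and pq: "p < q"
  and E: "E \<in> sets borel"
  and covp: "!!x d. x \<in> E ==> d > 0 ==> \<exists>a b. a < x & x < b & b - a < d & f b - f a <= p * (b - a)"
  and covq: "!!x d. x \<in> E ==> d > 0 ==> \<exists>a b. a < x & x < b & b - a < d & f b - f a >= q * (b - a)"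
 shows "emeasure lborel E = 0"
proof -
 have L0: "L >= 0" using lip[of 1 0] by auto
 (* The linear term makes the function strictly increasing, hence invertible. *)
 define F where "F = (%x. f x + (L + 1) * x)"
 have Finc: "y - x <= F y - F x" "F y - F x <= (2*L+1) * (y - x)" if "x <= y" for x y
 proof -
  have *: "\<bar>f y - f x\<bar> <= L * (y - x)" using lip[of y x] that by simp
  then show "y - x <= F y - F x" unfolding F_def by (simp add: algebra_simps abs_le_iff)
  show "F y - F x <= (2*L+1) * (y - x)" using * unfolding F_def by (simp add: algebra_simps abs_le_iff)
 qed
 have mono: "strict_mono F"
 proof (rule strict_monoI)
  fix x y :: real assume "x < y" then show "F x < F y" using Finc(1)[of x y] by simp
 qed
 have lipF: "\<bar>F x - F y\<bar> <= (2*L+1) * \<bar>x - y\<bar>" for x y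
  using Finc[of x y] Finc[of y x] by (cases "x <= y") auto
 have cF: "continuous_on UNIV F"
  unfolding continuous_on_iff
 proof (intro ballI allI impI)
  fix x e :: real assume e: "e > 0"
  have "dist (F y) (F x) < e" if "dist y x < e/(2*L+1)" for y
  proof -
   have "(2*L+1) * \<bar>y - x\<bar> < e" using that L0 by (simp add: dist_real_def field_simps)
   then show ?thesis using lipF[of y x] by (simp add: dist_real_def)
  qed
  then show "\<exists>d>0. \<forall>x'\<in>UNIV. dist x' x < d --> dist (F x') (F x) < e"
   using e L0 by (intro exI[of _ "e/(2*L+1)"]) auto
 qed
 have surj: "\<exists>x. F x = y" for y
 proof -
  define R where "R = \<bar>y - F 0\<bar>"
  have "F (-R) <= y" using Finc(1)[of "-R" 0] by (auto simp: R_def)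
  moreover have "y <= F R" using Finc(1)[of 0 R] by (auto simp: R_def)
  moreover have "-R <= R" by (simp add: R_def)
  ultimately show ?thesis using IVT'[of F "-R" y R] cF by (meson continuous_on_subset subset_UNIV)
 qed
 define Fi where "Fi = inv F"
 have inv: "Fi (F x) = x" "F (Fi y) = y" for x y
  using strict_mono_imp_inj_on[OF mono] surj[of y] by (auto simp: Fi_def f_inv_into_f surj_def inv_f_f)
 have lipFi: "\<bar>Fi x - Fi y\<bar> <= 1 * \<bar>x - y\<bar>" for x y
  using Finc(1)[of "Fi x" "Fi y"] Finc(1)[of "Fi y" "Fi x"] inv by (cases "Fi x <= Fi y") auto
 have monoFi: "strict_mono Fi"
  by (rule strict_monoI) (metis inv(2) mono strict_mono_less)
 have cFi: "continuous_on UNIV Fi"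
  unfolding continuous_on_iff using lipFi by (metis dist_real_def le_less_trans mult_1)
 have Fim: "F ` X = Fi -` X" for X
  using inv by (auto simp: image_iff) metis
 have FiF: "Fi ` F ` X = X" for X using inv by (auto simp: image_iff)
 have bdd: "emeasure lborel (E \<inter> {-n..n}) = 0" for n :: real
 proof -
  define E' where "E' = E \<inter> {-n..n}"
  have E'b: "E' \<in> sets borel" using E by (simp add: E'_def)
  have fin: "emeasure lborel E' < \<infinity>"
   by (rule emeasure_bounded_finite) (auto simp: E'_def intro: bounded_subset[of "{-n..n}"])
  have FE': "F ` E' \<in> sets borel" unfolding Fim by (rule measurable_sets_borel[OF borel_cont[OF cFi] E'b])
  define P where "P = max 0 (p + L + 1)"
  define Q where "Q = q + L + 1"
  have up: "emeasure lborel (F ` E') <= ennreal P * emeasure lborel E'"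
  proof (rule emeasure_image_le_of_small_slopes[OF mono inv cFi lipF E'b])
   fix x d assume "x \<in> E'" "d > (0::real)"
   then obtain a b where "a < x" "x < b" "b - a < d" "f b - f a <= p * (b - a)"
    using covp[of x d] by (auto simp: E'_def)
   moreover have "(p + L + 1) * (b - a) <= P * (b - a)" if "a < b"
    using that by (intro mult_right_mono) (auto simp: P_def)
   ultimately show "\<exists>a b. a < x & x < b & b - a < d & F b - F a <= P * (b - a)"
    by (intro exI[of _ a] exI[of _ b]) (auto simp: F_def algebra_simps)
  qed (simp add: P_def)
  show ?thesis
  proof (cases "E' = {}")
   case True then show ?thesis by (simp add: E'_def)
  next
   case False
   then obtain x0 where "x0 \<in> E" by (auto simp: E'_def)
   then obtain a b where ab: "a < x0" "x0 < b" "f b - f a <= p * (b - a)" using covp[of x0 1] by auto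
   have "- L * (b - a) <= f b - f a" using lip[of b a] ab by (auto simp: abs_le_iff)
   then have "(- L) * (b - a) <= p * (b - a)" using ab by linarith
   then have "- L <= p" using ab mult_le_cancel_right[of "-L" "b-a" p] by linarith
   then have P1: "P = p + L + 1" and Q1: "Q > 0" "P < Q" using pq by (auto simp: P_def Q_def)
   have lo: "emeasure lborel (Fi ` (F ` E')) <= ennreal (1/Q) * emeasure lborel (F ` E')"
   proof (rule emeasure_image_le_of_small_slopes[OF monoFi inv(2,1) cF lipFi FE'])
    fix y d assume y: "y \<in> F ` E'" and d: "d > (0::real)"
    then obtain x where x: "x \<in> E" "y = F x" by (auto simp: E'_def)
    obtain a b where ab: "a < x" "x < b" "b - a < d/(2*L+1)" "f b - f a >= q * (b - a)"
     using covq[OF x(1), of "d/(2*L+1)"] d L0 by auto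
    have "F b - F a <= (2*L+1) * (b - a)" using Finc(2)[of a b] ab by simp
    also have "... < d" using ab(3) L0 by (simp add: field_simps)
    finally have "F b - F a < d" .
    moreover have "F b - F a >= Q * (b - a)" using ab(4) by (simp add: F_def Q_def algebra_simps)
    then have "Fi (F b) - Fi (F a) <= 1/Q * (F b - F a)" using Q1 inv by (simp add: field_simps)
    ultimately show "\<exists>a b. a < y & y < b & b - a < d & Fi b - Fi a <= 1/Q * (b - a)"
     using x ab mono by (intro exI[of _ "F a"] exI[of _ "F b"]) (auto simp: strict_mono_less)
   qed (use Q1 in auto)
   obtain m where m: "emeasure lborel E' = ennreal m" "m >= 0"
    using fin by (cases "emeasure lborel E'") auto
   have "ennreal m <= ennreal (1/Q) * (ennreal P * ennreal m)"
    using lo up m unfolding FiF by (metis dual_order.trans mult_left_mono zero_le)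
   also have "... = ennreal (1/Q * (P * m))"
    using Q1 m by (simp add: ennreal_mult[symmetric] P_def)
   finally have "m <= 1/Q * (P * m)" using m Q1 by (subst (asm) ennreal_le_iff) (auto simp: P_def)
   then have "Q * m <= P * m" using Q1 by (simp add: field_simps)
   then have "m = 0" using Q1 m by (metis less_le_not_le mult_strict_right_mono order_le_less)
   then show ?thesis using m by (simp add: E'_def)
  qed
 qed
 have EU: "E = (\<Union>n::nat. E \<inter> {-real n..real n})"
 proof (intro equalityI subsetI)
  fix x assume x: "x \<in> E"
  obtain n :: nat where "\<bar>x\<bar> <= real n" using real_arch_simple by blast
  then have "x \<in> E \<inter> {-real n..real n}" using x by (simp add: abs_le_iff)
  then show "x \<in> (\<Union>n::nat. E \<inter> {-real n..real n})" by blast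
 qed blast
 have "emeasure lborel (\<Union>n::nat. E \<inter> {-real n..real n}) = 0"
 proof (rule emeasure_UN_eq_0)
  show "emeasure lborel (E \<inter> {-real n..real n}) = 0" for n by (rule bdd)
  show "range (%n::nat. E \<inter> {-real n..real n}) <= sets lborel" using E by auto
 qed
 then show ?thesis using EU by simp
qed

lemma nn_integral_lborel_translation:
 fixes c :: "'a::euclidean_space"
 assumes [measurable]: "f \<in> borel_fun"
 shows "(NI x. f (c + x)) = (NI x. f x)"
 by (subst (2) lborel_distr_plus[of c, symmetric], subst nn_integral_distr) auto

text \<open>Tonelli, after averaging over translates in the direction \<open>e\<close>; this avoids splitting the space as a
product.\<close>

lemma null_set_by_lines:
 fixes e :: "'a::euclidean_space"
 assumes N[measurable]: "N \<in> sets borel"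
  and lines: "!!x. emeasure lborel {t::real. x + t *. e \<in> N} = 0"
 shows "emeasure lborel N = 0"
proof -
 have m[measurable]: "(%(t::real, x::'a). indicator {0..1} t * (indicator N (t *. e + x) :: ennreal)) \<in> borel_measurable (lborel \<Otimes>\<^sub>M lborel)"
  by measurable
 have "emeasure lborel N = (NI t. indicator {0..1::real} t * emeasure lborel N)"
  by (simp add: nn_integral_multc)
 also have "... = (NI t. NI x. indicator {0..1} t * indicator N (t *. e + x))"
  by (intro nn_integral_cong) (simp add: nn_integral_cmult nn_integral_lborel_translation[of "indicator N"])
 also have "... = (NI x. NI t. indicator {0..1} t * indicator N (t *. e + x))"
  by (rule lborel_pair.Fubini') (use m in simp)
 also have "... = (NI x::'a. 0)"
 proof (intro nn_integral_cong)
  fix x :: 'a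
  have "(NI t. indicator {0..1::real} t * indicator N (t *. e + x))
    <= (NI t. indicator {t. x + t *. e \<in> N} t)"
   by (intro nn_integral_mono) (auto split: split_indicator simp: add.commute)
  also have "... = emeasure lborel {t. x + t *. e \<in> N}"
   by (rule nn_integral_indicator) measurable
  finally show "(NI t. indicator {0..1::real} t * indicator N (t *. e + x)) = 0"
   using lines by simp
 qed
 finally show ?thesis by simp
qed

lemma le_of_le_add_small:
 fixes X Y c :: real
 assumes "!!s. 0 < s ==> s < smax ==> X <= Y + c * s" "smax > 0"
 shows "X <= Y"
proof (rule ccontr)
 assume n: "\<not> X <= Y"
 define s where "s = min (smax/2) ((X - Y) / (2 * (\<bar>c\<bar> + 1)))"
 have s: "0 < s" "s < smax" using n assms(2) by (auto simp: s_def)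
 have "c * s <= (\<bar>c\<bar> + 1) * s" using s by (intro mult_right_mono) auto
 also have "... <= (\<bar>c\<bar> + 1) * ((X - Y) / (2 * (\<bar>c\<bar> + 1)))" by (intro mult_left_mono) (auto simp: s_def)
 also have "... = (X - Y) / 2" by (simp add: field_simps)
 finally have "c * s <= (X - Y)/2" .
 then show False using assms(1)[OF s] n by (simp add: field_simps)
qed

lemma derivative_of_squeezed_slopes:
 fixes f :: "real => real"
 assumes lip: "!!x y. \<bar>f x - f y\<bar> <= L * \<bar>x - y\<bar>"
  and sq: "!!eps. eps > 0 ==> \<exists>d>0. \<forall>a<0. \<forall>b>0. b - a < d --> \<bar>f b - f a - l * (b - a)\<bar> <= eps * (b - a)"
 shows "(f has_real_derivative l) (at 0)"
proof -
 have "\<exists>d>0. \<forall>t. 0 < \<bar>t\<bar> & \<bar>t\<bar> < d --> \<bar>f t - f 0 - l * t\<bar> <= eps * \<bar>t\<bar>" if eps: "eps > 0" for eps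
 proof -
  obtain d where d: "d > 0" "!!a b. a < 0 ==> b > 0 ==> b - a < d ==> \<bar>f b - f a - l * (b - a)\<bar> <= eps * (b - a)"
   using sq[OF eps] by blast
  have "\<bar>f t - f 0 - l * t\<bar> <= eps * \<bar>t\<bar>" if t: "0 < \<bar>t\<bar>" "\<bar>t\<bar> < d" for t
  proof (rule le_of_le_add_small[where smax = "d - \<bar>t\<bar>" and c = "eps + L + \<bar>l\<bar>"])
   fix s assume s: "0 < s" "s < d - \<bar>t\<bar>"
   show "\<bar>f t - f 0 - l * t\<bar> <= eps * \<bar>t\<bar> + (eps + L + \<bar>l\<bar>) * s"
   proof (cases "t > 0")
    case True
    have 1: "\<bar>f t - f (-s) - l * (t + s)\<bar> <= eps * (t + s)" using d(2)[of "-s" t] s True by simp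
    have 2: "\<bar>f (-s) - f 0\<bar> <= L * s" using lip[of "-s" 0] s by simp
    have 3: "\<bar>l * s\<bar> <= \<bar>l\<bar> * s" using s by (simp add: abs_mult)
    have "f t - f 0 - l * t = (f t - f (-s) - l * (t + s)) + (f (-s) - f 0) + l * s" by (simp add: algebra_simps)
    then have "\<bar>f t - f 0 - l * t\<bar> <= eps * (t + s) + L * s + \<bar>l\<bar> * s" using 1 2 3 by linarith
    then show ?thesis using True by (simp add: algebra_simps)
   next
    case False
    then have tn: "t < 0" using t by auto
    have 1: "\<bar>f s - f t - l * (s - t)\<bar> <= eps * (s - t)" using d(2)[of t s] s tn by simp
    have 2: "\<bar>f s - f 0\<bar> <= L * s" using lip[of s 0] s by simp
    have 3: "\<bar>l * s\<bar> <= \<bar>l\<bar> * s" using s by (simp add: abs_mult)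
    have "f t - f 0 - l * t = - (f s - f t - l * (s - t)) + (f s - f 0) - l * s" by (simp add: algebra_simps)
    then have "\<bar>f t - f 0 - l * t\<bar> <= eps * (s - t) + L * s + \<bar>l\<bar> * s" using 1 2 3 by linarith
    then show ?thesis using tn by (simp add: algebra_simps)
   qed
  qed (use t in auto)
  then show ?thesis using d(1) by blast
 qed
 note key = this
 show ?thesis unfolding has_field_derivative_iff LIM_def
 proof (intro allI impI)
  fix r :: real assume r: "r > 0"
  obtain d where d: "d > 0" "!!t. 0 < \<bar>t\<bar> ==> \<bar>t\<bar> < d ==> \<bar>f t - f 0 - l * t\<bar> <= (r/2) * \<bar>t\<bar>"
   using key[of "r/2"] r by auto
  have "\<bar>(f t - f 0) / t - l\<bar> < r" if "t ~= 0" "\<bar>t\<bar> < d" for t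
  proof -
   have "\<bar>(f t - f 0) / t - l\<bar> = \<bar>f t - f 0 - l * t\<bar> / \<bar>t\<bar>"
    using that by (subst abs_divide[symmetric]) (simp add: field_simps)
   also have "... <= r/2" using d(2)[of t] that by (simp add: field_simps)
   finally show ?thesis using r by simp
  qed
  then show "\<exists>s>0. \<forall>x. x ~= 0 & dist x 0 < s --> dist ((f x - f 0) / (x - 0)) l < r"
   using d(1) by (intro exI[of _ d]) (auto simp: dist_real_def)
 qed
qed

text \<open>Without a derivative, some pair of rationals \<open>p < q\<close> has arbitrarily short intervals of slope below
\<open>p\<close> and of slope above \<open>q\<close> around the point. The exceptional set is thus a countable union
of sets that meet every line in a null set.\<close>

lemma lipschitz_directional_derivative_ae:
 fixes f :: "'a::euclidean_space => real" and e :: 'a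
 assumes lip: "!!x y. \<bar>f x - f y\<bar> <= L * norm (x - y)"
 obtains N where "N \<in> sets borel" "emeasure lborel N = 0"
  "!!x. x ~: N ==> \<exists>D. ((%t. f (x + t *. e)) has_real_derivative D) (at 0)"
proof -
 have L0: "L >= 0"
 proof -
  obtain b :: 'a where "b \<in> Basis" using nonempty_Basis by blast
  then show ?thesis using lip[of b 0] norm_Basis[of b] by (auto intro: order_trans[OF abs_ge_zero])
 qed
 have lipline: "\<bar>f (x + s *. e) - f (x + t *. e)\<bar> <= (L * norm e) * \<bar>s - t\<bar>" for x s t
  using lip[of "x + s *. e" "x + t *. e"]
  by (simp add: algebra_simps flip: scaleR_diff_left)
 have cf: "continuous_on UNIV f"
 proof (rule uniformly_continuous_imp_continuous, unfold uniformly_continuous_on_def, intro allI impI)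
  fix r :: real assume r: "r > 0"
  have "dist (f y) (f x) < r" if "dist y x < r / (L + 1)" for x y
  proof -
   have "L * norm (y - x) <= (L + 1) * dist y x" by (simp add: dist_norm algebra_simps)
   also have "... < r" using that L0 by (simp add: field_simps)
   finally show ?thesis using lip[of y x] by (simp add: dist_real_def)
  qed
  then show "\<exists>d>0. \<forall>x\<in>UNIV. \<forall>x'\<in>UNIV. dist x' x < d --> dist (f x') (f x) < r"
   using r L0 by (intro exI[of _ "r / (L + 1)"]) auto
 qed
 define Lo where "Lo p d = (\<Union>a\<in>{..<0}. \<Union>b\<in>{b. b > 0 & b - a < d}. {x. f (x + b *. e) - f (x + a *. e) < p * (b - a)})" for p d
 define Hi where "Hi q d = (\<Union>a\<in>{..<0}. \<Union>b\<in>{b. b > 0 & b - a < d}. {x. f (x + b *. e) - f (x + a *. e) > q * (b - a)})" for q d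
 have cf2: "continuous_on UNIV (%x. f (x + b *. e))" for b
  by (rule continuous_on_compose2[OF cf]) (auto intro!: continuous_intros)
 have opn: "open (Lo p d)" "open (Hi p d)" for p d
  unfolding Lo_def Hi_def
  by (intro open_UN ballI open_Collect_less continuous_intros cf2)+
 define Bad where "Bad p q = (\<Inter>n::nat. Lo p (1 / real (Suc n)) \<inter> Hi q (1 / real (Suc n)))" for p q
 have Badb: "Bad p q \<in> sets borel" for p q unfolding Bad_def
  by (intro sets.countable_INT) (use opn in auto)
 have Badnull: "emeasure lborel (Bad p q) = 0" if pq: "p < q" for p q
 proof (rule null_set_by_lines[where e = e, OF Badb])
  fix x :: 'a
  have meas: "{t. x + t *. e \<in> Bad p q} \<in> sets borel"
   using measurable_sets_borel[of "%t. x + t *. e" borel "Bad p q"] Badb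
   by (simp add: vimage_def)
  have ex: "\<exists>n::nat. 1 / real (Suc n) < d" if "d > 0" for d
   using reals_Archimedean[OF that] by (simp add: inverse_eq_divide)
  show "emeasure lborel {t. x + t *. e \<in> Bad p q} = 0"
  proof (rule null_set_between_slopes[of "%t. f (x + t *. e)", OF lipline pq meas])
   fix t d assume t: "t \<in> {t. x + t *. e \<in> Bad p q}" and d: "d > (0::real)"
   obtain n :: nat where n: "1 / real (Suc n) < d" using ex[OF d] by blast
   have "x + t *. e \<in> Lo p (1 / real (Suc n))" "x + t *. e \<in> Hi q (1 / real (Suc n))"
    using t by (auto simp: Bad_def)
   then obtain a b a' b' where
    1: "a < 0" "b > 0" "b - a < 1 / real (Suc n)" "f (x + t *. e + b *. e) - f (x + t *. e + a *. e) < p * (b - a)"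
    and 2: "a' < 0" "b' > 0" "b' - a' < 1 / real (Suc n)" "f (x + t *. e + b' *. e) - f (x + t *. e + a' *. e) > q * (b' - a')"
    unfolding Lo_def Hi_def by auto
   show "\<exists>a b. a < t & t < b & b - a < d & f (x + b *. e) - f (x + a *. e) <= p * (b - a)"
    using 1 n by (intro exI[of _ "t + a"] exI[of _ "t + b"]) (auto simp: algebra_simps)
   show "\<exists>a b. a < t & t < b & b - a < d & f (x + b *. e) - f (x + a *. e) >= q * (b - a)"
    using 2 n by (intro exI[of _ "t + a'"] exI[of _ "t + b'"]) (auto simp: algebra_simps)
  qed
 qed
 define N where "N = (\<Union>(p,q)\<in>{(p,q). p \<in> \<rat> & q \<in> \<rat> & p < q}. Bad p q)"
 have cQ: "countable {(p::real,q). p \<in> \<rat> & q \<in> \<rat> & p < q}"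
  by (rule countable_subset[of _ "\<rat> \<times> \<rat>"]) (auto intro: countable_rat)
 have Nb: "N \<in> sets borel" unfolding N_def
  by (intro sets.countable_UN'[OF cQ]) (use Badb in auto)
 have Nn: "emeasure lborel N = 0"
 proof -
  have "N \<in> null_sets lborel" unfolding N_def
   by (intro null_sets_UN'[OF cQ]) (use Badb Badnull in "auto simp: null_sets_def")
  then show ?thesis by (simp add: null_sets_def)
 qed
 have "\<exists>D. ((%t. f (x + t *. e)) has_real_derivative D) (at 0)" if x: "x ~: N" for x
 proof -
  define R where "R = L * norm e"
  define h where "h = (%t. f (x + t *. e))"
  have hl: "\<bar>h s - h t\<bar> <= R * \<bar>s - t\<bar>" for s t using lipline by (simp add: h_def R_def)
  define low where "low = {p. \<exists>d>0. \<forall>a<0. \<forall>b>0. b - a < d --> h b - h a >= p * (b - a)}"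
  define l where "l = Sup low"
  have ne: "- R \<in> low"
  proof -
   have "h b - h a >= - R * (b - a)" if "a < 0" "b > 0" for a b
    using hl[of b a] that by (auto simp: abs_le_iff)
   then show ?thesis unfolding low_def by (auto intro!: exI[of _ 1])
  qed
  have ub: "p <= R" if pl: "p \<in> low" for p
  proof -
   obtain d where d: "d > 0" "!!a b. a < 0 ==> b > 0 ==> b - a < d ==> h b - h a >= p * (b - a)"
    using pl by (auto simp: low_def)
   have "p * (d/2) <= h (d/4) - h (-d/4)" using d(2)[of "-d/4" "d/4"] d(1) by simp
   also have "... <= R * (d/2)" using order_trans[OF abs_ge_self hl[of "d/4" "-d/4"]] d(1) by simp
   finally show ?thesis using d(1) by simp
  qed
  have bdd: "bdd_above low" using ub by (auto simp: bdd_above_def)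
  have "(h has_real_derivative l) (at 0)"
  proof (rule derivative_of_squeezed_slopes[OF hl])
   fix eps :: real assume eps: "eps > 0"
   obtain p0 where p0: "p0 \<in> low" "l - eps < p0"
    using less_cSup_iff[of low "l - eps"] ne bdd eps unfolding l_def by auto
   obtain d1 where d1: "d1 > 0" "!!a b. a < 0 ==> b > 0 ==> b - a < d1 ==> h b - h a >= p0 * (b - a)"
    using p0 by (auto simp: low_def)
   obtain p where p: "p \<in> \<rat>" "l < p" "p < l + eps" using Rats_dense_in_real[of l "l + eps"] eps by auto
   obtain q where q: "q \<in> \<rat>" "p < q" "q < l + eps" using Rats_dense_in_real[OF p(3)] by auto
   have pn: "p ~: low" using p(2) cSup_upper[OF _ bdd] unfolding l_def by force
   have "x ~: Bad p q" using x p q unfolding N_def by auto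
   then obtain n where n: "x ~: Lo p (1 / real (Suc n)) \<or> x ~: Hi q (1 / real (Suc n))"
    unfolding Bad_def by auto
   have "x \<in> Lo p d" if dp: "d > 0" for d
   proof -
    obtain a b where "a < 0" "b > 0" "b - a < d" "\<not> h b - h a >= p * (b - a)"
     using pn dp unfolding low_def by blast
    then show ?thesis unfolding Lo_def h_def by (auto intro!: bexI[of _ a] exI[of _ b])
   qed
   then have "x ~: Hi q (1 / real (Suc n))" using n by auto
   then have up: "h b - h a <= q * (b - a)" if "a < 0" "b > 0" "b - a < 1 / real (Suc n)" for a b
    using that unfolding Hi_def h_def by force
   have "\<bar>h b - h a - l * (b - a)\<bar> <= eps * (b - a)"
    if ab: "a < 0" "b > 0" "b - a < min d1 (1 / real (Suc n))" for a b
   proof -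
    have "q * (b - a) <= (l + eps) * (b - a)" "(l - eps) * (b - a) <= p0 * (b - a)"
     using q p0 ab by (auto intro!: mult_right_mono)
    then show ?thesis using up[of a b] d1(2)[of a b] ab by (auto simp: abs_le_iff algebra_simps)
   qed
   then show "\<exists>d>0. \<forall>a<0. \<forall>b>0. b - a < d --> \<bar>h b - h a - l * (b - a)\<bar> <= eps * (b - a)"
    using d1(1) by (intro exI[of _ "min d1 (1 / real (Suc n))"]) auto
  qed
  then show ?thesis unfolding h_def by blast
 qed
 with Nb Nn show thesis using that by blast
qed

lemma vector_derivative_as_sequence_limit:
 assumes "(F has_vector_derivative D) (at 0)"
 shows "(%n. real (Suc n) *. (F (1 / real (Suc n)) - F 0)) \<longlonglongrightarrow> D"
proof -
 have "(%h. norm (F (0 + h) - F 0 - h *. D) / norm h) \<midarrow>0\<rightarrow> 0"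
  using assms unfolding has_vector_derivative_def has_derivative_at by auto
 moreover have "filterlim (%n. 1 / real (Suc n)) (at 0) sequentially"
  using LIMSEQ_inverse_real_of_nat by (auto simp: filterlim_at inverse_eq_divide)
 ultimately have "(%n. norm (F (0 + 1 / real (Suc n)) - F 0 - (1 / real (Suc n)) *. D) / norm (1 / real (Suc n))) \<longlonglongrightarrow> 0"
  by (rule filterlim_compose)
 moreover have "norm (F (0 + 1 / real (Suc n)) - F 0 - (1 / real (Suc n)) *. D) / norm (1 / real (Suc n))
   = norm (real (Suc n) *. (F (1 / real (Suc n)) - F 0) - D)" for n
 proof -
  have "real (Suc n) *. (F (1 / real (Suc n)) - F 0) - D = real (Suc n) *. (F (1 / real (Suc n)) - F 0 - (1 / real (Suc n)) *. D)"
   by (simp add: scaleR_diff_right)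
  then show ?thesis by (simp add: mult.commute)
 qed
 ultimately show ?thesis by (simp add: LIM_zero_iff tendsto_norm_zero_iff)
qed

text \<open>The Borel representative is the limit of difference quotients along a fixed sequence, set to zero on a Borel null set
outside of which the derivative exists.\<close>

lemma lipschitz_directional_derivative_borel:
 fixes f :: "'a::euclidean_space => 'b::euclidean_space" and e :: 'a
 assumes lip: "!!x y. norm (f x - f y) <= L * norm (x - y)" and e: "norm e = 1"
 obtains G where "G \<in> borel_fun" "!!x. norm (G x) <= L"
  "AE x in lborel. ((%t. f (x + t *. e)) has_vector_derivative G x) (at 0)"
proof -
 have L0: "L >= 0" using lip[of e 0] e by (auto intro: order_trans[OF norm_ge_zero])
 have lipb: "\<bar>f x \<bullet> b - f y \<bullet> b\<bar> <= L * norm (x - y)" if "b \<in> Basis" for b x y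
  using order_trans[OF Basis_le_norm[OF that, of "f x - f y"] lip] by (simp add: inner_diff_left)
 have "\<exists>N. N \<in> sets borel & emeasure lborel N = 0 &
   (\<forall>x. x ~: N --> (\<exists>D. ((%t. f (x + t *. e) \<bullet> b) has_real_derivative D) (at 0)))" if "b \<in> Basis" for b
  by (rule lipschitz_directional_derivative_ae[of "%x. f x \<bullet> b" L e]) (use lipb[OF that] in auto)
 then obtain N where N: "!!b. b \<in> Basis ==> N b \<in> sets borel" "!!b. b \<in> Basis ==> emeasure lborel (N b) = 0"
  "!!b x. b \<in> Basis ==> x ~: N b ==> \<exists>D. ((%t. f (x + t *. e) \<bullet> b) has_real_derivative D) (at 0)"
  by metis
 define N0 where "N0 = (\<Union>b\<in>Basis. N b)"
 have N0n: "N0 \<in> null_sets lborel" unfolding N0_def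
  by (intro null_sets_UN') (use N in "auto simp: null_sets_def intro: countable_finite")
 then have N0b[measurable]: "N0 \<in> sets borel" by (auto simp: null_sets_def)
 have ex: "\<exists>D. ((%t. f (x + t *. e)) has_vector_derivative D) (at 0)" if "x ~: N0" for x
 proof -
  have "\<forall>b\<in>Basis. \<exists>D. ((%t. f (x + t *. e) \<bullet> b) has_real_derivative D) (at 0)"
   using N(3) that by (auto simp: N0_def)
  then obtain D where D: "!!b. b \<in> Basis ==> ((%t. f (x + t *. e) \<bullet> b) has_real_derivative D b) (at 0)"
   by metis
  have "((%t. \<Sum>b\<in>Basis. (f (x + t *. e) \<bullet> b) *. b) has_vector_derivative (\<Sum>b\<in>Basis. D b *. b)) (at 0)"
   using D by (auto intro!: derivative_eq_intros simp: real_vector_deriv[symmetric])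
  then show ?thesis by (auto simp: euclidean_representation)
 qed
 then obtain G0 where G0: "!!x. x ~: N0 ==> ((%t. f (x + t *. e)) has_vector_derivative G0 x) (at 0)"
  by metis
 define G where "G x = (if x \<in> N0 then 0 else G0 x)" for x
 define q where "q n x = (if x \<in> N0 then 0 else real (Suc n) *. (f (x + (1 / real (Suc n)) *. e) - f x))" for n x
 have lim: "(%n. q n x) \<longlonglongrightarrow> G x" for x
 proof (cases "x \<in> N0")
  case False
  show ?thesis using vector_derivative_as_sequence_limit[OF G0[OF False]] False
   by (simp add: q_def G_def)
 qed (simp add: G_def q_def)
 have "continuous_on UNIV f"
  by (rule lipschitz_on_continuous_on[of L]) (use lip L0 in "auto simp: lipschitz_on_def dist_norm")
 then have [measurable]: "f \<in> borel_fun" by (rule borel_cont)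
 show thesis
 proof (rule that)
  show "G \<in> borel_fun"
   by (rule borel_measurable_LIMSEQ_metric[OF _ lim]) (unfold q_def, measurable)
  show "norm (G x) <= L" for x
  proof (rule Lim_norm_ubound[OF _ lim])
   have "norm (q n x) <= L" for n
   proof (cases "x \<in> N0")
    case False
    have "norm (q n x) = real (Suc n) * norm (f (x + (1 / real (Suc n)) *. e) - f x)"
     using False by (simp add: q_def)
    also have "... <= real (Suc n) * (L * (1 / real (Suc n)))"
     using lip[of "x + (1 / real (Suc n)) *. e" x] e by (intro mult_left_mono) auto
    finally show ?thesis by simp
   qed (use L0 in "simp add: q_def")
   then show "\<forall>\<^sub>F n in sequentially. norm (q n x) <= L" by simp
  qed simp
  show "AE x in lborel. ((%t. f (x + t *. e)) has_vector_derivative G x) (at 0)"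
   by (rule AE_I'[OF N0n]) (use G0 in "auto simp: G_def")
 qed
qed

section \<open>Integration by parts for compactly supported functions\<close>

lemma lborel_integral_translation:
 fixes c :: "'a::euclidean_space" and f :: "'a => 'b::{banach,second_countable_topology}"
 assumes [measurable]: "f \<in> borel_fun"
 shows "(LI x. f (c + x)) = (LI x. f x)"
 by (subst (2) lborel_distr_plus[of c, symmetric], subst integral_distr) auto

lemma lborel_integrable_translation:
 fixes c :: "'a::euclidean_space" and f :: "'a => 'b::{banach,second_countable_topology}"
 assumes "integrable lborel f"
 shows "integrable lborel (%x. f (c + x))"
proof -
 have [measurable]: "f \<in> borel_fun" using borel_measurable_integrable[OF assms] by simp
 have "integrable (distr lborel borel ((+) c)) f" using assms by (simp add: lborel_distr_plus)
 then show ?thesis by (subst (asm) integrable_distr_eq) auto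
qed

lemma continuous_extension_by_zero:
 fixes f :: "'a::t2_space => 'b::{topological_space,zero}"
 assumes "open Om" "compact K" "K <= Om" "continuous_on Om f" "!!x. x ~: K ==> f x = 0"
 shows "continuous_on UNIV f"
proof -
 have op: "open (- K)" using assms(2) by (simp add: compact_imp_closed open_Compl)
 have "continuous_on (- K) f"
  by (rule continuous_on_eq[OF continuous_on_const[of _ 0]]) (use assms(5) in auto)
 then have "continuous_on (Om \<union> - K) f"
  using assms(1,4) op by (intro continuous_on_open_Un) auto
 moreover have "Om \<union> - K = UNIV" using assms(3) by auto
 ultimately show ?thesis by simp
qed

lemma integrable_compact_support:
 fixes f :: "'a::euclidean_space => 'b::{banach,second_countable_topology}"
 assumes "compact K" "continuous_on UNIV f" "!!x. x ~: K ==> f x = 0"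
 shows "integrable lborel f"
proof -
 have "integrable lborel (%x. indicator K x *. f x)"
  by (rule borel_integrable_compact[OF assms(1)]) (use assms(2) continuous_on_subset in blast)
 moreover have "(%x. indicator K x *. f x) = f" using assms(3) by (auto simp: indicator_def)
 ultimately show ?thesis by simp
qed

lemma bounded_continuous_compact_support:
 fixes f :: "'a::euclidean_space => 'b::real_normed_vector"
 assumes "compact K" "continuous_on UNIV f" "!!x. x ~: K ==> f x = 0"
 obtains B where "B >= 0" "!!x. norm (f x) <= B"
proof -
 have "compact (f ` K)" using assms by (meson compact_continuous_image continuous_on_subset subset_UNIV)
 then obtain B where B: "!!x. x \<in> K ==> norm (f x) <= B" by (meson compact_imp_bounded bounded_iff imageI)
 have "norm (f x) <= max B 0" for x using B[of x] assms(3)[of x] by (cases "x \<in> K") auto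
 then show thesis using that[of "max B 0"] by auto
qed

text \<open>The integral of a difference quotient vanishes by translation invariance; dominated convergence gives the derivative.\<close>

lemma integral_directional_derivative_zero:
 fixes F F' :: "'a::euclidean_space => real" and e :: 'a
 assumes K: "compact K"
  and der: "!!x. ((%t. F (x + t *. e)) has_real_derivative F' x) (at 0)"
  and cF: "continuous_on UNIV F" and cF': "continuous_on UNIV F'"
  and z: "!!x. x ~: K ==> F x = 0" "!!x. x ~: K ==> F' x = 0"
 shows "(LI x. F' x) = 0"
proof -
 obtain B where B: "B >= 0" "!!x. \<bar>F' x\<bar> <= B"
  using bounded_continuous_compact_support[OF K cF' z(2)] by auto
 obtain R where "\<forall>x\<in>K. norm x <= R" using compact_imp_bounded[OF K] unfolding bounded_iff by blast
 then have R: "K <= cball 0 R" by auto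
 have iF: "integrable lborel F" by (rule integrable_compact_support[OF K cF z(1)])
 have [measurable]: "F \<in> borel_fun" "F' \<in> borel_fun"
  using cF cF' by (auto intro: borel_cont)
 define q where "q n x = real (Suc n) * (F (x + (1 / real (Suc n)) *. e) - F x)" for n x
 have der': "((%t. F (x + t *. e)) has_real_derivative F' (x + s *. e)) (at s)" for x s
 proof -
  have "((%t. F (x + s *. e + (t - s) *. e)) has_real_derivative F' (x + s *. e)) (at s)"
   using DERIV_shift[of "%t. F (x + s *. e + t *. e)" "F' (x + s *. e)" s "-s"] der[of "x + s *. e"] by simp
  then show ?thesis by (simp add: algebra_simps)
 qed
 have qb: "\<bar>q n x\<bar> <= B" for n x
 proof -
  obtain s where s: "F (x + (1 / real (Suc n)) *. e) - F (x + 0 *. e) = (1 / real (Suc n) - 0) * F' (x + s *. e)"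
   using MVT2[of 0 "1 / real (Suc n)" "%t. F (x + t *. e)" "%s. F' (x + s *. e)"] der' by auto
  then have "q n x = F' (x + s *. e)" by (simp add: q_def)
  then show ?thesis using B by simp
 qed
 have q0: "q n x = 0" if "x ~: cball 0 (R + norm e)" for n x
 proof -
  have "norm ((1 / real (Suc n)) *. e) <= 1 * norm e" by (simp add: field_simps)
  then have "norm (x + (1 / real (Suc n)) *. e) > R" "norm x > R"
   using that norm_triangle_ineq2[of x "- ((1 / real (Suc n)) *. e)"] norm_ge_zero[of e]
   unfolding mem_cball dist_norm norm_minus_cancel diff_minus_eq_add diff_0 by linarith+
  then have "x ~: K" "x + (1 / real (Suc n)) *. e ~: K" using R by auto
  then show ?thesis using z(1) by (simp add: q_def)
 qed
 have lim: "(%n. q n x) \<longlonglongrightarrow> F' x" for x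
  using vector_derivative_as_sequence_limit[of "%t. F (x + t *. e)" "F' x"] der[of x]
  by (simp add: q_def real_vector_deriv)
 have "(%n. LI x. q n x) \<longlonglongrightarrow> (LI x. F' x)"
 proof (rule integral_dominated_convergence[where w = "%x. B * indicator (cball 0 (R + norm e)) x"])
  show "integrable lborel (%x. B * indicator (cball 0 (R + norm e)) x :: real)"
   by (intro integrable_mult_right integrable_real_indicator emeasure_bounded_finite) auto
  show "AE x in lborel. norm (q n x) <= B * indicator (cball 0 (R + norm e)) x" for n
   using qb q0 by (auto split: split_indicator)
  show "q n \<in> borel_measurable lborel" for n unfolding q_def by measurable
 qed (use lim in auto)
 moreover have "(LI x. q n x) = 0" for n
 proof -
  have "integrable lborel (%x. F (x + (1 / real (Suc n)) *. e))"
   using lborel_integrable_translation[OF iF, of "(1 / real (Suc n)) *. e"] by (simp add: add.commute)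
  moreover have "(LI x. F (x + (1 / real (Suc n)) *. e)) = (LI x. F x)"
   using lborel_integral_translation[of F "(1 / real (Suc n)) *. e"] by (simp add: add.commute)
  ultimately show ?thesis using iF by (simp add: q_def)
 qed
 ultimately show ?thesis by (simp add: LIMSEQ_const_iff)
qed

lemma integral_divergence_zero:
 fixes W :: "real^'n::finite => real^'n" and W' :: "'n => real^'n => real^'n"
 assumes Om: "open Om" and K: "compact K" "K <= Om"
  and der: "!!x i. x \<in> Om ==> ((%t. W (x + t *. axis i 1)) has_vector_derivative W' i x) (at 0)"
  and cW: "continuous_on Om W" and cW': "!!i. continuous_on Om (W' i)"
  and z: "!!x. x ~: K ==> W x = 0" "!!x i. x ~: K ==> W' i x = 0"
 shows "(LI x. (\<Sum>i\<in>UNIV. W' i x $ i)) = 0"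
  and "integrable lborel (%x. \<Sum>i\<in>UNIV. W' i x $ i)"
proof -
 have cU: "continuous_on UNIV W" "continuous_on UNIV (W' i)" for i
  using continuous_extension_by_zero[OF Om K] cW cW' z by blast+
 have i: "integrable lborel (%x. W' i x $ i)" for i
  by (rule integrable_compact_support[OF K(1)]) (use z in "auto intro!: continuous_intros cU")
 have der': "((%t. W (x + t *. axis i 1)) has_vector_derivative W' i x) (at 0)" for x i
 proof (cases "x \<in> K")
  case True then show ?thesis using der K by auto
 next
  case False
  have op: "open (- K)" using K by (simp add: compact_imp_closed open_Compl)
  have "continuous_on UNIV (%t::real. x + t *. axis i 1 :: real^'n)" by (intro continuous_intros)
  then have "open ((%t::real. x + t *. axis i 1 :: real^'n) -` (- K))"
   using op by (rule open_vimage[rotated])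
  moreover have "0 \<in> ((%t::real. x + t *. axis i 1 :: real^'n) -` (- K))" using False by simp
  ultimately have "((%t. W (x + t *. axis i 1)) has_vector_derivative 0) (at 0)"
   by (rule has_vector_derivative_transform_within_open[OF has_vector_derivative_const[of 0]])
    (use z(1) in auto)
  then show ?thesis using z(2) False by simp
 qed
 have "(LI x. W' i x $ i) = 0" for i
 proof (rule integral_directional_derivative_zero[OF K(1), of "%x. W x $ i" "axis i 1"])
  fix x
  show "((%t. W (x + t *. axis i 1) $ i) has_real_derivative W' i x $ i) (at 0)"
   unfolding real_vector_deriv
   by (rule linear_vector_deriv[OF bounded_linear_vec_nth der'])
 qed (use z in "auto intro!: continuous_intros cU")
 then show "(LI x. (\<Sum>i\<in>UNIV. W' i x $ i)) = 0" using i by simp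
 show "integrable lborel (%x. \<Sum>i\<in>UNIV. W' i x $ i)" using i by simp
qed

lemma has_vector_derivative_at_0_iff:
 "(F has_vector_derivative D) (at 0) \<longleftrightarrow> ((%t. (1 / t) *. (F t - F 0)) \<longlongrightarrow> D) (at (0::real))"
proof -
 have "(F has_vector_derivative D) (at 0) \<longleftrightarrow> (%h. norm (F h - F 0 - h *. D) / norm h) \<midarrow>0\<rightarrow> 0"
  unfolding has_vector_derivative_def has_derivative_at by (simp add: bounded_linear_scaleR_left)
 also have "... \<longleftrightarrow> (%h. norm ((1 / h) *. (F h - F 0) - D)) \<midarrow>0\<rightarrow> 0"
 proof (rule LIM_cong)
  fix h :: real assume "h ~= 0"
  then have "(1 / h) *. (F h - F 0) - D = (1/h) *. (F h - F 0 - h *. D)" by (simp add: scaleR_diff_right)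
  then show "norm (F h - F 0 - h *. D) / norm h = norm ((1 / h) *. (F h - F 0) - D)" by simp
 qed auto
 also have "... \<longleftrightarrow> ((%t. (1 / t) *. (F t - F 0)) \<longlongrightarrow> D) (at (0::real))"
  by (simp add: tendsto_norm_zero_iff LIM_zero_iff)
 finally show ?thesis .
qed

text \<open>Differentiability under the integral is only required almost everywhere, because the Lipschitz bound supplies the
domination. This is what carries derivatives of Lipschitz coefficients through an average.\<close>

lemma has_vector_derivative_lebesgue_integral:
 fixes f :: "real => 'z => 'b::{banach,second_countable_topology}"
 assumes int: "!!t. integrable M (f t)" and B: "integrable M B" and d: "d > 0"
  and lip: "!!t z. \<bar>t\<bar> < d ==> norm (f t z - f 0 z) <= \<bar>t\<bar> * B z"
  and der: "AE z in M. ((%t. f t z) has_vector_derivative f' z) (at 0)"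
  and [measurable]: "f' \<in> borel_measurable M"
 shows "((%t. \<integral>z. f t z \<partial>M) has_vector_derivative (\<integral>z. f' z \<partial>M)) (at 0)"
 unfolding has_vector_derivative_at_0_iff tendsto_at_iff_sequentially
proof (intro allI impI)
 fix X :: "nat => real" assume X: "\<forall>i. X i \<in> UNIV - {0}" and X0: "X \<longlonglongrightarrow> 0"
 obtain n0 where n0: "!!n. n >= n0 ==> \<bar>X n\<bar> < d" using X0 d unfolding LIMSEQ_def by force
 have [measurable]: "f t \<in> borel_measurable M" for t using int by auto
 have "(%n. \<integral>z. (1 / X (n + n0)) *. (f (X (n + n0)) z - f 0 z) \<partial>M) \<longlonglongrightarrow> (\<integral>z. f' z \<partial>M)"
 proof (rule integral_dominated_convergence[OF _ _ B])
  show "AE z in M. (%n. (1 / X (n + n0)) *. (f (X (n + n0)) z - f 0 z)) \<longlonglongrightarrow> f' z"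
   using der
  proof eventually_elim
   case (elim z)
   then have "(%n. (1 / X n) *. (f (X n) z - f 0 z)) \<longlonglongrightarrow> f' z"
    using X X0 unfolding has_vector_derivative_at_0_iff tendsto_at_iff_sequentially comp_def by blast
   then show ?case by (rule LIMSEQ_ignore_initial_segment)
  qed
  show "AE z in M. norm ((1 / X (n + n0)) *. (f (X (n + n0)) z - f 0 z)) <= B z" for n
  proof (rule AE_I2)
   fix z
   have "X (n + n0) ~= 0" using X by auto
   then show "norm ((1 / X (n + n0)) *. (f (X (n + n0)) z - f 0 z)) <= B z"
    using lip[of "X (n + n0)" z] n0[of "n + n0"] unfolding norm_scaleR
    by (simp add: pos_divide_le_eq mult.commute)
  qed
 qed auto
 then have "(%n. \<integral>z. (1 / X n) *. (f (X n) z - f 0 z) \<partial>M) \<longlonglongrightarrow> (\<integral>z. f' z \<partial>M)"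
  by (rule LIMSEQ_offset)
 then show "((%t. (1 / t) *. ((\<integral>z. f t z \<partial>M) - (\<integral>z. f 0 z \<partial>M))) \<circ> X) \<longlonglongrightarrow> (\<integral>z. f' z \<partial>M)"
  using int by (simp add: comp_def)
qed

lemma AE_lborel_affine:
 fixes x :: "'a::euclidean_space"
 assumes ae: "AE y in lborel. P y" and c: "c ~= 0"
 shows "AE z in lborel. P (x + c *. z)"
proof -
 obtain N where N: "{y. \<not> P y} <= N" "N \<in> sets borel" "emeasure lborel N = 0"
  using ae unfolding eventually_ae_filter null_sets_def by auto
 have [measurable]: "N \<in> sets borel" by fact
 have "emeasure (density (distr lborel borel (%z. x + c *. z)) (%_. ennreal (\<bar>c\<bar> ^ DIM('a)))) N = 0"
  using lborel_affine[OF c, of x] N(3) by simp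
 then have "ennreal (\<bar>c\<bar> ^ DIM('a)) * emeasure lborel ((%z. x + c *. z) -` N) = 0"
  by (simp add: emeasure_density nn_integral_cmult_indicator emeasure_distr)
 then have "emeasure lborel ((%z. x + c *. z) -` N) = 0" using c by simp
 moreover have "(%z. x + c *. z) -` N \<in> sets borel"
  using measurable_sets_borel[of "%z. x + c *. z" borel N] N(2) by simp
 ultimately show ?thesis
  by (intro AE_I[of _ _ "(%z. x + c *. z) -` N"]) (use N(1) in auto)
qed

section \<open>Averaging over small balls\<close>

definition kernel :: "('a::euclidean_space => real) => bool"
 where "kernel kap \<longleftrightarrow> continuous_on UNIV kap & (\<forall>z. 1 <= norm z --> kap z = 0)"

definition moll :: "('a::euclidean_space => real) => real => ('a => 'b::euclidean_space) => 'a => 'b"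
 where "moll kap eps b x = (LI z. kap z *. b (x - eps *. z))"

definition bump_mass :: "'a::euclidean_space itself => real"
 where "bump_mass _ = (LI z::'a. (max 0 (1 - z \<bullet> z))^2)"

text \<open>A kernel of class \<open>C^1\<close> is enough, since only first derivatives of averages occur; a polynomial
expression keeps its derivative \<open>dbump\<close> explicit.\<close>

definition bump :: "'a::euclidean_space => real"
 where "bump z = (max 0 (1 - z \<bullet> z))^2 / bump_mass TYPE('a)"

definition dbump :: "'a::euclidean_space => 'a => real"
 where "dbump e z = - 4 * max 0 (1 - z \<bullet> z) * (z \<bullet> e) / bump_mass TYPE('a)"

lemma one_minus_norm_nonpos: "1 <= norm (z::'a::real_inner) ==> max 0 (1 - z \<bullet> z) = 0"
 using power_mono[of 1 "norm z" 2] by (simp add: dot_square_norm)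

lemma kernel_bounded:
 assumes "kernel kap" obtains C where "C >= 0" "!!z. \<bar>kap z\<bar> <= C"
 using bounded_continuous_compact_support[of "cball 0 1" kap] assms unfolding kernel_def
 by (metis compact_cball linear mem_cball_0 real_norm_def)

lemma kernel_borel[measurable]: "kernel kap ==> kap \<in> borel_fun"
 unfolding kernel_def by (auto intro: borel_cont)

lemma integrable_kernel:
 assumes "kernel (kap :: 'a::euclidean_space => real)" shows "integrable lborel kap"
 by (rule integrable_compact_support[of "cball 0 1"]) (use assms in "auto simp: kernel_def")

lemma bump_mass_pos: "bump_mass TYPE('a::euclidean_space) > 0"
proof -
 let ?f = "%z::'a. (max 0 (1 - z \<bullet> z))^2"
 have i: "integrable lborel ?f"
  by (rule integrable_compact_support[of "cball 0 1"])
   (auto intro!: continuous_intros simp: one_minus_norm_nonpos)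
 have "bump_mass TYPE('a) ~= 0"
 proof
  assume "bump_mass TYPE('a) = 0"
  then have "AE z in lborel. ?f z = 0"
   using integral_nonneg_eq_0_iff_AE[OF i] by (simp add: bump_mass_def)
  then have "AE z in (lborel::'a measure). z ~: ball 0 1"
  proof eventually_elim
   case (elim z)
   then have "z \<bullet> z >= 1" by auto
   then have "(norm z)^2 >= 1^2" by (simp add: dot_square_norm)
   then have "norm z >= 1" by (rule power2_le_imp_le) simp
   then show ?case by simp
  qed
  then have "ball (0::'a) 1 \<in> null_sets lborel" by (subst AE_iff_null_sets) auto
  then have "negligible (ball (0::'a) 1)"
   by (simp add: negligible_iff_null_sets null_sets_completionI)
  then show False using open_not_negligible[of "ball (0::'a) 1"] by simp
 qed
 moreover have "bump_mass TYPE('a) >= 0" unfolding bump_mass_def by simp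
 ultimately show ?thesis by simp
qed

lemma bump_nonneg: "bump z >= 0" using bump_mass_pos[where 'a='a] by (simp add: bump_def)

lemma kernel_bump: "kernel (bump :: 'a::euclidean_space => real)"
 and kernel_dbump: "kernel (dbump e :: 'a::euclidean_space => real)"
 unfolding kernel_def bump_def dbump_def
 using bump_mass_pos[where 'a='a] by (auto intro!: continuous_intros simp: one_minus_norm_nonpos)

lemma integral_bump: "(LI z. bump z) = 1"
 using bump_mass_pos[where 'a='a] unfolding bump_def bump_mass_def by simp

lemma max_square_derivative: "((%u::real. (max 0 u)^2) has_real_derivative 2 * max 0 u) (at u)"
proof -
 consider "u > 0" | "u < 0" | "u = 0" by linarith
 then show ?thesis
 proof cases
  case 1
  have "((%u::real. u^2) has_real_derivative 2 * max 0 u) (at u)"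
   using 1 by (auto intro!: derivative_eq_intros)
  then show ?thesis
   by (rule has_field_derivative_transform_within_open[of _ _ _ "{0<..}"]) (use 1 in auto)
 next
  case 2
  have "((%u::real. 0) has_real_derivative 2 * max 0 u) (at u)"
   using 2 by (auto intro!: derivative_eq_intros)
  then show ?thesis
   by (rule has_field_derivative_transform_within_open[of _ _ _ "{..<0}"]) (use 2 in auto)
 next
  case 3
  have "((%h. (max 0 h)^2 / h) \<longlongrightarrow> 0) (at (0::real))"
  proof (rule Lim_null_comparison)
   show "\<forall>\<^sub>F h in at 0. norm ((max 0 h)^2 / h) <= \<bar>h\<bar>"
    by (auto simp: eventually_at_filter max_def power2_eq_square)
  qed (auto intro!: tendsto_eq_intros)
  then show ?thesis unfolding has_field_derivative_iff using 3 by simp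
 qed
qed

lemma bump_derivative: "((%t. bump (z + t *. e)) has_real_derivative dbump e (z + s *. e)) (at s)"
proof -
 have 1: "((%t. 1 - (z + t *. e) \<bullet> (z + t *. e)) has_real_derivative - 2 * ((z + s *. e) \<bullet> e)) (at s)"
  unfolding has_field_derivative_def
  by (auto intro!: derivative_eq_intros simp: algebra_simps inner_commute)
 have "((%t. (max 0 (1 - (z + t *. e) \<bullet> (z + t *. e)))^2) has_real_derivative
   (2 * max 0 (1 - (z + s *. e) \<bullet> (z + s *. e))) * (- 2 * ((z + s *. e) \<bullet> e))) (at s)"
  by (rule DERIV_chain2[OF max_square_derivative 1])
 from DERIV_cdivide[OF this, of "bump_mass TYPE('a)"] show ?thesis
  unfolding bump_def dbump_def by (simp add: algebra_simps)
qed

lemma bump_lipschitz: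
 assumes C: "!!z. \<bar>dbump e z\<bar> <= C"
 shows "\<bar>bump (z + t *. e) - bump z\<bar> <= C * \<bar>t\<bar>"
 using field_differentiable_bound[of UNIV "%t. bump (z + t *. e)" "%s. dbump e (z + s *. e)" C t 0]
  bump_derivative C by (auto simp: has_field_derivative_at_within)

lemma moll_integrable:
 fixes b :: "'a::euclidean_space => 'b::euclidean_space"
 assumes k: "kernel kap" and b[measurable]: "b \<in> borel_fun" and B: "!!x. norm (b x) <= B"
 shows "integrable lborel (%z. kap z *. b (x - eps *. z))"
proof (rule Bochner_Integration.integrable_bound)
 have [measurable]: "kap \<in> borel_fun" using k by simp
 show "(%z. kap z *. b (x - eps *. z)) \<in> borel_measurable lborel" by simp
 show "integrable lborel (%z. B * kap z)" using integrable_kernel[OF k] by simp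
 have "B >= 0" using B[of 0] norm_ge_zero order_trans by blast
 then show "AE z in lborel. norm (kap z *. b (x - eps *. z)) <= norm (B * kap z)"
  using B by (auto simp: abs_mult mult.commute[of B] intro!: mult_left_mono)
qed

lemma moll_bound:
 fixes b :: "'a::euclidean_space => 'b::euclidean_space"
 assumes k: "kernel kap" and b[measurable]: "b \<in> borel_fun" and B: "!!x. norm (b x) <= B"
 shows "norm (moll kap eps b x) <= B * (LI z. \<bar>kap z\<bar>)"
proof -
 have "norm (moll kap eps b x) <= (LI z. norm (kap z *. b (x - eps *. z)))"
  unfolding moll_def by (rule integral_norm_bound)
 also have "... <= (LI z. B * \<bar>kap z\<bar>)"
  by (intro integral_mono integrable_norm moll_integrable[OF k b B] integrable_mult_right integrable_abs integrable_kernel[OF k])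
   (use B in "auto simp: mult.commute[of B] intro!: mult_left_mono")
 finally show ?thesis by simp
qed

lemma moll_shift:
 fixes b :: "'a::euclidean_space => 'b::euclidean_space"
 assumes k: "kernel kap" and b[measurable]: "b \<in> borel_fun" and B: "!!x. norm (b x) <= B" and e: "eps ~= 0"
 shows "moll kap eps b (x + p) = (LI z. kap (z + (1/eps) *. p) *. b (x - eps *. z))"
  and "integrable lborel (%z. kap (z + (1/eps) *. p) *. b (x - eps *. z))"
proof -
 have [measurable]: "kap \<in> borel_fun" using k by simp
 let ?h = "%z. kap z *. b (x + p - eps *. z)"
 have eq: "?h ((1/eps) *. p + z) = kap (z + (1/eps) *. p) *. b (x - eps *. z)" for z
  using e by (simp add: scaleR_add_right algebra_simps)
 show "moll kap eps b (x + p) = (LI z. kap (z + (1/eps) *. p) *. b (x - eps *. z))"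
  using lborel_integral_translation[of ?h "(1/eps) *. p"] unfolding eq moll_def by simp
 show "integrable lborel (%z. kap (z + (1/eps) *. p) *. b (x - eps *. z))"
  using lborel_integrable_translation[OF moll_integrable[OF k b B, of "x+p" eps], of "(1/eps) *. p"] unfolding eq .
qed

lemma kernel_shift_zero: "kernel kap ==> norm w <= 1 ==> z ~: cball 0 2 ==> kap (z + w) = 0"
 unfolding kernel_def using norm_triangle_ineq2[of z "- w"] by auto

lemma integrable_const_ball: "integrable lborel (%z. c * indicator (cball (0::'a::euclidean_space) r) z :: real)"
 by (intro integrable_mult_right integrable_real_indicator emeasure_bounded_finite) auto

lemma moll_continuous:
 fixes b :: "'a::euclidean_space => 'b::euclidean_space"
 assumes k: "kernel kap" and b[measurable]: "b \<in> borel_fun" and B: "!!x. norm (b x) <= B" and e: "eps > 0"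
 shows "continuous_on UNIV (moll kap eps b)"
 unfolding continuous_on_sequentially comp_def
proof (intro allI ballI impI, elim conjE)
 fix X a assume X: "X \<longlonglongrightarrow> (a::'a)"
 have [measurable]: "kap \<in> borel_fun" using k by simp
 obtain C where C: "C >= 0" "!!z. \<bar>kap z\<bar> <= C" using kernel_bounded[OF k] by blast
 have B0: "B >= 0" using B[of 0] norm_ge_zero order_trans by blast
 obtain n0 where n0: "!!n. n >= n0 ==> norm (X n - a) < eps"
  using X e unfolding LIMSEQ_def dist_norm by blast
 define p where "p n = (1/eps) *. (X (n + n0) - a)" for n
 have p1: "norm (p n) <= 1" for n using n0[of "n + n0"] e unfolding p_def norm_scaleR by simp
 have "(%n. X (n + n0) - a) \<longlonglongrightarrow> a - a" by (rule tendsto_diff[OF LIMSEQ_ignore_initial_segment[OF X] tendsto_const])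
 then have "p \<longlonglongrightarrow> (1/eps) *. (a - a)" unfolding p_def by (rule tendsto_scaleR[OF tendsto_const])
 then have p0: "p \<longlonglongrightarrow> 0" by simp
 have eq: "moll kap eps b (X (n + n0)) = (LI z. kap (z + p n) *. b (a - eps *. z))" for n
  using moll_shift(1)[OF k b B, of eps a "X (n + n0) - a"] e by (simp add: p_def)
 have "(%n. LI z. kap (z + p n) *. b (a - eps *. z)) \<longlonglongrightarrow> (LI z. kap (z + 0) *. b (a - eps *. z))"
 proof (rule integral_dominated_convergence[where w = "%z. (C * B) * indicator (cball 0 2) z"])
  show "AE z in lborel. (%n. kap (z + p n) *. b (a - eps *. z)) \<longlonglongrightarrow> kap (z + 0) *. b (a - eps *. z)"
  proof (rule AE_I2)
   fix z
   have "(%n. z + p n) \<longlonglongrightarrow> z + 0" by (intro tendsto_intros p0)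
   then have "(%n. kap (z + p n)) \<longlonglongrightarrow> kap (z + 0)"
    using k unfolding kernel_def by (metis UNIV_I continuous_on_eq_continuous_at isCont_tendsto_compose open_UNIV)
   then show "(%n. kap (z + p n) *. b (a - eps *. z)) \<longlonglongrightarrow> kap (z + 0) *. b (a - eps *. z)"
    by (intro tendsto_intros)
  qed
  show "AE z in lborel. norm (kap (z + p n) *. b (a - eps *. z)) <= (C * B) * indicator (cball 0 2) z" for n
  proof (rule AE_I2)
   fix z
   show "norm (kap (z + p n) *. b (a - eps *. z)) <= (C * B) * indicator (cball 0 2) z"
    using kernel_shift_zero[OF k p1, of z n] C B B0 by (cases "z \<in> cball 0 2") (auto intro!: mult_mono)
  qed
 qed (use integrable_const_ball in auto)
 then have "(%n. moll kap eps b (X (n + n0))) \<longlonglongrightarrow> moll kap eps b a" unfolding eq by (simp add: moll_def)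
 then show "(%n. moll kap eps b (X n)) \<longlonglongrightarrow> moll kap eps b a" by (rule LIMSEQ_offset)
qed

text \<open>For a merely bounded function the derivative falls on the kernel and costs a factor \<open>1 / eps\<close>.\<close>

lemma moll_bump_derivative:
 fixes b :: "'a::euclidean_space => 'b::euclidean_space"
 assumes b[measurable]: "b \<in> borel_fun" and B: "!!x. norm (b x) <= B" and eps: "eps > 0" and e: "norm e = 1"
 shows "((%t. moll bump eps b (x + t *. e)) has_vector_derivative (1/eps) *. moll (dbump e) eps b x) (at 0)"
proof -
 have [measurable]: "bump \<in> borel_measurable (borel::'a measure)" "dbump e \<in> borel_fun"
  by (rule kernel_borel[OF kernel_bump], rule kernel_borel[OF kernel_dbump])
 obtain C where C: "C >= 0" "!!z. \<bar>dbump e z\<bar> <= C" using kernel_bounded[OF kernel_dbump] by blast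
 define f where "f t z = bump (z + (1/eps) *. (t *. e)) *. b (x - eps *. z)" for t z
 have "((%t. LI z. f t z) has_vector_derivative (LI z. (1/eps) *. (dbump e z *. b (x - eps *. z)))) (at 0)"
 proof (rule has_vector_derivative_lebesgue_integral[where d = eps])
  show "integrable lborel (f t)" for t
   unfolding f_def by (rule moll_shift(2)[OF kernel_bump b B]) (use eps in auto)
  show "integrable lborel (%z. (C * B / eps) * indicator (cball (0::'a) 2) z)" by (rule integrable_const_ball)
  show "norm (f t z - f 0 z) <= \<bar>t\<bar> * ((C * B / eps) * indicator (cball 0 2) z)" if t: "\<bar>t\<bar> < eps" for t z
  proof (cases "z \<in> cball 0 2")
   case True
   have "norm (f t z - f 0 z) = \<bar>bump (z + (t/eps) *. e) - bump z\<bar> * norm (b (x - eps *. z))"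
    by (simp add: f_def flip: scaleR_diff_left)
   also have "... <= (C * \<bar>t/eps\<bar>) * B" using bump_lipschitz[OF C(2), of z "t/eps"] B C
    by (intro mult_mono) auto
   finally show ?thesis using True eps by (simp add: field_simps)
  next
   case False
   have "norm ((1/eps) *. (t *. e)) <= 1" using t eps e by (simp add: field_simps)
   from kernel_shift_zero[OF kernel_bump this False] kernel_shift_zero[OF kernel_bump _ False, of 0]
   show ?thesis using False by (simp add: f_def)
  qed
  show "AE z in lborel. ((%t. f t z) has_vector_derivative (1/eps) *. (dbump e z *. b (x - eps *. z))) (at 0)"
  proof (rule AE_I2)
   fix z
   have "((%t. bump (z + (t/eps) *. e)) has_real_derivative dbump e (z + (0/eps) *. e) * (1/eps)) (at 0)"
    by (rule DERIV_chain2[OF bump_derivative]) (use eps in "auto intro!: derivative_eq_intros")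
   then have "((%t. bump (z + (t/eps) *. e) *. b (x - eps *. z)) has_vector_derivative (dbump e z * (1/eps)) *. b (x - eps *. z)) (at 0)"
    by (auto intro!: derivative_eq_intros)
   then show "((%t. f t z) has_vector_derivative (1/eps) *. (dbump e z *. b (x - eps *. z))) (at 0)"
    by (simp add: f_def)
  qed
 qed (use eps in auto)
 moreover have "moll bump eps b (x + t *. e) = (LI z. f t z)" for t
  using moll_shift(1)[OF kernel_bump b B, of eps x "t *. e"] eps by (simp add: f_def)
 moreover have "(LI z. (1/eps) *. (dbump e z *. b (x - eps *. z))) = (1/eps) *. moll (dbump e) eps b x"
  by (simp only: moll_def integral_scaleR_right)
 ultimately show ?thesis by simp
qed

text \<open>For a Lipschitz function the derivative of the average is the average of the almost everywhere derivative, hence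
bounded uniformly in \<open>eps\<close>.\<close>

lemma moll_lipschitz_derivative:
 fixes A G :: "'a::euclidean_space => 'b::euclidean_space"
 assumes lip: "!!x y. norm (A x - A y) <= L * norm (x - y)" and A[measurable]: "A \<in> borel_fun" and B: "!!x. norm (A x) <= B"
  and G[measurable]: "G \<in> borel_fun" and e: "norm e = 1" and eps: "eps > 0"
  and ae: "AE x in lborel. ((%t. A (x + t *. e)) has_vector_derivative G x) (at 0)"
 shows "((%t. moll bump eps A (x + t *. e)) has_vector_derivative moll bump eps G x) (at 0)"
 unfolding moll_def
proof (rule has_vector_derivative_lebesgue_integral[where d = 1])
 have [measurable]: "bump \<in> borel_measurable (borel::'a measure)" by (rule kernel_borel[OF kernel_bump])
 show "integrable lborel (%z. bump z *. A (x + t *. e - eps *. z))" for t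
  by (rule moll_integrable[OF kernel_bump A B])
 show "integrable lborel (%z::'a. L * bump z)" using integrable_kernel[OF kernel_bump[where 'a='a]] by simp
 show "norm (bump z *. A (x + t *. e - eps *. z) - bump z *. A (x + 0 *. e - eps *. z)) <= \<bar>t\<bar> * (L * bump z)" for t z
 proof -
  have "norm (A (x + t *. e - eps *. z) - A (x - eps *. z)) <= L * \<bar>t\<bar>"
   using lip[of "x + t *. e - eps *. z" "x - eps *. z"] e by simp
  from mult_left_mono[OF this bump_nonneg[of z]] show ?thesis
   using bump_nonneg[of z] by (simp add: mult.commute mult.left_commute flip: scaleR_diff_right)
 qed
 have "AE z in lborel. ((%t. A (x + (-eps) *. z + t *. e)) has_vector_derivative G (x + (-eps) *. z)) (at 0)"
  by (rule AE_lborel_affine[OF ae]) (use eps in auto)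
 then show "AE z in lborel. ((%t. bump z *. A (x + t *. e - eps *. z)) has_vector_derivative bump z *. G (x - eps *. z)) (at 0)"
 proof eventually_elim
  case (elim z)
  have "((%t. bump z *. A (x + (-eps) *. z + t *. e)) has_vector_derivative bump z *. G (x + (-eps) *. z)) (at 0)"
   by (rule linear_vector_deriv[OF bounded_linear_scaleR_right elim])
  then show ?case by (simp add: algebra_simps)
 qed
 show "(%z. bump z *. G (x - eps *. z)) \<in> borel_measurable lborel" by simp
qed auto

lemma moll_lipschitz_dist:
 fixes A :: "'a::euclidean_space => 'b::euclidean_space"
 assumes lip: "!!x y. norm (A x - A y) <= L * norm (x - y)" and A[measurable]: "A \<in> borel_fun" and B: "!!x. norm (A x) <= B"
  and eps: "eps > 0"
 shows "norm (moll bump eps A x - A x) <= L * eps"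
proof -
 have L0: "L >= 0"
 proof -
  obtain b :: 'a where "b \<in> Basis" using nonempty_Basis by blast
  then show ?thesis using lip[of b 0] norm_Basis[of b] by (auto intro: order_trans[OF norm_ge_zero])
 qed
 have ib: "integrable lborel (%z::'a. bump z)" using integrable_kernel[OF kernel_bump] .
 have 1: "integrable lborel (%z. bump z *. A (x - eps *. z))" by (rule moll_integrable[OF kernel_bump A B])
 have 2: "integrable lborel (%z::'a. bump z *. A x)" by (rule integrable_scaleR_left) (use ib in auto)
 have "moll bump eps A x - A x = (LI z. bump z *. A (x - eps *. z)) - (LI z. bump (z::'a) *. A x)"
  using integral_bump[where 'a='a] ib by (simp add: moll_def)
 also have "... = (LI z. bump z *. A (x - eps *. z) - bump z *. A x)" using 1 2 by simp
 also have "norm ... <= (LI z. norm (bump z *. A (x - eps *. z) - bump z *. A x))" by (rule integral_norm_bound)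
 also have "... <= (LI z. (L * eps) * bump (z::'a))"
 proof (intro integral_mono integrable_norm Bochner_Integration.integrable_diff[OF 1 2] integrable_mult_right ib)
  fix z :: 'a
  show "norm (bump z *. A (x - eps *. z) - bump z *. A x) <= (L * eps) * bump z"
  proof (cases "norm z <= 1")
   case True
   have "norm (A (x - eps *. z) - A x) <= L * (eps * norm z)" using lip[of "x - eps *. z" x] eps by simp
   also have "... <= L * (eps * 1)" using True eps L0 by (intro mult_left_mono) auto
   finally have "norm (A (x - eps *. z) - A x) <= L * eps" by simp
   from mult_left_mono[OF this bump_nonneg[of z]] show ?thesis using bump_nonneg[of z]
    by (simp add: mult.commute[of _ "bump z"] flip: scaleR_diff_right)
  next
   case False
   then have "1 <= norm z" by simp
   then have "bump z = 0" using kernel_bump unfolding kernel_def by blast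
   then show ?thesis by simp
  qed
 qed
 finally show ?thesis using integral_bump[where 'a='a] by simp
qed

lemma moll_linear:
 fixes b :: "'a::euclidean_space => 'b::euclidean_space" and T :: "'b => 'c::euclidean_space"
 assumes T: "bounded_linear T" and k: "kernel kap" and b: "b \<in> borel_fun" and B: "!!x. norm (b x) <= B"
 shows "T (moll kap eps b x) = moll kap eps (%y. T (b y)) x"
 using integral_bounded_linear[OF T moll_integrable[OF k b B, of x eps]]
 unfolding moll_def by (simp add: linear_simps[OF T])

section \<open>A Remez inequality for entire functions\<close>

lemma lagrange_interpolation_at_zero:
 fixes P :: "real poly" and t :: "nat => real"
 assumes deg: "degree P <= N" and inj: "inj_on t {..N}"
 shows "poly P 0 = (\<Sum>i\<le>N. poly P (t i) * (\<Prod>j\<in>{..N}-{i}. t j / (t j - t i)))"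
proof -
 define l where "l i = (\<Prod>j\<in>{..N}-{i}. smult (1 / (t i - t j)) [:- t j, 1:])" for i
 define q where "q = (\<Sum>i\<le>N. smult (poly P (t i)) (l i))"
 have dl: "degree (l i) <= N" if "i <= N" for i
 proof -
  have "degree (l i) <= sum (degree \<circ> (%j. smult (1 / (t i - t j)) [:- t j, 1:])) ({..N}-{i})"
   unfolding l_def by (rule degree_prod_sum_le) simp
  also have "... <= sum (%j. 1) ({..N}-{i})"
   by (intro sum_mono) (auto intro: order_trans[OF degree_smult_le])
  also have "... = N" using that by simp
  finally show ?thesis .
 qed
 have dq: "degree q <= N" unfolding q_def
  by (intro degree_sum_le) (auto intro: order_trans[OF degree_smult_le] dl)
 have lk: "poly (l i) (t k) = (if i = k then 1 else 0)" if "i <= N" "k <= N" for i k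
 proof (cases "i = k")
  case True
  have "poly (l i) (t i) = (\<Prod>j\<in>{..N}-{i}. 1)" unfolding l_def poly_prod
  proof (rule prod.cong[OF refl])
   fix j assume j: "j \<in> {..N}-{i}"
   then have "t i - t j ~= 0" using inj that by (auto simp: inj_on_def)
   then show "poly (smult (1 / (t i - t j)) [:- t j, 1:]) (t i) = 1"
    by (simp add: diff_divide_distrib[symmetric])
  qed
  then show ?thesis using True by simp
 next
  case False
  then show ?thesis unfolding l_def poly_prod using that by (auto intro!: bexI[of _ k])
 qed
 have "P = q"
 proof (rule poly_eqI_degree[where A = "t ` {..N}"])
  fix x assume "x \<in> t ` {..N}"
  then obtain k where k: "k <= N" "x = t k" by auto
  have "poly q x = (\<Sum>i\<le>N. poly P (t i) * (if i = k then 1 else 0))"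
   unfolding q_def poly_sum by (rule sum.cong) (use k lk in auto)
  then show "poly P x = poly q x" using k by (simp add: if_distrib[where f="%x. _ * x"] cong: if_cong)
 qed (use deg dq card_image[OF inj] in auto)
 then have "poly P 0 = poly q 0" by (rule arg_cong)
 also have "... = (\<Sum>i\<le>N. poly P (t i) * poly (l i) 0)" by (simp add: q_def poly_sum)
 also have "... = (\<Sum>i\<le>N. poly P (t i) * (\<Prod>j\<in>{..N}-{i}. t j / (t j - t i)))"
 proof (rule sum.cong[OF refl])
  fix i
  have "poly (l i) 0 = (\<Prod>j\<in>{..N}-{i}. t j / (t j - t i))"
   unfolding l_def poly_prod
  proof (rule prod.cong[OF refl])
   fix j
   have "(- t j) / (- (t j - t i)) = t j / (t j - t i)" by (rule minus_divide_divide)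
   then show "poly (smult (1 / (t i - t j)) [:- t j, 1:]) 0 = t j / (t j - t i)" by simp
  qed
  then show "poly P (t i) * poly (l i) 0 = poly P (t i) * (\<Prod>j\<in>{..N}-{i}. t j / (t j - t i))" by simp
 qed
 finally show ?thesis .
qed

text \<open>Take a point of \<open>E\<close> close to its infimum, discard everything up to distance \<open>d\<close> beyond it,
and apply the induction hypothesis to the rest.\<close>

lemma separated_points_in_set:
 fixes E :: "real set"
 assumes "E \<in> sets borel" "E <= {0..1}" "d > 0" "measure lborel E > real N * d"
 shows "\<exists>t. (\<forall>i\<le>N. t i \<in> E) & (\<forall>i<N. t i + d <= t (Suc i))"
 using assms
proof (induction N arbitrary: E)
 case 0
 then have "E ~= {}" by auto
 then show ?case by auto
next
 case (Suc N)
 have ne: "E ~= {}"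
 proof
  assume "E = {}"
  then show False using Suc.prems(4) Suc.prems(3) by (simp add: mult_less_0_iff)
 qed
 have bb: "bdd_below E" using Suc.prems(2) by (intro bdd_belowI[of _ 0]) auto
 define a where "a = Inf E"
 define eta where "eta = (measure lborel E - real (Suc N) * d) / 2"
 have eta: "eta > 0" using Suc.prems(4) by (simp add: eta_def)
 obtain t0 where t0: "t0 \<in> E" "t0 < a + eta"
  using cInf_less_iff[OF ne bb, of "a + eta"] eta unfolding a_def by auto
 have a: "a <= x" if "x \<in> E" for x unfolding a_def by (rule cInf_lower[OF that bb])
 define E' where "E' = E \<inter> {t0 + d..}"
 have E': "E' \<in> sets borel" "E' <= {0..1}" using Suc.prems by (auto simp: E'_def)
 have fm: "E' \<in> fmeasurable lborel"
  by (rule fmeasurableI2[of "{0..1}"]) (use E' in "auto simp: fmeasurable_def")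
 have "measure lborel E <= measure lborel (E' \<union> {a..t0 + d})"
 proof (rule measure_mono_fmeasurable)
  show "E <= E' \<union> {a..t0 + d}" using a by (auto simp: E'_def)
  show "E' \<union> {a..t0 + d} \<in> fmeasurable lborel" by (rule fmeasurable.Un[OF fm]) (simp add: fmeasurable_def emeasure_lborel_Icc_eq)
 qed (use Suc.prems in auto)
 also have "... <= measure lborel E' + measure lborel {a..t0 + d}"
  by (rule measure_Un_le) (use E' in auto)
 also have "measure lborel {a..t0 + d} = t0 + d - a" using a[OF t0(1)] Suc.prems(3) by simp
 finally have "measure lborel E' > real N * d" using t0(2) eta by (simp add: eta_def field_simps)
 then obtain s where s: "!!i. i <= N ==> s i \<in> E'" "!!i. i < N ==> s i + d <= s (Suc i)"
  using Suc.IH[OF E' Suc.prems(3)] by blast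
 define t where "t i = (case i of 0 => t0 | Suc k => s k)" for i
 have "t i \<in> E" if "i <= Suc N" for i
  using that t0 s(1) by (cases i) (auto simp: t_def E'_def)
 moreover have "t i + d <= t (Suc i)" if "i < Suc N" for i
  using that s(1)[of 0] s(2) by (cases i) (auto simp: t_def E'_def)
 ultimately show ?case by blast
qed

lemma prod_index_distances:
 assumes "i <= N"
 shows "(\<Prod>j\<in>{..N}-{i}. \<bar>real j - real i\<bar>) = fact i * fact (N - i)"
proof -
 have sp: "{..N}-{i} = {..<i} \<union> {i<..N}" using assms by auto
 have "(\<Prod>j\<in>{..N}-{i}. \<bar>real j - real i\<bar>) = (\<Prod>j<i. \<bar>real j - real i\<bar>) * (\<Prod>j\<in>{i<..N}. \<bar>real j - real i\<bar>)"
  unfolding sp by (rule prod.union_disjoint) auto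
 also have "(\<Prod>j<i. \<bar>real j - real i\<bar>) = (\<Prod>j\<in>{1..i}. real j)"
  by (rule prod.reindex_bij_witness[of _ "%j. i - j" "%j. i - j"]) (auto simp: of_nat_diff)
 also have "... = fact i" by (simp add: fact_prod)
 also have "(\<Prod>j\<in>{i<..N}. \<bar>real j - real i\<bar>) = (\<Prod>j\<in>{1..N - i}. real j)"
  by (rule prod.reindex_bij_witness[of _ "%j. j + i" "%j. j - i"]) (auto simp: of_nat_diff)
 also have "... = fact (N - i)" by (simp add: fact_prod)
 finally show ?thesis .
qed

text \<open>Lagrange interpolation at \<open>N + 1\<close> points of \<open>E\<close> with mutual distance \<open>d\<close>; all
nodes lie in the unit interval, so the numerators are at most one, and the sum of the reciprocal denominators is a
binomial sum.\<close>

lemma polynomial_at_zero_bound: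
 fixes P :: "real poly" and E :: "real set"
 assumes deg: "degree P <= N" and E: "E \<in> sets borel" "E <= {0..1}" and d: "d > 0" "measure lborel E > real N * d"
  and s: "!!t. t \<in> E ==> \<bar>poly P t\<bar> <= s"
 shows "\<bar>poly P 0\<bar> <= s * (2 / d) ^ N / fact N"
proof -
 obtain t where t: "!!i. i <= N ==> t i \<in> E" "!!i. i < N ==> t i + d <= t (Suc i)"
  using separated_points_in_set[OF E d] by blast
 have gap: "t i + real k * d <= t (i + k)" if "i + k <= N" for i k
  using that
 proof (induction k)
  case (Suc k)
  then have "t (i + k) + d <= t (Suc (i + k))" by (intro t(2)) simp
  with Suc show ?case by (simp add: algebra_simps)
 qed simp
 have sep: "\<bar>real j - real i\<bar> * d <= \<bar>t j - t i\<bar>" if "i <= N" "j <= N" for i j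
 proof (cases "i <= j")
  case True
  then show ?thesis using gap[of i "j - i"] that d by (simp add: of_nat_diff)
 next
  case False
  then have "j + (i - j) = i" by simp
  then show ?thesis using gap[of j "i - j"] that d False by (simp add: of_nat_diff)
 qed
 have inj: "inj_on t {..N}"
 proof (rule inj_onI)
  fix i j assume "i \<in> {..N}" "j \<in> {..N}" "t i = t j"
  then have "\<bar>real j - real i\<bar> * d <= 0" using sep[of i j] by simp
  then show "i = j" using d by (simp add: mult_le_0_iff)
 qed
 have s0: "s >= 0" using s[OF t(1)[of 0]] by (auto intro: order_trans[OF abs_ge_zero])
 have L: "\<bar>\<Prod>j\<in>{..N}-{i}. t j / (t j - t i)\<bar> <= (1 / d)^N * (1 / (fact i * fact (N - i)))" if i: "i <= N" for i
 proof -
  have "\<bar>\<Prod>j\<in>{..N}-{i}. t j / (t j - t i)\<bar> = (\<Prod>j\<in>{..N}-{i}. \<bar>t j / (t j - t i)\<bar>)" by (rule abs_prod)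
  also have "... <= (\<Prod>j\<in>{..N}-{i}. (1/d) * (1 / \<bar>real j - real i\<bar>))"
  proof (rule prod_mono)
   fix j assume j: "j \<in> {..N}-{i}"
   have p: "\<bar>real j - real i\<bar> * d > 0" using j d by simp
   have tj: "\<bar>t j\<bar> <= 1" using t(1)[of j] j E by auto
   have "\<bar>t j\<bar> / \<bar>t j - t i\<bar> <= 1 / (\<bar>real j - real i\<bar> * d)"
    by (rule frac_le) (use tj p sep[of i j] i j in auto)
   then show "0 <= \<bar>t j / (t j - t i)\<bar> & \<bar>t j / (t j - t i)\<bar> <= (1/d) * (1 / \<bar>real j - real i\<bar>)"
    by (simp add: mult.commute)
  qed
  also have "... = (1/d)^card ({..N}-{i}) * (1 / (\<Prod>j\<in>{..N}-{i}. \<bar>real j - real i\<bar>))"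
   by (subst prod.distrib) (simp add: prod_dividef)
  also have "... = (1 / d)^N * (1 / (fact i * fact (N - i)))"
   using i by (simp add: prod_index_distances)
  finally show ?thesis .
 qed
 have "\<bar>poly P 0\<bar> <= (\<Sum>i\<le>N. \<bar>poly P (t i)\<bar> * \<bar>\<Prod>j\<in>{..N}-{i}. t j / (t j - t i)\<bar>)"
  unfolding lagrange_interpolation_at_zero[OF deg inj]
  by (rule order_trans[OF sum_abs]) (simp only: abs_mult order_refl)
 also have "... <= (\<Sum>i\<le>N. s * ((1 / d)^N * (1 / (fact i * fact (N - i)))))"
  by (intro sum_mono mult_mono L s t) (use s0 in auto)
 also have "... = (\<Sum>i\<le>N. s * (1/d)^N / fact N * real (N choose i))"
  by (intro sum.cong refl) (simp add: binomial_fact field_simps)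
 also have "... = s * (1/d)^N / fact N * 2^N"
  unfolding sum_distrib_left[symmetric] of_nat_sum[symmetric] choose_row_sum by simp
 also have "... = s * (2 / d) ^ N / fact N" by (simp add: power_divide)
 finally show ?thesis .
qed

lemma power_over_sqrt_fact_tendsto_0: "(%n. c ^ n / sqrt (fact n)) \<longlonglongrightarrow> (0::real)"
proof -
 have "(%n. (c^2) ^ n / fact n) \<longlonglongrightarrow> 0"
  using summable_LIMSEQ_zero[OF summable_exp[of "c^2"]] by (simp add: field_simps)
 then have "(%n. sqrt ((c^2) ^ n / fact n)) \<longlonglongrightarrow> sqrt 0" by (rule tendsto_real_sqrt)
 moreover have "sqrt ((c^2) ^ n / fact n) = \<bar>c ^ n / sqrt (fact n)\<bar>" for n
 proof -
  have "(c^2) ^ n = (c ^ n)^2" by (simp only: power_mult[symmetric] mult.commute)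
  then show ?thesis by (simp add: real_sqrt_divide)
 qed
 ultimately have "(%n. \<bar>c ^ n / sqrt (fact n)\<bar>) \<longlonglongrightarrow> 0" by simp
 then show ?thesis by (rule tendsto_rabs_zero_cancel)
qed

text \<open>A function that is approximated by polynomials of degree \<open>N\<close> at the rate of an entire function of order
two is controlled at \<open>0\<close> by its size on a set of positive measure, up to a small multiple of its global
size \<open>\<mu>\<close>. With separation \<open>l / (N + 1)\<close> the constant of the polynomial estimate grows
only exponentially in \<open>N\<close>; the factorial in the approximation rate wins, and \<open>N\<close> is fixed by
\<open>dl\<close>.\<close>

lemma remez_for_entire_functions:
 fixes B l dl :: real
 assumes B: "B >= 0" and l: "l > 0" and dl: "dl > 0"
 obtains K where "K >= 0"
  "!!(W :: real => real) \<mu> s E. [|\<mu> >= 0; E \<in> sets borel; E <= {0..1}; measure lborel E >= l;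
   !!t. t \<in> E ==> \<bar>W t\<bar> <= s;
   !!N. \<exists>P. degree P <= N & (\<forall>t\<in>{0..1}. \<bar>W t - poly P t\<bar> <= \<mu> * (B ^ Suc N / sqrt (fact (Suc N))))|]
   ==> \<bar>W 0\<bar> <= K * s + dl * \<mu>"
proof -
 define c where "c = exp 1 * (2 / l + 1)"
 have c1: "c >= 1" using l mult_mono[of 1 "exp 1" 1 "2/l + 1"] by (simp add: c_def)
 have lim: "(%n. 2 * ((c * B) ^ Suc n / sqrt (fact (Suc n)))) \<longlonglongrightarrow> 2 * 0"
  by (intro tendsto_intros filterlim_compose[OF power_over_sqrt_fact_tendsto_0 filterlim_Suc])
 then obtain N where N: "2 * ((c * B) ^ Suc N / sqrt (fact (Suc N))) < dl"
  using order_tendstoD(2)[OF lim, of dl] dl unfolding eventually_sequentially by auto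
 define d where "d = l / real (Suc N)"
 define K where "K = (2 / d) ^ N / fact N"
 define r where "r = B ^ Suc N / sqrt (fact (Suc N))"
 have r0: "r >= 0" using B by (simp add: r_def)
 have d: "d > 0" "real N * d < l" using l by (auto simp: d_def field_simps)
 have K0: "K >= 0" using d by (simp add: K_def)
 have "K = (2 / l) ^ N * (real (Suc N) ^ N / fact N)"
 proof -
  have "2 / d = (2 / l) * real (Suc N)" by (simp add: d_def)
  then show ?thesis unfolding K_def by (simp only: power_mult_distrib times_divide_eq_right)
 qed
 also have "real (Suc N) ^ N / fact N <= exp (real (Suc N))"
 proof -
  have "(\<Sum>i\<in>{N}. real (Suc N) ^ i /\<^sub>R fact i) <= (\<Sum>i. real (Suc N) ^ i /\<^sub>R fact i)"
  proof (rule sum_le_suminf)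
   show "summable (%i. real (Suc N) ^ i /\<^sub>R fact i)" by (rule summable_exp_generic)
   show "0 <= real (Suc N) ^ n /\<^sub>R fact n" for n by (rule scaleR_nonneg_nonneg) auto
  qed simp
  also have "... = exp (real (Suc N))" by (simp only: exp_def)
  also have "(\<Sum>i\<in>{N}. real (Suc N) ^ i /\<^sub>R fact i) = real (Suc N) ^ N / fact N"
   by (simp only: sum.insert finite.emptyI empty_iff not_False_eq_True sum.empty add_0_right real_scaleR_def divide_inverse mult.commute)
  finally show ?thesis .
 qed
 also have "(2 / l) ^ N * exp (real (Suc N)) <= (2 / l + 1) ^ Suc N * exp 1 ^ Suc N"
 proof (intro mult_mono)
  have "(2 / l) ^ N <= (2 / l + 1) ^ N" using l by (intro power_mono) auto
  also have "... <= (2 / l + 1) ^ Suc N" using l by (intro power_increasing) auto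
  finally show "(2 / l) ^ N <= (2 / l + 1) ^ Suc N" .
  show "exp (real (Suc N)) <= exp 1 ^ Suc N" by (simp only: exp_of_nat_mult[symmetric] mult_1_right order_refl)
 qed (use l in auto)
 also have "... = c ^ Suc N" by (simp only: c_def power_mult_distrib mult.commute)
 finally have Kc: "K <= c ^ Suc N" using l by (simp add: mult_left_mono)
 have "(K + 1) * r <= (c ^ Suc N + c ^ Suc N) * r"
  using Kc one_le_power[OF c1, of "Suc N"] r0 by (intro mult_right_mono add_mono) auto
 also have "... = 2 * ((c * B) ^ Suc N / sqrt (fact (Suc N)))"
  by (simp only: r_def power_mult_distrib mult_2[symmetric] times_divide_eq_right mult.assoc)
 finally have small: "(K + 1) * r <= dl" using N by simp
 show thesis
 proof (rule that[OF K0])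
  fix W :: "real => real" and \<mu> s :: real and E :: "real set"
  assume mu: "\<mu> >= 0" and E: "E \<in> sets borel" "E <= {0..1}" "measure lborel E >= l"
   and s: "!!t. t \<in> E ==> \<bar>W t\<bar> <= s"
   and ap: "!!N. \<exists>P. degree P <= N & (\<forall>t\<in>{0..1}. \<bar>W t - poly P t\<bar> <= \<mu> * (B ^ Suc N / sqrt (fact (Suc N))))"
  obtain P where P: "degree P <= N" "!!t. t \<in> {0..1} ==> \<bar>W t - poly P t\<bar> <= \<mu> * r"
   using ap[of N] unfolding r_def by blast
  have "\<bar>poly P 0\<bar> <= (s + \<mu> * r) * (2 / d) ^ N / fact N"
  proof (rule polynomial_at_zero_bound[OF P(1) E(1,2) d(1)])
   show "real N * d < measure lborel E" using d E by simp
   fix t assume t: "t \<in> E"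
   then show "\<bar>poly P t\<bar> <= s + \<mu> * r" using s[OF t] P(2)[of t] E by auto
  qed
  then have "\<bar>poly P 0\<bar> <= (s + \<mu> * r) * K" by (simp add: K_def)
  moreover have "\<bar>W 0\<bar> <= \<bar>poly P 0\<bar> + \<mu> * r" using P(2)[of 0] by auto
  ultimately have "\<bar>W 0\<bar> <= K * s + \<mu> * ((K + 1) * r)" by (simp add: algebra_simps)
  also have "\<mu> * ((K + 1) * r) <= dl * \<mu>" using mult_left_mono[OF small mu] by (simp add: mult.commute)
  finally show "\<bar>W 0\<bar> <= K * s + dl * \<mu>" by simp
 qed
qed

section \<open>Matrices and Gaussian integrals\<close>

lemma sym_matrix_inner: "transpose A = A ==> (x::real^'n) \<bullet> (A *v y) = (A *v x) \<bullet> y"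
 by (metis dot_lmul_matrix transpose_matrix_vector)

lemma norm_matrix_vector_le: "norm ((A::real^'n^'m) *v x) <= norm A * norm x"
proof -
 have "norm (A *v x) = L2_set (%i. norm ((A *v x) $ i)) UNIV" by (rule norm_vec_def)
 also have "... <= L2_set (%i. norm x * norm (A $ i)) UNIV"
 proof (rule L2_set_mono)
  show "norm ((A *v x) $ i) <= norm x * norm (A $ i)" for i
   using cauchy_schwarz[of x "A $ i"] by (simp add: matrix_vector_mul_component inner_commute)
 qed simp
 also have "... = norm x * norm A" by (simp add: L2_set_right_distrib norm_vec_def)
 finally show ?thesis by (simp add: mult.commute)
qed

lemma bounded_bilinear_matrix_vector: "bounded_bilinear ((*v) :: real^'n^'m => real^'n => real^'m)"
proof
 fix A B :: "real^'n^'m" and x y :: "real^'n" and r :: real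
 show "(A + B) *v x = A *v x + B *v x" by (rule matrix_vector_mult_add_rdistrib)
 show "A *v (x + y) = A *v x + A *v y" by (rule matrix_vector_right_distrib)
 show "(r *. A) *v x = r *. (A *v x)" by (rule scaleR_matrix_vector_assoc[symmetric])
 show "A *v (r *. x) = r *. (A *v x)" by (rule linear_cmul[OF mv_linear])
 show "\<exists>K. \<forall>A x. norm ((A::real^'n^'m) *v x) <= norm A * norm x * K"
  by (rule exI[of _ 1]) (simp add: norm_matrix_vector_le)
qed

lemmas continuous_on_matrix_vector [continuous_intros] =
 bounded_bilinear.continuous_on[OF bounded_bilinear_matrix_vector]

lemma symmetric_trace_product:
 fixes a H :: "real^'n^'n"
 assumes "transpose a = a"
 shows "(\<Sum>i\<in>UNIV. (a *v (H *v axis i 1)) $ i) = a \<bullet> H"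
proof -
 have s: "a $ i $ j = a $ j $ i" for i j using assms by (metis transpose_def vec_lambda_beta)
 have "(\<Sum>i\<in>UNIV. (a *v (H *v axis i 1)) $ i) = (\<Sum>i\<in>UNIV. \<Sum>j\<in>UNIV. a $ i $ j * H $ j $ i)"
  unfolding matrix_vector_mult_basis by (simp add: column_def matrix_vector_mult_def)
 also have "... = (\<Sum>j\<in>UNIV. \<Sum>i\<in>UNIV. a $ j $ i * H $ j $ i)"
  by (subst sum.swap) (simp add: s)
 also have "... = a \<bullet> H" by (simp add: inner_vec_def)
 finally show ?thesis .
qed

lemma integrable_gaussian:
 assumes b: "b > 0"
 shows "integrable lborel (%zeta::'a::euclidean_space. gauss b zeta)"
proof -
 have r: "(NI x::real. ennreal (exp (- b * x^2))) < \<infinity>"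
 proof -
  define sgm where "sgm = 1 / sqrt (2 * b)"
  have sgm: "sgm > 0" "sgm^2 = 1 / (2 * b)" using b by (auto simp: sgm_def power_divide)
  have "exp (- b * x^2) = sqrt (2 * pi * sgm^2) * normal_density 0 sgm x" for x
   unfolding normal_density_def using b sgm by (simp add: field_simps)
  then have "integrable lborel (%x::real. exp (- b * x^2))"
   using integrable_normal_moment[OF sgm(1), of 0 0] by simp
  then show ?thesis by (simp add: integrable_iff_bounded)
 qed
 have eq: "ennreal (gauss b zeta) = (\<Prod>i\<in>Basis. ennreal (exp (- b * (zeta \<bullet> i)^2)))" for zeta :: 'a
 proof -
  have "gauss b zeta = exp (\<Sum>i\<in>Basis. - b * (zeta \<bullet> i)^2)"
   by (subst euclidean_inner) (simp add: sum_distrib_left power2_eq_square)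
  then show ?thesis by (simp add: exp_sum prod_ennreal)
 qed
 have "(NI zeta::'a. ennreal (gauss b zeta)) = (\<Prod>i\<in>(Basis::'a set). NI x. ennreal (exp (- b * x^2)))"
  unfolding eq by (rule nn_integral_lborel_prod) auto
 also have "... < \<infinity>"
  using r by (simp add: less_top[symmetric] power_eq_top_ennreal)
 finally show ?thesis by (simp add: integrable_iff_bounded)
qed

lemma square_le_exp: "b > 0 ==> x^2 <= (1 / b) * exp (b * x^2)" for x :: real
proof -
 assume b: "b > 0"
 have "b * x^2 <= exp (b * x^2)" using exp_ge_add_one_self[of "b * x^2"] by linarith
 then show ?thesis using b by (simp add: field_simps)
qed

lemma integrable_gaussian_quadratic:
 assumes b: "b > 0"
 shows "integrable lborel (%zeta::'a::euclidean_space. gauss b zeta * (1 + (norm zeta)^2))"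
proof (rule Bochner_Integration.integrable_bound)
 show "integrable lborel (%zeta::'a. (1 + 2 / b) * gauss (b/2) zeta)"
  by (intro integrable_mult_right integrable_gaussian) (use b in simp)
 have "gauss b zeta * (1 + (norm zeta)^2) <= (1 + 2 / b) * gauss (b/2) zeta" for zeta :: 'a
 proof -
  have "(norm zeta)^2 <= (2 / b) * exp (b/2 * (norm zeta)^2)" using square_le_exp[of "b/2" "norm zeta"] b by simp
  moreover have "1 <= exp (b/2 * (norm zeta)^2)" using b by simp
  ultimately have "1 + (norm zeta)^2 <= exp (b/2 * (norm zeta)^2) + (2 / b) * exp (b/2 * (norm zeta)^2)"
   by (intro add_mono)
  then have "1 + (norm zeta)^2 <= (1 + 2 / b) * exp (b/2 * (zeta \<bullet> zeta))"
   by (simp add: dot_square_norm distrib_right)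
  then have "gauss b zeta * (1 + (norm zeta)^2) <= gauss b zeta * ((1 + 2 / b) * exp (b/2 * (zeta \<bullet> zeta)))"
   by (intro mult_left_mono) auto
  also have "... = (1 + 2 / b) * gauss (b/2) zeta"
   by (simp add: mult_exp_exp[symmetric] field_simps exp_add[symmetric])
  finally show ?thesis .
 qed
 then show "AE zeta::'a in lborel. norm (gauss b zeta * (1 + (norm zeta)^2)) <= norm ((1 + 2 / b) * gauss (b/2) zeta)"
  using b by (intro AE_I2) (simp add: abs_mult)
qed simp

lemma continuous_integral_of_product:
 fixes h :: "'p::metric_space => 'a::euclidean_space => real"
 assumes \<gamma>: "integrable lborel \<gamma>" and h: "!!zeta. continuous_on UNIV (%p. h p zeta)"
  and m: "!!p. h p \<in> borel_fun" and B: "!!p zeta. \<bar>h p zeta\<bar> <= B"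
 shows "continuous_on UNIV (%p. LI zeta. \<gamma> zeta * h p zeta)"
 unfolding continuous_on_sequentially comp_def
proof (intro allI ballI impI, elim conjE)
 fix X and p :: 'p assume X: "X \<longlonglongrightarrow> p"
 have [measurable]: "\<gamma> \<in> borel_fun" using borel_measurable_integrable[OF \<gamma>] by simp
 note m[measurable]
 show "(%n. LI zeta. \<gamma> zeta * h (X n) zeta) \<longlonglongrightarrow> (LI zeta. \<gamma> zeta * h p zeta)"
 proof (rule integral_dominated_convergence[where w = "%zeta. \<bar>\<gamma> zeta\<bar> * B"])
  show "integrable lborel (%zeta. \<bar>\<gamma> zeta\<bar> * B)" using \<gamma> by simp
  show "AE zeta in lborel. (%n. \<gamma> zeta * h (X n) zeta) \<longlonglongrightarrow> \<gamma> zeta * h p zeta"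
  proof (rule AE_I2)
   fix zeta
   have "(%n. h (X n) zeta) \<longlonglongrightarrow> h p zeta"
    using h[of zeta] X unfolding continuous_on_sequentially comp_def by blast
   then show "(%n. \<gamma> zeta * h (X n) zeta) \<longlonglongrightarrow> \<gamma> zeta * h p zeta" by (rule tendsto_mult_left)
  qed
  show "AE zeta in lborel. norm (\<gamma> zeta * h (X n) zeta) <= \<bar>\<gamma> zeta\<bar> * B" for n
   using B by (intro AE_I2) (auto simp: abs_mult intro!: mult_left_mono)
 qed auto
qed

section \<open>Gaussian averages adapted to an elliptic operator with constant coefficients\<close>

lemma deriv_along_line:
 assumes "(F has_derivative F') (at x)"
 shows "((%t::real. F (x + t *. e)) has_vector_derivative F' e) (at 0)"
proof -
 interpret F': bounded_linear F' using assms by (rule has_derivative_bounded_linear)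
 have "((%t::real. x + t *. e) has_derivative (%t. t *. e)) (at 0)"
  by (auto intro!: derivative_eq_intros)
 moreover have "(F has_derivative F') (at (x + 0 *. e))" using assms by simp
 ultimately have "((%t::real. F (x + t *. e)) has_derivative (%t. F' (t *. e))) (at 0)"
  by (rule has_derivative_compose)
 then show ?thesis by (simp add: has_vector_derivative_def F'.scaleR)
qed

text \<open>Here \<open>f = a : D^2 w + k w\<close> measures how far \<open>w\<close> is from a solution of an equation with
constant coefficients; \<open>g\<close> is the inverse of \<open>a\<close>, so that the Gaussian \<open>gam\<close> is
the heat kernel of \<open>a : D^2\<close> up to normalisation.\<close>

locale gaussian_average =
 fixes g a :: "real^'n^'n" and c C k k0 :: real and w :: "real^'n => real"
  and wV :: "real^'n => real^'n" and wH :: "real^'n => real^'n^'n" and K :: "(real^'n) set"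
 assumes symg: "transpose g = g" and syma: "transpose a = a" and inverse: "!!zeta. a *v (g *v zeta) = zeta"
  and c: "c > 0" and ell: "!!zeta. c * (zeta \<bullet> zeta) <= zeta \<bullet> (g *v zeta)" and gbound: "!!zeta. norm (g *v zeta) <= C * norm zeta"
  and dw: "!!x. (w has_derivative (%h. wV x \<bullet> h)) (at x)"
  and dV: "!!x. (wV has_derivative (%h. wH x *v h)) (at x)"
  and cH: "continuous_on UNIV wH" and K: "compact K"
  and zero: "!!x. x ~: K ==> w x = 0" "!!x. x ~: K ==> wV x = 0" "!!x. x ~: K ==> wH x = 0"
  and k: "\<bar>k\<bar> <= k0"
begin

definition gam :: "real^'n => real" where "gam zeta = exp (- (zeta \<bullet> (g *v zeta)) / 4)"
definition Z :: real where "Z = (LI zeta. gam zeta)"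
definition f :: "real^'n => real" where "f x = a \<bullet> wH x + k * w x"
definition phi :: "real^'n => real => real" where "phi y s = (LI zeta. gam zeta * w (y + s *. zeta))"
definition rhs :: "real^'n => ennreal" where
 "rhs y = (NI s. indicator {0..1} s * (NI zeta. ennreal (gauss (c/4) zeta * (f (y + s *. zeta))^2)))"

lemma quad_bound: "zeta \<bullet> (g *v zeta) <= C * (zeta \<bullet> zeta)"
proof -
 have "zeta \<bullet> (g *v zeta) <= norm zeta * norm (g *v zeta)" by (rule norm_cauchy_schwarz)
 also have "... <= norm zeta * (C * norm zeta)" by (intro mult_left_mono gbound) simp
 finally show ?thesis by (simp add: dot_square_norm power2_eq_square algebra_simps)
qed

lemma Cpos: "C > 0"
proof -
 have "c * 1 <= C * 1" using ell[of "axis undefined 1"] quad_bound[of "axis undefined 1"] by (simp add: inner_axis_axis)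
 then show ?thesis using c by simp
qed

lemma gam_le: "gam zeta <= gauss (c/4) zeta" and gam_ge: "gauss (C/4) zeta <= gam zeta" and gam_pos: "gam zeta > 0"
 using ell[of zeta] quad_bound[of zeta] by (auto simp: gam_def)

lemma continuous_gam: "continuous_on UNIV gam"
 unfolding gam_def by (intro continuous_intros) auto

lemma borel_gam[measurable]: "gam \<in> borel_fun"
 by (rule borel_cont[OF continuous_gam])

lemma integrable_gam: "integrable lborel gam"
proof (rule Bochner_Integration.integrable_bound)
 show "integrable lborel (%zeta::real^'n. gauss (c/4) zeta)" by (rule integrable_gaussian) (use c in simp)
 show "AE zeta in lborel. norm (gam zeta) <= norm (gauss (c/4) zeta)"
  using gam_le gam_pos by (intro AE_I2) (simp add: less_imp_le)
qed simp

lemma Z_ge: "(LI zeta::real^'n. gauss (C/4) zeta) <= Z"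
 unfolding Z_def by (intro integral_mono integrable_gaussian integrable_gam gam_ge) (use Cpos in simp)

lemma integrable_gam_mult:
 assumes [measurable]: "h \<in> borel_fun" and B: "!!zeta. \<bar>h zeta\<bar> <= B"
 shows "integrable lborel (%zeta. gam zeta * h zeta)"
proof (rule Bochner_Integration.integrable_bound)
 show "integrable lborel (%zeta. gam zeta * B)" using integrable_gam by simp
 show "AE zeta in lborel. norm (gam zeta * h zeta) <= norm (gam zeta * B)"
 proof (rule AE_I2)
  fix zeta have "\<bar>h zeta\<bar> <= \<bar>B\<bar>" using B[of zeta] by linarith
  then show "norm (gam zeta * h zeta) <= norm (gam zeta * B)"
   by (simp add: abs_mult mult_left_mono)
 qed
qed simp

lemma cw: "continuous_on UNIV w" and cV: "continuous_on UNIV wV"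
 using dw dV by (auto intro!: continuous_at_imp_continuous_on has_derivative_continuous)

lemma cf: "continuous_on UNIV f" unfolding f_def by (intro continuous_intros cw cH)

lemma borel_w[measurable]: "w \<in> borel_fun" and borel_V[measurable]: "wV \<in> borel_fun"
 and borel_H[measurable]: "wH \<in> borel_fun" and borel_f[measurable]: "f \<in> borel_fun"
 by (auto intro!: borel_cont cw cV cH cf)

lemma f_zero: "x ~: K ==> f x = 0" using zero by (simp add: f_def)

lemma bounds:
 obtains B where "B >= 0" "!!x. \<bar>w x\<bar> <= B" "!!x. norm (wV x) <= B" "!!x. norm (wH x) <= B" "!!x. \<bar>f x\<bar> <= B"
proof -
 obtain B1 where 1: "B1 >= 0" "!!x. norm (w x) <= B1" using bounded_continuous_compact_support[OF K cw zero(1)] by blast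
 obtain B2 where 2: "B2 >= 0" "!!x. norm (wV x) <= B2" using bounded_continuous_compact_support[OF K cV zero(2)] by blast
 obtain B3 where 3: "B3 >= 0" "!!x. norm (wH x) <= B3" using bounded_continuous_compact_support[OF K cH zero(3)] by blast
 obtain B4 where 4: "B4 >= 0" "!!x. norm (f x) <= B4" using bounded_continuous_compact_support[OF K cf f_zero] by blast
 show thesis
 proof (rule that[of "B1 + B2 + B3 + B4"])
  fix x
  show "\<bar>w x\<bar> <= B1 + B2 + B3 + B4" "norm (wV x) <= B1 + B2 + B3 + B4" "norm (wH x) <= B1 + B2 + B3 + B4" "\<bar>f x\<bar> <= B1 + B2 + B3 + B4"
   using 1(1) 2(1) 3(1) 4(1) 1(2)[of x] 2(2)[of x] 3(2)[of x] 4(2)[of x] by auto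
 qed (use 1 2 3 4 in auto)
qed

text \<open>The gradient of \<open>gam\<close> is \<open>- gam g zeta / 2\<close>; applied to \<open>a wV\<close> this returns
\<open>zeta\<close> because \<open>a\<close> inverts \<open>g\<close>.\<close>

lemma gaussian_integration_by_parts:
 assumes s: "s ~= 0"
 shows "(LI zeta. gam zeta * (wV (y + s *. zeta) \<bullet> zeta)) = 2 * s * (LI zeta. gam zeta * (a \<bullet> wH (y + s *. zeta)))"
proof -
 define K' where "K' = (%x. (1/s) *. (x - y)) ` K"
 have K': "compact K'" unfolding K'_def by (intro compact_continuous_image continuous_intros K)
 have out: "y + s *. zeta ~: K" if "zeta ~: K'" for zeta
 proof
  assume "y + s *. zeta \<in> K"
  then have "(1/s) *. (y + s *. zeta - y) \<in> K'" unfolding K'_def by (rule imageI)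
  then show False using that s by simp
 qed
 have cwV: "continuous_on UNIV (%zeta. wV (y + s *. zeta))" by (rule continuous_on_compose2[OF cV]) (auto intro!: continuous_intros)
 have cwH: "continuous_on UNIV (%zeta. wH (y + s *. zeta))" by (rule continuous_on_compose2[OF cH]) (auto intro!: continuous_intros)
 define W where "W zeta = gam zeta *. (a *v wV (y + s *. zeta))" for zeta
 define W' where "W' i zeta = gam zeta *. (s *. (a *v (wH (y + s *. zeta) *v axis i 1)))
   + (- (1/2) * (g *v zeta) $ i * gam zeta) *. (a *v wV (y + s *. zeta))" for i zeta
 have div: "(LI zeta. (\<Sum>i\<in>UNIV. W' i zeta $ i)) = 0"
 proof (rule integral_divergence_zero(1)[OF open_UNIV K'])
  fix zeta i
  have "((%t. wV ((y + s *. zeta) + t *. (s *. axis i 1))) has_vector_derivative wH (y + s *. zeta) *v (s *. axis i 1)) (at 0)"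
   by (rule deriv_along_line[OF dV])
  then have 1: "((%t. wV (y + s *. (zeta + t *. axis i 1))) has_vector_derivative s *. (wH (y + s *. zeta) *v axis i 1)) (at 0)"
   by (simp add: algebra_simps linear_cmul[OF mv_linear])
  have 2: "((%t. a *v wV (y + s *. (zeta + t *. axis i 1))) has_vector_derivative s *. (a *v (wH (y + s *. zeta) *v axis i 1))) (at 0)"
   using linear_vector_deriv[OF matrix_vector_mul_bounded_linear 1, of a]
   by (simp add: linear_cmul[OF mv_linear])
  have q: "(zeta + t *. axis i 1) \<bullet> (g *v (zeta + t *. axis i 1))
    = zeta \<bullet> (g *v zeta) + t * (2 * (g *v zeta) $ i) + t^2 * (axis i 1 \<bullet> (g *v axis i 1))" for t
  proof -
   have "zeta \<bullet> (g *v axis i 1) = (g *v zeta) $ i"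
    by (simp add: sym_matrix_inner[OF symg] inner_axis)
   then show ?thesis
    by (simp add: matrix_vector_right_distrib linear_cmul[OF mv_linear] inner_add inner_axis' power2_eq_square algebra_simps)
  qed
  have 3: "((%t. gam (zeta + t *. axis i 1)) has_real_derivative - (1/2) * (g *v zeta) $ i * gam zeta) (at 0)"
   unfolding gam_def q by (auto intro!: derivative_eq_intros)
  show "((%t. W (zeta + t *. axis i 1)) has_vector_derivative W' i zeta) (at 0)"
   unfolding W_def W'_def using has_vector_derivative_scaleR[OF 3 2] by (simp add: algebra_simps)
 next
  show "continuous_on UNIV W" unfolding W_def by (intro continuous_intros continuous_gam cwV)
  show "continuous_on UNIV (W' i)" for i unfolding W'_def by (intro continuous_intros continuous_gam cwV cwH)
  show "W zeta = 0" if "zeta ~: K'" for zeta using zero(2)[OF out[OF that]] by (simp add: W_def)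
  show "W' i zeta = 0" if "zeta ~: K'" for zeta i using zero(2,3)[OF out[OF that]] by (simp add: W'_def)
 qed simp
 have eq: "(\<Sum>i\<in>UNIV. W' i zeta $ i) = s * (gam zeta * (a \<bullet> wH (y + s *. zeta))) - (1/2) * (gam zeta * (wV (y + s *. zeta) \<bullet> zeta))" for zeta
 proof -
  let ?v = "wV (y + s *. zeta)"
  have "(\<Sum>i\<in>UNIV. (g *v zeta) $ i * (a *v ?v) $ i) = (g *v zeta) \<bullet> (a *v ?v)" by (simp add: inner_vec_def)
  also have "... = zeta \<bullet> ?v" by (simp add: sym_matrix_inner[OF syma] inverse)
  finally have 1: "(\<Sum>i\<in>UNIV. (g *v zeta) $ i * (a *v ?v) $ i) = ?v \<bullet> zeta" by (simp add: inner_commute)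
  have "(\<Sum>i\<in>UNIV. W' i zeta $ i) = s * gam zeta * (\<Sum>i\<in>UNIV. (a *v (wH (y + s *. zeta) *v axis i 1)) $ i)
    - (1/2) * gam zeta * (\<Sum>i\<in>UNIV. (g *v zeta) $ i * (a *v ?v) $ i)"
   unfolding W'_def sum_distrib_left sum_subtractf[symmetric] by (rule sum.cong) (auto simp: algebra_simps)
  then show ?thesis unfolding 1 symmetric_trace_product[OF syma] by simp
 qed
 have i1: "integrable lborel (%zeta. gam zeta * (a \<bullet> wH (y + s *. zeta)))"
  by (rule integrable_compact_support[OF K']) (use out zero(3) in "auto intro!: continuous_intros continuous_gam cwH")
 have i2: "integrable lborel (%zeta. gam zeta * (wV (y + s *. zeta) \<bullet> zeta))"
  by (rule integrable_compact_support[OF K']) (use out zero(2) in "auto intro!: continuous_intros continuous_gam cwV")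
 show ?thesis using div i1 i2 unfolding eq by simp
qed

lemma phi_derivative: "(phi y has_real_derivative (LI zeta. gam zeta * (wV (y + s *. zeta) \<bullet> zeta))) (at s)"
proof -
 obtain B where B: "B >= 0" "!!x. \<bar>w x\<bar> <= B" "!!x. norm (wV x) <= B" using bounds by metis
 have on: "onorm (%h. wV x \<bullet> h) <= B" for x
 proof (rule onorm_le)
  show "norm (wV x \<bullet> h) <= B * norm h" for h
   using order_trans[OF cauchy_schwarz mult_right_mono[OF B(3) norm_ge_zero]] by simp
 qed
 have lipw: "\<bar>w x - w x'\<bar> <= B * norm (x - x')" for x x'
  using differentiable_bound[of UNIV w "%x h. wV x \<bullet> h" B x x'] dw on by simp
 have "((%t. LI zeta. gam zeta * w (y + (s + t) *. zeta)) has_vector_derivative (LI zeta. gam zeta * (wV (y + s *. zeta) \<bullet> zeta))) (at 0)"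
 proof (rule has_vector_derivative_lebesgue_integral[where d = 1 and B = "%zeta. B * (gauss (c/4) zeta * (1 + (norm zeta)^2))"])
  show "integrable lborel (%zeta. gam zeta * w (y + (s + t) *. zeta))" for t
   by (rule integrable_gam_mult) (use B in auto)
  show "integrable lborel (%zeta::real^'n. B * (gauss (c/4) zeta * (1 + (norm zeta)^2)))"
   by (intro integrable_mult_right integrable_gaussian_quadratic) (use c in simp)
  show "norm (gam zeta * w (y + (s + t) *. zeta) - gam zeta * w (y + (s + 0) *. zeta)) <= \<bar>t\<bar> * (B * (gauss (c/4) zeta * (1 + (norm zeta)^2)))" for t zeta
  proof -
   have n: "norm zeta <= 1 + (norm zeta)^2" using zero_le_power2[of "norm zeta - 1"] by (simp add: power2_diff) (smt (verit) norm_ge_zero)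
   have "\<bar>w (y + (s + t) *. zeta) - w (y + s *. zeta)\<bar> <= B * (\<bar>t\<bar> * norm zeta)"
    using lipw[of "y + (s + t) *. zeta" "y + s *. zeta"] by (simp add: algebra_simps)
   also have "... <= B * (\<bar>t\<bar> * (1 + (norm zeta)^2))" using n B by (intro mult_left_mono) auto
   finally have 1: "\<bar>w (y + (s + t) *. zeta) - w (y + s *. zeta)\<bar> <= B * (\<bar>t\<bar> * (1 + (norm zeta)^2))" .
   have "norm (gam zeta * w (y + (s + t) *. zeta) - gam zeta * w (y + (s + 0) *. zeta)) = gam zeta * \<bar>w (y + (s + t) *. zeta) - w (y + s *. zeta)\<bar>"
    using gam_pos[of zeta] by (simp add: abs_mult flip: right_diff_distrib)
   also have "... <= gauss (c/4) zeta * (B * (\<bar>t\<bar> * (1 + (norm zeta)^2)))"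
    by (intro mult_mono gam_le 1) auto
   finally show ?thesis by (simp add: algebra_simps)
  qed
  show "AE zeta in lborel. ((%t. gam zeta * w (y + (s + t) *. zeta)) has_vector_derivative gam zeta * (wV (y + s *. zeta) \<bullet> zeta)) (at 0)"
  proof (rule AE_I2)
   fix zeta
   have "((%t. w ((y + s *. zeta) + t *. zeta)) has_vector_derivative wV (y + s *. zeta) \<bullet> zeta) (at 0)"
    by (rule deriv_along_line[OF dw])
   from linear_vector_deriv[OF bounded_linear_mult_right this, of "gam zeta"]
   show "((%t. gam zeta * w (y + (s + t) *. zeta)) has_vector_derivative gam zeta * (wV (y + s *. zeta) \<bullet> zeta)) (at 0)"
    by (simp add: algebra_simps)
  qed
 qed auto
 then have "((%t. phi y (s + t)) has_real_derivative (LI zeta. gam zeta * (wV (y + s *. zeta) \<bullet> zeta))) (at 0)"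
  by (simp add: real_vector_deriv phi_def)
 then show ?thesis
  using DERIV_at_within_shift[of "phi y" _ s 0 UNIV] by simp
qed

lemma integrable_gam_w: "integrable lborel (%zeta. gam zeta * w (y + s *. zeta))"
 and integrable_gam_H: "integrable lborel (%zeta. gam zeta * (a \<bullet> wH (y + s *. zeta)))"
proof -
 obtain B where B: "B >= 0" "!!x. \<bar>w x\<bar> <= B" "!!x. norm (wH x) <= B" using bounds by metis
 show "integrable lborel (%zeta. gam zeta * w (y + s *. zeta))" by (rule integrable_gam_mult) (use B in auto)
 show "integrable lborel (%zeta. gam zeta * (a \<bullet> wH (y + s *. zeta)))"
 proof (rule integrable_gam_mult)
  show "\<bar>a \<bullet> wH (y + s *. zeta)\<bar> <= norm a * B" for zeta
   by (rule order_trans[OF cauchy_schwarz]) (intro mult_left_mono B, simp)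
 qed simp
qed

text \<open>In the variable \<open>s^2\<close> the average \<open>phi y s\<close> solves the heat equation; the factor \<open>exp
(k s^2)\<close> absorbs the zero order term, and only \<open>f\<close> remains.\<close>

lemma heat_derivative:
 assumes s: "s ~= 0"
 shows "((%s. exp (k * s^2) * phi y s) has_real_derivative
  2 * s * exp (k * s^2) * (LI zeta. gam zeta * f (y + s *. zeta))) (at s)"
proof -
 have "(LI zeta. gam zeta * f (y + s *. zeta)) = (LI zeta. gam zeta * (a \<bullet> wH (y + s *. zeta)) + k * (gam zeta * w (y + s *. zeta)))"
  by (simp add: f_def algebra_simps)
 also have "... = (LI zeta. gam zeta * (a \<bullet> wH (y + s *. zeta))) + k * phi y s"
  unfolding phi_def using integrable_gam_w integrable_gam_H by simp
 finally have e: "(LI zeta. gam zeta * f (y + s *. zeta)) = (LI zeta. gam zeta * (a \<bullet> wH (y + s *. zeta))) + k * phi y s" .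
 have "((%s. exp (k * s^2) * phi y s) has_real_derivative
  exp (k * s^2) * (k * (2 * s)) * phi y s + exp (k * s^2) * (LI zeta. gam zeta * (wV (y + s *. zeta) \<bullet> zeta))) (at s)"
  by (auto intro!: derivative_eq_intros phi_derivative)
 then show ?thesis unfolding e gaussian_integration_by_parts[OF s] by (simp add: algebra_simps)
qed

lemma continuous_gam_average:
 fixes h :: "real^'n => real"
 assumes h: "continuous_on UNIV h" and B: "!!x. \<bar>h x\<bar> <= B"
 shows "continuous_on UNIV (%s. LI zeta. gam zeta * h (y + s *. zeta))"
  and "continuous_on UNIV (%y. LI zeta. gam zeta * h (y + s *. zeta))"
proof -
 have [measurable]: "h \<in> borel_fun" using h by (rule borel_cont)
 show "continuous_on UNIV (%s. LI zeta. gam zeta * h (y + s *. zeta))"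
  by (rule continuous_integral_of_product[OF integrable_gam])
   (auto intro!: continuous_on_compose2[OF h] continuous_intros B)
 show "continuous_on UNIV (%y. LI zeta. gam zeta * h (y + s *. zeta))"
  by (rule continuous_integral_of_product[OF integrable_gam])
   (auto intro!: continuous_on_compose2[OF h] continuous_intros B)
qed

text \<open>Integrate the previous derivative from \<open>s = 0\<close>, where the normalised average is \<open>w y\<close>, to
\<open>s = 1\<close>: the function \<open>w\<close> differs from its average, which is analytic, only by an integral
of \<open>f\<close>.\<close>

lemma gaussian_heat_estimate:
 "ennreal ((exp k * phi y 1 / Z - w y)^2) <= ennreal (4 * exp (2 * k0) / Z) * rhs y"
proof -
 obtain B where B: "B >= 0" "!!x. \<bar>w x\<bar> <= B" "!!x. \<bar>f x\<bar> <= B" using bounds by metis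
 have Zp: "Z > 0"
 proof -
  have "Z ~= 0"
  proof
   assume "Z = 0"
   then have "AE zeta in lborel. gam zeta = 0"
    using integral_nonneg_eq_0_iff_AE[OF integrable_gam] gam_pos by (simp add: Z_def less_imp_le)
   then have "AE zeta in (lborel :: (real^'n) measure). zeta ~: UNIV" using gam_pos by (simp add: less_le)
   then have "UNIV \<in> null_sets (lborel :: (real^'n) measure)" by (subst AE_iff_null_sets) auto
   then show False by (simp add: null_sets_def)
  qed
  moreover have "Z >= 0" unfolding Z_def using gam_pos by (intro lint_nonneg) (simp add: less_imp_le)
  ultimately show ?thesis by simp
 qed
 define G where "G s = 2 * s * exp (k * s^2) * (LI zeta. gam zeta * f (y + s *. zeta))" for s
 have cG: "continuous_on UNIV G" unfolding G_def
  by (intro continuous_intros continuous_gam_average[OF cf B(3)])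
 have cphi: "continuous_on UNIV (phi y)" unfolding phi_def
  by (rule continuous_gam_average(1)[OF cw B(2)])
 have "(G has_integral (exp (k * 1^2) * phi y 1 - exp (k * 0^2) * phi y 0)) {0..1}"
 proof (rule fundamental_theorem_of_calculus_interior)
  show "continuous_on {0..1} (%s. exp (k * s^2) * phi y s)"
   by (intro continuous_intros continuous_on_subset[OF cphi]) auto
  show "((%s. exp (k * s^2) * phi y s) has_vector_derivative G s) (at s)" if "s \<in> {0<..<1}" for s
   using heat_derivative[of s y] that by (simp add: G_def real_vector_deriv)
 qed simp
 moreover have phi0: "phi y 0 = Z * w y" by (simp add: phi_def Z_def)
 moreover have si: "set_integrable lborel {0..1} G"
  by (rule borel_integrable_atLeastAtMost'[OF continuous_on_subset[OF cG]]) simp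
 ultimately have int: "exp k * phi y 1 - Z * w y = (LI s. indicator {0..1} s *. G s)"
  using set_borel_integral_eq_integral(2)[OF si] by (simp add: integral_unique set_lebesgue_integral_def)
 define X where "X s = (NI zeta. ennreal (gam zeta * \<bar>f (y + s *. zeta)\<bar>))" for s
 have [measurable]: "X \<in> borel_fun" unfolding X_def by measurable
 have "ennreal \<bar>exp k * phi y 1 - Z * w y\<bar> <= (NI s. norm (indicator {0..1} s *. G s))"
  using integral_norm_bound_ennreal[of lborel "%s. indicator {0..1} s *. G s"] si
  unfolding int by (simp add: set_integrable_def)
 also have "... <= (NI s. indicator {0..1} s * (ennreal (2 * exp k0) * X s))"
 proof (rule nn_integral_mono)
  fix s :: real
  show "ennreal (norm (indicator {0..1} s *. G s)) <= indicator {0..1} s * (ennreal (2 * exp k0) * X s)"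
  proof (cases "s \<in> {0..1}")
   case True
   have i: "integrable lborel (%zeta. gam zeta * f (y + s *. zeta))" by (rule integrable_gam_mult) (use B in auto)
   have "ennreal \<bar>LI zeta. gam zeta * f (y + s *. zeta)\<bar> <= X s"
    using integral_norm_bound_ennreal[OF i] gam_pos by (simp add: X_def abs_mult less_imp_le)
   moreover have "\<bar>2 * s * exp (k * s^2)\<bar> <= 2 * exp k0"
   proof -
    have "k * s^2 <= \<bar>k\<bar> * 1" using True by (intro mult_mono) (auto simp: power_le_one)
    then have "exp (k * s^2) <= exp k0" using k by simp
    then have "s * exp (k * s^2) <= 1 * exp k0" using True by (intro mult_mono) auto
    then show ?thesis using True by (simp add: abs_mult)
   qed
   ultimately have "ennreal \<bar>2 * s * exp (k * s^2)\<bar> * ennreal \<bar>LI zeta. gam zeta * f (y + s *. zeta)\<bar> <= ennreal (2 * exp k0) * X s"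
    by (intro mult_mono ennreal_leI) auto
   then show ?thesis using True by (simp add: G_def abs_mult ennreal_mult[symmetric])
  qed simp
 qed
 also have "... = ennreal (2 * exp k0) * (NI s. indicator {0..1} s * X s)"
  by (subst nn_integral_cmult[symmetric]) (auto intro!: nn_integral_cong simp: ac_simps)
 finally have 1: "ennreal \<bar>exp k * phi y 1 - Z * w y\<bar> <= ennreal (2 * exp k0) * (NI s. indicator {0..1} s * X s)" .
 have X2: "(X s)^2 <= ennreal Z * (NI zeta. ennreal (gauss (c/4) zeta * (f (y + s *. zeta))^2))" for s
 proof -
  have "X s = (NI zeta. ennreal (sqrt (gam zeta)) * ennreal (sqrt (gam zeta) * \<bar>f (y + s *. zeta)\<bar>))"
   unfolding X_def by (intro nn_integral_cong) (use gam_pos in "simp add: ennreal_mult[symmetric] less_imp_le flip: mult.assoc")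
  also have "...^2 <= (NI zeta. (ennreal (sqrt (gam zeta)))^2) * (NI zeta. (ennreal (sqrt (gam zeta) * \<bar>f (y + s *. zeta)\<bar>))^2)"
   by (rule Cauchy_Schwarz_nn_integral) auto
  also have "(NI zeta. (ennreal (sqrt (gam zeta)))^2) = (NI zeta. ennreal (gam zeta))"
   by (intro nn_integral_cong) (use gam_pos in "simp add: ennreal_power less_imp_le")
  also have "... = ennreal Z" unfolding Z_def
   by (rule nn_integral_eq_integral[OF integrable_gam]) (use gam_pos in "simp add: less_imp_le")
  also have "(NI zeta. (ennreal (sqrt (gam zeta) * \<bar>f (y + s *. zeta)\<bar>))^2) <= (NI zeta. ennreal (gauss (c/4) zeta * (f (y + s *. zeta))^2))"
  proof (rule nn_integral_mono)
   fix zeta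
   have "(ennreal (sqrt (gam zeta) * \<bar>f (y + s *. zeta)\<bar>))^2 = ennreal (gam zeta * (f (y + s *. zeta))^2)"
    using gam_pos[of zeta] by (simp add: ennreal_power power_mult_distrib less_imp_le)
   also have "... <= ennreal (gauss (c/4) zeta * (f (y + s *. zeta))^2)"
    by (intro ennreal_leI mult_right_mono gam_le) simp
   finally show "(ennreal (sqrt (gam zeta) * \<bar>f (y + s *. zeta)\<bar>))^2 <= ennreal (gauss (c/4) zeta * (f (y + s *. zeta))^2)" .
  qed
  finally show ?thesis by (simp add: mult_left_mono)
 qed
 have "(NI s. indicator {0..1} s * X s)^2 = (NI s. indicator {0..1::real} s * (indicator {0..1} s * X s))^2"
  by (intro arg_cong[where f = "%x. x^2"] nn_integral_cong) (auto split: split_indicator)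
 also have "... <= (NI s. (indicator {0..1::real} s)^2) * (NI s. (indicator {0..1} s * X s)^2)"
  by (rule Cauchy_Schwarz_nn_integral) auto
 also have "(NI s. (indicator {0..1::real} s)^2) = (NI s. indicator {0..1::real} s)"
  by (intro nn_integral_cong) (auto split: split_indicator)
 also have "... = 1" by simp
 also have "1 * (NI s. (indicator {0..1} s * X s)^2) <= (NI s. ennreal Z * (indicator {0..1} s * (NI zeta. ennreal (gauss (c/4) zeta * (f (y + s *. zeta))^2))))"
  unfolding mult_1 by (intro nn_integral_mono) (use X2 in "auto split: split_indicator")
 also have "... = ennreal Z * rhs y" unfolding rhs_def by (rule nn_integral_cmult) measurable
 finally have 2: "(NI s. indicator {0..1} s * X s)^2 <= ennreal Z * rhs y" .
 have "(exp k * phi y 1 / Z - w y)^2 = (1/Z)^2 * \<bar>exp k * phi y 1 - Z * w y\<bar>^2"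
  using Zp by (simp add: field_simps)
 then have "ennreal ((exp k * phi y 1 / Z - w y)^2) = ennreal ((1/Z)^2) * (ennreal \<bar>exp k * phi y 1 - Z * w y\<bar>)^2"
  by (simp add: ennreal_mult ennreal_power)
 also have "... <= ennreal ((1/Z)^2) * (ennreal (2 * exp k0) * (NI s. indicator {0..1} s * X s))^2"
  by (intro mult_left_mono power_mono 1) auto
 also have "... <= ennreal ((1/Z)^2) * (ennreal ((2 * exp k0)^2) * (ennreal Z * rhs y))"
  unfolding power_mult_distrib by (intro mult_left_mono mult_mono 2) (auto simp: ennreal_power)
 also have "... = ennreal ((1/Z)^2 * (2 * exp k0)^2 * Z) * rhs y"
  using Zp by (simp add: ennreal_mult mult.assoc)
 also have "(1/Z)^2 * (2 * exp k0)^2 * Z = 4 * exp (2 * k0) / Z"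
  using Zp by (simp add: power2_eq_square field_simps exp_add[symmetric] mult_2)
 finally show ?thesis .
qed

end

text \<open>Tonelli: the lengths of the ray sections are averaged over \<open>y\<close> in the ball of radius two. Only
\<open>t\<close> between one half and one is used, where the preimage of \<open>F\<close> under \<open>y -> t
y\<close> stays in that ball and has at least the measure of \<open>F\<close>.\<close>

lemma ray_through_large_set:
 fixes F :: "'a::euclidean_space set"
 assumes F[measurable]: "F \<in> sets borel" and F1: "F <= cball 0 1" and d: "measure lborel F >= d" "d > 0"
 obtains y where "norm y <= 2" "measure lborel {t\<in>{0..1}. t *. y \<in> F} >= d / (4 * measure lborel (cball (0::'a) 2))"
proof -
 note found = that
 define vol where "vol = measure lborel (cball (0::'a) 2)"
 have fin: "emeasure lborel (cball (0::'a) 2) < \<infinity>" by (rule emeasure_bounded_finite) simp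
 have Ffin: "emeasure lborel F < \<infinity>" by (rule emeasure_bounded_finite) (rule bounded_subset[OF bounded_cball F1])
 have vol: "vol > 0"
 proof -
  have "measure lborel F <= vol" unfolding vol_def
   by (rule measure_mono_fmeasurable) (use F1 fin in "auto simp: fmeasurable_def")
  then show ?thesis using d by simp
 qed
 define E where "E y = {t\<in>{1/2..1::real}. t *. y \<in> F}" for y
 have [measurable]: "E y \<in> sets borel" for y unfolding E_def by measurable
 have Efin: "emeasure lborel (E y) < \<infinity>" for y
  by (rule emeasure_bounded_finite) (auto intro: bounded_subset[of "{0..1::real}"] simp: E_def)
 have scale: "emeasure lborel F <= emeasure lborel {y. t *. y \<in> F}" if t: "t \<in> {1/2..1}" for t :: real
 proof -
  have "emeasure lborel F = emeasure (density (distr lborel borel (%x. 0 + t *. x)) (%_. ennreal (\<bar>t\<bar> ^ DIM('a)))) F"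
   using lborel_affine[of t "0::'a"] t by simp
  also have "... = ennreal (\<bar>t\<bar> ^ DIM('a)) * emeasure lborel {y. t *. y \<in> F}"
   by (simp add: emeasure_density nn_integral_cmult_indicator emeasure_distr vimage_def)
  also have "... <= 1 * emeasure lborel {y. t *. y \<in> F}"
   using t by (intro mult_right_mono) (auto simp: power_le_one)
  finally show ?thesis by simp
 qed
 show thesis
 proof (rule ccontr)
  assume neg: "\<not> thesis"
  have small: "measure lborel (E y) <= d / (4 * vol)" if "norm y <= 2" for y
  proof -
   have "measure lborel (E y) <= measure lborel {t\<in>{0..1}. t *. y \<in> F}"
   proof (rule measure_mono_fmeasurable)
    have "emeasure lborel {t\<in>{0..1::real}. t *. y \<in> F} < \<infinity>"
     by (rule emeasure_bounded_finite) (auto intro: bounded_subset[of "{0..1::real}"])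
    then show "{t\<in>{0..1::real}. t *. y \<in> F} \<in> fmeasurable lborel" by (simp add: fmeasurable_def)
   qed (auto simp: E_def)
   also have "... <= d / (4 * vol)" using neg found[of y] that unfolding vol_def by force
   finally show ?thesis .
  qed
  have m: "(%(t::real, y). indicator {1/2..1} t * (indicator F (t *. y) :: ennreal)) \<in> borel_measurable (lborel \<Otimes>\<^sub>M lborel)"
   by measurable
  have "ennreal (1/2) * emeasure lborel F = (NI t. indicator {1/2..1::real} t * emeasure lborel F)"
   by (simp add: nn_integral_multc)
  also have "... <= (NI t. indicator {1/2..1::real} t * emeasure lborel {y. t *. y \<in> F})"
   by (intro nn_integral_mono) (use scale in "auto split: split_indicator")
  also have "... = (NI t. NI y. indicator {1/2..1::real} t * indicator F (t *. y))"
  proof (rule nn_integral_cong)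
   fix t :: real
   have "(NI y. indicator F (t *. y)) = (NI y. indicator {y. t *. y \<in> F} y)"
    by (intro nn_integral_cong) (auto split: split_indicator)
   also have "... = emeasure lborel {y. t *. y \<in> F}" by (rule nn_integral_indicator) measurable
   finally show "indicator {1/2..1::real} t * emeasure lborel {y. t *. y \<in> F} = (NI y. indicator {1/2..1::real} t * indicator F (t *. y))"
    by (simp add: nn_integral_cmult)
  qed
  also have "... = (NI y. NI t. indicator {1/2..1::real} t * indicator F (t *. y))"
   by (rule lborel_pair.Fubini') (use m in simp)
  also have "... <= (NI y. ennreal (d / (4 * vol)) * indicator (cball 0 2) (y::'a))"
  proof (rule nn_integral_mono)
   fix y :: 'a
   have eq: "(NI t. indicator {1/2..1::real} t * indicator F (t *. y)) = emeasure lborel (E y)"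
   proof -
    have "(NI t. indicator {1/2..1::real} t * indicator F (t *. y)) = (NI t. indicator (E y) t)"
     by (intro nn_integral_cong) (auto split: split_indicator simp: E_def)
    then show ?thesis by simp
   qed
   show "(NI t. indicator {1/2..1::real} t * indicator F (t *. y)) <= ennreal (d / (4 * vol)) * indicator (cball 0 2) y"
   proof (cases "norm y <= 2")
    case True
    have "emeasure lborel (E y) = ennreal (measure lborel (E y))"
     using Efin[of y] by (simp add: emeasure_eq_ennreal_measure less_top)
    also have "... <= ennreal (d / (4 * vol))" using small[OF True] by (rule ennreal_leI)
    finally show ?thesis using True eq by simp
   next
    case False
    have "E y = {}"
    proof -
     have "t *. y ~: F" if "t \<in> {1/2..1}" for t
     proof
      assume "t *. y \<in> F"
      then have "t * norm y <= 1" using F1 that by auto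
      moreover have "t * norm y >= 1/2 * norm y" using that by (intro mult_right_mono) auto
      ultimately show False using False by simp
     qed
     then show ?thesis by (auto simp: E_def)
    qed
    then show ?thesis using eq by simp
   qed
  qed
  also have "... = ennreal (d / (4 * vol)) * ennreal vol"
   using fin by (simp add: nn_integral_cmult_indicator vol_def emeasure_eq_ennreal_measure less_top)
  also have "... = ennreal (d / 4)" using vol d by (simp add: ennreal_mult[symmetric])
  finally have "ennreal (1/2) * emeasure lborel F <= ennreal (d/4)" .
  moreover have "emeasure lborel F = ennreal (measure lborel F)" using Ffin by (simp add: emeasure_eq_ennreal_measure less_top)
  ultimately have "ennreal (1/2) * ennreal (measure lborel F) <= ennreal (d/4)" by simp
  then have "ennreal (1/2 * measure lborel F) <= ennreal (d/4)" by (subst ennreal_mult) auto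
  then have "1/2 * measure lborel F <= d/4" using d by (subst (asm) ennreal_le_iff) auto
  then show False using d by simp
 qed
qed

lemma power_le_fact_exp:
 fixes x :: real
 assumes "x >= 0"
 shows "x ^ n <= fact n * exp x"
proof -
 have e: "exp x = (\<Sum>i. inverse (fact i) * x ^ i)" by (simp add: exp_def)
 have "(\<Sum>i\<in>{n}. inverse (fact i) * x ^ i) <= (\<Sum>i. inverse (fact i) * x ^ i)"
  by (rule sum_le_suminf[OF summable_exp]) (use assms in auto)
 then have "inverse (fact n) * x ^ n <= exp x" unfolding e by simp
 then show ?thesis by (simp add: field_simps)
qed

lemma ennreal_power2_le_imp_le:
 assumes "x^2 <= ennreal (R^2)" "R >= 0" shows "x <= ennreal R"
proof (cases x)
 case (real r)
 then have "ennreal (r^2) <= ennreal (R^2)" using assms by (simp add: ennreal_power)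
 then have "r^2 <= R^2" by simp
 then show ?thesis using real assms(2) by (auto intro!: ennreal_leI power2_le_imp_le[of r R])
next
 case top
 then show ?thesis using assms(1) by (simp add: power2_eq_square ennreal_mult_top top_unique)
qed

context gaussian_average begin

definition Zl :: real where "Zl = (LI zeta::real^'n. gauss (C/4) zeta)"
definition J :: real where "J = exp (16 * C^2 / c) * (LI zeta::real^'n. gauss (c/8) zeta)"
definition m :: real where "m = (LI zeta. gauss (c/4) zeta * (w zeta)^2)"

lemma taylor_weight_bound:
 fixes zeta :: "real^'n"
 shows "gauss (c/4) zeta * ((C * norm zeta) ^ N / fact N * exp (C * norm zeta))^2
  <= ((16 * C^2 / c) ^ N / fact N) * (exp (16 * C^2 / c) * gauss (c/8) zeta)"
proof -
 define x where "x = norm zeta"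
 have zz: "zeta \<bullet> zeta = x^2" by (simp add: x_def dot_square_norm)
 have p: "(x^2) ^ N <= (16/c) ^ N * (fact N * exp (c/16 * x^2))"
 proof -
  have "(c/16 * x^2) ^ N <= fact N * exp (c/16 * x^2)"
   by (rule power_le_fact_exp) (use c in auto)
  then have "(16/c) ^ N * (c/16 * x^2) ^ N <= (16/c) ^ N * (fact N * exp (c/16 * x^2))"
   using c by (intro mult_left_mono) auto
  moreover have "(16/c) ^ N * (c/16 * x^2) ^ N = (x^2) ^ N"
   using c by (subst power_mult_distrib[symmetric]) simp
  ultimately show ?thesis by simp
 qed
 have e: "(exp (C * x))^2 <= exp (16 * C^2 / c) * exp (c/16 * x^2)"
 proof -
  have "0 <= (4 * C / sqrt c - sqrt c / 4 * x)^2" by simp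
  also have "... = 16 * C^2 / c - 2 * C * x + c/16 * x^2"
   using c by (simp add: power2_diff power_mult_distrib power_divide)
  finally have "2 * (C * x) <= 16 * C^2 / c + c/16 * x^2" by simp
  then show ?thesis by (simp add: exp_double[symmetric] exp_add[symmetric])
 qed
 have "exp (- (c/4) * x^2) * ((C * x) ^ N / fact N * exp (C * x))^2
   = exp (- (c/4) * x^2) * ((C^2) ^ N / (fact N)^2 * ((x^2) ^ N * (exp (C * x))^2))"
 proof -
  have "((C * x) ^ N)^2 = (C^2) ^ N * (x^2) ^ N"
   by (simp only: power_mult[symmetric] mult.commute[of N] power_mult_distrib)
  then show ?thesis by (simp add: power_mult_distrib power_divide)
 qed
 also have "... <= exp (- (c/4) * x^2) * ((C^2) ^ N / (fact N)^2 *
   (((16/c) ^ N * (fact N * exp (c/16 * x^2))) * (exp (16 * C^2 / c) * exp (c/16 * x^2))))"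
  by (intro mult_left_mono mult_mono p e) (use c in auto)
 also have "... = ((C^2) ^ N * (16/c) ^ N) / fact N * (exp (16 * C^2 / c) * (exp (- (c/4) * x^2) * exp (c/16 * x^2) * exp (c/16 * x^2)))"
  by (simp only: power2_eq_square[of "fact N"]) (simp)
 also have "exp (- (c/4) * x^2) * exp (c/16 * x^2) * exp (c/16 * x^2) = exp (- (c/8) * x^2)"
  by (simp add: exp_add[symmetric])
 also have "(C^2) ^ N * (16/c) ^ N = (16 * C^2 / c) ^ N"
  by (subst power_mult_distrib[symmetric]) (simp add: mult.commute)
 finally show ?thesis unfolding zz x_def[symmetric] .
qed

lemma m_finite: "(NI zeta. ennreal (gauss (c/4) zeta * (w zeta)^2)) = ennreal m" and m_nonneg: "m >= 0"
proof -
 have i: "integrable lborel (%zeta. gauss (c/4) zeta * (w zeta)^2)"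
  by (rule integrable_compact_support[OF K]) (use zero(1) in "auto intro!: continuous_intros cw")
 show "(NI zeta. ennreal (gauss (c/4) zeta * (w zeta)^2)) = ennreal m"
  unfolding m_def by (rule nn_integral_eq_integral[OF i]) auto
 show "m >= 0" unfolding m_def by (intro lint_nonneg) auto
qed

lemma taylor_remainder_average:
 "(NI zeta. ennreal (gauss (c/4) zeta * ((C * norm zeta) ^ N / fact N * exp (C * norm zeta)) * \<bar>w zeta\<bar>))
  <= ennreal (sqrt J * sqrt m * ((4 * C / sqrt c) ^ N / sqrt (fact N)))"
 (is "?I <= ennreal ?R")
proof -
 define h where "h zeta = (C * norm zeta) ^ N / fact N * exp (C * norm zeta)" for zeta :: "real^'n"
 have sq: "(exp (- (c/8) * q))^2 = exp (- (c/4) * q)" for q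
  by (simp add: exp_double[symmetric])
 have h0: "h zeta >= 0" for zeta using Cpos by (simp add: h_def)
 have [measurable]: "h \<in> borel_fun" unfolding h_def by measurable
 have J0: "J >= 0" unfolding J_def by (intro mult_nonneg_nonneg lint_nonneg) auto
 have i: "integrable lborel (%zeta::real^'n. gauss (c/8) zeta)" by (rule integrable_gaussian) (use c in simp)
 define u where "u zeta = ennreal (gauss (c/8) zeta * h zeta)" for zeta
 define v where "v zeta = ennreal (gauss (c/8) zeta * \<bar>w zeta\<bar>)" for zeta
 define R where "R = (16 * C^2 / c) ^ N / fact N"
 have R0: "R >= 0" using c by (simp add: R_def)
 have [measurable]: "u \<in> borel_fun" "v \<in> borel_fun" unfolding u_def v_def by measurable
 have I: "?I = (NI zeta. u zeta * v zeta)"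
 proof (rule nn_integral_cong)
  fix zeta :: "real^'n"
  have "gauss (c/4) zeta = gauss (c/8) zeta * gauss (c/8) zeta" by (simp add: exp_add[symmetric])
  then show "ennreal (gauss (c/4) zeta * ((C * norm zeta) ^ N / fact N * exp (C * norm zeta)) * \<bar>w zeta\<bar>)
   = u zeta * v zeta"
   unfolding h_def[symmetric] u_def v_def using h0[of zeta] by (simp add: ennreal_mult[symmetric] ac_simps)
 qed
 have V: "(NI zeta. (v zeta)^2) = ennreal m"
 proof -
  have "(v zeta)^2 = ennreal (gauss (c/4) zeta * (w zeta)^2)" for zeta
   unfolding v_def by (subst ennreal_power) (auto simp only: power_mult_distrib sq power2_abs mult_nonneg_nonneg exp_ge_zero abs_ge_zero)
  then show ?thesis by (simp only: m_finite)
 qed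
 have U: "(NI zeta. (u zeta)^2) <= ennreal (R * J)"
 proof -
  have "(NI zeta. (u zeta)^2) <= (NI zeta::real^'n. ennreal (R * (exp (16 * C^2 / c) * gauss (c/8) zeta)))"
  proof (rule nn_integral_mono)
   fix zeta :: "real^'n"
   have "(u zeta)^2 = ennreal (gauss (c/4) zeta * (h zeta)^2)"
    unfolding u_def using h0[of zeta] by (subst ennreal_power) (auto simp only: power_mult_distrib sq mult_nonneg_nonneg exp_ge_zero)
   then show "(u zeta)^2 <= ennreal (R * (exp (16 * C^2 / c) * gauss (c/8) zeta))"
    using ennreal_leI[OF taylor_weight_bound[of zeta N]] by (simp only: h_def R_def)
  qed
  also have "... = ennreal (LI zeta::real^'n. R * (exp (16 * C^2 / c) * gauss (c/8) zeta))"
  proof (rule nn_integral_eq_integral)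
   show "integrable lborel (%zeta::real^'n. R * (exp (16 * C^2 / c) * gauss (c/8) zeta))"
    by (intro integrable_mult_right i)
   show "AE zeta::real^'n in lborel. 0 <= R * (exp (16 * C^2 / c) * gauss (c/8) zeta)"
    using R0 by (intro AE_I2 mult_nonneg_nonneg) auto
  qed
  finally show ?thesis unfolding J_def integral_mult_right_zero .
 qed
 have "(NI zeta. u zeta * v zeta)^2 <= (NI zeta. (u zeta)^2) * (NI zeta. (v zeta)^2)"
  by (rule Cauchy_Schwarz_nn_integral) auto
 also have "... <= ennreal (R * J) * ennreal m" unfolding V by (rule mult_right_mono[OF U]) simp
 also have "... = ennreal (R * J * m)" using R0 J0 m_nonneg by (simp add: ennreal_mult)
 also have "R * J * m = ?R^2"
 proof -
  have "((4 * C / sqrt c) ^ N)^2 = ((4 * C / sqrt c)^2) ^ N" by (simp only: power_mult[symmetric] mult.commute)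
  also have "(4 * C / sqrt c)^2 = 16 * C^2 / c" using c by (simp add: power_divide power_mult_distrib)
  finally have e: "((4 * C / sqrt c) ^ N)^2 = (16 * C^2 / c) ^ N" .
  have "?R^2 = (sqrt J)^2 * (sqrt m)^2 * (((4 * C / sqrt c) ^ N)^2 / (sqrt (fact N))^2)"
   by (simp only: power_mult_distrib power_divide)
  then show ?thesis using J0 m_nonneg unfolding e R_def by simp
 qed
 finally have "?I^2 <= ennreal (?R^2)" unfolding I .
 moreover have "?R >= 0" using J0 m_nonneg c Cpos by (intro mult_nonneg_nonneg divide_nonneg_nonneg zero_le_power) auto
 ultimately show ?thesis by (rule ennreal_power2_le_imp_le)
qed

lemma Zl_pos: "Zl > 0"
proof -
 have i: "integrable lborel (%zeta::real^'n. gauss (C/4) zeta)" by (rule integrable_gaussian) (use Cpos in simp)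
 have "Zl ~= 0"
 proof
  assume "Zl = 0"
  then have "AE zeta::real^'n in lborel. gauss (C/4) zeta = 0"
   using integral_nonneg_eq_0_iff_AE[OF i] by (simp add: Zl_def)
  then have "AE zeta in (lborel :: (real^'n) measure). zeta ~: UNIV" by simp
  then have "UNIV \<in> null_sets (lborel :: (real^'n) measure)" by (subst AE_iff_null_sets) auto
  then show False by (simp add: null_sets_def)
 qed
 moreover have "Zl >= 0" unfolding Zl_def by (intro lint_nonneg) simp
 ultimately show ?thesis by simp
qed

lemma Z_pos: "Z > 0" and Zl_le: "Zl <= Z"
 using Z_ge Zl_pos by (simp_all add: Zl_def)

definition avg :: "real^'n => real" where "avg y = exp k * phi y 1 / Z"

lemma continuous_avg: "continuous_on UNIV avg"
proof -
 obtain B where B: "!!x. \<bar>w x\<bar> <= B" using bounds by metis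
 have "continuous_on UNIV (%y. phi y 1)" unfolding phi_def by (rule continuous_gam_average(2)[OF cw B])
 then show ?thesis unfolding avg_def using Z_pos by (intro continuous_intros) auto
qed

text \<open>Completing the square in the Gaussian exhibits the average along a ray as an explicit factor times a Laplace transform
in \<open>t\<close>.\<close>

lemma avg_along_ray:
 "exp (t^2 * ((y \<bullet> (g *v y)) / 4)) * avg (t *. y)
  = exp k / Z * (LI zeta. gam zeta * exp (t * ((zeta \<bullet> (g *v y)) / 2)) * w zeta)"
proof -
 have "phi (t *. y) 1 = (LI zeta. gam (t *. y + zeta - t *. y) * w (t *. y + zeta))" by (simp add: phi_def)
 also have "... = (LI zeta. gam (zeta - t *. y) * w zeta)"
  by (rule lborel_integral_translation[of "%zeta. gam (zeta - t *. y) * w zeta"]) simp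
 finally have "exp (t^2 * ((y \<bullet> (g *v y)) / 4)) * phi (t *. y) 1
   = (LI zeta. exp (t^2 * ((y \<bullet> (g *v y)) / 4)) * (gam (zeta - t *. y) * w zeta))" by simp
 also have "... = (LI zeta. gam zeta * exp (t * ((zeta \<bullet> (g *v y)) / 2)) * w zeta)"
 proof (rule Bochner_Integration.integral_cong[OF refl])
  fix zeta
  have "(zeta - t *. y) \<bullet> (g *v (zeta - t *. y)) = zeta \<bullet> (g *v zeta) - 2 * t * (zeta \<bullet> (g *v y)) + t^2 * (y \<bullet> (g *v y))"
   using sym_matrix_inner[OF symg, of y zeta]
   by (simp add: matrix_vector_mult_diff_distrib linear_cmul[OF mv_linear] inner_diff_left inner_diff_right inner_commute power2_eq_square algebra_simps)
  then have "exp (t^2 * ((y \<bullet> (g *v y)) / 4)) * gam (zeta - t *. y) = gam zeta * exp (t * ((zeta \<bullet> (g *v y)) / 2))"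
   unfolding gam_def exp_add[symmetric] by (simp add: field_simps)
  then show "exp (t^2 * ((y \<bullet> (g *v y)) / 4)) * (gam (zeta - t *. y) * w zeta) = gam zeta * exp (t * ((zeta \<bullet> (g *v y)) / 2)) * w zeta"
   by (simp only: mult.assoc[symmetric])
 qed
 finally show ?thesis by (simp add: avg_def field_simps)
qed

text \<open>Expand the exponential of \<open>t X\<close> to order \<open>N\<close>; the remainder is integrated against
\<open>w\<close> with the Cauchy-Schwarz inequality, and the Gaussian moments give the square root of the factorial.\<close>

lemma avg_polynomial_approximation:
 assumes y: "norm y <= 2"
 shows "\<exists>P. degree P <= N & (\<forall>t\<in>{0..1}. \<bar>exp (t^2 * ((y \<bullet> (g *v y)) / 4)) * avg (t *. y) - poly P t\<bar>
   <= (exp k0 / Zl * (sqrt J * sqrt m)) * ((4 * C / sqrt c) ^ Suc N / sqrt (fact (Suc N))))"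
proof -
 define X where "X zeta = (zeta \<bullet> (g *v y)) / 2" for zeta
 define q where "q i = exp k / Z * (LI zeta. gam zeta * (X zeta ^ i / fact i) * w zeta)" for i
 define P where "P = (\<Sum>i<Suc N. monom (q i) i)"
 have cX: "continuous_on UNIV X" unfolding X_def by (intro continuous_intros) auto
 then have [measurable]: "X \<in> borel_fun" by (rule borel_cont)
 have Xle: "\<bar>X zeta\<bar> <= C * norm zeta" for zeta
 proof -
  have "\<bar>zeta \<bullet> (g *v y)\<bar> <= norm zeta * norm (g *v y)" by (rule cauchy_schwarz)
  also have "... <= norm zeta * (C * 2)"
   using gbound[of y] y Cpos by (intro mult_left_mono) (auto intro: order_trans mult_left_mono)
  finally show ?thesis by (simp add: X_def ac_simps)
 qed
 have i1: "integrable lborel (%zeta. gam zeta * (X zeta ^ i / fact i) * w zeta)" for i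
  by (rule integrable_compact_support[OF K]) (use zero(1) in "auto intro!: continuous_intros continuous_gam cX cw")
 have i2: "integrable lborel (%zeta. gam zeta * exp (t * X zeta) * w zeta)" for t
  by (rule integrable_compact_support[OF K]) (use zero(1) in "auto intro!: continuous_intros continuous_gam cX cw")
 have dP: "degree P <= N" unfolding P_def
  by (rule degree_sum_le) (auto intro: order_trans[OF degree_monom_le])
 have est: "\<bar>exp (t^2 * ((y \<bullet> (g *v y)) / 4)) * avg (t *. y) - poly P t\<bar>
   <= (exp k0 / Zl * (sqrt J * sqrt m)) * ((4 * C / sqrt c) ^ Suc N / sqrt (fact (Suc N)))" if t: "t \<in> {0..1}" for t
 proof -
  define T where "T zeta = exp (t * X zeta) - (\<Sum>i<Suc N. (t * X zeta) ^ i / fact i)" for zeta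
  have "poly P t = (\<Sum>i<Suc N. q i * t ^ i)" by (simp add: P_def poly_sum poly_monom)
  also have "... = exp k / Z * (\<Sum>i<Suc N. LI zeta. t ^ i * (gam zeta * (X zeta ^ i / fact i) * w zeta))"
   unfolding sum_distrib_left by (rule sum.cong) (simp_all add: q_def)
  also have "(\<Sum>i<Suc N. LI zeta. t ^ i * (gam zeta * (X zeta ^ i / fact i) * w zeta))
    = (LI zeta. (\<Sum>i<Suc N. t ^ i * (gam zeta * (X zeta ^ i / fact i) * w zeta)))"
   by (rule Bochner_Integration.integral_sum[symmetric]) (intro integrable_mult_right i1)
  finally have Pt: "poly P t = exp k / Z * (LI zeta. (\<Sum>i<Suc N. t ^ i * (gam zeta * (X zeta ^ i / fact i) * w zeta)))" .
  have iS: "integrable lborel (%zeta. \<Sum>i<Suc N. t ^ i * (gam zeta * (X zeta ^ i / fact i) * w zeta))"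
   by (intro Bochner_Integration.integrable_sum integrable_mult_right i1)
  have "exp (t^2 * ((y \<bullet> (g *v y)) / 4)) * avg (t *. y) - poly P t
    = exp k / Z * ((LI zeta. gam zeta * exp (t * X zeta) * w zeta) - (LI zeta. (\<Sum>i<Suc N. t ^ i * (gam zeta * (X zeta ^ i / fact i) * w zeta))))"
   unfolding avg_along_ray Pt X_def[symmetric] by (simp only: right_diff_distrib)
  also have "(LI zeta. gam zeta * exp (t * X zeta) * w zeta) - (LI zeta. (\<Sum>i<Suc N. t ^ i * (gam zeta * (X zeta ^ i / fact i) * w zeta)))
    = (LI zeta. gam zeta * exp (t * X zeta) * w zeta - (\<Sum>i<Suc N. t ^ i * (gam zeta * (X zeta ^ i / fact i) * w zeta)))"
   by (rule Bochner_Integration.integral_diff[symmetric, OF i2 iS])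
  also have "... = (LI zeta. gam zeta * T zeta * w zeta)"
   by (rule Bochner_Integration.integral_cong[OF refl])
    (simp only: T_def right_diff_distrib left_diff_distrib sum_distrib_left sum_distrib_right power_mult_distrib times_divide_eq_right times_divide_eq_left mult.assoc mult.commute mult.left_commute)
  finally have e1: "exp (t^2 * ((y \<bullet> (g *v y)) / 4)) * avg (t *. y) - poly P t = exp k / Z * (LI zeta. gam zeta * T zeta * w zeta)" .
  have Tle: "\<bar>T zeta\<bar> <= (C * norm zeta) ^ Suc N / fact (Suc N) * exp (C * norm zeta)" for zeta
  proof -
   have tX: "\<bar>t * X zeta\<bar> <= C * norm zeta"
    using mult_mono[of "\<bar>t\<bar>" 1 "\<bar>X zeta\<bar>" "C * norm zeta"] Xle[of zeta] t by (simp add: abs_mult)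
   obtain r where r: "\<bar>r\<bar> <= \<bar>t * X zeta\<bar>" "exp (t * X zeta) = (\<Sum>i<Suc N. (t * X zeta) ^ i / fact i) + exp r / fact (Suc N) * (t * X zeta) ^ Suc N"
    using Maclaurin_exp_le[of "t * X zeta" "Suc N"] by blast
   have "\<bar>T zeta\<bar> = exp r / fact (Suc N) * \<bar>t * X zeta\<bar> ^ Suc N"
    unfolding T_def r(2) add_diff_cancel_left' abs_mult abs_divide power_abs abs_exp_cancel
    by (simp only: abs_of_nonneg[OF fact_ge_zero])
   also have "... <= exp (C * norm zeta) / fact (Suc N) * (C * norm zeta) ^ Suc N"
    using r(1) tX by (intro mult_mono divide_right_mono power_mono) auto
   finally show ?thesis by (simp only: mult.commute times_divide_eq_right times_divide_eq_left)
  qed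
  have iT: "integrable lborel (%zeta. gam zeta * T zeta * w zeta)"
   unfolding T_def by (rule integrable_compact_support[OF K]) (use zero(1) in "auto intro!: continuous_intros continuous_gam cX cw")
  have "ennreal \<bar>LI zeta. gam zeta * T zeta * w zeta\<bar> <= (NI zeta. norm (gam zeta * T zeta * w zeta))"
   using integral_norm_bound_ennreal[OF iT] by simp
  also have "... <= (NI zeta. ennreal (gauss (c/4) zeta * ((C * norm zeta) ^ Suc N / fact (Suc N) * exp (C * norm zeta)) * \<bar>w zeta\<bar>))"
  proof (intro nn_integral_mono ennreal_leI)
   fix zeta
   show "norm (gam zeta * T zeta * w zeta) <= gauss (c/4) zeta * ((C * norm zeta) ^ Suc N / fact (Suc N) * exp (C * norm zeta)) * \<bar>w zeta\<bar>"
    unfolding real_norm_def abs_mult using gam_pos[of zeta] gam_le[of zeta] Tle[of zeta] Cpos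
    by (intro mult_mono mult_nonneg_nonneg divide_nonneg_nonneg zero_le_power) auto
  qed
  also have "... <= ennreal (sqrt J * sqrt m * ((4 * C / sqrt c) ^ Suc N / sqrt (fact (Suc N))))"
   by (rule taylor_remainder_average)
  finally have "\<bar>LI zeta. gam zeta * T zeta * w zeta\<bar> <= sqrt J * sqrt m * ((4 * C / sqrt c) ^ Suc N / sqrt (fact (Suc N)))"
  proof (subst (asm) ennreal_le_iff)
   have "J >= 0" unfolding J_def by (intro mult_nonneg_nonneg lint_nonneg) auto
   then show "0 <= sqrt J * sqrt m * ((4 * C / sqrt c) ^ Suc N / sqrt (fact (Suc N)))"
    using m_nonneg c Cpos by (intro mult_nonneg_nonneg divide_nonneg_nonneg zero_le_power) auto
  qed
  moreover have "exp k / Z <= exp k0 / Zl" using k Zl_pos Zl_le by (intro frac_le) auto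
  ultimately have "exp k / Z * \<bar>LI zeta. gam zeta * T zeta * w zeta\<bar> <= exp k0 / Zl * (sqrt J * sqrt m * ((4 * C / sqrt c) ^ Suc N / sqrt (fact (Suc N))))"
   using Z_pos Zl_pos by (intro mult_mono) auto
  then show ?thesis unfolding e1 abs_mult using Z_pos by (simp only: abs_divide abs_exp_cancel abs_of_pos mult.assoc)
 qed
 show ?thesis using dP est by blast
qed

lemma borel_rhs: "rhs \<in> borel_fun"
 unfolding rhs_def[abs_def] by measurable

text \<open>On the zero set of \<open>w\<close> the average equals its difference from \<open>w\<close>, which is controlled by
\<open>rhs\<close> in the mean. By Chebyshev it is small on a subset of half the measure; along a ray meeting this
subset substantially the Remez inequality bounds the average at the centre.\<close>

lemma center_bound:
 fixes d Kr dr :: real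
 assumes d: "d > 0" and Kr: "Kr >= 0" and dr: "dr >= 0"
  and remez: "!!W \<mu> s E. [|\<mu> >= 0; E \<in> sets borel; E <= {0..1}; measure lborel E >= d / (8 * measure lborel (cball (0::real^'n) 2));
   !!t. t \<in> E ==> \<bar>W t\<bar> <= s;
   !!N. \<exists>P. degree P <= N & (\<forall>t\<in>{0..1}. \<bar>W t - poly P t\<bar> <= \<mu> * ((4 * C / sqrt c) ^ Suc N / sqrt (fact (Suc N))))|]
   ==> \<bar>W 0\<bar> <= Kr * s + dr * \<mu>"
  and large: "measure lborel {y\<in>cball 0 1. w y = 0} >= d"
 shows "ennreal ((w 0)^2) <= ennreal (4 * exp (2 * k0) / Zl * (2 + 8 * Kr^2 * (exp C)^2 / d)) * (rhs 0 + (NI y. indicator (cball 0 1) y * rhs y))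
   + ennreal (4 * dr^2 * ((exp k0 / Zl)^2 * J)) * (NI zeta. ennreal (gauss (c/4) zeta * (w zeta)^2))"
proof -
 define D where "D y = avg y - w y" for y
 have cD: "continuous_on UNIV D" unfolding D_def by (intro continuous_intros continuous_avg cw)
 have [measurable]: "D \<in> borel_fun" "avg \<in> borel_fun"
  using cD continuous_avg by (auto intro: borel_cont)
 have J0: "J >= 0" unfolding J_def by (intro mult_nonneg_nonneg lint_nonneg) auto
 define \<mu> where "\<mu> = exp k0 / Zl * (sqrt J * sqrt m)"
 have mu0: "\<mu> >= 0" using Zl_pos J0 m_nonneg by (simp add: \<mu>_def)
 define r1 where "r1 = (LI y. indicator (cball 0 1) y *. (D y)^2)"
 have ir1: "integrable lborel (%y. indicator (cball 0 1) y *. (D y)^2)"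
  by (rule borel_integrable_compact) (auto intro!: continuous_intros continuous_on_subset[OF cD])
 have r1: "(NI y. ennreal (indicator (cball 0 1) y *. (D y)^2)) = ennreal r1" "r1 >= 0"
  unfolding r1_def by (rule nn_integral_eq_integral[OF ir1]) (auto intro!: lint_nonneg)
 define F where "F = {y\<in>cball 0 1. w y = 0}"
 have [measurable]: "F \<in> sets borel" unfolding F_def by measurable
 have Ffin: "F \<in> fmeasurable lborel"
 proof -
  have "F <= cball 0 1" by (auto simp: F_def)
  then have "emeasure lborel F < \<infinity>" by (intro emeasure_bounded_finite bounded_subset[OF bounded_cball])
  then show ?thesis by (simp add: fmeasurable_def)
 qed
 have main: "(w 0)^2 <= (2 * (D 0)^2 + 8 * Kr^2 * (exp C)^2 / d * r1 + 4 * dr^2 * \<mu>^2) + (8 * Kr^2 * (exp C)^2 / d) * eta" if eta: "eta > 0" for eta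
 proof -
  define x1 where "x1 = r1 + eta"
  have x1: "x1 > 0" "r1 <= x1" using r1(2) eta by (auto simp: x1_def)
  define s where "s = sqrt (2 * x1 / d)"
  have s: "s > 0" "s^2 = 2 * x1 / d" using x1 d by (auto simp: s_def)
  define F' where "F' = {y\<in>F. \<bar>avg y\<bar> <= s}"
  have [measurable]: "F' \<in> sets borel" unfolding F'_def by measurable
  have F'1: "F' <= cball 0 1" by (auto simp: F'_def F_def)
  have bad: "measure lborel (F - F') <= d / 2"
  proof -
   have fm: "F - F' \<in> fmeasurable lborel" using Ffin by (rule fmeasurable_Diff) simp
   have "ennreal (s^2) * emeasure lborel (F - F') = (NI y. ennreal (s^2) * indicator (F - F') y)"
    by (rule nn_integral_cmult_indicator[symmetric]) simp
   also have "... <= (NI y. ennreal (indicator (cball 0 1) y *. (D y)^2))"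
   proof (rule nn_integral_mono)
    fix y
    show "ennreal (s^2) * indicator (F - F') y <= ennreal (indicator (cball 0 1) y *. (D y)^2)"
    proof (cases "y \<in> F - F'")
     case True
     then have "y \<in> cball 0 1" "D y = avg y" "s <= \<bar>avg y\<bar>" by (auto simp: F'_def F_def D_def)
     then have "s^2 <= (D y)^2" using s(1) by (simp add: abs_le_square_iff[symmetric])
     then show ?thesis using True \<open>y \<in> cball 0 1\<close> by (simp add: ennreal_leI)
    qed simp
   qed
   also have "... <= ennreal x1" using r1 x1 by (simp add: ennreal_leI)
   finally have "ennreal (s^2) * ennreal (measure lborel (F - F')) <= ennreal x1"
    using fm by (simp add: emeasure_eq_measure2)
   then have "ennreal (s^2 * measure lborel (F - F')) <= ennreal x1" by (subst ennreal_mult) auto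
   then have "s^2 * measure lborel (F - F') <= x1" using x1 by (subst (asm) ennreal_le_iff) auto
   then show ?thesis using x1 d unfolding s(2) by (simp add: field_simps)
  qed
  have "measure lborel F <= measure lborel F' + measure lborel (F - F')"
  proof -
   have "measure lborel (F' \<union> (F - F')) <= measure lborel F' + measure lborel (F - F')" by (rule measure_Un_le) auto
   moreover have "F' \<union> (F - F') = F" by (auto simp: F'_def)
   ultimately show ?thesis by simp
  qed
  then have F'd: "measure lborel F' >= d / 2" using large bad by (simp add: F_def)
  obtain y where y: "norm y <= 2" "measure lborel {t\<in>{0..1}. t *. y \<in> F'} >= (d/2) / (4 * measure lborel (cball (0::real^'n) 2))"
   using ray_through_large_set[OF _ F'1 F'd] d by auto
  (* The factor removes the Gaussian in t; what remains is entire of order two. *)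
  define W where "W t = exp (t^2 * ((y \<bullet> (g *v y)) / 4)) * avg (t *. y)" for t
  have q: "0 <= (y \<bullet> (g *v y)) / 4" "(y \<bullet> (g *v y)) / 4 <= C"
  proof -
   have "0 <= c * (y \<bullet> y)" using c by simp
   then show "0 <= (y \<bullet> (g *v y)) / 4" using ell[of y] by linarith
   have "y \<bullet> y <= 4" using y(1) power_mono[of "norm y" 2 2] by (simp add: dot_square_norm)
   then have "C * (y \<bullet> y) <= C * 4" using Cpos by (intro mult_left_mono) auto
   then show "(y \<bullet> (g *v y)) / 4 <= C" using quad_bound[of y] by simp
  qed
  have "\<bar>W 0\<bar> <= Kr * (exp C * s) + dr * \<mu>"
  proof (rule remez[of \<mu> "{t\<in>{0..1}. t *. y \<in> F'}"])
   show "{t\<in>{0..1}. t *. y \<in> F'} \<in> sets borel" by measurable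
   show "d / (8 * measure lborel (cball (0::real^'n) 2)) <= measure lborel {t\<in>{0..1}. t *. y \<in> F'}" using y(2) by simp
   fix t assume t: "t \<in> {t\<in>{0..1}. t *. y \<in> F'}"
   then have "\<bar>avg (t *. y)\<bar> <= s" by (simp add: F'_def)
   moreover have "exp (t^2 * ((y \<bullet> (g *v y)) / 4)) <= exp C"
   proof -
    have "t^2 * ((y \<bullet> (g *v y)) / 4) <= 1 * C" using t q by (intro mult_mono) (auto simp: power_le_one)
    then show ?thesis by simp
   qed
   ultimately show "\<bar>W t\<bar> <= exp C * s" unfolding W_def abs_mult abs_exp_cancel by (intro mult_mono) auto
  next
   show "\<exists>P. degree P <= N & (\<forall>t\<in>{0..1}. \<bar>W t - poly P t\<bar> <= \<mu> * ((4 * C / sqrt c) ^ Suc N / sqrt (fact (Suc N))))" for N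
    unfolding W_def \<mu>_def by (rule avg_polynomial_approximation[OF y(1)])
  qed (use mu0 in auto)
  then have a0: "\<bar>avg 0\<bar> <= Kr * (exp C * s) + dr * \<mu>" by (simp add: W_def)
  have "(w 0)^2 = (avg 0 - D 0)^2" by (simp add: D_def)
  also have "... <= 2 * (avg 0)^2 + 2 * (D 0)^2" using zero_le_power2[of "avg 0 + D 0"] by (simp add: power2_sum power2_diff)
  also have "(avg 0)^2 <= (Kr * (exp C * s) + dr * \<mu>)^2" using a0 by (simp add: abs_le_square_iff[symmetric])
  also have "... <= 2 * (Kr * (exp C * s))^2 + 2 * (dr * \<mu>)^2"
   using zero_le_power2[of "Kr * (exp C * s) - dr * \<mu>"] by (simp add: power2_sum power2_diff)
  also have "... = 2 * (Kr^2 * (exp C)^2 * (2 * x1 / d)) + 2 * (dr^2 * \<mu>^2)" by (simp only: power_mult_distrib s(2) mult.assoc)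
  finally have "(w 0)^2 <= 2 * (2 * (Kr^2 * (exp C)^2 * (2 * x1 / d)) + 2 * (dr^2 * \<mu>^2)) + 2 * (D 0)^2" by simp
  then show ?thesis unfolding x1_def by (simp add: algebra_simps add_divide_distrib)
 qed
 have "(w 0)^2 <= 2 * (D 0)^2 + 8 * Kr^2 * (exp C)^2 / d * r1 + 4 * dr^2 * \<mu>^2"
  by (rule le_of_le_add_small[where smax = 1 and c = "8 * Kr^2 * (exp C)^2 / d"]) (use main in auto)
 also have "\<mu>^2 = ((exp k0 / Zl)^2 * J) * m"
  unfolding \<mu>_def using J0 m_nonneg by (simp only: power_mult_distrib real_sqrt_pow2 mult.assoc)
 finally have fin: "(w 0)^2 <= 2 * (D 0)^2 + 8 * Kr^2 * (exp C)^2 / d * r1 + 4 * dr^2 * (((exp k0 / Zl)^2 * J) * m)" .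
 define C1 where "C1 = 4 * exp (2 * k0) / Zl"
 define A where "A = 8 * Kr^2 * (exp C)^2 / d"
 have A0: "A >= 0" using d by (simp add: A_def)
 have C10: "C1 >= 0" using Zl_pos by (simp add: C1_def)
 have De: "ennreal ((D y)^2) <= ennreal C1 * rhs y" for y
 proof -
  have "ennreal ((D y)^2) <= ennreal (4 * exp (2 * k0) / Z) * rhs y" using gaussian_heat_estimate[of y] by (simp add: D_def avg_def)
  also have "... <= ennreal C1 * rhs y" unfolding C1_def
   by (intro mult_right_mono ennreal_leI divide_left_mono Zl_le mult_pos_pos Zl_pos Z_pos) auto
  finally show ?thesis .
 qed
 have "ennreal r1 <= (NI y. ennreal C1 * (indicator (cball 0 1) y * rhs y))"
  unfolding r1(1)[symmetric] by (rule nn_integral_mono) (use De in "auto split: split_indicator")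
 also have "... = ennreal C1 * (NI y. indicator (cball 0 1) y * rhs y)"
  by (rule nn_integral_cmult) (use borel_rhs in "auto intro!: borel_measurable_times_ennreal borel_measurable_indicator")
 finally have r1e: "ennreal r1 <= ennreal C1 * (NI y. indicator (cball 0 1) y * rhs y)" .
 let ?I = "NI y. indicator (cball 0 1) y * rhs y"
 have "ennreal ((w 0)^2) <= ennreal (2 * (D 0)^2 + A * r1 + 4 * dr^2 * (((exp k0 / Zl)^2 * J) * m))"
  using fin by (intro ennreal_leI) (simp add: A_def)
 also have "... = ennreal 2 * ennreal ((D 0)^2) + ennreal A * ennreal r1 + ennreal (4 * dr^2 * ((exp k0 / Zl)^2 * J)) * ennreal m"
  using A0 r1(2) J0 m_nonneg by (simp add: ennreal_plus ennreal_mult[symmetric] mult.assoc del: ennreal_numeral)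
 also have "... <= ennreal (2 + A) * (ennreal C1 * rhs 0) + ennreal (2 + A) * (ennreal C1 * ?I) + ennreal (4 * dr^2 * ((exp k0 / Zl)^2 * J)) * ennreal m"
  by (intro add_mono mult_mono De r1e ennreal_leI) (use A0 J0 in auto)
 also have "ennreal (2 + A) * (ennreal C1 * rhs 0) + ennreal (2 + A) * (ennreal C1 * ?I) = ennreal (C1 * (2 + A)) * (rhs 0 + ?I)"
 proof -
  have "ennreal (C1 * (2 + A)) = ennreal (2 + A) * ennreal C1"
   using A0 C10 by (subst mult.commute) (rule ennreal_mult, auto)
  then show ?thesis by (simp only: distrib_left mult.assoc)
 qed
 finally show ?thesis unfolding C1_def A_def m_finite .
qed

end

text \<open>A function that vanishes on a definite part of the unit ball is small at the centre, up to the defect in the equation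
and an arbitrarily small multiple of its Gaussian mass. The constants depend on the ellipticity only, which permits a
different frozen equation at every centre.\<close>

lemma vanishing_set_bound:
 fixes c C k0 d kap :: real
 assumes c: "c > 0" and C: "C > 0" and d: "d > 0" and kap: "kap > 0"
 obtains Kc where "Kc >= 0"
  "!!g a k w wV wH K. [|gaussian_average (g :: real^'n^'n) a c C k k0 w wV wH K; measure lborel {y\<in>cball 0 1. w y = 0} >= d|] ==>
   ennreal ((w 0)^2) <= ennreal Kc * (gaussian_average.rhs a c k w wH 0 + (NI y. indicator (cball 0 1) y * gaussian_average.rhs a c k w wH y))
   + ennreal kap * (NI zeta. ennreal (gauss (c/4) zeta * (w zeta)^2))"
proof -
 define vol where "vol = measure lborel (cball (0::real^'n) 2)"
 have vol: "vol > 0"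
  using content_cball[of 2 "0::real^'n"] unit_ball_vol_pos by (simp add: vol_def)
 define T where "T = (exp k0 / gaussian_average.Zl TYPE('n) C)^2 * gaussian_average.J TYPE('n) c C"
 define dr where "dr = sqrt (kap / (4 * (\<bar>T\<bar> + 1)))"
 have dr: "dr > 0" "4 * dr^2 * T <= kap"
 proof -
  show "dr > 0" using kap by (simp add: dr_def)
  have "4 * dr^2 * T = kap * (T / (\<bar>T\<bar> + 1))" using kap by (simp add: dr_def field_simps)
  also have "... <= kap * 1" using kap by (intro mult_left_mono) (auto simp: field_simps)
  finally show "4 * dr^2 * T <= kap" by simp
 qed
 obtain Kr where Kr: "Kr >= 0"
  "!!(W :: real => real) \<mu> s E. [|\<mu> >= 0; E \<in> sets borel; E <= {0..1}; measure lborel E >= d / (8 * vol);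
   !!t. t \<in> E ==> \<bar>W t\<bar> <= s;
   !!N. \<exists>P. degree P <= N & (\<forall>t\<in>{0..1}. \<bar>W t - poly P t\<bar> <= \<mu> * ((4 * C / sqrt c) ^ Suc N / sqrt (fact (Suc N))))|]
   ==> \<bar>W 0\<bar> <= Kr * s + dr * \<mu>"
  by (rule remez_for_entire_functions[of "4 * C / sqrt c" "d / (8 * vol)" dr]) (use c C d vol dr in auto)
 define Kc where "Kc = \<bar>4 * exp (2 * k0) / gaussian_average.Zl TYPE('n) C * (2 + 8 * Kr^2 * (exp C)^2 / d)\<bar>"
 show thesis
 proof (rule that[of Kc])
  show "Kc >= 0" by (simp add: Kc_def)
  fix g a :: "real^'n^'n" and k w wV wH K
  assume ga: "gaussian_average g a c C k k0 w wV wH K" and large: "measure lborel {y\<in>cball 0 1. w y = 0} >= d"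
  interpret gaussian_average g a c C k k0 w wV wH K by (rule ga)
  have "ennreal ((w 0)^2) <= ennreal (4 * exp (2 * k0) / Zl * (2 + 8 * Kr^2 * (exp C)^2 / d)) * (rhs 0 + (NI y. indicator (cball 0 1) y * rhs y))
   + ennreal (4 * dr^2 * ((exp k0 / Zl)^2 * J)) * (NI zeta. ennreal (gauss (c/4) zeta * (w zeta)^2))"
   by (rule center_bound[OF d Kr(1) less_imp_le[OF dr(1)] _ large]) (rule Kr(2), auto simp: vol_def)
  also have "... <= ennreal Kc * (rhs 0 + (NI y. indicator (cball 0 1) y * rhs y))
   + ennreal kap * (NI zeta. ennreal (gauss (c/4) zeta * (w zeta)^2))"
  proof (intro add_mono mult_right_mono ennreal_leI)
   show "4 * exp (2 * k0) / Zl * (2 + 8 * Kr^2 * (exp C)^2 / d) <= Kc" unfolding Kc_def by (rule abs_ge_self)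
   show "4 * dr^2 * ((exp k0 / Zl)^2 * J) <= kap" using dr(2) by (simp only: T_def)
  qed auto
  finally show "ennreal ((w 0)^2) <= ennreal Kc * (rhs 0 + (NI y. indicator (cball 0 1) y * rhs y))
   + ennreal kap * (NI zeta. ennreal (gauss (c/4) zeta * (w zeta)^2))" .
 qed
qed

section \<open>The mass near the exterior\<close>

locale elliptic_coefficients =
 fixes A g :: "real^'n => real^'n^'n" and cA CA L :: real
 assumes symA: "!!x. transpose (A x) = A x" and symg: "!!x. transpose (g x) = g x"
  and A_g: "!!x zeta. A x *v (g x *v zeta) = zeta"
  and cA: "cA > 0" and ellA: "!!x xi. cA * (xi \<bullet> xi) <= xi \<bullet> (A x *v xi)"
  and ellg: "!!x xi. cA * (xi \<bullet> xi) <= xi \<bullet> (g x *v xi)"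
  and normA: "!!x. norm (A x) <= CA" and normg: "!!x xi. norm (g x *v xi) <= CA * norm xi"
  and lipA: "!!x y. norm (A x - A y) <= L * norm (x - y)"

text \<open>A twice continuously differentiable function with its gradient and Hessian, all vanishing off \<open>K\<close>.\<close>

locale c2_compact_support =
 fixes v :: "real^'n => real" and V :: "real^'n => real^'n" and Hv :: "real^'n => real^'n^'n" and K :: "(real^'n) set"
 assumes dv: "!!x. (v has_derivative (%h. V x \<bullet> h)) (at x)"
  and dV: "!!x. (V has_derivative (%h. Hv x *v h)) (at x)"
  and cHv: "continuous_on UNIV Hv" and K: "compact K"
  and zero: "!!x. x ~: K ==> v x = 0" "!!x. x ~: K ==> V x = 0" "!!x. x ~: K ==> Hv x = 0"
begin

lemma cv: "continuous_on UNIV v" and cV: "continuous_on UNIV V"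
 using dv dV by (auto intro!: continuous_at_imp_continuous_on has_derivative_continuous)

lemma borel_data[measurable]: "v \<in> borel_fun" "V \<in> borel_fun" "Hv \<in> borel_fun"
 by (auto intro!: borel_cont cv cV cHv)

lemma integrable_data:
 "integrable lborel (%x. (v x)^2)" "integrable lborel (%x. (norm (V x))^2)" "integrable lborel (%x. (norm (Hv x))^2)"
 by (rule integrable_compact_support[OF K]; use zero in "auto intro!: continuous_intros cv cV cHv")+

end

lemma (in c2_compact_support) gaussian_average_rescaled:
 fixes A g :: "real^'n => real^'n^'n"
 assumes "elliptic_coefficients A g cA CA L" and eps: "eps > 0" and k: "\<bar>k\<bar> <= k0"
 shows "gaussian_average (g z) (A z) cA CA k k0 (%y. v (z - eps *. y)) (%y. (-eps) *. V (z - eps *. y)) (%y. eps^2 *. Hv (z - eps *. y)) ((%x. (1/eps) *. (z - x)) ` K)"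
proof -
 interpret elliptic_coefficients A g cA CA L by fact
 have out: "z - eps *. y ~: K" if "y ~: (%x. (1/eps) *. (z - x)) ` K" for y
 proof
  assume "z - eps *. y \<in> K"
  then have "(1/eps) *. (z - (z - eps *. y)) \<in> (%x. (1/eps) *. (z - x)) ` K" by (rule imageI)
  then show False using that eps by simp
 qed
 have lin: "((%y. z - eps *. y) has_derivative (%h. (-eps) *. h)) (at x)" for x
  by (auto intro!: derivative_eq_intros)
 show ?thesis
 proof
  fix x
  show "((%y. v (z - eps *. y)) has_derivative (%h. (-eps) *. V (z - eps *. x) \<bullet> h)) (at x)"
   using has_derivative_compose[OF lin dv] by simp
  have "((%y. (-eps) *. V (z - eps *. y)) has_derivative (%h. (-eps) *. (Hv (z - eps *. x) *v ((-eps) *. h)))) (at x)"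
   by (rule has_derivative_scaleR_right[OF has_derivative_compose[OF lin dV]])
  moreover have "(-eps) *. (Hv (z - eps *. x) *v ((-eps) *. h)) = eps^2 *. Hv (z - eps *. x) *v h" for h
   by (simp only: linear_cmul[OF mv_linear] scaleR_scaleR scaleR_matrix_vector_assoc[symmetric])
    (simp add: power2_eq_square)
  ultimately show "((%y. (-eps) *. V (z - eps *. y)) has_derivative (%h. eps^2 *. Hv (z - eps *. x) *v h)) (at x)"
   by (simp only:)
 next
  show "continuous_on UNIV (%y. eps^2 *. Hv (z - eps *. y))"
   by (intro continuous_intros continuous_on_compose2[OF cHv]) auto
  show "compact ((%x. (1/eps) *. (z - x)) ` K)" by (intro compact_continuous_image continuous_intros K)
 qed (use symA symg A_g cA ellg normg k zero out in auto)
qed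

lemma translated_gaussian_integral:
 fixes R :: "real^'n => ennreal" and q :: "real^'n => real^'n"
 assumes [measurable]: "R \<in> borel_fun" "q \<in> borel_fun" and G[measurable]: "G \<in> borel_fun"
 shows "(NI z. (NI zeta. G zeta * R (z + q zeta))) = (NI zeta::real^'n. G zeta) * (NI x. R x)"
proof -
 have "(NI z. (NI zeta. G zeta * R (z + q zeta))) = (NI zeta. (NI z. G zeta * R (z + q zeta)))"
  by (rule lborel_pair.Fubini') measurable
 also have "... = (NI zeta. G zeta * (NI x. R x))"
 proof (rule nn_integral_cong)
  fix zeta
  have "(NI z. R (z + q zeta)) = (NI x. R x)"
   using nn_integral_lborel_translation[of R "q zeta"] by (simp add: add.commute)
  then show "(NI z. G zeta * R (z + q zeta)) = G zeta * (NI x. R x)" by (simp add: nn_integral_cmult)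
 qed
 also have "... = (NI zeta. G zeta) * (NI x. R x)" by (simp add: nn_integral_multc)
 finally show ?thesis .
qed

text \<open>Uniform continuity in a form that can be integrated against a Gaussian.\<close>

lemma quadratic_modulus_of_continuity:
 fixes f :: "'a::real_normed_vector => real"
 assumes S: "compact S" and f: "continuous_on S f" and sgm: "sgm > 0"
 obtains c where "c >= 0" "!!x z. [|x \<in> S; z \<in> S|] ==> (f x - f z)^2 <= sgm + c * (norm (x - z))^2"
proof -
 have "compact (f ` S)" using S f by (intro compact_continuous_image)
 then obtain B where B: "!!x. x \<in> S ==> \<bar>f x\<bar> <= B" by (meson bounded_real compact_imp_bounded imageI)
 obtain rho where rho: "rho > 0" "!!x z. [|x \<in> S; z \<in> S; dist z x < rho|] ==> dist (f z) (f x) < sqrt sgm"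
  using compact_uniformly_continuous[OF f S] sgm unfolding uniformly_continuous_on_def
  by (metis real_sqrt_gt_0_iff)
 show thesis
 proof (rule that[of "(2 * B)^2 / rho^2"])
  fix x z assume xz: "x \<in> S" "z \<in> S"
  show "(f x - f z)^2 <= sgm + (2 * B)^2 / rho^2 * (norm (x - z))^2"
  proof (cases "norm (x - z) < rho")
   case True
   then have "\<bar>f x - f z\<bar> < sqrt sgm" using rho(2)[of z x] xz by (simp add: dist_norm)
   then have "(f x - f z)^2 <= (sqrt sgm)^2" using power_mono[of "\<bar>f x - f z\<bar>" "sqrt sgm" 2] by simp
   moreover have "0 <= (2 * B)^2 / rho^2 * (norm (x - z))^2" by (intro mult_nonneg_nonneg divide_nonneg_nonneg) auto
   ultimately show ?thesis using real_sqrt_pow2[of sgm] sgm by linarith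
  next
   case False
   have "\<bar>f x - f z\<bar> <= \<bar>2 * B\<bar>" using B[OF xz(1)] B[OF xz(2)] by linarith
   then have 1: "(f x - f z)^2 <= (2 * B)^2" by (simp add: abs_le_square_iff)
   have "rho^2 <= (norm (x - z))^2" using False rho by (intro power_mono) auto
   then have "1 <= (norm (x - z))^2 / rho^2" using rho by simp
   then have "(2 * B)^2 * 1 <= (2 * B)^2 * ((norm (x - z))^2 / rho^2)" by (intro mult_left_mono) auto
   with 1 sgm show ?thesis by simp
  qed
 qed simp
qed

text \<open>The fields \<open>p\<close> and \<open>H\<close> are the gradient and the Hessian of the weight; they carry
information only on the closure of \<open>Om\<close>.\<close>

locale weighted_domain = elliptic_coefficients A g cA CA L
 for A g :: "real^'n => real^'n^'n" and cA CA L :: real +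
 fixes Om :: "(real^'n) set" and phi :: "real^'n => real" and p :: "real^'n => real^'n" and H :: "real^'n => real^'n^'n" and Cp cp :: real
 assumes open_dom: "open Om" and bounded_dom: "bounded Om"
  and cp_on: "continuous_on (closure Om) p" and cH_on: "continuous_on (closure Om) H"
  and pH_bound: "!!x. x \<in> closure Om ==> norm (p x) <= Cp" "!!x. x \<in> closure Om ==> norm (H x) <= Cp"
  and p_lower: "!!x. x \<in> closure Om ==> cp <= norm (p x)" and cp: "cp > 0"
  and d\<phi>: "!!x. x \<in> Om ==> (phi has_derivative (%h. p x \<bullet> h)) (at x)"
  and dp: "!!x. x \<in> Om ==> (p has_derivative (%h. H x *v h)) (at x)"
begin

lemma cl: "Om <= closure Om" by (rule closure_subset)

lemma L_nonneg: "L >= 0"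
 using order_trans[OF norm_ge_zero lipA[of "axis undefined 1" 0]] by (simp add: norm_axis_1)

lemma cA_on: "continuous_on UNIV A"
 by (rule lipschitz_on_continuous_on[of L]) (use lipA L_nonneg in "auto simp: lipschitz_on_def dist_norm")

lemma compact_closure_dom: "compact (closure Om)"
 using bounded_dom by (simp add: compact_closure)

definition kz :: "real^'n => real" where "kz x = p x \<bullet> (A x *v p x)"

lemma kz_continuous: "continuous_on (closure Om) kz"
 unfolding kz_def by (intro continuous_intros cp_on continuous_on_subset[OF cA_on]) auto

lemma kz_bound: "x \<in> closure Om ==> \<bar>kz x\<bar> <= CA * Cp^2"
proof -
 assume x: "x \<in> closure Om"
 have "\<bar>kz x\<bar> <= norm (p x) * norm (A x *v p x)" unfolding kz_def by (rule cauchy_schwarz)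
 also have "... <= norm (p x) * (norm (A x) * norm (p x))" by (intro mult_left_mono norm_matrix_vector_le) simp
 also have "... = norm (A x) * (norm (p x))^2" by (simp add: power2_eq_square)
 also have "... <= CA * Cp^2" using normA[of x] pH_bound(1)[OF x] by (intro mult_mono power_mono) (auto intro: order_trans[OF norm_ge_zero])
 finally show ?thesis .
qed

definition ext_density :: "real => real^'n => real"
 where "ext_density eps = moll bump eps (indicator (- Om))"

lemma exterior_indicator: "indicat_real (- Om) \<in> borel_fun" "!!x. norm (indicat_real (- Om) x) <= 1"
 using open_dom by (auto simp: indicator_def)

lemma ext_density_continuous: "eps > 0 ==> continuous_on UNIV (ext_density eps)"
 unfolding ext_density_def by (rule moll_continuous[OF kernel_bump exterior_indicator])

lemma ext_density_range: "0 <= ext_density eps x" "ext_density eps x <= 1"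
proof -
 have i: "integrable lborel (%z. bump z *. indicat_real (- Om) (x - eps *. z))"
  by (rule moll_integrable[OF kernel_bump exterior_indicator])
 show "0 <= ext_density eps x" unfolding ext_density_def moll_def
  by (intro lint_nonneg) (simp add: bump_nonneg)
 have "ext_density eps x <= (LI z. bump (z::real^'n))" unfolding ext_density_def moll_def
  by (intro integral_mono i integrable_kernel[OF kernel_bump]) (auto simp: indicator_def bump_nonneg)
 then show "ext_density eps x <= 1" by (simp add: integral_bump)
qed

lemma ext_density_large_set:
 assumes C: "!!z::real^'n. bump z <= C" and v: "!!x. x ~: Om ==> v x = 0" and [measurable]: "v \<in> borel_fun"
 shows "ext_density eps z <= C * measure lborel {y\<in>cball 0 1. v (z - eps *. y) = (0::real)}"
proof -
 let ?X = "{y\<in>cball 0 1. v (z - eps *. y) = 0}"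
 have X[measurable]: "?X \<in> sets borel" by measurable
 have fin: "emeasure lborel ?X < \<infinity>" by (rule emeasure_bounded_finite) (rule bounded_subset[OF bounded_cball[of 0 1]], auto)
 have i: "integrable lborel (%y. bump y *. indicat_real (- Om) (z - eps *. y))"
  by (rule moll_integrable[OF kernel_bump exterior_indicator])
 have "ext_density eps z <= (LI y. C * indicator ?X y)"
  unfolding ext_density_def moll_def
 proof (intro integral_mono i integrable_mult_right integrable_real_indicator)
  fix y
  have C0: "C >= 0" using C[of 0] bump_nonneg[of "0::real^'n"] by linarith
  show "bump y *. indicat_real (- Om) (z - eps *. y) <= C * indicator ?X y"
  proof (cases "norm y < 1")
   case True
   then show ?thesis using C[of y] C0 v[of "z - eps *. y"] by (auto simp: indicator_def)
  next
   case False
   then have "bump y = 0" using kernel_bump[where 'a="real^'n"] unfolding kernel_def by auto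
   then show ?thesis using C0 by (simp add: indicator_def)
  qed
 qed (use X fin in auto)
 then show ?thesis using X by simp
qed

text \<open>Freeze the coefficients at \<open>z\<close>, rescale by \<open>eps = M / tau\<close>, and apply
\<open>vanishing_set_bound\<close> wherever the exterior density at \<open>z\<close> is at least \<open>dl /
2\<close>. The defect \<open>f\<close> consists of \<open>S v\<close>, the error of freezing \<open>A\<close>, which
costs \<open>eps |D^2 v|\<close>, and the error of freezing \<open>kz\<close>, which is small by uniform continuity.
Integration over \<open>z\<close> turns all averages into integrals over the whole space.\<close>

lemma mass_near_exterior:
 assumes M: "M > 0" and dl: "dl > 0"
 shows "\<exists>CU\<ge>0. \<exists>tau1>0. \<forall>tau\<ge>tau1. \<forall>v V Hv K. c2_compact_support v V Hv K --> K <= Om -->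
  (LI x. ext_density (M/tau) x * (v x)^2) <= dl * (LI x. (v x)^2)
   + CU * ((M/tau)^4 * (LI x. (A x \<bullet> Hv x + tau^2 * kz x * v x)^2) + (M/tau)^6 * (LI x. (norm (Hv x))^2))"
proof -
 define b where "b = cA / 4"
 have b: "b > 0" using cA by (simp add: b_def)
 define k0 where "k0 = M^2 * (CA * Cp^2)"
 obtain bmax where bmax: "!!z::real^'n. bump z <= bmax" "bmax > 0"
 proof -
  obtain c where c: "!!z::real^'n. \<bar>bump z\<bar> <= c" "c >= 0" using kernel_bounded[OF kernel_bump[where 'a="real^'n"]] by metis
  show thesis
  proof (rule that[of "c + 1"])
   show "bump z <= c + 1" for z :: "real^'n" using c(1)[of z] by linarith
  qed (use c in simp)
 qed
 define i0 where "i0 = (LI zeta::real^'n. gauss b zeta)"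
 define i1 where "i1 = (LI zeta::real^'n. 3 * (gauss b zeta * (1 + (norm zeta)^2)))"
 have i0: "i0 >= 0" "(NI zeta::real^'n. ennreal (gauss b zeta)) = ennreal i0"
 proof -
  show "i0 >= 0" unfolding i0_def by (intro lint_nonneg) simp
  show "(NI zeta::real^'n. ennreal (gauss b zeta)) = ennreal i0"
   unfolding i0_def by (rule nn_integral_eq_integral[OF integrable_gaussian[OF b]]) simp
 qed
 have i1: "i1 >= 0" "(NI zeta::real^'n. ennreal (3 * (gauss b zeta * (1 + (norm zeta)^2)))) = ennreal i1"
 proof -
  show "i1 >= 0" unfolding i1_def by (intro lint_nonneg) auto
  show "(NI zeta::real^'n. ennreal (3 * (gauss b zeta * (1 + (norm zeta)^2)))) = ennreal i1"
   unfolding i1_def by (rule nn_integral_eq_integral) (intro integrable_mult_right integrable_gaussian_quadratic b, auto)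
 qed
 define vol where "vol = measure lborel (cball (0::real^'n) 1)"
 have vol0: "vol >= 0" and vole: "emeasure lborel (cball (0::real^'n) 1) = ennreal vol"
  unfolding vol_def using emeasure_bounded_finite[of "cball (0::real^'n) 1"] by (auto simp: emeasure_eq_ennreal_measure less_top)
 have CA0: "CA > 0"
 proof -
  have "cA * 1 <= CA * 1"
  proof -
   define e where "e = (axis undefined 1 :: real^'n)"
   have e: "e \<bullet> e = 1" "norm e = 1" by (simp_all add: e_def inner_axis_axis norm_axis_1)
   have "cA * (e \<bullet> e) <= e \<bullet> (A 0 *v e)" by (rule ellA)
   also have "... <= norm e * norm (A 0 *v e)" by (rule norm_cauchy_schwarz)
   also have "... <= 1 * (norm (A 0) * 1)" using norm_matrix_vector_le[of "A 0" e] by (simp add: e)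
   finally show ?thesis using normA[of 0] by (simp add: e)
  qed
  then show ?thesis using cA by simp
 qed
 define kap where "kap = dl / (4 * (i0 + 1))"
 have kap: "kap > 0" "kap * i0 <= dl / 4"
 proof -
  show "kap > 0" using dl i0 by (simp add: kap_def)
  have "kap * i0 = dl/4 * (i0 / (i0 + 1))" by (simp add: kap_def)
  also have "... <= dl/4 * 1" using dl i0 by (intro mult_left_mono) auto
  finally show "kap * i0 <= dl / 4" by simp
 qed
 define d where "d = dl / 2 / bmax"
 have d: "d > 0" using dl bmax by (simp add: d_def)
 obtain Kc where Kc: "Kc >= 0"
  "!!g a k w wV wH K. [|gaussian_average (g :: real^'n^'n) a cA CA k k0 w wV wH K; measure lborel {y\<in>cball 0 1. w y = 0} >= d|] ==>
   ennreal ((w 0)^2) <= ennreal Kc * (gaussian_average.rhs a cA k w wH 0 + (NI y. indicator (cball 0 1) y * gaussian_average.rhs a cA k w wH y))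
   + ennreal kap * (NI zeta. ennreal (gauss (cA/4) zeta * (w zeta)^2))"
  by (rule vanishing_set_bound[OF cA CA0 d kap(1), where 'n='n and ?k0.0=k0]) (rule that, assumption, assumption)
 define X where "X = Kc * (1 + vol) * i1"
 have X0: "X >= 0" using Kc vol0 i1 by (simp add: X_def)
 define sgm where "sgm = dl / (8 * (X * 3 * M^4 + 1))"
 have XM: "X * 3 * M^4 >= 0" using X0 by (intro mult_nonneg_nonneg) auto
 have sgm: "sgm > 0" "X * 3 * M^4 * sgm <= dl / 8"
 proof -
  show "sgm > 0" using dl XM by (simp add: sgm_def)
  have "X * 3 * M^4 * sgm = dl/8 * (X * 3 * M^4 / (X * 3 * M^4 + 1))" by (simp add: sgm_def)
  also have "... <= dl/8 * 1" using dl XM by (intro mult_left_mono) auto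
  finally show "X * 3 * M^4 * sgm <= dl / 8" by simp
 qed
 obtain csgm where csgm: "csgm >= 0" "!!x z. [|x \<in> closure Om; z \<in> closure Om|] ==> (kz x - kz z)^2 <= sgm + csgm * (norm (x - z))^2"
  using quadratic_modulus_of_continuity[OF compact_closure_dom kz_continuous sgm(1)] by metis
 define tau1 where "tau1 = 1 + 8 * (X * 3 * M^4 * csgm * M^2) / dl"
 have XMc: "X * 3 * M^4 * csgm * M^2 >= 0" using mult_nonneg_nonneg[OF mult_nonneg_nonneg[OF XM csgm(1)], of "M^2"] by simp
 define CU where "CU = X * 3 * (1 + L^2)"
 show ?thesis
 proof (rule exI[of _ CU], intro conjI, goal_cases)
  case 1 show ?case using X0 by (simp add: CU_def)
 next
  case 2 show ?case
  proof (rule exI[of _ tau1], intro conjI allI impI)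
   have "8 * (X * 3 * M^4 * csgm * M^2) / dl >= 0" using XMc dl by (intro divide_nonneg_nonneg) auto
   then have t1: "tau1 >= 1" by (simp add: tau1_def)
   then show "tau1 > 0" by simp
   fix tau v V Hv and K :: "(real^'n) set"
   assume tau: "tau1 <= tau" and c2: "c2_compact_support v V Hv K" and KOm: "K <= Om"
   interpret c2_compact_support v V Hv K by fact
   have tau1: "tau >= 1" "tau > 0" using tau t1 by auto
   define eps where "eps = M / tau"
   have eps: "eps > 0" using M tau1 by (simp add: eps_def)
   have eM: "eps^2 * tau^2 = M^2" using tau1 by (simp add: eps_def power_divide)
   have small: "X * 3 * M^4 * (sgm + csgm * eps^2) <= dl / 4"
   proof -
    have "X * 3 * M^4 * csgm * M^2 * 8 <= dl * tau"
    proof -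
     have "dl * (8 * (X * 3 * M^4 * csgm * M^2) / dl) <= dl * tau" using tau dl by (intro mult_left_mono) (auto simp: tau1_def)
     then show ?thesis using dl by simp
    qed
    also have "... <= dl * tau^2" using dl tau1 by (intro mult_left_mono) (auto simp: power2_eq_square)
    finally have "X * 3 * M^4 * csgm * (M^2 / tau^2) <= dl / 8" using tau1 by (simp add: field_simps)
    then have "X * 3 * M^4 * (csgm * eps^2) <= dl / 8" by (simp add: eps_def power_divide mult.assoc)
    then show ?thesis using sgm(2) by (simp add: distrib_left)
   qed
   let ?v = "%z y. v (z - eps *. y)" and ?h = "%z y. eps^2 *. Hv (z - eps *. y)"
   define S where "S x = A x \<bullet> Hv x + tau^2 * kz x * v x" for x
   have S0: "S x = 0" if "x ~: K" for x using zero that by (simp add: S_def)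
   have cS: "continuous_on UNIV S"
   proof (rule continuous_extension_by_zero[OF open_dom K KOm _ S0])
    show "continuous_on Om S" unfolding S_def
     by (intro continuous_intros continuous_on_subset[OF cA_on] continuous_on_subset[OF cHv] continuous_on_subset[OF kz_continuous] continuous_on_subset[OF cv])
      (auto intro: closure_subset[THEN subsetD])
   qed
   have [measurable]: "S \<in> borel_fun" using cS by (rule borel_cont)
   have iS: "integrable lborel (%x. (S x)^2)"
    by (rule integrable_compact_support[OF K]) (use S0 in "auto intro!: continuous_intros cS")
   define R where "R x = 3 * (eps^4 * (S x)^2 + L^2 * eps^6 * (norm (Hv x))^2 + M^4 * (sgm + csgm * eps^2) * (v x)^2)" for x
   have R0: "R x >= 0" for x using sgm csgm by (auto simp: R_def intro!: add_nonneg_nonneg mult_nonneg_nonneg)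
   have [measurable]: "R \<in> borel_fun" unfolding R_def by measurable
   have iR: "integrable lborel R" unfolding R_def
    by (intro integrable_mult_right Bochner_Integration.integrable_add iS integrable_data)
   define IR where "IR = (LI x. R x)"
   have IR: "(NI x. ennreal (R x)) = ennreal IR" "IR >= 0"
    unfolding IR_def by (auto intro!: nn_integral_eq_integral iR lint_nonneg R0)
   have kb: "\<bar>M^2 * kz z\<bar> <= k0" if "z \<in> Om" for z
    using kz_bound[of z] that closure_subset[of Om] unfolding k0_def abs_mult by (auto intro!: mult_left_mono)
   note ga = gaussian_average_rescaled[OF elliptic_coefficients_axioms eps]
   have fR: "(gaussian_average.f (A z) (M^2 * kz z) (?v z) (?h z) y)^2 <= (1 + (norm y)^2) * R (z - eps *. y)"
    if z: "z \<in> Om" for z y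
   proof -
    interpret G: gaussian_average "g z" "A z" cA CA "M^2 * kz z" k0 "%y. v (z - eps *. y)" "%y. (-eps) *. V (z - eps *. y)" "%y. eps^2 *. Hv (z - eps *. y)" "(%x. (1/eps) *. (z - x)) ` K"
     by (rule ga[OF kb[OF z]])
    define x where "x = z - eps *. y"
    show ?thesis
    proof (cases "x \<in> K")
     case False
     then show ?thesis using zero R0[of x] unfolding G.f_def x_def[symmetric] by simp
    next
     case True
     then have xc: "x \<in> closure Om" "z \<in> closure Om" using KOm z closure_subset by auto
     have xz: "norm (x - z) = eps * norm y" using eps by (simp add: x_def)
     define e1 where "e1 = (A z - A x) \<bullet> Hv x"
     define e2 where "e2 = tau^2 * (kz z - kz x) * v x"
     have "G.f y = eps^2 * (S x + e1 + e2)"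
      unfolding G.f_def x_def[symmetric] S_def e1_def e2_def using eM[symmetric] by (simp add: inner_diff_left algebra_simps)
     then have "(G.f y)^2 = eps^4 * (S x + e1 + e2)^2" by (simp add: power_mult_distrib)
     also have "(S x + e1 + e2)^2 <= 3 * ((S x)^2 + e1^2 + e2^2)"
     proof -
      have "0 <= (S x - e1)^2 + (S x - e2)^2 + (e1 - e2)^2" by simp
      then show ?thesis by (simp add: power2_eq_square algebra_simps)
     qed
     also have "e1^2 <= L^2 * eps^2 * (norm y)^2 * (norm (Hv x))^2"
     proof -
      have "\<bar>e1\<bar> <= norm (A z - A x) * norm (Hv x)" unfolding e1_def by (rule cauchy_schwarz)
      also have "... <= (L * (eps * norm y)) * norm (Hv x)"
       using lipA[of z x] xz by (intro mult_right_mono) (auto simp: norm_minus_commute)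
      finally have "\<bar>e1\<bar> <= \<bar>(L * (eps * norm y)) * norm (Hv x)\<bar>" by linarith
      then have "e1^2 <= ((L * (eps * norm y)) * norm (Hv x))^2" by (simp only: abs_le_square_iff)
      then show ?thesis by (simp only: power_mult_distrib mult.assoc)
     qed
     also have "e2^2 <= tau^4 * (sgm + csgm * eps^2 * (norm y)^2) * (v x)^2"
     proof -
      have "(kz z - kz x)^2 <= sgm + csgm * eps^2 * (norm y)^2"
       using csgm(2)[OF xc] xz by (simp add: power2_commute power_mult_distrib mult.assoc)
      then have "tau^4 * (kz z - kz x)^2 * (v x)^2 <= tau^4 * (sgm + csgm * eps^2 * (norm y)^2) * (v x)^2"
       by (intro mult_right_mono mult_left_mono) auto
      then show ?thesis by (simp add: e2_def power_mult_distrib)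
     qed
     finally have f1: "(G.f y)^2 <= eps^4 * (3 * ((S x)^2 + L^2 * eps^2 * (norm y)^2 * (norm (Hv x))^2 + tau^4 * (sgm + csgm * eps^2 * (norm y)^2) * (v x)^2))"
      by (simp add: mult_left_mono)
     define Y where "Y = 1 + (norm y)^2"
     have Y: "1 <= Y" "(norm y)^2 <= Y" by (auto simp: Y_def)
     have "eps^4 * (3 * ((S x)^2 + L^2 * eps^2 * (norm y)^2 * (norm (Hv x))^2 + tau^4 * (sgm + csgm * eps^2 * (norm y)^2) * (v x)^2))
      <= eps^4 * (3 * (Y * (S x)^2 + L^2 * eps^2 * Y * (norm (Hv x))^2 + tau^4 * (sgm * Y + csgm * eps^2 * Y) * (v x)^2))"
      using Y sgm csgm by (intro mult_left_mono add_mono mult_right_mono) (auto intro: mult_right_mono[of 1 Y, simplified] mult_left_mono[of 1 Y sgm, simplified])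
     also have "... = 3 * (Y * (eps^4 * (S x)^2 + L^2 * (eps^4 * eps^2) * (norm (Hv x))^2 + (eps^2 * tau^2)^2 * (sgm + csgm * eps^2) * (v x)^2))"
      by (simp add: power_mult_distrib algebra_simps)
     also have "... = Y * R x" unfolding R_def eM by (simp flip: power_add power_mult)
     finally show ?thesis using f1 unfolding Y_def x_def by linarith
    qed
   qed
   define G3 where "G3 zeta = ennreal (3 * (gauss b zeta * (1 + (norm zeta)^2)))" for zeta :: "real^'n"
   have [measurable]: "G3 \<in> borel_fun" unfolding G3_def by measurable
   define rb where "rb y z = (NI s. indicator {0..1::real} s * (NI zeta. G3 zeta * ennreal (R (z + (-eps) *. (y + s *. zeta)))))" for y z :: "real^'n"
   have rhs_le: "gaussian_average.rhs (A z) cA (M^2 * kz z) (?v z) (?h z) y <= rb y z"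
    if z: "z \<in> Om" and y: "norm y <= 1" for z y
    unfolding gaussian_average.rhs_def[OF ga[OF kb[OF z]]] rb_def
   proof (intro nn_integral_mono)
    fix s :: real
    show "indicator {0..1} s * (NI zeta. ennreal (gauss (cA/4) zeta * (gaussian_average.f (A z) (M^2 * kz z) (?v z) (?h z) (y + s *. zeta))^2))
     <= indicator {0..1} s * (NI zeta. G3 zeta * ennreal (R (z + (-eps) *. (y + s *. zeta))))"
    proof (cases "s \<in> {0..1}")
     case True
     have "(NI zeta. ennreal (gauss (cA/4) zeta * (gaussian_average.f (A z) (M^2 * kz z) (?v z) (?h z) (y + s *. zeta))^2))
      <= (NI zeta. G3 zeta * ennreal (R (z + (-eps) *. (y + s *. zeta))))"
     proof (rule nn_integral_mono)
      fix zeta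
      define y' where "y' = y + s *. zeta"
      have "norm y' <= 1 + norm zeta"
       using norm_triangle_ineq[of y "s *. zeta"] y True mult_right_mono[of s 1 "norm zeta"] by (simp add: y'_def)
      then have "(norm y')^2 <= (1 + norm zeta)^2" by (intro power_mono) auto
      also have "... <= 2 + 2 * (norm zeta)^2" using zero_le_power2[of "1 - norm zeta"] by (simp add: power2_eq_square algebra_simps)
      also have "... <= 2 + 3 * (norm zeta)^2" by simp
      finally have y3: "1 + (norm y')^2 <= 3 * (1 + (norm zeta)^2)" by simp
      have "(gaussian_average.f (A z) (M^2 * kz z) (?v z) (?h z) y')^2 <= (1 + (norm y')^2) * R (z - eps *. y')"
       by (rule fR[OF z])
      also have "... <= (3 * (1 + (norm zeta)^2)) * R (z - eps *. y')" by (intro mult_right_mono y3 R0)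
      finally have "gauss b zeta * (gaussian_average.f (A z) (M^2 * kz z) (?v z) (?h z) y')^2
        <= gauss b zeta * ((3 * (1 + (norm zeta)^2)) * R (z - eps *. y'))" by (intro mult_left_mono) auto
      also have "... = (3 * (gauss b zeta * (1 + (norm zeta)^2))) * R (z + (-eps) *. y')" by simp
      finally show "ennreal (gauss (cA/4) zeta * (gaussian_average.f (A z) (M^2 * kz z) (?v z) (?h z) (y + s *. zeta))^2)
       <= G3 zeta * ennreal (R (z + (-eps) *. (y + s *. zeta)))"
       unfolding y'_def[symmetric] G3_def b_def[symmetric]
       by (subst ennreal_mult[symmetric]) (auto intro!: ennreal_leI R0)
     qed
     then show ?thesis using True by simp
    qed simp
   qed
   have rb_int: "(NI z. rb y z) = ennreal (i1 * IR)" for y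
   proof -
    have "(NI z. rb y z) = (NI s. NI z. indicator {0..1::real} s * (NI zeta. G3 zeta * ennreal (R (z + (-eps) *. (y + s *. zeta)))))"
     unfolding rb_def by (rule lborel_pair.Fubini') measurable
    also have "... = (NI s. indicator {0..1::real} s * ennreal (i1 * IR))"
    proof (rule nn_integral_cong)
     fix s :: real
     have "(NI z. (NI zeta. G3 zeta * ennreal (R (z + (-eps) *. (y + s *. zeta))))) = ennreal i1 * ennreal IR"
      using translated_gaussian_integral[of "%x. ennreal (R x)" "%zeta. (-eps) *. (y + s *. zeta)" G3] i1(2) IR(1)
      by (simp add: G3_def)
     then show "(NI z. indicator {0..1::real} s * (NI zeta. G3 zeta * ennreal (R (z + (-eps) *. (y + s *. zeta))))) = indicator {0..1::real} s * ennreal (i1 * IR)"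
      using i1 IR by (subst nn_integral_cmult) (auto simp: ennreal_mult)
    qed
    also have "... = ennreal (i1 * IR)" by (simp add: nn_integral_multc)
    finally show ?thesis .
   qed
   have [measurable]: "cball (0::real^'n) 1 \<in> sets borel" by simp
   have [measurable]: "rb y \<in> borel_fun" for y unfolding rb_def[abs_def] by measurable
   define rc where "rc z = (NI y. indicator (cball 0 1) y * rb y z)" for z
   have [measurable]: "rc \<in> borel_fun" unfolding rc_def[abs_def] rb_def by measurable
   define mz where "mz z = (NI zeta. ennreal (gauss b zeta) * ennreal ((v (z + (-eps) *. zeta))^2))" for z
   have [measurable]: "mz \<in> borel_fun" unfolding mz_def[abs_def] by measurable
   define IV where "IV = (LI x. (v x)^2)"
   have IV: "(NI x. ennreal ((v x)^2)) = ennreal IV" "IV >= 0"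
    unfolding IV_def by (auto intro!: nn_integral_eq_integral integrable_data lint_nonneg)
   have mz_int: "(NI z. mz z) = ennreal (i0 * IV)"
    unfolding mz_def using translated_gaussian_integral[of "%x. ennreal ((v x)^2)" "%zeta. (-eps) *. zeta" "%zeta. ennreal (gauss b zeta)"] i0 IV
    by (simp add: ennreal_mult)
   define bound where "bound z = ennreal Kc * (rb 0 z + rc z) + ennreal kap * mz z" for z
   have [measurable]: "bound \<in> borel_fun" unfolding bound_def[abs_def] by measurable
   have point: "ennreal (ext_density eps z * (v z)^2) <= ennreal (dl/2) * ennreal ((v z)^2) + bound z" for z
   proof (cases "z \<in> Om & ext_density eps z >= dl/2")
    case False
    then consider "z ~: Om" | "ext_density eps z <= dl/2" by linarith
    then show ?thesis
    proof cases
     case 1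
     then have "v z = 0" using zero(1) KOm by auto
     then show ?thesis by simp
    next
     case 2
     have "ennreal (ext_density eps z * (v z)^2) <= ennreal (dl/2 * (v z)^2)" using 2 by (intro ennreal_leI mult_right_mono) auto
     also have "... = ennreal (dl/2) * ennreal ((v z)^2)" using dl by (intro ennreal_mult) auto
     finally show ?thesis by (simp add: add_increasing2)
    qed
   next
    case True
    then have z: "z \<in> Om" by simp
    have "v x = 0" if "x ~: Om" for x using that KOm zero(1) by auto
    then have "dl/2 <= bmax * measure lborel {y\<in>cball 0 1. v (z - eps *. y) = 0}"
     using ext_density_large_set[OF bmax(1), of v eps z] True by simp
    then have large: "d <= measure lborel {y\<in>cball 0 1. v (z - eps *. y) = 0}" using bmax(2) by (simp add: d_def field_simps)
    have I1: "(NI y. indicator (cball 0 1) y * gaussian_average.rhs (A z) cA (M^2 * kz z) (?v z) (?h z) y)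
      <= (NI y. indicator (cball 0 1) y * rb y z)"
    proof (rule nn_integral_mono)
     fix y :: "real^'n"
     show "indicator (cball 0 1) y * gaussian_average.rhs (A z) cA (M^2 * kz z) (?v z) (?h z) y <= indicator (cball 0 1) y * rb y z"
      by (cases "norm y <= 1") (use rhs_le[OF z, of y] in "auto simp: indicator_def")
    qed
    have "ennreal ((v z)^2) <= ennreal Kc * (gaussian_average.rhs (A z) cA (M^2 * kz z) (?v z) (?h z) 0
      + (NI y. indicator (cball 0 1) y * gaussian_average.rhs (A z) cA (M^2 * kz z) (?v z) (?h z) y))
     + ennreal kap * (NI zeta. ennreal (gauss (cA/4) zeta * (v (z - eps *. zeta))^2))"
     using Kc(2)[OF ga[OF kb[OF z]] large] by simp
    also have "(NI zeta. ennreal (gauss (cA/4) zeta * (v (z - eps *. zeta))^2)) = mz z"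
     unfolding mz_def b_def by (intro nn_integral_cong) (simp add: ennreal_mult)
    also have "ennreal Kc * (gaussian_average.rhs (A z) cA (M^2 * kz z) (?v z) (?h z) 0
      + (NI y. indicator (cball 0 1) y * gaussian_average.rhs (A z) cA (M^2 * kz z) (?v z) (?h z) y))
     + ennreal kap * mz z <= bound z" unfolding bound_def rc_def
     by (intro add_mono mult_left_mono I1 rhs_le[OF z]) auto
    finally have vb: "ennreal ((v z)^2) <= bound z" .
    have "ennreal (ext_density eps z * (v z)^2) <= ennreal (1 * (v z)^2)"
     using ext_density_range by (intro ennreal_leI mult_right_mono) auto
    also have "... <= bound z" using vb by simp
    finally show ?thesis by (simp add: add_increasing)
   qed
   have bound_int: "(NI z. bound z) = ennreal (X * IR + kap * (i0 * IV))"
   proof -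
    have "(NI z. (NI y. indicator (cball 0 1) y * rb y z)) = (NI y. (NI z. indicator (cball 0 1) y * rb y z))"
     unfolding rb_def by (rule lborel_pair.Fubini') measurable
    also have "... = (NI y. indicator (cball 0 1) (y::real^'n) * ennreal (i1 * IR))"
     by (intro nn_integral_cong) (simp add: nn_integral_cmult rb_int)
    also have "... = ennreal vol * ennreal (i1 * IR)" by (subst nn_integral_multc) (auto simp: vole)
    finally have 1: "(NI z. (NI y. indicator (cball 0 1) y * rb y z)) = ennreal vol * ennreal (i1 * IR)" .
    have "(NI z. bound z) = ennreal Kc * (ennreal (i1 * IR) + ennreal vol * ennreal (i1 * IR)) + ennreal kap * ennreal (i0 * IV)"
     using 1 unfolding bound_def rc_def[symmetric]
     by (subst nn_integral_add; (subst nn_integral_cmult)?; (subst nn_integral_add)?; simp add: rb_int mz_int nn_integral_cmult nn_integral_add)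
    also have "... = ennreal (X * IR + kap * (i0 * IV))"
     using Kc vol0 i1 i0 IR IV kap by (simp add: X_def ennreal_mult[symmetric] ennreal_plus[symmetric] algebra_simps del: ennreal_plus)
    finally show ?thesis .
   qed
   have [measurable]: "ext_density eps \<in> borel_fun"
    using ext_density_continuous[OF eps] by (rule borel_cont)
   have itheta: "integrable lborel (%x. ext_density eps x * (v x)^2)"
    by (rule integrable_compact_support[OF K]) (use zero in "auto intro!: continuous_intros cv ext_density_continuous eps")
   have "ennreal (LI x. ext_density eps x * (v x)^2) = (NI x. ennreal (ext_density eps x * (v x)^2))"
    by (rule nn_integral_eq_integral[OF itheta, symmetric]) (simp add: ext_density_range)
   also have "... <= (NI x. ennreal (dl/2) * ennreal ((v x)^2) + bound x)" by (intro nn_integral_mono point)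
   also have "... = ennreal (dl/2) * ennreal IV + ennreal (X * IR + kap * (i0 * IV))"
    by (simp add: nn_integral_add nn_integral_cmult IV bound_int)
   also have "... = ennreal (dl/2 * IV + (X * IR + kap * (i0 * IV)))"
    using dl IV X0 IR kap i0 by (simp add: ennreal_mult[symmetric] ennreal_plus[symmetric] del: ennreal_plus)
   finally have "(LI x. ext_density eps x * (v x)^2) <= dl/2 * IV + (X * IR + kap * (i0 * IV))"
    using dl IV X0 IR kap i0 by (subst (asm) ennreal_le_iff) auto
   also have "kap * (i0 * IV) <= dl/4 * IV" using mult_right_mono[OF kap(2) IV(2)] by (simp add: mult.assoc)
   also have "X * IR = (X * 3 * eps^4) * (LI x. (S x)^2) + (X * 3 * L^2 * eps^6) * (LI x. (norm (Hv x))^2) + X * 3 * M^4 * (sgm + csgm * eps^2) * IV"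
    unfolding IR_def R_def IV_def using iS integrable_data by (simp add: algebra_simps)
   also have "X * 3 * M^4 * (sgm + csgm * eps^2) * IV <= dl/4 * IV" by (rule mult_right_mono[OF small IV(2)])
   finally have "(LI x. ext_density eps x * (v x)^2) <= dl * IV + ((X * 3 * eps^4) * (LI x. (S x)^2) + (X * 3 * L^2 * eps^6) * (LI x. (norm (Hv x))^2))"
    by (simp add: algebra_simps)
   also have "... <= dl * IV + CU * (eps^4 * (LI x. (S x)^2) + eps^6 * (LI x. (norm (Hv x))^2))"
   proof -
    have a: "(X * 3 * eps^4) * (LI x. (S x)^2) <= CU * (eps^4 * (LI x. (S x)^2))"
     unfolding CU_def using X0 by (simp add: mult.assoc mult_left_mono mult_right_mono algebra_simps)
    have b': "(X * 3 * L^2 * eps^6) * (LI x. (norm (Hv x))^2) <= CU * (eps^6 * (LI x. (norm (Hv x))^2))"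
     unfolding CU_def using X0 by (simp add: mult.assoc mult_left_mono mult_right_mono algebra_simps)
    show ?thesis using a b' by (simp add: distrib_left)
   qed
   finally show "(LI x. ext_density (M/tau) x * (v x)^2) <= dl * (LI x. (v x)^2)
    + CU * ((M/tau)^4 * (LI x. (A x \<bullet> Hv x + tau^2 * kz x * v x)^2) + (M/tau)^6 * (LI x. (norm (Hv x))^2))"
    unfolding eps_def IV_def S_def .
  qed
 qed
qed

end

section \<open>The commutator\<close>

lemma second_difference_estimate:
 fixes f :: "real^'n => real"
 assumes S: "open S" "x \<in> S" and df: "!!y. y \<in> S ==> (f has_derivative (%h. d y \<bullet> h)) (at y)"
  and dd: "(d has_derivative (%h. D *v h)) (at x)" and e: "e > 0"
 shows "\<exists>t0>0. \<forall>t. 0 < t & t < t0 -->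
  \<bar>(f (x + t *. h + t *. k) - f (x + t *. h) - f (x + t *. k) + f x) - t^2 * ((D *v k) \<bullet> h)\<bar> <= e * t^2"
proof -
 define c where "c = (2 * norm h + norm k) * norm h + 1"
 have c: "c > 0" by (auto simp: c_def intro!: add_nonneg_pos mult_nonneg_nonneg)
 obtain r where r: "r > 0" "ball x r <= S" using S open_contains_ball by blast
 obtain rho where rho: "rho > 0" "!!y. norm (y - x) < rho ==> norm (d y - d x - D *v (y - x)) <= (e / c) * norm (y - x)"
  using dd e c unfolding has_derivative_at_alt by (metis divide_pos_pos)
 define t0 where "t0 = min r rho / (norm h + norm k + 1)"
 have t0: "t0 > 0" using r rho by (auto simp: t0_def intro!: divide_pos_pos add_nonneg_pos)
 show ?thesis
 proof (intro exI[of _ t0] conjI allI impI t0, elim conjE)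
  fix t assume t: "0 < t" "t < t0"
  have tb: "t * (norm h + norm k) < min r rho"
  proof -
   have "t * (norm h + norm k) <= t * (norm h + norm k + 1)" using t by (intro mult_left_mono) auto
   also have "... < t0 * (norm h + norm k + 1)" using t by (intro mult_strict_right_mono add_nonneg_pos) auto
   also have "... = min r rho" unfolding t0_def using add_nonneg_pos[of "norm h + norm k" 1] by simp
   finally show ?thesis .
  qed
  have near: "norm (s *. h + l *. k) <= t * (norm h + norm k)" if "0 <= s" "s <= t" "0 <= l" "l <= t" for s l
  proof -
   have "norm (s *. h + l *. k) <= s * norm h + l * norm k"
    using norm_triangle_ineq[of "s *. h" "l *. k"] that by simp
   also have "... <= t * norm h + t * norm k" using that by (intro add_mono mult_right_mono) auto
   finally show ?thesis by (simp add: distrib_left)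
  qed
  have inS: "x + s *. h + l *. k \<in> S" if "0 <= s" "s <= t" "0 <= l" "l <= t" for s l
  proof -
   have "dist x (x + s *. h + l *. k) = norm (s *. h + l *. k)" by (metis add.assoc add_diff_cancel_left' dist_commute dist_norm)
   also have "... < r" using near[OF that] tb by linarith
   finally show ?thesis using r by auto
  qed
  define F where "F s = f (x + t *. k + s *. h) - f (x + s *. h)" for s
  have dF: "(F has_real_derivative (d (x + s *. h + t *. k) - d (x + s *. h)) \<bullet> h) (at s)" if s: "0 <= s" "s <= t" for s
  proof -
   have lin: "((%s. y + s *. h) has_derivative (%l. l *. h)) (at s)" for y :: "real^'n"
    by (auto intro!: derivative_eq_intros)
   have "x + t *. k + s *. h \<in> S" "x + s *. h \<in> S" using inS[of s t] inS[of s 0] s t by (auto simp: algebra_simps)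
   then have "(F has_derivative (%l. d (x + t *. k + s *. h) \<bullet> (l *. h) - d (x + s *. h) \<bullet> (l *. h))) (at s)"
    unfolding F_def by (intro has_derivative_diff has_derivative_compose[OF lin df])
   moreover have "(%l. d (x + t *. k + s *. h) \<bullet> (l *. h) - d (x + s *. h) \<bullet> (l *. h)) = (*) ((d (x + s *. h + t *. k) - d (x + s *. h)) \<bullet> h)"
    by (rule ext) (simp add: algebra_simps inner_diff_left)
   ultimately show ?thesis unfolding has_field_derivative_def by simp
  qed
  obtain s where s: "0 < s" "s < t" "F t - F 0 = (t - 0) * ((d (x + s *. h + t *. k) - d (x + s *. h)) \<bullet> h)"
   using MVT2[OF t(1), of F "%s. (d (x + s *. h + t *. k) - d (x + s *. h)) \<bullet> h"] dF by auto
  define w1 where "w1 = s *. h + t *. k"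
  define w2 where "w2 = s *. h"
  have n: "norm w1 <= t * norm h + t * norm k" "norm w2 <= t * norm h"
   using near[of s t] near[of s 0] s t by (auto simp: w1_def w2_def distrib_left intro: mult_right_mono)
  have tb2: "t * norm h + t * norm k < rho" using tb by (simp add: distrib_left)
  have tk: "0 <= t * norm k" using t by simp
  have l: "norm w1 < rho" using n(1) tb2 by linarith
  have l2: "norm w2 < rho" using n(2) tb2 tk by linarith
  have e1: "norm (d (x + w1) - d x - D *v w1) <= (e/c) * norm w1" using rho(2)[of "x + w1"] l by simp
  have e2: "norm (d (x + w2) - d x - D *v w2) <= (e/c) * norm w2" using rho(2)[of "x + w2"] l2 by simp
  have "d (x + w1) - d (x + w2) - t *. (D *v k) = (d (x + w1) - d x - D *v w1) - (d (x + w2) - d x - D *v w2)"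
   by (simp add: w1_def w2_def matrix_vector_right_distrib linear_cmul[OF mv_linear])
  then have "norm (d (x + w1) - d (x + w2) - t *. (D *v k)) <= norm (d (x + w1) - d x - D *v w1) + norm (d (x + w2) - d x - D *v w2)"
   by (simp only: norm_triangle_ineq4)
  also have "... <= (e/c) * norm w1 + (e/c) * norm w2" by (intro add_mono e1 e2)
  also have "... <= (e/c) * (t * norm h + t * norm k) + (e/c) * (t * norm h)"
   using n e c by (intro add_mono mult_left_mono) auto
  finally have e3: "norm (d (x + w1) - d (x + w2) - t *. (D *v k)) <= (e/c) * t * (2 * norm h + norm k)" by (simp add: algebra_simps)
  have "(f (x + t *. h + t *. k) - f (x + t *. h) - f (x + t *. k) + f x) - t^2 * ((D *v k) \<bullet> h) = t * ((d (x + w1) - d (x + w2) - t *. (D *v k)) \<bullet> h)"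
   using s(3) by (simp add: F_def w1_def w2_def inner_diff_left power2_eq_square algebra_simps)
  then have "\<bar>(f (x + t *. h + t *. k) - f (x + t *. h) - f (x + t *. k) + f x) - t^2 * ((D *v k) \<bullet> h)\<bar> = t * \<bar>(d (x + w1) - d (x + w2) - t *. (D *v k)) \<bullet> h\<bar>"
   using t by (simp add: abs_mult)
  also have "... <= t * (norm (d (x + w1) - d (x + w2) - t *. (D *v k)) * norm h)"
   using t by (intro mult_left_mono cauchy_schwarz) auto
  also have "... <= t * ((e/c) * t * (2 * norm h + norm k) * norm h)"
   using t e3 by (intro mult_left_mono mult_right_mono) auto
  also have "... = e * t^2 * (((2 * norm h + norm k) * norm h) / c)" by (simp add: power2_eq_square)
  also have "... <= e * t^2 * 1" using e c by (intro mult_left_mono) (auto simp: c_def)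
  finally show "\<bar>(f (x + t *. h + t *. k) - f (x + t *. h) - f (x + t *. k) + f x) - t^2 * ((D *v k) \<bullet> h)\<bar> <= e * t^2" by simp
 qed
qed

text \<open>Schwarz theorem under the sole assumption that the gradient is differentiable at the point.\<close>

lemma hessian_symmetric:
 fixes f :: "real^'n => real"
 assumes S: "open S" "x \<in> S" and df: "!!y. y \<in> S ==> (f has_derivative (%h. d y \<bullet> h)) (at y)"
  and dd: "(d has_derivative (%h. D *v h)) (at x)"
 shows "transpose D = D"
proof -
 have sym: "(D *v k) \<bullet> h = (D *v h) \<bullet> k" for h k
 proof (rule ccontr)
  assume neq: "(D *v k) \<bullet> h ~= (D *v h) \<bullet> k"
  define e where "e = \<bar>(D *v k) \<bullet> h - (D *v h) \<bullet> k\<bar> / 4"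
  have e: "e > 0" using neq by (simp add: e_def)
  obtain t1 where t1: "t1 > 0" "!!t. 0 < t ==> t < t1 ==> \<bar>(f (x + t *. h + t *. k) - f (x + t *. h) - f (x + t *. k) + f x) - t^2 * ((D *v k) \<bullet> h)\<bar> <= e * t^2"
   using second_difference_estimate[OF S df dd e, of h k] by blast
  obtain t2 where t2: "t2 > 0" "!!t. 0 < t ==> t < t2 ==> \<bar>(f (x + t *. k + t *. h) - f (x + t *. k) - f (x + t *. h) + f x) - t^2 * ((D *v h) \<bullet> k)\<bar> <= e * t^2"
   using second_difference_estimate[OF S df dd e, of k h] by blast
  define t where "t = min t1 t2 / 2"
  have t: "0 < t" "t < t1" "t < t2" using t1 t2 by (auto simp: t_def)
  have c: "x + t *. k + t *. h = x + t *. h + t *. k" by simp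
  have "\<bar>t^2 * ((D *v k) \<bullet> h) - t^2 * ((D *v h) \<bullet> k)\<bar> <= 2 * (e * t^2)"
   using t1(2)[of t] t2(2)[of t] t unfolding c by linarith
  moreover have "t^2 * ((D *v k) \<bullet> h) - t^2 * ((D *v h) \<bullet> k) = t^2 * ((D *v k) \<bullet> h - (D *v h) \<bullet> k)" by (simp add: right_diff_distrib)
  ultimately have "t^2 * \<bar>(D *v k) \<bullet> h - (D *v h) \<bullet> k\<bar> <= t^2 * (2 * e)" by (simp add: abs_mult mult.commute mult.left_commute)
  then have "\<bar>(D *v k) \<bullet> h - (D *v h) \<bullet> k\<bar> <= 2 * e" using t by simp
  then show False using e by (simp add: e_def)
 qed
 have "D $ i $ j = D $ j $ i" for i j
  using sym[of "axis j 1" "axis i 1"] by (simp add: matrix_vector_mult_basis inner_axis column_def)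
 then show ?thesis by (simp add: transpose_def vec_eq_iff)
qed

text \<open>\<open>G $ s\<close> is the derivative of the coefficient matrix in direction \<open>s\<close>; \<open>dirG\<close> is
the derivative along a vector and \<open>beta\<close> the divergence of the rows.\<close>

definition dirG :: "real^'n^'n^'n => real^'n => real^'n^'n" where "dirG G h = (\<Sum>s\<in>UNIV. (h $ s) *. (G $ s))"
definition beta :: "real^'n^'n^'n => real^'n" where "beta G = (\<Sum>s\<in>UNIV. (G $ s) *v axis s 1)"
text \<open>\<open>Bf\<close> is half of the iterated Poisson bracket of the weight with the symbol \<open>xi . a xi\<close>; the
form \<open>Q\<close> of the pseudoconvexity condition is \<open>2 (Bf xi + Bf p)\<close> for \<open>tau = 1\<close>.
\<open>Df\<close> is the divergence of \<open>a p\<close>.\<close>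

definition Bf :: "real^'n^'n => real^'n => real^'n^'n => real^'n^'n^'n => real^'n => real"
 where "Bf a p H G xi = 2 * ((H *v (a *v xi)) \<bullet> (a *v xi)) + 2 * (p \<bullet> (dirG G (a *v xi) *v xi)) - xi \<bullet> (dirG G (a *v p) *v xi)"
definition Df :: "real^'n^'n => real^'n => real^'n^'n => real^'n^'n^'n => real"
 where "Df a p H G = beta G \<bullet> p + a \<bullet> H"
definition jf :: "real^'n^'n => real^'n => real^'n^'n => real^'n^'n^'n => real^'n => real => real"
 where "jf a p H G V r = 2 * (p \<bullet> (a *v V)) * (beta G \<bullet> V) + Bf a p H G V - Df a p H G * (V \<bullet> (a *v V))
  + (Bf a p H G p + Df a p H G * (p \<bullet> (a *v p))) * r^2"

lemma sum_components_linear: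
 fixes l :: "real^'n => real"
 assumes "linear l"
 shows "(\<Sum>i\<in>UNIV. l (axis i 1) * y $ i) = l y"
proof -
 have "y = (\<Sum>i\<in>UNIV. y $ i *. axis i 1)"
  by (simp add: vec_eq_iff axis_def if_distrib[where f = "%c. _ * c"] cong: if_cong)
 then have "l y = l (\<Sum>i\<in>UNIV. y $ i *. axis i 1)" by (rule arg_cong)
 also have "... = (\<Sum>i\<in>UNIV. y $ i * l (axis i 1))" by (simp add: linear_sum[OF assms] linear_cmul[OF assms])
 finally show ?thesis by (simp add: mult.commute)
qed

lemma dirG_axis: "dirG G (axis i 1) = G $ i"
 unfolding dirG_def by (simp add: axis_def if_distrib[where f = "%c. c *. _"] cong: if_cong)

lemma linear_dirG_mult: "linear (%h. dirG G h *v xi)"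
proof (rule linearI)
 show "dirG G (b1 + b2) *v xi = dirG G b1 *v xi + dirG G b2 *v xi" for b1 b2
  by (simp add: dirG_def scaleR_add_left sum.distrib matrix_vector_mult_add_rdistrib)
 show "dirG G (r *. b) *v xi = r *. (dirG G b *v xi)" for r b
  by (simp add: dirG_def scaleR_matrix_vector_assoc scaleR_sum_right)
qed

lemma beta_inner:
 assumes "!!s. transpose (G $ s) = G $ s"
 shows "(\<Sum>i\<in>UNIV. (G $ i *v V) $ i) = beta G \<bullet> V"
proof -
 have "(G $ i *v V) $ i = (G $ i *v axis i 1) \<bullet> V" for i
  using sym_matrix_inner[OF assms, of "axis i 1" i V] by (simp add: inner_axis')
 then show ?thesis by (simp add: beta_def inner_sum_left)
qed

locale differentiable_coefficients =
 fixes a :: "real^'n => real^'n^'n" and G :: "real^'n => real^'n^'n^'n"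
 assumes sym_a: "!!x. transpose (a x) = a x" and sym_G: "!!x s. transpose (G x $ s) = G x $ s"
  and cont_a: "continuous_on UNIV a" and cont_G: "continuous_on UNIV G"
  and der_a: "!!x s. ((%t. a (x + t *. axis s 1)) has_vector_derivative G x $ s) (at 0)"

lemmas has_vector_derivative_matrix_vector = bounded_bilinear.has_vector_derivative[OF bounded_bilinear_matrix_vector]
lemmas has_vector_derivative_inner = bounded_bilinear.has_vector_derivative[OF bounded_bilinear_inner]
lemmas has_vector_derivative_scale = bounded_bilinear.has_vector_derivative[OF bounded_bilinear_scaleR]
lemmas has_vector_derivative_times = bounded_bilinear.has_vector_derivative[OF bounded_bilinear_mult]

context c2_compact_support begin

lemma sym_Hv: "transpose (Hv x) = Hv x"
 by (rule hessian_symmetric[OF open_UNIV UNIV_I dv dV])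

text \<open>The divergence of \<open>w v a grad v\<close> has integral zero.\<close>

lemma weighted_integration_by_parts:
 fixes w :: "real^'n => real" and w' :: "real^'n => real^'n"
 assumes dc: "differentiable_coefficients a G"
  and cw: "continuous_on UNIV w" and cw': "continuous_on UNIV w'"
  and dw: "!!x i. ((%t. w (x + t *. axis i 1)) has_real_derivative w' x $ i) (at 0)"
 shows "(LI x. w x * (V x \<bullet> (a x *v V x) + v x * (a x \<bullet> Hv x)))
  = - (LI x. v x * (w' x \<bullet> (a x *v V x) + w x * (beta (G x) \<bullet> V x)))"
proof -
 interpret differentiable_coefficients a G by fact
 define W where "W x = (w x * v x) *. (a x *v V x)" for x
 define W' where "W' i x = (w x * v x) *. (a x *v (Hv x *v axis i 1) + G x $ i *v V x) + (w x * (V x \<bullet> axis i 1) + w' x $ i * v x) *. (a x *v V x)" for i x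
 have c: "continuous_on UNIV W" "continuous_on UNIV (W' i)" for i
  unfolding W_def W'_def by (intro continuous_intros cont_a cont_G cv cV cHv cw cw')+
 have z: "W x = 0" "W' i x = 0" if "x ~: K" for x i using zero that by (auto simp: W_def W'_def)
 have der: "((%t. W (x + t *. axis i 1)) has_vector_derivative W' i x) (at 0)" for x i
 proof -
  have 1: "((%t. v (x + t *. axis i 1)) has_vector_derivative V x \<bullet> axis i 1) (at 0)"
   by (rule deriv_along_line[OF dv])
  have 2: "((%t. V (x + t *. axis i 1)) has_vector_derivative Hv x *v axis i 1) (at 0)"
   by (rule deriv_along_line[OF dV])
  have 3: "((%t. w (x + t *. axis i 1)) has_vector_derivative w' x $ i) (at 0)"
   using dw by (simp add: real_vector_deriv)
  show ?thesis unfolding W_def W'_def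
   using has_vector_derivative_scale[OF has_vector_derivative_times[OF 3 1] has_vector_derivative_matrix_vector[OF der_a[of x i] 2]]
   by simp
 qed
 note div = integral_divergence_zero[OF open_UNIV K _ der c z, simplified]
 have eq: "(\<Sum>i\<in>UNIV. W' i x $ i) = w x * (V x \<bullet> (a x *v V x) + v x * (a x \<bullet> Hv x)) + v x * (w' x \<bullet> (a x *v V x) + w x * (beta (G x) \<bullet> V x))" for x
 proof -
  have "(\<Sum>i\<in>UNIV. W' i x $ i) = w x * v x * ((\<Sum>i\<in>UNIV. (a x *v (Hv x *v axis i 1)) $ i) + (\<Sum>i\<in>UNIV. (G x $ i *v V x) $ i))
    + w x * (\<Sum>i\<in>UNIV. V x $ i * (a x *v V x) $ i) + v x * (\<Sum>i\<in>UNIV. w' x $ i * (a x *v V x) $ i)"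
   unfolding W'_def by (simp add: sum.distrib sum_distrib_left inner_axis algebra_simps)
  then show ?thesis
   by (simp add: symmetric_trace_product[OF sym_a] beta_inner[OF sym_G] inner_vec_def[of "V x" "a x *v V x"] inner_vec_def[of "w' x" "a x *v V x"] algebra_simps)
 qed
 have i1: "integrable lborel (%x. w x * (V x \<bullet> (a x *v V x) + v x * (a x \<bullet> Hv x)))"
  by (rule integrable_compact_support[OF K]) (use zero in "auto intro!: continuous_intros cont_a cont_G cv cV cHv cw cw'")
 have cb: "continuous_on UNIV (%x. beta (G x))" unfolding beta_def by (intro continuous_intros cont_G)
 have i2: "integrable lborel (%x. v x * (w' x \<bullet> (a x *v V x) + w x * (beta (G x) \<bullet> V x)))"
  by (rule integrable_compact_support[OF K]) (use zero in "auto intro!: continuous_intros cont_a cont_G cv cV cHv cw cw' cb")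
 show ?thesis using div(1) i1 i2 unfolding eq by simp
qed

end

lemma continuous_on_beta[continuous_intros]: "continuous_on S G ==> continuous_on S (%x. beta (G x))"
 unfolding beta_def by (intro continuous_intros)

lemma continuous_on_dirG[continuous_intros]:
 "continuous_on S G ==> continuous_on S h ==> continuous_on S (%x. dirG (G x) (h x))"
 unfolding dirG_def by (intro continuous_intros)

lemma continuous_on_jf[continuous_intros]:
 assumes "continuous_on S a" "continuous_on S p" "continuous_on S H" "continuous_on S G" "continuous_on S V" "continuous_on S r"
 shows "continuous_on S (%x. jf (a x) (p x) (H x) (G x) (V x) (r x))"
 unfolding jf_def Bf_def Df_def by (intro continuous_intros assms)

text \<open>The product \<open>S v T v\<close> is a divergence plus \<open>tau jf\<close>. The divergence is that of the vector
field \<open>- 2 tau (p . a V) a V + tau (V . a V) a p - tau^3 (p . a p) v^2 a p\<close>, written out here through its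
directional derivatives; all second derivatives of \<open>v\<close> except those in \<open>S v\<close> cancel by
symmetry.\<close>

lemma commutator_pointwise:
 fixes a H Hv :: "real^'n^'n" and G :: "real^'n^'n^'n" and p V :: "real^'n" and v tau :: real
 assumes sa: "transpose a = a" and sG: "!!s. transpose (G $ s) = G $ s" and sHv: "transpose Hv = Hv"
 defines "y \<equiv> a *v V" and "q \<equiv> a *v p"
 defines "Y \<equiv> %h. dirG G h *v V + a *v (Hv *v h)" and "Q \<equiv> %h. dirG G h *v p + a *v (H *v h)"
 shows "(\<Sum>i\<in>UNIV. ((- 2 * tau) *. (((H *v axis i 1) \<bullet> y + p \<bullet> Y (axis i 1)) *. y + (p \<bullet> y) *. Y (axis i 1))
   + tau *. (((Hv *v axis i 1) \<bullet> y + V \<bullet> Y (axis i 1)) *. q + (V \<bullet> y) *. Q (axis i 1))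
   - tau^3 *. ((((H *v axis i 1) \<bullet> q + p \<bullet> Q (axis i 1)) * v^2 + (p \<bullet> q) * (2 * v * (V \<bullet> axis i 1))) *. q + ((p \<bullet> q) * v^2) *. Q (axis i 1))) $ i)
  = (a \<bullet> Hv + tau^2 * (p \<bullet> q) * v) * (- 2 * tau * (p \<bullet> y)) - tau * jf a p H G V (tau * v)"
proof -
 have lY: "linear Y" unfolding Y_def
  by (intro linear_compose_add linear_dirG_mult linear_compose[OF mv_linear mv_linear, unfolded comp_def])
 have lQ: "linear Q" unfolding Q_def
  by (intro linear_compose_add linear_dirG_mult linear_compose[OF mv_linear mv_linear, unfolded comp_def])
 have li: "linear (%h. z \<bullet> f h)" if "linear f" for f :: "real^'n => real^'n" and z
  using linear_compose[OF that bounded_linear.linear[OF bounded_linear_inner_right[of z]]] by (simp add: comp_def)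
 have li': "linear (%h. f h \<bullet> z)" if "linear f" for f :: "real^'n => real^'n" and z
  using li[OF that, of z] by (simp add: inner_commute)
 have lid: "linear (%h::real^'n. h)" by (simp add: linear_id[unfolded id_def])
 have s1: "(\<Sum>i\<in>UNIV. ((H *v axis i 1) \<bullet> y + p \<bullet> Y (axis i 1)) * y $ i) = (H *v y) \<bullet> y + p \<bullet> Y y"
  by (rule sum_components_linear) (intro linear_compose_add li li' lY mv_linear)
 have s2: "(\<Sum>i\<in>UNIV. ((Hv *v axis i 1) \<bullet> y + V \<bullet> Y (axis i 1)) * q $ i) = (Hv *v q) \<bullet> y + V \<bullet> Y q"
  by (rule sum_components_linear) (intro linear_compose_add li li' lY mv_linear)
 have s3: "(\<Sum>i\<in>UNIV. ((H *v axis i 1) \<bullet> q + p \<bullet> Q (axis i 1)) * q $ i) = (H *v q) \<bullet> q + p \<bullet> Q q"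
  by (rule sum_components_linear) (intro linear_compose_add li li' lQ mv_linear)
 have s4: "(\<Sum>i\<in>UNIV. (V \<bullet> axis i 1) * q $ i) = V \<bullet> q"
  by (rule sum_components_linear) (intro li lid)
 have dY: "(\<Sum>i\<in>UNIV. Y (axis i 1) $ i) = beta G \<bullet> V + a \<bullet> Hv"
  unfolding Y_def by (simp add: sum.distrib dirG_axis beta_inner[OF sG] symmetric_trace_product[OF sa])
 have dQ: "(\<Sum>i\<in>UNIV. Q (axis i 1) $ i) = beta G \<bullet> p + a \<bullet> H"
  unfolding Q_def by (simp add: sum.distrib dirG_axis beta_inner[OF sG] symmetric_trace_product[OF sa])
 have "(\<Sum>i\<in>UNIV. ((- 2 * tau) *. (((H *v axis i 1) \<bullet> y + p \<bullet> Y (axis i 1)) *. y + (p \<bullet> y) *. Y (axis i 1))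
   + tau *. (((Hv *v axis i 1) \<bullet> y + V \<bullet> Y (axis i 1)) *. q + (V \<bullet> y) *. Q (axis i 1))
   - tau^3 *. ((((H *v axis i 1) \<bullet> q + p \<bullet> Q (axis i 1)) * v^2 + (p \<bullet> q) * (2 * v * (V \<bullet> axis i 1))) *. q + ((p \<bullet> q) * v^2) *. Q (axis i 1))) $ i)
  = (- 2 * tau) * ((\<Sum>i\<in>UNIV. ((H *v axis i 1) \<bullet> y + p \<bullet> Y (axis i 1)) * y $ i) + (p \<bullet> y) * (\<Sum>i\<in>UNIV. Y (axis i 1) $ i))
   + tau * ((\<Sum>i\<in>UNIV. ((Hv *v axis i 1) \<bullet> y + V \<bullet> Y (axis i 1)) * q $ i) + (V \<bullet> y) * (\<Sum>i\<in>UNIV. Q (axis i 1) $ i))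
   - tau^3 * (v^2 * (\<Sum>i\<in>UNIV. ((H *v axis i 1) \<bullet> q + p \<bullet> Q (axis i 1)) * q $ i) + (p \<bullet> q) * 2 * v * (\<Sum>i\<in>UNIV. (V \<bullet> axis i 1) * q $ i) + (p \<bullet> q) * v^2 * (\<Sum>i\<in>UNIV. Q (axis i 1) $ i))"
  unfolding sum_distrib_left sum.distrib[symmetric] sum_subtractf[symmetric]
  by (rule sum.cong[OF refl]) (simp add: algebra_simps)
 also have "... = (- 2 * tau) * ((H *v y) \<bullet> y + p \<bullet> Y y + (p \<bullet> y) * (beta G \<bullet> V + a \<bullet> Hv))
   + tau * ((Hv *v q) \<bullet> y + V \<bullet> Y q + (V \<bullet> y) * (beta G \<bullet> p + a \<bullet> H))
   - tau^3 * (v^2 * ((H *v q) \<bullet> q + p \<bullet> Q q) + (p \<bullet> q) * 2 * v * (V \<bullet> q) + (p \<bullet> q) * v^2 * (beta G \<bullet> p + a \<bullet> H))"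
  unfolding s1 s2 s3 s4 dY dQ ..
 also have "p \<bullet> Y y = p \<bullet> (dirG G y *v V) + (Hv *v q) \<bullet> y"
 proof -
  have "p \<bullet> (a *v (Hv *v y)) = q \<bullet> (Hv *v y)" unfolding q_def by (rule sym_matrix_inner[OF sa])
  also have "... = (Hv *v q) \<bullet> y" by (rule sym_matrix_inner[OF sHv])
  finally show ?thesis by (simp add: Y_def inner_add_right)
 qed
 also have "V \<bullet> Y q = V \<bullet> (dirG G q *v V) + (Hv *v q) \<bullet> y"
 proof -
  have "V \<bullet> (a *v (Hv *v q)) = y \<bullet> (Hv *v q)" unfolding y_def by (rule sym_matrix_inner[OF sa])
  then show ?thesis by (simp add: Y_def inner_add_right inner_commute)
 qed
 also have "p \<bullet> Q q = p \<bullet> (dirG G q *v p) + (H *v q) \<bullet> q"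
 proof -
  have "p \<bullet> (a *v (H *v q)) = q \<bullet> (H *v q)" unfolding q_def by (rule sym_matrix_inner[OF sa])
  then show ?thesis by (simp add: Q_def inner_add_right inner_commute)
 qed
 also have "V \<bullet> q = p \<bullet> y"
  unfolding q_def y_def using sym_matrix_inner[OF sa, of V p] by (simp add: inner_commute)
 finally show ?thesis
  unfolding jf_def Bf_def Df_def y_def[symmetric] q_def[symmetric]
  by (simp add: power2_eq_square power3_eq_cube algebra_simps)
qed

lemma (in weighted_domain) commutator_identity:
 assumes dc: "differentiable_coefficients a G" and c2: "c2_compact_support v V Hv K" and KOm: "K <= Om"
 shows "(LI x. (a x \<bullet> Hv x + tau^2 * (p x \<bullet> (a x *v p x)) * v x) * (- 2 * tau * (p x \<bullet> (a x *v V x))))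
   = tau * (LI x. jf (a x) (p x) (H x) (G x) (V x) (tau * v x))"
  and "integrable lborel (%x. (a x \<bullet> Hv x + tau^2 * (p x \<bullet> (a x *v p x)) * v x) * (- 2 * tau * (p x \<bullet> (a x *v V x))))"
  and "integrable lborel (%x. jf (a x) (p x) (H x) (G x) (V x) (tau * v x))"
proof -
 interpret differentiable_coefficients a G by fact
 interpret c2_compact_support v V Hv K by fact
 note ci = on_UNIV[OF cont_a] on_UNIV[OF cont_G] on_UNIV[OF cv]
  on_UNIV[OF cV] on_UNIV[OF cHv] continuous_on_subset[OF cp_on cl] continuous_on_subset[OF cH_on cl]
 define y where "y x = a x *v V x" for x
 define q where "q x = a x *v p x" for x
 define Y where "Y x h = dirG (G x) h *v V x + a x *v (Hv x *v h)" for x h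
 define Q where "Q x h = dirG (G x) h *v p x + a x *v (H x *v h)" for x h
 define W where "W x = (- 2 * tau) *. ((p x \<bullet> y x) *. y x) + tau *. ((V x \<bullet> y x) *. q x) - tau^3 *. (((p x \<bullet> q x) * (v x)^2) *. q x)" for x
 define W' where "W' i x = (- 2 * tau) *. (((H x *v axis i 1) \<bullet> y x + p x \<bullet> Y x (axis i 1)) *. y x + (p x \<bullet> y x) *. Y x (axis i 1))
   + tau *. (((Hv x *v axis i 1) \<bullet> y x + V x \<bullet> Y x (axis i 1)) *. q x + (V x \<bullet> y x) *. Q x (axis i 1))
   - tau^3 *. ((((H x *v axis i 1) \<bullet> q x + p x \<bullet> Q x (axis i 1)) * (v x)^2 + (p x \<bullet> q x) * (2 * v x * (V x \<bullet> axis i 1))) *. q x + ((p x \<bullet> q x) * (v x)^2) *. Q x (axis i 1))" for i x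
 have cW: "continuous_on Om W" unfolding W_def y_def q_def by (intro continuous_intros ci)
 have cW': "continuous_on Om (W' i)" for i unfolding W'_def y_def q_def Y_def Q_def by (intro continuous_intros ci)
 have z: "W x = 0" "W' i x = 0" if "x ~: K" for x i using zero that by (auto simp: W_def W'_def y_def Y_def)
 have der: "((%t. W (x + t *. axis i 1)) has_vector_derivative W' i x) (at 0)" if x: "x \<in> Om" for x i
 proof -
  have 1: "((%t. v (x + t *. axis i 1)) has_vector_derivative V x \<bullet> axis i 1) (at 0)"
   by (rule deriv_along_line[OF dv])
  have 2: "((%t. V (x + t *. axis i 1)) has_vector_derivative Hv x *v axis i 1) (at 0)"
   by (rule deriv_along_line[OF dV])
  have 3: "((%t. p (x + t *. axis i 1)) has_vector_derivative H x *v axis i 1) (at 0)"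
   by (rule deriv_along_line[OF dp[OF x]])
  have 4: "((%t. y (x + t *. axis i 1)) has_vector_derivative Y x (axis i 1)) (at 0)"
   using has_vector_derivative_matrix_vector[OF der_a[of x i] 2] by (simp add: y_def Y_def dirG_axis add.commute)
  have 5: "((%t. q (x + t *. axis i 1)) has_vector_derivative Q x (axis i 1)) (at 0)"
   using has_vector_derivative_matrix_vector[OF der_a[of x i] 3] by (simp add: q_def Q_def dirG_axis add.commute)
  have 6: "((%t. (v (x + t *. axis i 1))^2) has_vector_derivative 2 * v x * (V x \<bullet> axis i 1)) (at 0)"
   using has_vector_derivative_times[OF 1 1] by (simp add: power2_eq_square algebra_simps)
  note d1 = has_vector_derivative_scale[OF has_vector_derivative_inner[OF 3 4] 4]
  note d2 = has_vector_derivative_scale[OF has_vector_derivative_inner[OF 2 4] 5]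
  note d3 = has_vector_derivative_scale[OF has_vector_derivative_times[OF has_vector_derivative_inner[OF 3 5] 6] 5]
  note dd = has_vector_derivative_diff[OF has_vector_derivative_add[OF
    linear_vector_deriv[OF bounded_linear_scaleR_right[of "- 2 * tau"] d1]
    linear_vector_deriv[OF bounded_linear_scaleR_right[of tau] d2]]
    linear_vector_deriv[OF bounded_linear_scaleR_right[of "tau^3"] d3]]
  show ?thesis unfolding W_def
   by (rule has_vector_derivative_eq_rhs[OF dd]) (simp add: W'_def add.commute)
 qed
 note div = integral_divergence_zero[OF open_dom K KOm der cW cW' z]
 have eq: "(\<Sum>i\<in>UNIV. W' i x $ i) = (a x \<bullet> Hv x + tau^2 * (p x \<bullet> q x) * v x) * (- 2 * tau * (p x \<bullet> y x)) - tau * jf (a x) (p x) (H x) (G x) (V x) (tau * v x)" for x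
  unfolding W'_def Y_def Q_def y_def q_def by (rule commutator_pointwise[OF sym_a sym_G sym_Hv])
 have jz: "jf (a x) (p x) (H x) (G x) (V x) (tau * v x) = 0" if "x ~: K" for x
  using zero that by (simp add: jf_def Bf_def)
 show i1: "integrable lborel (%x. (a x \<bullet> Hv x + tau^2 * (p x \<bullet> (a x *v p x)) * v x) * (- 2 * tau * (p x \<bullet> (a x *v V x))))"
  by (rule integrable_compact_support[OF K continuous_extension_by_zero[OF open_dom K KOm]])
   (use zero in "auto intro!: continuous_intros ci")
 show i2: "integrable lborel (%x. jf (a x) (p x) (H x) (G x) (V x) (tau * v x))"
  by (rule integrable_compact_support[OF K continuous_extension_by_zero[OF open_dom K KOm]])
   (use jz in "auto intro!: continuous_intros ci")
 show "(LI x. (a x \<bullet> Hv x + tau^2 * (p x \<bullet> (a x *v p x)) * v x) * (- 2 * tau * (p x \<bullet> (a x *v V x))))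
   = tau * (LI x. jf (a x) (p x) (H x) (G x) (V x) (tau * v x))"
  using div(1) i1 i2 unfolding eq y_def q_def by simp
qed

text \<open>A smooth function of compact support, with its derivatives up to third order as plain functions:
 \<open>T x h\<close> is the directional derivative of the Hessian \<open>N\<close>.\<close>

section \<open>A weighted estimate of second derivatives\<close>

locale c3_compact_support =
 fixes u :: "real^'n => real" and U :: "real^'n => real^'n" and N :: "real^'n => real^'n^'n"
  and T :: "real^'n => real^'n^'n^'n" and K :: "(real^'n) set"
 assumes du: "!!x. (u has_derivative (%h. U x \<bullet> h)) (at x)"
  and dU: "!!x. (U has_derivative (%h. N x *v h)) (at x)"
  and dN: "!!x. (N has_derivative (%h. dirG (T x) h)) (at x)"
  and cT: "continuous_on UNIV T"
  and symT: "!!x s k. (T x $ s) *v axis k 1 = (T x $ k) *v axis s 1"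
  and K: "compact K"
  and zero: "!!x. x ~: K ==> u x = 0" "!!x. x ~: K ==> U x = 0" "!!x. x ~: K ==> N x = 0" "!!x. x ~: K ==> T x = 0"
begin

lemma cu: "continuous_on UNIV u" and cU: "continuous_on UNIV U" and cN: "continuous_on UNIV N"
 using du dU dN by (auto intro!: continuous_at_imp_continuous_on has_derivative_continuous)

end

text \<open>The right hand side is \<open>tr (a N^2)\<close>, the sum over \<open>k\<close> of the form \<open>a\<close> on the
rows of \<open>N\<close>.\<close>

lemma quadratic_matrix_lower_bound:
 fixes a N :: "real^'n^'n"
 assumes sa: "transpose a = a" and sN: "transpose N = N" and ell: "!!xi. c * (xi \<bullet> xi) <= xi \<bullet> (a *v xi)"
 shows "c * (norm N)^2 <= (\<Sum>i\<in>UNIV. (a *v (N *v (N *v axis i 1))) $ i)"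
proof -
 have e: "(a *v (N *v (N *v axis i 1))) $ i = (a *v axis i 1) \<bullet> (N *v (N *v axis i 1))" for i
  using sym_matrix_inner[OF sa, of "axis i 1" "N *v (N *v axis i 1)"] by (simp add: inner_axis')
 have "(\<Sum>i\<in>UNIV. (a *v (N *v (N *v axis i 1))) $ i) = a \<bullet> (N ** N)"
  using symmetric_trace_product[OF sa, of "N ** N"] by (simp add: matrix_vector_mul_assoc)
 also have "... = (\<Sum>i\<in>UNIV. \<Sum>j\<in>UNIV. a $ i $ j * (\<Sum>k\<in>UNIV. N $ i $ k * N $ k $ j))"
  by (simp add: inner_vec_def matrix_matrix_mult_def)
 also have "... = (\<Sum>k\<in>UNIV. (N *v axis k 1) \<bullet> (a *v (N *v axis k 1)))"
 proof -
  have sN': "N $ k $ j = N $ j $ k" for k j using sN by (metis transpose_def vec_lambda_beta)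
  have "(\<Sum>k\<in>UNIV. (N *v axis k 1) \<bullet> (a *v (N *v axis k 1))) = (\<Sum>k\<in>UNIV. \<Sum>i\<in>UNIV. \<Sum>j\<in>UNIV. a $ i $ j * (N $ i $ k * N $ k $ j))"
   unfolding matrix_vector_mult_basis
   by (intro sum.cong refl) (simp add: inner_vec_def matrix_vector_mult_def column_def sum_distrib_left sN' mult.commute mult.left_commute)
  also have "... = (\<Sum>i\<in>UNIV. \<Sum>k\<in>UNIV. \<Sum>j\<in>UNIV. a $ i $ j * (N $ i $ k * N $ k $ j))" by (rule sum.swap)
  also have "... = (\<Sum>i\<in>UNIV. \<Sum>j\<in>UNIV. \<Sum>k\<in>UNIV. a $ i $ j * (N $ i $ k * N $ k $ j))" by (intro sum.cong refl sum.swap)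
  finally show ?thesis by (simp add: sum_distrib_left)
 qed
 also have "... >= (\<Sum>k\<in>UNIV. c * ((N *v axis k 1) \<bullet> (N *v axis k 1)))" by (intro sum_mono ell)
 also have "(\<Sum>k\<in>UNIV. c * ((N *v axis k 1) \<bullet> (N *v axis k 1))) = c * (norm N)^2"
 proof -
  have "(\<Sum>k\<in>UNIV. (N *v axis k 1) \<bullet> (N *v axis k 1)) = (\<Sum>k\<in>UNIV. \<Sum>i\<in>UNIV. N $ i $ k * N $ i $ k)"
   unfolding matrix_vector_mult_basis by (simp add: inner_vec_def column_def)
  also have "... = (\<Sum>i\<in>UNIV. \<Sum>k\<in>UNIV. N $ i $ k * N $ i $ k)" by (rule sum.swap)
  also have "... = N \<bullet> N" by (simp add: inner_vec_def)
  finally show ?thesis by (simp add: sum_distrib_left[symmetric] dot_square_norm)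
 qed
 finally show ?thesis .
qed

lemma norm_dirG_le: "norm (dirG G h) <= real CARD('n) * norm G * norm h" for G :: "real^'n^'n^'n"
proof -
 have "norm (dirG G h) <= (\<Sum>s\<in>UNIV. norm ((h $ s) *. (G $ s)))" unfolding dirG_def by (rule norm_sum)
 also have "... <= (\<Sum>s\<in>(UNIV::'n set). norm h * norm G)"
  by (intro sum_mono) (auto intro!: mult_mono component_le_norm_cart simp: Finite_Cartesian_Product.norm_nth_le)
 finally show ?thesis by (simp add: mult.commute mult.left_commute)
qed

lemma norm_beta_le: "norm (beta G) <= real CARD('n) * norm G" for G :: "real^'n^'n^'n"
proof -
 have "norm (beta G) <= (\<Sum>s\<in>(UNIV::'n set). norm (G $ s *v axis s 1))" unfolding beta_def by (rule norm_sum)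
 also have "... <= (\<Sum>s\<in>(UNIV::'n set). norm G)"
 proof (rule sum_mono)
  fix s :: 'n
  have "norm (G $ s *v axis s 1) <= norm (G $ s) * norm (axis s (1::real) :: real^'n)" by (rule norm_matrix_vector_le)
  then show "norm (G $ s *v axis s 1) <= norm G" using Finite_Cartesian_Product.norm_nth_le[of G s] by (simp add: norm_axis_1)
 qed
 finally show ?thesis by simp
qed

text \<open>The vector field \<open>(a : N) U - a N U\<close> is chosen so that third derivatives cancel in its divergence,
leaving \<open>(a : N) tr N - tr (a N^2)\<close> and terms of lower order.\<close>

lemma (in weighted_domain) hessian_estimate_identity:
 assumes dc: "differentiable_coefficients a G" and c3: "c3_compact_support u U N T K" and KOm: "K <= Om"
 shows "(LI x. exp (2 * tau * phi x) * ((\<Sum>i\<in>UNIV. (a x *v (N x *v (N x *v axis i 1))) $ i)))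
  = (LI x. exp (2 * tau * phi x) * ((a x \<bullet> N x) * (mat 1 \<bullet> N x) + (dirG (G x) (U x)) \<bullet> N x - beta (G x) \<bullet> (N x *v U x)
    + 2 * tau * ((a x \<bullet> N x) * (p x \<bullet> U x) - p x \<bullet> (a x *v (N x *v U x)))))"
proof -
 interpret differentiable_coefficients a G by fact
 interpret c3_compact_support u U N T K by fact
 have c\<phi>: "continuous_on Om phi" using d\<phi> by (auto intro!: continuous_at_imp_continuous_on has_derivative_continuous)
 note ci = on_UNIV[OF cont_a] on_UNIV[OF cont_G] on_UNIV[OF cU]
  on_UNIV[OF cN] on_UNIV[OF cT] continuous_on_subset[OF cp_on cl] c\<phi>
 define rho where "rho x = exp (2 * tau * phi x)" for x
 define F where "F x = (a x \<bullet> N x) *. U x - a x *v (N x *v U x)" for x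
 define F' where "F' i x = (a x \<bullet> N x) *. (N x *v axis i 1) + (a x \<bullet> (T x $ i) + (G x $ i) \<bullet> N x) *. U x
   - (a x *v (N x *v (N x *v axis i 1) + (T x $ i) *v U x) + (G x $ i) *v (N x *v U x))" for i x
 define W where "W x = rho x *. F x" for x
 define W' where "W' i x = rho x *. F' i x + (2 * tau * (p x \<bullet> axis i 1) * rho x) *. F x" for i x
 have cW: "continuous_on Om W" unfolding W_def F_def rho_def by (intro continuous_intros ci)
 have cW': "continuous_on Om (W' i)" for i unfolding W'_def F_def F'_def rho_def by (intro continuous_intros ci)
 have z: "W x = 0" "W' i x = 0" if "x ~: K" for x i using zero that by (auto simp: W_def W'_def F_def F'_def)
 have der: "((%t. W (x + t *. axis i 1)) has_vector_derivative W' i x) (at 0)" if x: "x \<in> Om" for x i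
 proof -
  have 1: "((%t. U (x + t *. axis i 1)) has_vector_derivative N x *v axis i 1) (at 0)"
   by (rule deriv_along_line[OF dU])
  have 2: "((%t. N (x + t *. axis i 1)) has_vector_derivative T x $ i) (at 0)"
   using deriv_along_line[OF dN, of x "axis i 1"] by (simp add: dirG_axis)
  have 3: "((%t. rho (x + t *. axis i 1)) has_vector_derivative 2 * tau * (p x \<bullet> axis i 1) * rho x) (at 0)"
  proof -
   have "((%t. phi (x + t *. axis i 1)) has_real_derivative p x \<bullet> axis i 1) (at 0)"
    using deriv_along_line[OF d\<phi>[OF x]] by (simp add: real_vector_deriv)
   then have "((%t. exp (2 * tau * phi (x + t *. axis i 1))) has_real_derivative exp (2 * tau * phi (x + 0 *. axis i 1)) * (2 * tau * (p x \<bullet> axis i 1))) (at 0)"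
    by (auto intro!: derivative_eq_intros)
   then show ?thesis by (simp add: rho_def real_vector_deriv mult.commute)
  qed
  note d1 = has_vector_derivative_scale[OF has_vector_derivative_inner[OF der_a[of x i] 2] 1]
  note d2 = has_vector_derivative_matrix_vector[OF der_a[of x i] has_vector_derivative_matrix_vector[OF 2 1]]
  show ?thesis unfolding W_def F_def
   by (rule has_vector_derivative_eq_rhs[OF has_vector_derivative_scale[OF 3 has_vector_derivative_diff[OF d1 d2]]])
    (simp add: W'_def F_def F'_def)
 qed
 note div = integral_divergence_zero[OF open_dom K KOm der cW cW' z]
 have eq: "(\<Sum>i\<in>UNIV. W' i x $ i) = rho x * ((a x \<bullet> N x) * (mat 1 \<bullet> N x) + (dirG (G x) (U x)) \<bullet> N x - beta (G x) \<bullet> (N x *v U x)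
    + 2 * tau * ((a x \<bullet> N x) * (p x \<bullet> U x) - p x \<bullet> (a x *v (N x *v U x)))) - rho x * (\<Sum>i\<in>UNIV. (a x *v (N x *v (N x *v axis i 1))) $ i)" for x
 proof -
  have lin1: "(\<Sum>i\<in>UNIV. (G x $ i \<bullet> N x) * U x $ i) = dirG (G x) (U x) \<bullet> N x"
   by (simp add: dirG_def inner_sum_left mult.commute)
  have lin2: "(\<Sum>i\<in>UNIV. (a x \<bullet> T x $ i) * U x $ i) = a x \<bullet> dirG (T x) (U x)"
   by (simp add: dirG_def inner_sum_right mult.commute)
  have tr: "(\<Sum>i\<in>UNIV. (N x *v axis i 1) $ i) = mat 1 \<bullet> N x"
   using symmetric_trace_product[of "mat 1" "N x"] by (simp add: transpose_mat)
  have third: "(\<Sum>i\<in>UNIV. (a x *v ((T x $ i) *v U x)) $ i) = a x \<bullet> dirG (T x) (U x)"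
  proof -
   have TU: "(T x $ i) *v U x = dirG (T x) (U x) *v axis i 1" for i
   proof -
    have "U x = (\<Sum>s\<in>UNIV. U x $ s *. axis s 1)"
     by (simp add: vec_eq_iff axis_def if_distrib[where f = "%c. _ * c"] cong: if_cong)
    then have "(T x $ i) *v U x = (T x $ i) *v (\<Sum>s\<in>UNIV. U x $ s *. axis s 1)" by (rule arg_cong)
    also have "... = (\<Sum>s\<in>UNIV. U x $ s *. ((T x $ i) *v axis s 1))"
     by (simp add: linear_sum[OF mv_linear] linear_cmul[OF mv_linear])
    also have "... = (\<Sum>s\<in>UNIV. U x $ s *. ((T x $ s) *v axis i 1))" by (simp add: symT[of x i])
    also have "... = dirG (T x) (U x) *v axis i 1"
     unfolding dirG_def by (simp add: bounded_bilinear.sum_left[OF bounded_bilinear_matrix_vector] scaleR_matrix_vector_assoc)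
    finally show ?thesis .
   qed
   show ?thesis unfolding TU by (rule symmetric_trace_product[OF sym_a])
  qed
  have pF: "(\<Sum>i\<in>UNIV. (p x \<bullet> axis i 1) * F x $ i) = (a x \<bullet> N x) * (p x \<bullet> U x) - p x \<bullet> (a x *v (N x *v U x))"
  proof -
   have "(\<Sum>i\<in>UNIV. (p x \<bullet> axis i 1) * F x $ i) = p x \<bullet> F x" by (simp add: inner_axis inner_vec_def[of "p x" "F x"])
   then show ?thesis by (simp add: F_def inner_diff_right)
  qed
  have "(\<Sum>i\<in>UNIV. W' i x $ i) = rho x * ((a x \<bullet> N x) * (\<Sum>i\<in>UNIV. (N x *v axis i 1) $ i) + ((\<Sum>i\<in>UNIV. (a x \<bullet> T x $ i) * U x $ i) + (\<Sum>i\<in>UNIV. (G x $ i \<bullet> N x) * U x $ i))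
    - ((\<Sum>i\<in>UNIV. (a x *v (N x *v (N x *v axis i 1))) $ i) + (\<Sum>i\<in>UNIV. (a x *v ((T x $ i) *v U x)) $ i) + (\<Sum>i\<in>UNIV. (G x $ i *v (N x *v U x)) $ i)))
    + 2 * tau * rho x * (\<Sum>i\<in>UNIV. (p x \<bullet> axis i 1) * F x $ i)"
   unfolding W'_def F'_def sum_distrib_left sum.distrib[symmetric] sum_subtractf[symmetric]
   by (rule sum.cong[OF refl]) (simp add: matrix_vector_right_distrib algebra_simps)
  then show ?thesis unfolding lin1 lin2 tr third pF beta_inner[OF sym_G] by (simp add: algebra_simps)
 qed
 have i1: "integrable lborel (%x. rho x * ((a x \<bullet> N x) * (mat 1 \<bullet> N x) + (dirG (G x) (U x)) \<bullet> N x - beta (G x) \<bullet> (N x *v U x)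
    + 2 * tau * ((a x \<bullet> N x) * (p x \<bullet> U x) - p x \<bullet> (a x *v (N x *v U x)))))"
  unfolding rho_def by (rule integrable_compact_support[OF K continuous_extension_by_zero[OF open_dom K KOm]])
   (use zero in "auto intro!: continuous_intros ci")
 have i2: "integrable lborel (%x. rho x * (\<Sum>i\<in>UNIV. (a x *v (N x *v (N x *v axis i 1))) $ i))"
  unfolding rho_def by (rule integrable_compact_support[OF K continuous_extension_by_zero[OF open_dom K KOm]])
   (use zero in "auto intro!: continuous_intros ci")
 show ?thesis using div(1) i1 i2 unfolding eq by (simp add: rho_def)
qed

lemma bounded_linear_transpose: "bounded_linear (transpose :: real^'n^'m => real^'m^'n)"
 by (intro linear_conv_bounded_linear[THEN iffD1] linearI) (simp_all add: transpose_def vec_eq_iff)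

lemma moll_bump_mono_const:
 fixes b :: "'a::euclidean_space => real"
 assumes b: "b \<in> borel_fun" "!!x. norm (b x) <= B" and c: "!!x. c <= b x"
 shows "c <= moll bump eps b x"
proof -
 have "(LI z::'a. bump z * c) <= moll bump eps b x"
  unfolding moll_def real_scaleR_def
  by (intro integral_mono integrable_mult_left integrable_kernel[OF kernel_bump] moll_integrable[OF kernel_bump b, unfolded real_scaleR_def] mult_left_mono c bump_nonneg)
 then show ?thesis using integral_bump[where 'a='a] by simp
qed

lemma moll_bump_norm_le:
 fixes b :: "'a::euclidean_space => 'b::euclidean_space"
 assumes "b \<in> borel_fun" "!!x. norm (b x) <= B"
 shows "norm (moll bump eps b x) <= B"
 using moll_bound[OF kernel_bump assms, of eps x] integral_bump[where 'a='a] by (simp add: bump_nonneg)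

text \<open>A linear inequality that holds almost everywhere in a ball passes to the averages.\<close>

lemma moll_ae_lower_bound:
 fixes b :: "'a::euclidean_space => 'b::euclidean_space" and f :: "'b => real" and q :: "'a => real"
 assumes b: "b \<in> borel_fun" "!!x. norm (b x) <= B"
  and q: "q \<in> borel_fun" "!!x. norm (q x) <= Q" and f: "bounded_linear f" and eps: "eps > 0"
  and ae: "AE y in lborel. norm (x - y) < eps --> q y <= f (b y) + k"
 shows "moll bump eps q x <= f (moll bump eps b x) + k"
proof -
 have i1: "integrable lborel (%z. bump z *. f (b (x - eps *. z)))"
  using integrable_bounded_linear[OF f moll_integrable[OF kernel_bump b, of x eps]] by (simp add: linear_simps[OF f])
 have ae': "AE z in lborel. norm (x - (x + (- eps) *. z)) < eps --> q (x + (- eps) *. z) <= f (b (x + (- eps) *. z)) + k"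
  by (rule AE_lborel_affine[OF ae]) (use eps in simp)
 have "moll bump eps q x <= (LI z. bump z *. f (b (x - eps *. z)) + bump z * k)"
  unfolding moll_def
 proof (rule integral_mono_AE)
  show "integrable lborel (%z. bump z *. q (x - eps *. z))" by (rule moll_integrable[OF kernel_bump q])
  show "integrable lborel (%z. bump z *. f (b (x - eps *. z)) + bump z * k)"
   by (intro Bochner_Integration.integrable_add i1 integrable_mult_left integrable_kernel[OF kernel_bump])
  show "AE z in lborel. bump z *. q (x - eps *. z) <= bump z *. f (b (x - eps *. z)) + bump z * k"
   using ae'
  proof eventually_elim
   case (elim z)
   show ?case
   proof (cases "norm z < 1")
    case True
    then have "norm (x - (x + (- eps) *. z)) < eps" using eps by simp
    with elim have "q (x - eps *. z) <= f (b (x - eps *. z)) + k" by simp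
    from mult_left_mono[OF this bump_nonneg[of z]] show ?thesis by (simp add: distrib_left)
   next
    case False
    then have "bump z = 0" using kernel_bump[where 'a='a] unfolding kernel_def by auto
    then show ?thesis by simp
   qed
  qed
 qed
 also have "... = f (moll bump eps b x) + k"
  using moll_linear[OF f kernel_bump b, of eps x] i1 integral_bump[where 'a='a] integrable_kernel[OF kernel_bump[where 'a='a]]
  by (simp add: moll_def)
 finally show ?thesis .
qed

section \<open>Averaged coefficients\<close>

text \<open>Pseudoconvexity is required on the vectors \<open>xi\<close> for which \<open>xi + i p\<close> is a zero of the
symbol; \<open>G\<close> is a Borel representative of the derivatives of \<open>A\<close>.\<close>

locale carleman_setting = weighted_domain A g cA CA L Om phi p H Cp cp
 for A g :: "real^'n => real^'n^'n" and cA CA L :: real and Om :: "(real^'n) set" and phi :: "real^'n => real"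
  and p :: "real^'n => real^'n" and H :: "real^'n => real^'n^'n" and Cp cp :: real +
 fixes G :: "real^'n => real^'n^'n^'n" and CG c2 :: real
 assumes G_borel[measurable]: "G \<in> borel_fun" and normG: "!!x. norm (G x) <= CG"
  and symG: "!!x s. transpose (G x $ s) = G x $ s"
  and der_A: "AE x in lborel. \<forall>s. ((%t. A (x + t *. axis s 1)) has_vector_derivative G x $ s) (at 0)"
  and c2: "c2 > 0"
  and pseudoconvex: "AE x in lborel. x \<in> Om --> (\<forall>xi. p x \<bullet> (A x *v xi) = 0 & xi \<bullet> (A x *v xi) = p x \<bullet> (A x *v p x)
    --> c2 <= Bf (A x) (p x) (H x) (G x) xi + Bf (A x) (p x) (H x) (G x) (p x))"
begin

lemma A_borel[measurable]: "A \<in> borel_fun" by (rule borel_cont[OF cA_on])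

definition Am :: "real => real^'n => real^'n^'n" where "Am eps = moll bump eps A"
definition Gm :: "real => real^'n => real^'n^'n^'n" where "Gm eps = moll bump eps G"

lemma mollified_coefficients:
 assumes eps: "eps > 0"
 shows "differentiable_coefficients (Am eps) (Gm eps)"
proof
 show "transpose (Am eps x) = Am eps x" for x
  unfolding Am_def by (subst moll_linear[OF bounded_linear_transpose kernel_bump A_borel normA]) (simp add: symA)
 show "transpose (Gm eps x $ s) = Gm eps x $ s" for x s
  unfolding Gm_def
  by (subst moll_linear[OF bounded_linear_compose[OF bounded_linear_transpose bounded_linear_vec_nth] kernel_bump G_borel normG])
   (simp add: symG moll_linear[OF bounded_linear_vec_nth kernel_bump G_borel normG])
 show "continuous_on UNIV (Am eps)" unfolding Am_def by (rule moll_continuous[OF kernel_bump A_borel normA eps])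
 show "continuous_on UNIV (Gm eps)" unfolding Gm_def by (rule moll_continuous[OF kernel_bump G_borel normG eps])
 show "((%t. Am eps (x + t *. axis s 1)) has_vector_derivative Gm eps x $ s) (at 0)" for x s
 proof -
  have m: "(%x. G x $ s) \<in> borel_fun"
   by (rule borel_measurable_continuous_on[OF _ G_borel]) (intro continuous_intros)
  have "((%t. moll bump eps A (x + t *. axis s 1)) has_vector_derivative moll bump eps (%x. G x $ s) x) (at 0)"
   by (rule moll_lipschitz_derivative[OF lipA A_borel normA m _ eps]) (use der_A in "auto simp: norm_axis_1")
  then show ?thesis unfolding Am_def Gm_def by (simp add: moll_linear[OF bounded_linear_vec_nth kernel_bump G_borel normG])
 qed
qed

lemma norm_Am: "norm (Am eps x) <= CA" unfolding Am_def by (rule moll_bump_norm_le[OF A_borel normA])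
lemma norm_Gm: "norm (Gm eps x) <= CG" unfolding Gm_def by (rule moll_bump_norm_le[OF G_borel normG])
lemma Am_close: "eps > 0 ==> norm (Am eps x - A x) <= L * eps"
 unfolding Am_def by (rule moll_lipschitz_dist[OF lipA A_borel normA])

lemma CA_nonneg: "CA >= 0" using order_trans[OF norm_ge_zero normA] .
lemma CG_nonneg: "CG >= 0" using order_trans[OF norm_ge_zero normG] .

lemma Am_elliptic: "cA * (xi \<bullet> xi) <= xi \<bullet> (Am eps x *v xi)"
proof -
 have bl: "bounded_linear (%a. xi \<bullet> (a *v xi))"
  by (rule bounded_linear_compose[OF bounded_linear_inner_right bounded_bilinear.bounded_linear_left[OF bounded_bilinear_matrix_vector]])
 have m: "(%y. xi \<bullet> (A y *v xi)) \<in> borel_fun"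
  by (intro borel_cont continuous_intros cA_on)
 have b: "norm (xi \<bullet> (A y *v xi)) <= norm xi * (CA * norm xi)" for y
  using order_trans[OF cauchy_schwarz mult_left_mono[OF order_trans[OF norm_matrix_vector_le mult_right_mono[OF normA]]]] by auto
 show ?thesis unfolding Am_def moll_linear[OF bl kernel_bump A_borel normA]
  by (rule moll_bump_mono_const[OF m b ellA])
qed

end

section \<open>Positivity of the quadratic form\<close>

text \<open>The form \<open>jf\<close> with the two terms that enlarge the cone on which it is positive.\<close>

definition Jw :: "real => real^'n^'n => real^'n => real^'n^'n => real^'n^'n^'n => real => real^'n => real => real"
 where "Jw Lm a p H G w V r = jf a p H G V r + w * (V \<bullet> (a *v V) - (p \<bullet> (a *v p)) * r^2) + Lm * (p \<bullet> (a *v V))^2"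

lemma dirG_add: "dirG (G + G') h = dirG G h + dirG G' h"
 and dirG_scaleR: "dirG (c *. G) h = c *. dirG G h"
 and beta_add: "beta (G + G') = beta G + beta G'"
 and beta_scaleR: "beta (c *. G) = c *. beta G"
 and dirG_scaleR_right: "dirG G (c *. h) = c *. dirG G h"
 by (simp_all add: dirG_def beta_def scaleR_add_right sum.distrib scaleR_sum_right matrix_vector_mult_add_rdistrib scaleR_matrix_vector_assoc mult.commute)

lemma matrix_scaleR_right: "(B::real^'n^'m) *v (c *. x) = c *. (B *v x)"
 by (rule linear_cmul[OF mv_linear])

lemma Bf_scale: "Bf a p H G (t *. xi) = t^2 * Bf a p H G xi"
 unfolding Bf_def by (simp add: matrix_scaleR_right dirG_scaleR_right scaleR_matrix_vector_assoc[symmetric] power2_eq_square algebra_simps)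

lemma Jw_scale: "Jw Lm a p H G w (t *. V) (t * r) = t^2 * Jw Lm a p H G w V r"
 unfolding Jw_def jf_def Bf_scale by (simp add: matrix_scaleR_right power2_eq_square algebra_simps)

lemma Jw_lower_by_scaling:
 assumes u: "!!V r. (norm V)^2 + r^2 = 1 ==> c <= Jw Lm a p H G w V r"
 shows "c * ((norm V)^2 + r^2) <= Jw Lm a p H G w V r"
proof (cases "(norm V)^2 + r^2 = 0")
 case True
 then have "V = 0" "r = 0" by (auto simp: add_nonneg_eq_0_iff)
 then show ?thesis by (simp add: Jw_def jf_def Bf_def)
next
 case False
 define t where "t = sqrt ((norm V)^2 + r^2)"
 have t: "t > 0" "t^2 = (norm V)^2 + r^2" using False by (auto simp: t_def intro: order.not_eq_order_implies_strict)
 have "(norm ((1/t) *. V))^2 + ((1/t) * r)^2 = ((norm V)^2 + r^2) / t^2"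
  by (simp add: power_mult_distrib power_divide add_divide_distrib)
 also have "... = 1" using t False by simp
 finally have "c <= Jw Lm a p H G w ((1/t) *. V) ((1/t) * r)" by (rule u)
 then have "c <= (1/t)^2 * Jw Lm a p H G w V r" by (simp only: Jw_scale)
 then have "t^2 * c <= t^2 * ((1/t)^2 * Jw Lm a p H G w V r)" by (intro mult_left_mono) auto
 also have "... = Jw Lm a p H G w V r" using t(1) by (simp add: power_divide)
 finally show ?thesis by (simp add: t(2) mult.commute)
qed

lemma Jw_tuple_continuous:
 "continuous_on UNIV (%X :: (real^'n^'n) \<times> (real^'n) \<times> (real^'n^'n) \<times> (real^'n^'n^'n) \<times> real \<times> (real^'n) \<times> real.
   Jw Lm (fst X) (fst (snd X)) (fst (snd (snd X))) (fst (snd (snd (snd X)))) (fst (snd (snd (snd (snd X))))) (fst (snd (snd (snd (snd (snd X)))))) (snd (snd (snd (snd (snd (snd X)))))))"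
 unfolding Jw_def by (intro continuous_intros)

lemma norm_7tuple_le: "norm (a,p,H,G,w,V,r) <= norm a + norm p + norm H + norm G + norm w + norm V + norm r"
 using norm_Pair_le[of a "(p,H,G,w,V,r)"] norm_Pair_le[of p "(H,G,w,V,r)"] norm_Pair_le[of H "(G,w,V,r)"]
  norm_Pair_le[of G "(w,V,r)"] norm_Pair_le[of w "(V,r)"] norm_Pair_le[of V r] by linarith

lemma Jw_bounded:
 obtains C where "C >= 0" "!!a p H G w V r. [|norm (a::real^'n^'n) <= R; norm p <= R; norm H <= R; norm G <= R; norm w <= R; norm V <= R; norm r <= R|]
  ==> \<bar>Jw Lm a p H G w V r\<bar> <= C"
proof -
 let ?F = "%X :: (real^'n^'n) \<times> (real^'n) \<times> (real^'n^'n) \<times> (real^'n^'n^'n) \<times> real \<times> (real^'n) \<times> real.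
   Jw Lm (fst X) (fst (snd X)) (fst (snd (snd X))) (fst (snd (snd (snd X)))) (fst (snd (snd (snd (snd X))))) (fst (snd (snd (snd (snd (snd X)))))) (snd (snd (snd (snd (snd (snd X))))))"
 have "compact (?F ` cball 0 (7 * R))"
  by (intro compact_continuous_image compact_cball continuous_on_subset[OF Jw_tuple_continuous]) simp
 then obtain C where C: "!!X. X \<in> cball 0 (7 * R) ==> \<bar>?F X\<bar> <= C" by (meson bounded_real compact_imp_bounded imageI)
 show thesis
 proof (rule that[of "max C 0"])
  fix a H :: "real^'n^'n" and p V :: "real^'n" and G :: "real^'n^'n^'n" and w r :: real
  assume b: "norm a <= R" "norm p <= R" "norm H <= R" "norm G <= R" "norm (w::real) <= R" "norm V <= R" "norm (r::real) <= R"
  then have "(a,p,H,G,w,V,r) \<in> cball 0 (7 * R)" using norm_7tuple_le[of a p H G w V r] by simp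
  from C[OF this] show "\<bar>Jw Lm a p H G w V r\<bar> <= max C 0" by simp
 qed simp
qed

text \<open>Continuity on a compact set of data; the derivatives \<open>G\<close> and the weight \<open>w\<close> are not
perturbed, since they have no continuity in the point.\<close>

lemma Jw_uniform:
 assumes e: "e > 0"
 obtains rho where "rho > 0" "!!a p H G w V r a' p' H' V'. [|norm (a::real^'n^'n) <= R; norm p <= R; norm H <= R; norm G <= R; norm w <= R; norm V <= R; norm r <= R;
   norm a' <= R; norm p' <= R; norm H' <= R; norm V' <= R; norm (a - a') < rho; norm (p - p') < rho; norm (H - H') < rho; norm (V - V') < rho|]
  ==> \<bar>Jw Lm a p H G w V r - Jw Lm a' p' H' G w V' r\<bar> < e"
proof -
 let ?F = "%X :: (real^'n^'n) \<times> (real^'n) \<times> (real^'n^'n) \<times> (real^'n^'n^'n) \<times> real \<times> (real^'n) \<times> real.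
   Jw Lm (fst X) (fst (snd X)) (fst (snd (snd X))) (fst (snd (snd (snd X)))) (fst (snd (snd (snd (snd X))))) (fst (snd (snd (snd (snd (snd X)))))) (snd (snd (snd (snd (snd (snd X))))))"
 have "uniformly_continuous_on (cball 0 (7 * R)) ?F"
  by (intro compact_uniformly_continuous compact_cball continuous_on_subset[OF Jw_tuple_continuous]) simp
 then obtain d where d: "d > 0" "!!X Y. [|X \<in> cball 0 (7 * R); Y \<in> cball 0 (7 * R); dist Y X < d|] ==> dist (?F Y) (?F X) < e"
  using e unfolding uniformly_continuous_on_def by meson
 show thesis
 proof (rule that[of "d / 4"])
  fix a a' H H' :: "real^'n^'n" and p p' V V' :: "real^'n" and G :: "real^'n^'n^'n" and w r :: real
  assume b: "norm a <= R" "norm p <= R" "norm H <= R" "norm G <= R" "norm (w::real) <= R" "norm V <= R" "norm (r::real) <= R"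
   "norm a' <= R" "norm p' <= R" "norm H' <= R" "norm V' <= R"
   and n: "norm (a - a') < d/4" "norm (p - p') < d/4" "norm (H - H') < d/4" "norm (V - V') < d/4"
  have in1: "(a,p,H,G,w,V,r) \<in> cball 0 (7 * R)" "(a',p',H',G,w,V',r) \<in> cball 0 (7 * R)"
   using norm_7tuple_le[of a p H G w V r] norm_7tuple_le[of a' p' H' G w V' r] b by auto
  have "dist (a,p,H,G,w,V,r) (a',p',H',G,w,V',r) = norm (a - a', p - p', H - H', 0 :: real^'n^'n^'n, 0::real, V - V', 0::real)"
   by (simp add: dist_norm)
  also have "... <= norm (a - a') + norm (p - p') + norm (H - H') + norm (0::real^'n^'n^'n) + norm (0::real) + norm (V - V') + norm (0::real)"
   by (rule norm_7tuple_le)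
  also have "... < d" using n by simp
  finally show "\<bar>Jw Lm a p H G w V r - Jw Lm a' p' H' G w V' r\<bar> < e"
   using d(2)[OF in1(2,1)] by (simp add: dist_real_def)
 qed (use d in simp)
qed

lemma weight_bounded:
 obtains C where "C >= 0" "!!a p H G. [|norm (a::real^'n^'n) <= R; norm p <= R; norm H <= R; norm G <= R|]
  ==> \<bar>Df a p H G\<bar> <= C & \<bar>Bf a p H G p\<bar> <= C"
proof -
 have c: "continuous_on UNIV (%X :: (real^'n^'n) \<times> (real^'n) \<times> (real^'n^'n) \<times> (real^'n^'n^'n).
   Df (fst X) (fst (snd X)) (fst (snd (snd X))) (snd (snd (snd X))))"
  "continuous_on UNIV (%X :: (real^'n^'n) \<times> (real^'n) \<times> (real^'n^'n) \<times> (real^'n^'n^'n).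
   Bf (fst X) (fst (snd X)) (fst (snd (snd X))) (snd (snd (snd X))) (fst (snd X)))"
  unfolding Df_def Bf_def by (intro continuous_intros)+
 obtain C1 where C1: "!!X. X \<in> cball 0 (4 * R) ==> \<bar>Df (fst X) (fst (snd X)) (fst (snd (snd X))) (snd (snd (snd X)) :: real^'n^'n^'n)\<bar> <= C1"
  using compact_continuous_image[OF continuous_on_subset[OF c(1) subset_UNIV] compact_cball[of 0 "4 * R"]]
  by (meson bounded_real compact_imp_bounded imageI)
 obtain C2 where C2: "!!X. X \<in> cball 0 (4 * R) ==> \<bar>Bf (fst X) (fst (snd X)) (fst (snd (snd X))) (snd (snd (snd X)) :: real^'n^'n^'n) (fst (snd X))\<bar> <= C2"
  using compact_continuous_image[OF continuous_on_subset[OF c(2) subset_UNIV] compact_cball[of 0 "4 * R"]]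
  by (meson bounded_real compact_imp_bounded imageI)
 show thesis
 proof (rule that[of "\<bar>C1\<bar> + \<bar>C2\<bar>"])
  fix a H :: "real^'n^'n" and p :: "real^'n" and G :: "real^'n^'n^'n"
  assume b: "norm a <= R" "norm p <= R" "norm H <= R" "norm G <= R"
  have "(a,p,H,G) \<in> cball 0 (4 * R)"
   using norm_Pair_le[of a "(p,H,G)"] norm_Pair_le[of p "(H,G)"] norm_Pair_le[of H G] b by simp
  from C1[OF this] C2[OF this] have "\<bar>Df a p H G\<bar> <= C1" "\<bar>Bf a p H G p\<bar> <= C2" by simp_all
  then show "\<bar>Df a p H G\<bar> <= \<bar>C1\<bar> + \<bar>C2\<bar> & \<bar>Bf a p H G p\<bar> <= \<bar>C1\<bar> + \<bar>C2\<bar>" by linarith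
 qed simp
qed

lemma inner_matrix_le: "\<bar>x \<bullet> ((a::real^'n^'n) *v y)\<bar> <= norm a * norm x * norm y"
 using order_trans[OF cauchy_schwarz[of x "a *v y"] mult_left_mono[OF norm_matrix_vector_le[of a y] norm_ge_zero[of x]]]
 by (simp add: mult.commute mult.left_commute)

text \<open>The choice of \<open>w\<close> cancels the divergence terms of \<open>jf\<close> and replaces the coefficient of
\<open>r^2\<close> by \<open>c1 (p . a p)\<close>. On vectors \<open>X\<close> with \<open>p . a X = 0\<close> there
remains \<open>Bf X\<close> plus a multiple of \<open>X . a X\<close>, which is the pseudoconvexity condition for
\<open>X\<close> scaled to the characteristic length.\<close>

lemma tangential_lower_bound:
 fixes a H :: "real^'n^'n" and p :: "real^'n"
 defines "kap \<equiv> p \<bullet> (a *v p)"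
 assumes cA: "cA > 0" and ell: "!!xi. cA * (xi \<bullet> xi) <= xi \<bullet> (a *v xi)"
  and kap: "0 < kap" "kap <= K" and c1: "c1 = c2 / (2 * K)" and c2: "c2 > 0"
  and pc: "!!xi. p \<bullet> (a *v xi) = 0 ==> xi \<bullet> (a *v xi) = kap ==> c2 <= Bf a p H G xi + Bf a p H G p"
  and X: "p \<bullet> (a *v X) = 0"
 shows "c1 * (X \<bullet> (a *v X)) + c1 * kap * r^2 <= Jw 0 a p H G (Df a p H G + Bf a p H G p / kap - c1) X r"
proof -
 define q where "q = X \<bullet> (a *v X)"
 have "2 * c1 * q <= Bf a p H G X + Bf a p H G p / kap * q"
 proof (cases "X = 0")
  case True then show ?thesis by (simp add: q_def Bf_def)
 next
  case False
  have q: "q > 0" using ell[of X] cA False unfolding q_def by (meson inner_gt_zero_iff less_le_trans mult_pos_pos)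
  (* For this t the vector t X + i p is a zero of the symbol. *)
  define t where "t = sqrt (kap / q)"
  have t: "t^2 = kap / q" using q kap by (simp add: t_def)
  have "c2 <= Bf a p H G (t *. X) + Bf a p H G p"
  proof (rule pc)
   show "p \<bullet> (a *v (t *. X)) = 0" using X by (simp add: matrix_scaleR_right)
   have "(t *. X) \<bullet> (a *v (t *. X)) = t^2 * q" by (simp add: matrix_scaleR_right q_def power2_eq_square)
   then show "(t *. X) \<bullet> (a *v (t *. X)) = kap" using t q by simp
  qed
  then have "c2 <= kap / q * Bf a p H G X + Bf a p H G p" by (simp add: Bf_scale t)
  then have "q / kap * c2 <= q / kap * (kap / q * Bf a p H G X + Bf a p H G p)" using q kap by (intro mult_left_mono) auto
  also have "... = Bf a p H G X + Bf a p H G p / kap * q" using q kap by (simp add: distrib_left)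
  finally have 1: "q / kap * c2 <= Bf a p H G X + Bf a p H G p / kap * q" .
  have "2 * c1 * q = q / K * c2" using kap by (simp add: c1)
  also have "... <= q / kap * c2" using q kap c2 by (intro mult_right_mono divide_left_mono) auto
  finally show ?thesis using 1 by linarith
 qed
 moreover have "Jw 0 a p H G (Df a p H G + Bf a p H G p / kap - c1) X r = Bf a p H G X + Bf a p H G p / kap * q - c1 * q + c1 * kap * r^2"
  unfolding Jw_def jf_def X q_def[symmetric] kap_def[symmetric] using kap by (simp add: field_simps)
 ultimately show ?thesis unfolding q_def[symmetric] by linarith
qed

text \<open>Decompose \<open>V = X + s p\<close> with \<open>p . a X = 0\<close>. If \<open>s\<close> is small, the form at
\<open>V\<close> is close to the form at \<open>X\<close>; otherwise \<open>(p . a V)^2\<close> is bounded below and a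
large \<open>Lm\<close> wins. The constants depend on bounds for the data only.\<close>

lemma pseudoconvex_lower_bound:
 assumes cA: "cA > 0" and cp: "cp > 0" and c2: "c2 > 0" and R: "R >= 0"
 obtains c c1 Lm Cw where "c > 0" "Lm >= 0" "Cw >= 0"
  "!!a p H G V r. [|transpose (a::real^'n^'n) = a; !!xi. cA * (xi \<bullet> xi) <= xi \<bullet> (a *v xi); norm a <= R; norm p <= R; norm H <= R; norm G <= R; cp <= norm p;
    !!xi. p \<bullet> (a *v xi) = 0 ==> xi \<bullet> (a *v xi) = p \<bullet> (a *v p) ==> c2 <= Bf a p H G xi + Bf a p H G p|]
   ==> c * ((norm V)^2 + r^2) <= Jw Lm a p H G (Df a p H G + Bf a p H G p / (p \<bullet> (a *v p)) - c1) V r"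
  "!!a p H G. [|!!xi. cA * (xi \<bullet> xi) <= xi \<bullet> (a *v xi); norm (a::real^'n^'n) <= R; norm p <= R; norm H <= R; norm G <= R; cp <= norm p|]
   ==> \<bar>Df a p H G + Bf a p H G p / (p \<bullet> (a *v p)) - c1\<bar> <= Cw"
proof -
 define K where "K = R * R * R + 1"
 have K: "K > 0" using R by (auto simp: K_def intro!: add_nonneg_pos)
 define c1 where "c1 = c2 / (2 * K)"
 have c1: "c1 > 0" using K c2 by (simp add: c1_def)
 define km where "km = cA * cp^2"
 have km: "km > 0" using cA cp by (simp add: km_def)
 define c3 where "c3 = c1 * min cA km"
 have c3: "c3 > 0" using c1 cA km by (simp add: c3_def)
 obtain C0 where C0: "C0 >= 0" "!!a p H G. [|norm (a::real^'n^'n) <= R; norm p <= R; norm H <= R; norm G <= R|]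
  ==> \<bar>Df a p H G\<bar> <= C0 & \<bar>Bf a p H G p\<bar> <= C0" using weight_bounded[of R] by blast
 define Cw where "Cw = C0 + C0 / km + c1"
 have Cw: "Cw >= 0" using C0 km c1 by (simp add: Cw_def)
 define s0 where "s0 = R * R / km"
 have s0: "s0 >= 0" using R km by (simp add: s0_def)
 define R2 where "R2 = R + Cw + (1 + s0 * R)"
 have R2: "R <= R2" "Cw <= R2" "1 + s0 * R <= R2" "1 <= R2" using R Cw s0 by (auto simp: R2_def intro!: add_nonneg_nonneg)
 obtain rho' where rho': "rho' > 0" "!!a p H G w V r a' p' H' V'. [|norm (a::real^'n^'n) <= R2; norm p <= R2; norm H <= R2; norm G <= R2; norm w <= R2; norm V <= R2; norm r <= R2;
   norm a' <= R2; norm p' <= R2; norm H' <= R2; norm V' <= R2; norm (a - a') < rho'; norm (p - p') < rho'; norm (H - H') < rho'; norm (V - V') < rho'|]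
  ==> \<bar>Jw 0 a p H G w V r - Jw 0 a' p' H' G w V' r\<bar> < c3 / 4"
  by (rule Jw_uniform[of "c3/4" R2 0]) (use c3 in simp, blast)
 define rho where "rho = min rho' (1/4)"
 have rho: "rho > 0" "rho <= rho'" "rho <= 1/4" using rho' by (auto simp: rho_def)
 obtain CJ where CJ: "CJ >= 0" "!!a p H G w V r. [|norm (a::real^'n^'n) <= R2; norm p <= R2; norm H <= R2; norm G <= R2; norm w <= R2; norm V <= R2; norm r <= R2|]
  ==> \<bar>Jw 0 a p H G w V r\<bar> <= CJ" by (rule Jw_bounded[of R2 0]) blast
 define Lm where "Lm = (c3/4 + CJ) / (rho * cA * cp)^2"
 have Lm: "Lm >= 0" using c3 CJ by (simp add: Lm_def)
 have kap: "km <= p \<bullet> (a *v p)" if "!!xi. cA * (xi \<bullet> xi) <= xi \<bullet> (a *v xi)" "cp <= norm p" for a :: "real^'n^'n" and p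
 proof -
  have "km <= cA * (norm p)^2" unfolding km_def using that cA cp by (intro mult_left_mono power_mono) auto
  then show ?thesis using that(1)[of p] by (simp add: dot_square_norm)
 qed
 have wb: "\<bar>Df a p H G + Bf a p H G p / (p \<bullet> (a *v p)) - c1\<bar> <= Cw"
  if e: "!!xi. cA * (xi \<bullet> xi) <= xi \<bullet> (a *v xi)" and b: "norm a <= R" "norm p <= R" "norm H <= R" "norm G <= R" "cp <= norm p"
  for a H :: "real^'n^'n" and p G
 proof -
  have k: "km <= p \<bullet> (a *v p)" by (rule kap[OF e b(5)])
  have "\<bar>Bf a p H G p / (p \<bullet> (a *v p))\<bar> = \<bar>Bf a p H G p\<bar> / (p \<bullet> (a *v p))" using k km by simp
  also have "... <= C0 / km" using C0(2)[OF b(1-4)] k km C0(1) by (intro frac_le) auto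
  finally show ?thesis using C0(2)[OF b(1-4)] c1 unfolding Cw_def by linarith
 qed
 show thesis
 proof (rule that[of "c3/4" Lm Cw c1])
  fix a H :: "real^'n^'n" and p :: "real^'n" and G V and r :: real
  assume sa: "transpose a = a" and e: "!!xi. cA * (xi \<bullet> xi) <= xi \<bullet> (a *v xi)" and b: "norm a <= R" "norm p <= R" "norm H <= R" "norm G <= R" "cp <= norm p"
   and pc: "!!xi. p \<bullet> (a *v xi) = 0 ==> xi \<bullet> (a *v xi) = p \<bullet> (a *v p) ==> c2 <= Bf a p H G xi + Bf a p H G p"
  define kap where "kap = p \<bullet> (a *v p)"
  define w where "w = Df a p H G + Bf a p H G p / kap - c1"
  have k: "km <= kap" unfolding kap_def by (rule kap[OF e b(5)])
  have kK: "kap <= K"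
  proof -
   have "kap <= norm a * norm p * norm p" unfolding kap_def using inner_matrix_le[of p a p] by linarith
   also have "... <= R * R * R" using b R by (intro mult_mono) auto
   finally show ?thesis by (simp add: K_def)
  qed
  have kpos: "0 < kap" using k km by linarith
  have wB: "norm w <= R2" using wb[OF e b] R2(2) unfolding w_def kap_def by simp
  show "c3/4 * ((norm V)^2 + r^2) <= Jw Lm a p H G (Df a p H G + Bf a p H G p / (p \<bullet> (a *v p)) - c1) V r"
   unfolding kap_def[symmetric] w_def[symmetric]
  proof (rule Jw_lower_by_scaling)
   fix V :: "real^'n" and r :: real assume unit: "(norm V)^2 + r^2 = 1"
   have V1: "norm V <= 1" "\<bar>r\<bar> <= 1"
   proof -
    have "(norm V)^2 <= 1^2" "\<bar>r\<bar>^2 <= 1^2" using unit zero_le_power2[of r] zero_le_power2[of "norm V"] unfolding power2_abs one_power2 by linarith+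
    then show "norm V <= 1" "\<bar>r\<bar> <= 1" by (auto simp: power2_le_iff_abs_le abs_square_le_1)
   qed
   define s where "s = (p \<bullet> (a *v V)) / kap"
   define X where "X = V - s *. p"
   have pX: "p \<bullet> (a *v X) = 0" using kpos
    by (simp add: X_def s_def matrix_vector_mult_diff_distrib matrix_scaleR_right inner_diff_right kap_def[symmetric])
   have s: "\<bar>s\<bar> <= s0"
   proof -
    have "\<bar>p \<bullet> (a *v V)\<bar> <= norm a * norm p * norm V" by (rule inner_matrix_le)
    also have "... <= R * R * 1" using b R V1 by (intro mult_mono) auto
    finally have n: "\<bar>p \<bullet> (a *v V)\<bar> <= R * R" by simp
    have "\<bar>s\<bar> = \<bar>p \<bullet> (a *v V)\<bar> / kap" using kpos by (simp add: s_def)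
    also have "... <= R * R / km" using n k km R by (intro frac_le) auto
    finally show ?thesis by (simp add: s0_def)
   qed
   have XV: "norm (V - X) = \<bar>s\<bar> * norm p" by (simp add: X_def)
   have nX: "norm X <= R2"
   proof -
    have "norm X <= norm V + \<bar>s\<bar> * norm p" unfolding X_def using norm_triangle_ineq4[of V "s *. p"] by simp
    also have "... <= 1 + s0 * R" using V1 s s0 b by (intro add_mono mult_mono) auto
    finally show ?thesis using R2 by linarith
   qed
   note bds = order_trans[OF b(1) R2(1)] order_trans[OF b(2) R2(1)] order_trans[OF b(3) R2(1)] order_trans[OF b(4) R2(1)] wB
   have nV: "norm V <= R2" "norm r <= R2" using V1 R2 by auto
   have split: "Jw Lm a p H G w V r = Jw 0 a p H G w V r + Lm * (p \<bullet> (a *v V))^2" by (simp add: Jw_def)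
   show "c3/4 <= Jw Lm a p H G w V r"
   proof (cases "norm (V - X) < rho")
    case True
    have "norm (V - X) < rho'" using True rho by linarith
    then have "\<bar>Jw 0 a p H G w V r - Jw 0 a p H G w X r\<bar> < c3/4"
     by (intro rho'(2) bds nV nX) (use rho' in auto)
    moreover have "c3 / 2 <= Jw 0 a p H G w X r"
    proof -
     have tl: "c1 * (X \<bullet> (a *v X)) + c1 * kap * r^2 <= Jw 0 a p H G w X r"
      unfolding w_def kap_def
      by (rule tangential_lower_bound[where ?c2.0 = c2 and K = K and cA = cA]) (use cA e kpos kK c1_def c2 pc pX in "auto simp: kap_def")
     have m: "min cA km >= 0" using cA km by simp
     have "c3 * ((norm X)^2 + r^2) = c1 * (min cA km * (X \<bullet> X)) + c1 * (min cA km * r^2)"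
      by (simp add: c3_def dot_square_norm distrib_left)
     also have "... <= c1 * (X \<bullet> (a *v X)) + c1 * (kap * r^2)"
     proof (intro add_mono mult_left_mono)
      have "min cA km * (X \<bullet> X) <= cA * (X \<bullet> X)" by (intro mult_right_mono) auto
      also have "... <= X \<bullet> (a *v X)" by (rule e)
      finally show "min cA km * (X \<bullet> X) <= X \<bullet> (a *v X)" .
      show "min cA km * r^2 <= kap * r^2" using k by (intro mult_right_mono) auto
     qed (use c1 in auto)
     finally have low: "c3 * ((norm X)^2 + r^2) <= Jw 0 a p H G w X r" using tl by (simp add: mult.assoc)
     have "norm V - rho <= norm X" using True norm_triangle_ineq2[of V X] by linarith
     then have "(norm V)^2 - 1/2 <= (norm X)^2"
     proof (cases "norm V <= rho")
      case True
      then have "(norm V)^2 <= (1/4)^2" using rho by (intro power_mono) auto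
      then have "(norm V)^2 <= 1/16" by (simp add: power_divide)
      then show ?thesis using zero_le_power2[of "norm X"] by linarith
     next
      case False
      assume h: "norm V - rho <= norm X"
      have "(norm V - rho)^2 <= (norm X)^2" using h False by (intro power_mono) auto
      moreover have "(norm V - rho)^2 = (norm V)^2 - 2 * (norm V * rho) + rho^2" by (simp add: power2_diff)
      moreover have "norm V * rho <= 1 * (1/4)" using V1 rho by (intro mult_mono) auto
      ultimately show ?thesis using zero_le_power2[of rho] by linarith
     qed
     then have "1/2 <= (norm X)^2 + r^2" using unit by linarith
     from mult_left_mono[OF this, of c3] c3 have "c3 / 2 <= c3 * ((norm X)^2 + r^2)" by simp
     with low show ?thesis by linarith
    qed
    moreover have "Lm * (p \<bullet> (a *v V))^2 >= 0" using Lm by simp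
    ultimately show ?thesis unfolding split by linarith
   next
    case False
    have lowp: "rho * cA * cp <= \<bar>p \<bullet> (a *v V)\<bar>"
    proof -
     have "cA * (norm p)^2 <= kap" using e[of p] by (simp add: kap_def dot_square_norm)
     then have "cA * norm p * norm p <= kap" by (simp add: power2_eq_square)
     have "rho * cA * cp <= (\<bar>s\<bar> * norm p) * cA * norm p"
      using False XV b(5) cp cA rho by (intro mult_mono) auto
     also have "... = \<bar>s\<bar> * (cA * norm p * norm p)" by simp
     also have "... <= \<bar>s\<bar> * kap" using \<open>cA * norm p * norm p <= kap\<close> by (intro mult_left_mono) auto
     also have "... = \<bar>p \<bullet> (a *v V)\<bar>" using kpos by (simp add: s_def)
     finally show ?thesis .
    qed
    have pos: "rho * cA * cp > 0" using rho cA cp by simp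
    have "(rho * cA * cp)^2 <= (p \<bullet> (a *v V))^2" using power_mono[OF lowp, of 2] pos by simp
    then have "Lm * (rho * cA * cp)^2 <= Lm * (p \<bullet> (a *v V))^2" using Lm by (intro mult_left_mono)
    moreover have "Lm * (rho * cA * cp)^2 = c3/4 + CJ" using less_imp_neq[OF pos] unfolding Lm_def by auto
    moreover have "\<bar>Jw 0 a p H G w V r\<bar> <= CJ" by (intro CJ(2) bds nV)
    ultimately show ?thesis unfolding split by linarith
   qed
  qed
 qed ((use c3 in simp), rule Lm, rule Cw, rule wb)
qed

lemma bounded_linear_Jw_coefficients:
 "bounded_linear (%Y :: (real^'n^'n^'n) \<times> real. Jw Lm a p H (fst Y) (snd Y) V r - Jw Lm a p H 0 0 V r)"
proof (rule linear_conv_bounded_linear[THEN iffD1], rule linearI)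
 fix X Y :: "(real^'n^'n^'n) \<times> real"
 show "Jw Lm a p H (fst (X + Y)) (snd (X + Y)) V r - Jw Lm a p H 0 0 V r
  = (Jw Lm a p H (fst X) (snd X) V r - Jw Lm a p H 0 0 V r) + (Jw Lm a p H (fst Y) (snd Y) V r - Jw Lm a p H 0 0 V r)"
  unfolding Jw_def jf_def Bf_def Df_def fst_add snd_add dirG_add beta_add
  by (simp add: dirG_def beta_def matrix_vector_mult_add_rdistrib inner_add_left inner_add_right algebra_simps)
next
 fix c and Y :: "(real^'n^'n^'n) \<times> real"
 show "Jw Lm a p H (fst (c *. Y)) (snd (c *. Y)) V r - Jw Lm a p H 0 0 V r = c *. (Jw Lm a p H (fst Y) (snd Y) V r - Jw Lm a p H 0 0 V r)"
  unfolding Jw_def jf_def Bf_def Df_def fst_scaleR snd_scaleR dirG_scaleR beta_scaleR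
  by (simp add: dirG_def beta_def scaleR_matrix_vector_assoc[symmetric] algebra_simps)
qed

lemma moll_bump_affine:
 fixes b :: "'a::euclidean_space => real"
 assumes b: "b \<in> borel_fun" "!!x. norm (b x) <= B"
 shows "moll bump eps (%y. k + c * b y) x = k + c * moll bump eps b x"
proof -
 have i: "integrable lborel (%z. bump z * b (x - eps *. z))" using moll_integrable[OF kernel_bump b] by simp
 have "moll bump eps (%y. k + c * b y) x = (LI z. k * bump z + c * (bump z * b (x - eps *. z)))"
  unfolding moll_def by (intro Bochner_Integration.integral_cong) (auto simp: algebra_simps)
 also have "... = k + c * moll bump eps b x"
  using i integrable_kernel[OF kernel_bump[where 'a='a]] integral_bump[where 'a='a] by (simp add: moll_def)
 finally show ?thesis .
qed

context carleman_setting begin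

text \<open>The extension by zero is harmless, because outside \<open>Om\<close> the form is only bounded from below by a
constant.\<close>

definition wt :: "real => real^'n => real"
 where "wt c1 x = (if x \<in> Om then Df (A x) (p x) (H x) (G x) + Bf (A x) (p x) (H x) (G x) (p x) / (p x \<bullet> (A x *v p x)) - c1 else 0)"

lemma wt_borel: "wt c1 \<in> borel_fun"
proof -
 have O[measurable]: "Om \<in> sets borel" using open_dom by simp
 have p': "(%x. indicator Om x *. p x) \<in> borel_fun" "(%x. indicator Om x *. H x) \<in> borel_fun"
  by (rule borel_measurable_continuous_on_indicator[OF O], rule continuous_on_subset[OF _ cl], rule cp_on cH_on)+
 define X where "X x = (A x, indicator Om x *. p x, indicator Om x *. H x, G x)" for x
 have mX: "X \<in> borel_fun" unfolding X_def by (intro borel_measurable_Pair A_borel G_borel p')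
 have c: "continuous_on UNIV (%X :: (real^'n^'n) \<times> (real^'n) \<times> (real^'n^'n) \<times> (real^'n^'n^'n).
   Df (fst X) (fst (snd X)) (fst (snd (snd X))) (snd (snd (snd X))))"
  "continuous_on UNIV (%X :: (real^'n^'n) \<times> (real^'n) \<times> (real^'n^'n) \<times> (real^'n^'n^'n).
   Bf (fst X) (fst (snd X)) (fst (snd (snd X))) (snd (snd (snd X))) (fst (snd X)))"
  "continuous_on UNIV (%X :: (real^'n^'n) \<times> (real^'n) \<times> (real^'n^'n) \<times> (real^'n^'n^'n). fst (snd X) \<bullet> (fst X *v fst (snd X)))"
  unfolding Df_def Bf_def by (intro continuous_intros)+
 note m = borel_measurable_continuous_on[OF c(1) mX] borel_measurable_continuous_on[OF c(2) mX] borel_measurable_continuous_on[OF c(3) mX]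
 have eq: "wt c1 = (%x. indicator Om x * (Df (fst (X x)) (fst (snd (X x))) (fst (snd (snd (X x)))) (snd (snd (snd (X x))))
   + Bf (fst (X x)) (fst (snd (X x))) (fst (snd (snd (X x)))) (snd (snd (snd (X x)))) (fst (snd (X x))) / (fst (snd (X x)) \<bullet> (fst (X x) *v fst (snd (X x)))) - c1))"
  by (rule ext) (simp add: wt_def X_def indicator_def)
 show ?thesis unfolding eq
  by (intro borel_measurable_times borel_measurable_add borel_measurable_diff borel_measurable_divide m borel_measurable_indicator O borel_measurable_const)
qed

text \<open>At fixed \<open>x\<close> the form is an affine function of \<open>(G, w)\<close>, so its value at the averages is the
average of its values. At points \<open>y\<close> of the ball inside \<open>Om\<close> the continuous data at
\<open>x\<close> may be replaced by those at \<open>y\<close>, where the pointwise bound holds; the other points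
contribute the term with \<open>ext_density\<close>.\<close>

lemma averaged_lower_bound:
 obtains c c1 Lm Cw C1 eps0 where "c > 0" "Lm >= 0" "Cw >= 0" "C1 >= 0" "eps0 > 0" "!!x. norm (wt c1 x) <= Cw"
  "!!eps x V r. [|0 < eps; eps < eps0; x \<in> Om|] ==>
    (c - C1 * ext_density eps x) * ((norm V)^2 + r^2) <= Jw Lm (Am eps x) (p x) (H x) (Gm eps x) (moll bump eps (wt c1) x) V r"
proof -
 define R where "R = CA + \<bar>Cp\<bar> + CG"
 have R: "R >= 0" "CA <= R" "Cp <= R" "CG <= R" using CA_nonneg CG_nonneg by (auto simp: R_def)
 show thesis
 proof (rule pseudoconvex_lower_bound[OF cA cp c2 R(1), where 'n='n])
 fix c c1 Lm Cw :: real
 assume k: "c > 0" "Lm >= 0" "Cw >= 0"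
  and low: "!!a p H G V r. [|transpose (a::real^'n^'n) = a; !!xi. cA * (xi \<bullet> xi) <= xi \<bullet> (a *v xi); norm a <= R; norm p <= R; norm H <= R; norm G <= R; cp <= norm p;
    !!xi. p \<bullet> (a *v xi) = 0 ==> xi \<bullet> (a *v xi) = p \<bullet> (a *v p) ==> c2 <= Bf a p H G xi + Bf a p H G p|]
   ==> c * ((norm V)^2 + r^2) <= Jw Lm a p H G (Df a p H G + Bf a p H G p / (p \<bullet> (a *v p)) - c1) V r"
  and wb: "!!a p H G. [|!!xi. cA * (xi \<bullet> xi) <= xi \<bullet> (a *v xi); norm (a::real^'n^'n) <= R; norm p <= R; norm H <= R; norm G <= R; cp <= norm p|]
   ==> \<bar>Df a p H G + Bf a p H G p / (p \<bullet> (a *v p)) - c1\<bar> <= Cw"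
 have cl: "x \<in> Om ==> x \<in> closure Om" for x using closure_subset by blast
 have nA: "norm (A x) <= R" "norm (Am eps x) <= R" "norm (G x) <= R" "norm (Gm eps x) <= R" for x eps
  using normA[of x] norm_Am[of eps x] normG[of x] norm_Gm[of eps x] R by linarith+
 have npH: "norm (p x) <= R" "norm (H x) <= R" if "x \<in> Om" for x using pH_bound[OF cl[OF that]] R by linarith+
 have wtb: "norm (wt c1 x) <= Cw" for x
 proof (cases "x \<in> Om")
  case True then show ?thesis unfolding wt_def real_norm_def by (simp add: wb[OF ellA nA(1) npH nA(3) p_lower[OF cl]])
 next
  case False then show ?thesis using k by (simp add: wt_def)
 qed
 define R2 where "R2 = R + Cw + 1"
 have R2: "R <= R2" "Cw <= R2" "1 <= R2" using R k by (auto simp: R2_def)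
 obtain rho where rho: "rho > 0" "!!a p H G w V r a' p' H' V'. [|norm (a::real^'n^'n) <= R2; norm p <= R2; norm H <= R2; norm G <= R2; norm w <= R2; norm V <= R2; norm r <= R2;
   norm a' <= R2; norm p' <= R2; norm H' <= R2; norm V' <= R2; norm (a - a') < rho; norm (p - p') < rho; norm (H - H') < rho; norm (V - V') < rho|]
  ==> \<bar>Jw Lm a p H G w V r - Jw Lm a' p' H' G w V' r\<bar> < c / 2"
  by (rule Jw_uniform[of "c/2" R2 Lm]) (use k in simp, blast)
 obtain CJ where CJ: "CJ >= 0" "!!a p H G w V r. [|norm (a::real^'n^'n) <= R2; norm p <= R2; norm H <= R2; norm G <= R2; norm w <= R2; norm V <= R2; norm r <= R2|]
  ==> \<bar>Jw Lm a p H G w V r\<bar> <= CJ" by (rule Jw_bounded[of R2 Lm]) blast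
 obtain dlp where dlp: "dlp > 0" "!!x y. [|x \<in> closure Om; y \<in> closure Om; dist y x < dlp|] ==> dist (p y) (p x) < rho"
  using compact_uniformly_continuous[OF cp_on compact_closure_dom] rho(1) unfolding uniformly_continuous_on_def by meson
 obtain dlH where dlH: "dlH > 0" "!!x y. [|x \<in> closure Om; y \<in> closure Om; dist y x < dlH|] ==> dist (H y) (H x) < rho"
  using compact_uniformly_continuous[OF cH_on compact_closure_dom] rho(1) unfolding uniformly_continuous_on_def by meson
 define eps0 where "eps0 = min (min dlp dlH) (rho / (2 * L + 1))"
 have eps0: "eps0 > 0" using dlp dlH rho L_nonneg by (auto simp: eps0_def)
 show thesis
 proof (rule that[of "c/2" Lm Cw "CJ + c/2" eps0 c1])
  fix eps x and V :: "real^'n" and r :: real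
  assume eps: "0 < eps" "eps < eps0" and x: "x \<in> Om"
  show "(c/2 - (CJ + c/2) * ext_density eps x) * ((norm V)^2 + r^2) <= Jw Lm (Am eps x) (p x) (H x) (Gm eps x) (moll bump eps (wt c1) x) V r"
  proof (rule Jw_lower_by_scaling)
   fix V :: "real^'n" and r :: real assume unit: "(norm V)^2 + r^2 = 1"
   have "(norm V)^2 <= 1^2" "\<bar>r\<bar>^2 <= 1^2" using unit zero_le_power2[of r] zero_le_power2[of "norm V"] unfolding power2_abs one_power2 by linarith+
   then have "norm V <= 1" "\<bar>r\<bar> <= 1" by (auto simp: power2_le_iff_abs_le abs_square_le_1)
   then have Vr: "norm V <= R2" "norm r <= R2" using R2 by auto
   define Y where "Y y = (G y, wt c1 y)" for y
   define q where "q y = c/2 + (- (CJ + c/2)) * indicat_real (- Om) y" for y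
   have mY: "Y \<in> borel_fun" unfolding Y_def by (intro borel_measurable_Pair G_borel wt_borel)
   have bY: "norm (Y y) <= CG + Cw" for y unfolding Y_def using norm_Pair_le[of "G y" "wt c1 y"] normG[of y] wtb[of y] by linarith
   have mq: "q \<in> borel_fun" unfolding q_def using exterior_indicator(1) by simp
   have bq: "norm (q y) <= c/2 + (CJ + c/2)" for y using k CJ(1) by (simp add: q_def indicator_def)
   have B: "norm (A y) <= R2" "norm (Am eps y) <= R2" "norm (G y) <= R2" "norm (wt c1 y) <= R2" for y
    using nA(1)[of y] nA(2)[where x = y and eps = eps] nA(3)[of y] wtb[of y] R2 by linarith+
   have Bp: "norm (p y) <= R2" "norm (H y) <= R2" if "y \<in> Om" for y using npH[OF that] R2 by linarith+
   define T where "T = (%Y. Jw Lm (Am eps x) (p x) (H x) (fst Y) (snd Y) V r - Jw Lm (Am eps x) (p x) (H x) 0 0 V r)"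
   have bT: "bounded_linear T" unfolding T_def by (rule bounded_linear_Jw_coefficients)
   have "moll bump eps q x <= T (moll bump eps Y x) + Jw Lm (Am eps x) (p x) (H x) 0 0 V r"
   proof (rule moll_ae_lower_bound[OF mY bY mq bq bT eps(1)])
    show "AE y in lborel. norm (x - y) < eps --> q y <= T (Y y) + Jw Lm (Am eps x) (p x) (H x) 0 0 V r"
     using pseudoconvex
    proof eventually_elim
     case (elim y)
     have TY: "T (Y y) + Jw Lm (Am eps x) (p x) (H x) 0 0 V r = Jw Lm (Am eps x) (p x) (H x) (G y) (wt c1 y) V r"
      by (simp add: T_def Y_def)
     show ?case unfolding TY
     proof
      assume near: "norm (x - y) < eps"
      show "q y <= Jw Lm (Am eps x) (p x) (H x) (G y) (wt c1 y) V r"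
      proof (cases "y \<in> Om")
       case False
       have "\<bar>Jw Lm (Am eps x) (p x) (H x) (G y) (wt c1 y) V r\<bar> <= CJ" by (intro CJ(2) B Bp x Vr)
       then show ?thesis using False by (simp add: q_def)
      next
       case True
       have d: "dist x y < dlp" "dist x y < dlH" using near eps by (auto simp: eps0_def dist_norm)
       have 1: "norm (p x - p y) < rho" using dlp(2)[OF cl[OF True] cl[OF x] d(1)] by (simp add: dist_norm)
       have 2: "norm (H x - H y) < rho" using dlH(2)[OF cl[OF True] cl[OF x] d(2)] by (simp add: dist_norm)
       have 3: "norm (Am eps x - A y) < rho"
       proof -
        have "norm (Am eps x - A y) <= norm (Am eps x - A x) + norm (A x - A y)" using norm_triangle_ineq[of "Am eps x - A x" "A x - A y"] by simp
        also have "... <= L * eps + L * eps"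
         using Am_close[OF eps(1), of x] lipA[of x y] mult_left_mono[OF less_imp_le[OF near] L_nonneg] by linarith
        also have "... <= (2 * L + 1) * eps" using eps by (simp add: algebra_simps)
        also have "... < (2 * L + 1) * (rho / (2 * L + 1))" using eps L_nonneg by (intro mult_strict_left_mono) (auto simp: eps0_def)
        also have "... = rho" using L_nonneg by simp
        finally show ?thesis .
       qed
       have "\<bar>Jw Lm (Am eps x) (p x) (H x) (G y) (wt c1 y) V r - Jw Lm (A y) (p y) (H y) (G y) (wt c1 y) V r\<bar> < c/2"
        by (intro rho(2) B Bp x True Vr 1 2 3) (use rho(1) in simp)
       moreover have "c * ((norm V)^2 + r^2) <= Jw Lm (A y) (p y) (H y) (G y) (wt c1 y) V r"
        unfolding wt_def if_P[OF True]
        by (rule low[OF symA ellA nA(1) npH[OF True] nA(3) p_lower[OF cl[OF True]]]) (use elim True in blast)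
       moreover have "q y = c/2" using True by (simp add: q_def)
       ultimately show ?thesis unfolding unit by linarith
      qed
     qed
    qed
   qed
   also have "moll bump eps Y x = (Gm eps x, moll bump eps (wt c1) x)"
    using moll_linear[OF bounded_linear_fst kernel_bump mY bY, of eps x] moll_linear[OF bounded_linear_snd kernel_bump mY bY, of eps x]
    unfolding prod_eq_iff Y_def Gm_def by (simp cong: )
   also have "moll bump eps q x = c/2 - (CJ + c/2) * ext_density eps x"
    unfolding q_def ext_density_def by (subst moll_bump_affine[OF exterior_indicator]) (simp add: algebra_simps)
   finally show "c/2 - (CJ + c/2) * ext_density eps x <= Jw Lm (Am eps x) (p x) (H x) (Gm eps x) (moll bump eps (wt c1) x) V r"
    by (simp add: T_def)
  qed
 qed (use k CJ eps0 wtb in auto)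
 qed
qed

end

section \<open>Conjugation with the weight\<close>

definition outer :: "real^'n => real^'n => real^'n^'n" where "outer p q = (\<chi> i j. p $ i * q $ j)"

lemma outer_mult: "outer p q *v h = (q \<bullet> h) *. p"
 by (simp add: vec_eq_iff outer_def matrix_vector_mult_def inner_vec_def sum_distrib_left sum_distrib_right mult_ac)

lemma inner_outer: "a \<bullet> outer p q = p \<bullet> (a *v q)"
 by (simp add: outer_def inner_vec_def matrix_vector_mult_def sum_distrib_left mult_ac)

lemma norm_outer: "norm (outer p q) = norm p * norm q"
proof -
 have "(norm (outer p q))^2 = outer p q \<bullet> outer p q" by (simp add: dot_square_norm)
 also have "... = (q \<bullet> q) * (p \<bullet> p)" by (simp add: inner_outer outer_mult)
 also have "... = (norm p * norm q)^2" by (simp add: dot_square_norm power_mult_distrib)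
 finally show ?thesis by simp
qed

lemma outer_scaleR: "outer (c *. p) q = c *. outer p q" "outer p (c *. q) = c *. outer p q"
 by (simp_all add: outer_def vec_eq_iff)

lemma continuous_on_outer[continuous_intros]:
 "continuous_on S f ==> continuous_on S g ==> continuous_on S (%x. outer (f x) (g x))"
 unfolding outer_def by (intro continuous_on_vec_lambda continuous_intros)

lemma square_sum_le:
 "(x + y)^2 <= 2 * x^2 + 2 * y^2" "(x + y + z)^2 <= 3 * x^2 + 3 * y^2 + 3 * z^2"
 "(x + y + z + t)^2 <= 4 * x^2 + 4 * y^2 + 4 * z^2 + 4 * t^2" for x y z t :: real
proof -
 show "(x + y)^2 <= 2 * x^2 + 2 * y^2" using zero_le_power2[of "x - y"] by (simp add: power2_eq_square algebra_simps)
 have "0 <= (x - y)^2 + (x - z)^2 + (y - z)^2" by simp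
 then show "(x + y + z)^2 <= 3 * x^2 + 3 * y^2 + 3 * z^2" by (simp add: power2_eq_square algebra_simps)
 have "0 <= (x - y)^2 + (x - z)^2 + (y - z)^2 + (x - t)^2 + (y - t)^2 + (z - t)^2" by simp
 then show "(x + y + z + t)^2 <= 4 * x^2 + 4 * y^2 + 4 * z^2 + 4 * t^2" by (simp add: power2_eq_square algebra_simps)
qed

context weighted_domain begin

lemma integrable_supported:
 fixes f :: "real^'n => real"
 assumes "compact K" "K <= Om" "continuous_on Om f" "!!x. x ~: K ==> f x = 0"
 shows "integrable lborel f"
 by (rule integrable_compact_support[OF assms(1) continuous_extension_by_zero[OF open_dom assms] assms(4)])

lemma cphi_dom: "continuous_on Om phi"
 using d\<phi> by (auto intro!: continuous_at_imp_continuous_on has_derivative_continuous)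

definition conj_fun :: "real => (real^'n => real) => real^'n => real"
 where "conj_fun tau u x = exp (tau * phi x) * u x"
definition conj_grad :: "real => (real^'n => real) => (real^'n => real^'n) => real^'n => real^'n"
 where "conj_grad tau u U x = exp (tau * phi x) *. (U x + (tau * u x) *. p x)"
definition conj_hess :: "real => (real^'n => real) => (real^'n => real^'n) => (real^'n => real^'n^'n) => real^'n => real^'n^'n"
 where "conj_hess tau u U N x = exp (tau * phi x) *. (N x + tau *. (outer (p x) (U x) + outer (U x) (p x)) + (tau * u x) *. H x + (tau^2 * u x) *. outer (p x) (p x))"

lemma conjugated_compact_support:
 assumes "c3_compact_support u U N T K" and KOm: "K <= Om"
 shows "c2_compact_support (conj_fun tau u) (conj_grad tau u U) (conj_hess tau u U N) K"
proof -
 interpret c3_compact_support u U N T K by fact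
 note ci = on_UNIV[OF cu] on_UNIV[OF cU]
  on_UNIV[OF cN] continuous_on_subset[OF cp_on cl] continuous_on_subset[OF cH_on cl] cphi_dom
 have out0: "outer q 0 = 0" "outer 0 q = 0" for q :: "real^'n" by (simp_all add: outer_def vec_eq_iff)
 have z: "conj_fun tau u x = 0" "conj_grad tau u U x = 0" "conj_hess tau u U N x = 0" if "x ~: K" for x
  using zero that by (simp_all add: conj_fun_def conj_grad_def conj_hess_def out0)
 have op: "open (- K)" using K by (simp add: compact_imp_closed open_Compl)
 show ?thesis
 proof
  fix x
  show "(conj_fun tau u has_derivative (%h. conj_grad tau u U x \<bullet> h)) (at x)"
  proof (cases "x \<in> K")
   case True
   then have x: "x \<in> Om" using KOm by blast
   have "((%x. exp (tau * phi x) * u x) has_derivative (%h. exp (tau * phi x) * (U x \<bullet> h) + tau * (p x \<bullet> h) * exp (tau * phi x) * u x)) (at x)"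
    by (rule derivative_eq_intros du d\<phi>[OF x] refl | simp)+
   then show ?thesis unfolding conj_fun_def[abs_def]
    by (rule has_derivative_eq_rhs) (auto simp: conj_grad_def inner_add_left algebra_simps)
  next
   case False
   have "((%x. 0) has_derivative (%h. 0::real)) (at x)" by simp
   then have "(conj_fun tau u has_derivative (%h. 0)) (at x)"
    by (rule has_derivative_transform_within_open[OF _ op]) (use False z in auto)
   then show ?thesis using z[OF False] by simp
  qed
  show "(conj_grad tau u U has_derivative (%h. conj_hess tau u U N x *v h)) (at x)"
  proof (cases "x \<in> K")
   case True
   then have x: "x \<in> Om" using KOm by blast
   have "((%x. exp (tau * phi x) *. (U x + (tau * u x) *. p x)) has_derivative
     (%h. exp (tau * phi x) *. (N x *v h + ((tau * u x) *. (H x *v h) + (tau * (U x \<bullet> h)) *. p x)) + (tau * (p x \<bullet> h) * exp (tau * phi x)) *. (U x + (tau * u x) *. p x))) (at x)"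
    by (rule derivative_eq_intros du dU d\<phi>[OF x] dp[OF x] refl | simp)+
   then show ?thesis unfolding conj_grad_def[abs_def]
    by (rule has_derivative_eq_rhs)
     (auto simp: conj_hess_def fun_eq_iff matrix_vector_mult_add_rdistrib scaleR_matrix_vector_assoc[symmetric] outer_mult scaleR_add_right power2_eq_square algebra_simps inner_commute)
  next
   case False
   have "((%x. 0) has_derivative (%h. 0::real^'n)) (at x)" by simp
   then have "(conj_grad tau u U has_derivative (%h. 0)) (at x)"
    by (rule has_derivative_transform_within_open[OF _ op]) (use False z in auto)
   then show ?thesis using z[OF False] by simp
  qed
 next
  show "continuous_on UNIV (conj_hess tau u U N)"
  proof (rule continuous_extension_by_zero[OF open_dom K KOm])
   show "continuous_on Om (conj_hess tau u U N)" unfolding conj_hess_def[abs_def] by (intro continuous_intros ci)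
  qed (rule z)
 qed (use K z in auto)
qed

text \<open>The left side of \<open>hessian_estimate_identity\<close> dominates \<open>cA |N|^2\<close>; every term on the right
contains \<open>a : N\<close> or \<open>tau U\<close>, so Young absorbs \<open>|N|^2\<close>.\<close>

lemma hessian_estimate:
 shows "\<exists>C\<ge>0. \<forall>a G u U N T K tau. differentiable_coefficients a G --> (\<forall>x xi. cA * (xi \<bullet> xi) <= xi \<bullet> (a x *v xi)) -->
   (\<forall>x. norm (a x) <= CA) --> (\<forall>x. norm (G x) <= CG) --> c3_compact_support u U N T K --> K <= Om --> tau >= 1 -->
   (LI x. exp (2 * tau * phi x) * (norm (N x))^2) <= C * (LI x. exp (2 * tau * phi x) * ((a x \<bullet> N x)^2 + (tau * norm (U x))^2))"
proof -
 define n where "n = real CARD('n)"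
 define D where "D = norm (mat 1 :: real^'n^'n) + 2 * n * \<bar>CG\<bar> + 2 * \<bar>Cp\<bar> + 2 * \<bar>Cp\<bar> * CA"
 have CA0: "CA >= 0" using order_trans[OF norm_ge_zero normA] .
 have D0: "D >= 0" using CA0 by (auto simp: D_def n_def intro!: add_nonneg_nonneg)
 define C where "C = (2 / cA) * (D^2 / cA + D / 2)"
 have C0: "C >= 0" using cA D0 by (auto simp: C_def)
 have alg: "Z <= C * B" if "cA * Z <= cA / 2 * Z + (D^2 / cA + D / 2) * B" for Z B :: real
 proof -
  have "cA / 2 * Z <= (D^2 / cA + D / 2) * B" using that by linarith
  then have "(2 / cA) * (cA / 2 * Z) <= (2 / cA) * ((D^2 / cA + D / 2) * B)" using cA by (intro mult_left_mono) auto
  moreover have "(2 / cA) * (cA / 2 * Z) = Z" using cA by simp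
  ultimately show ?thesis by (simp only: C_def mult.assoc)
 qed
 show ?thesis
 proof (intro exI[of _ C] conjI C0 allI impI)
  fix a :: "real^'n => real^'n^'n" and G u U N T K and tau :: real
  assume dc: "differentiable_coefficients a G" and ell: "\<forall>x xi. cA * (xi \<bullet> xi) <= xi \<bullet> (a x *v xi)"
   and na: "\<forall>x. norm (a x) <= CA" and nG: "\<forall>x. norm (G x) <= CG" and c3: "c3_compact_support u U N T K" and KOm: "K <= Om" and tau: "tau >= 1"
  interpret differentiable_coefficients a G by fact
  interpret c3_compact_support u U N T K by fact
  note ci = on_UNIV[OF cu] on_UNIV[OF cU] on_UNIV[OF cont_a] on_UNIV[OF cont_G]
   on_UNIV[OF cN] continuous_on_subset[OF cp_on cl] continuous_on_subset[OF cH_on cl] cphi_dom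
  define rho where "rho x = exp (2 * tau * phi x)" for x
  have rho0: "rho x > 0" for x by (simp add: rho_def)
  have crho: "continuous_on Om rho" unfolding rho_def by (intro continuous_intros ci)
  define Q where "Q x = (\<Sum>i\<in>UNIV. (a x *v (N x *v (N x *v axis i 1))) $ i)" for x
  define Y where "Y x = (a x \<bullet> N x) * (mat 1 \<bullet> N x) + (dirG (G x) (U x)) \<bullet> N x - beta (G x) \<bullet> (N x *v U x)
    + 2 * tau * ((a x \<bullet> N x) * (p x \<bullet> U x) - p x \<bullet> (a x *v (N x *v U x)))" for x
  have id: "(LI x. rho x * Q x) = (LI x. rho x * Y x)"
   unfolding rho_def Q_def Y_def by (rule hessian_estimate_identity[OF dc c3 KOm])
  have sN: "transpose (N x) = N x" for x by (rule hessian_symmetric[OF open_UNIV UNIV_I du dU])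
  have low: "cA * (norm (N x))^2 <= Q x" for x unfolding Q_def
   by (rule quadratic_matrix_lower_bound[OF sym_a sN]) (use ell in blast)
  have up: "Y x <= cA / 2 * (norm (N x))^2 + (D^2 / cA + D / 2) * ((a x \<bullet> N x)^2 + (tau * norm (U x))^2)" if x: "x \<in> Om" for x
  proof -
   define \<alpha> where "\<alpha> = \<bar>a x \<bullet> N x\<bar>"
   define r where "r = tau * norm (U x)"
   define m where "m = norm (N x)"
   have pos: "\<alpha> >= 0" "r >= 0" "m >= 0" using tau by (auto simp: \<alpha>_def r_def m_def)
   have px: "norm (p x) <= \<bar>Cp\<bar>" using pH_bound(1)[of x] x cl by fastforce
   have Ur: "norm (U x) <= r" using mult_right_mono[OF tau norm_ge_zero[of "U x"]] by (simp add: r_def)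
   have G': "norm (G x) <= \<bar>CG\<bar>" using nG by (meson abs_ge_self order_trans)
   have n0: "n >= 0" by (simp add: n_def)
   have t1: "(a x \<bullet> N x) * (mat 1 \<bullet> N x) <= norm (mat 1 :: real^'n^'n) * (\<alpha> * m)"
   proof -
    have "(a x \<bullet> N x) * (mat 1 \<bullet> N x) <= \<bar>a x \<bullet> N x\<bar> * \<bar>mat 1 \<bullet> N x\<bar>" by (metis abs_ge_self abs_mult)
    also have "... <= \<alpha> * (norm (mat 1 :: real^'n^'n) * m)" unfolding \<alpha>_def m_def by (intro mult_left_mono cauchy_schwarz) auto
    finally show ?thesis by (simp add: mult_ac)
   qed
   have t2: "(dirG (G x) (U x)) \<bullet> N x <= n * \<bar>CG\<bar> * (r * m)"
   proof -
    have "(dirG (G x) (U x)) \<bullet> N x <= norm (dirG (G x) (U x)) * norm (N x)" by (rule norm_cauchy_schwarz)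
    also have "... <= (n * \<bar>CG\<bar> * r) * m" unfolding m_def
     using order_trans[OF norm_dirG_le[of "G x" "U x"] mult_mono[OF mult_left_mono[OF G' n0[unfolded n_def]] Ur]] n0
     by (intro mult_right_mono) (auto simp: n_def)
    finally show ?thesis by (simp add: mult_ac)
   qed
   have t3: "- (beta (G x) \<bullet> (N x *v U x)) <= n * \<bar>CG\<bar> * (r * m)"
   proof -
    have b: "norm (beta (G x)) <= n * \<bar>CG\<bar>" using order_trans[OF norm_beta_le[of "G x"] mult_left_mono[OF G' n0[unfolded n_def]]] by (simp add: n_def)
    have "- (beta (G x) \<bullet> (N x *v U x)) <= norm (N x) * norm (beta (G x)) * norm (U x)" using inner_matrix_le[of "beta (G x)" "N x" "U x"] by linarith
    also have "... <= m * (n * \<bar>CG\<bar>) * r" unfolding m_def using b Ur n0 by (intro mult_mono) auto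
    finally show ?thesis by (simp add: mult_ac)
   qed
   have t4: "2 * tau * ((a x \<bullet> N x) * (p x \<bullet> U x)) <= 2 * \<bar>Cp\<bar> * (\<alpha> * r)"
   proof -
    have "(a x \<bullet> N x) * (p x \<bullet> U x) <= \<bar>a x \<bullet> N x\<bar> * \<bar>p x \<bullet> U x\<bar>" by (metis abs_ge_self abs_mult)
    also have "... <= \<alpha> * (\<bar>Cp\<bar> * norm (U x))" unfolding \<alpha>_def
     using order_trans[OF cauchy_schwarz[of "p x" "U x"] mult_right_mono[OF px norm_ge_zero]] by (intro mult_left_mono) auto
    finally have "2 * tau * ((a x \<bullet> N x) * (p x \<bullet> U x)) <= 2 * tau * (\<alpha> * (\<bar>Cp\<bar> * norm (U x)))" using tau by (intro mult_left_mono) auto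
    then show ?thesis by (simp add: r_def mult_ac)
   qed
   have t5: "- (2 * tau * (p x \<bullet> (a x *v (N x *v U x)))) <= 2 * \<bar>Cp\<bar> * CA * (r * m)"
   proof -
    have "- (p x \<bullet> (a x *v (N x *v U x))) <= norm (a x) * norm (p x) * norm (N x *v U x)" using inner_matrix_le[of "p x" "a x" "N x *v U x"] by linarith
    also have "... <= CA * \<bar>Cp\<bar> * (m * norm (U x))" unfolding m_def
     using na px CA0 by (intro mult_mono norm_matrix_vector_le) auto
    finally have "2 * tau * (- (p x \<bullet> (a x *v (N x *v U x)))) <= 2 * tau * (CA * \<bar>Cp\<bar> * (m * norm (U x)))" using tau by (intro mult_left_mono) auto
    moreover have "2 * tau * (CA * \<bar>Cp\<bar> * (m * norm (U x))) = 2 * \<bar>Cp\<bar> * CA * (r * m)" unfolding r_def by (simp only: mult_ac)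
    moreover have "2 * tau * (- (p x \<bullet> (a x *v (N x *v U x)))) = - (2 * tau * (p x \<bullet> (a x *v (N x *v U x))))" by simp
    ultimately show ?thesis by linarith
   qed
   have "Y x <= norm (mat 1 :: real^'n^'n) * (\<alpha> * m) + 2 * (n * \<bar>CG\<bar> * (r * m)) + 2 * \<bar>Cp\<bar> * (\<alpha> * r) + 2 * \<bar>Cp\<bar> * CA * (r * m)"
    using t1 t2 t3 t4 t5 unfolding Y_def by (simp only: right_diff_distrib)
   also have "... <= D * (\<alpha> * m) + D * (r * m) + D * (\<alpha> * r)"
   proof -
    have "norm (mat 1 :: real^'n^'n) <= D" "2 * \<bar>Cp\<bar> <= D" "2 * (n * \<bar>CG\<bar>) + 2 * \<bar>Cp\<bar> * CA <= D"
     using CA0 n0 unfolding D_def by (auto intro!: add_nonneg_nonneg)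
    then have "norm (mat 1 :: real^'n^'n) * (\<alpha> * m) <= D * (\<alpha> * m)" "2 * \<bar>Cp\<bar> * (\<alpha> * r) <= D * (\<alpha> * r)" "(2 * (n * \<bar>CG\<bar>) + 2 * \<bar>Cp\<bar> * CA) * (r * m) <= D * (r * m)"
     using pos by (auto intro!: mult_right_mono mult_nonneg_nonneg simp del: abs_mult)
    then show ?thesis by (simp add: algebra_simps)
   qed
   also have "... <= cA / 2 * m^2 + (D^2 / cA + D / 2) * (\<alpha>^2 + r^2)"
   proof -
    have y: "D * (x * m) <= cA / 4 * m^2 + D^2 / cA * x^2" for x
    proof -
     have "0 <= (cA * m / 2 - D * x)^2 / cA" using cA by simp
     also have "... = cA / 4 * m^2 + D^2 / cA * x^2 - D * (x * m)" using cA by (simp add: power2_eq_square field_simps)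
     finally show ?thesis by simp
    qed
    have "D * (\<alpha> * r) <= D / 2 * (\<alpha>^2 + r^2)"
    proof -
     have "2 * (\<alpha> * r) <= \<alpha>^2 + r^2" using sum_squares_bound[of \<alpha> r] by (simp add: mult.assoc)
     from mult_left_mono[OF this, of "D/2"] D0 show ?thesis by simp
    qed
    with y[of \<alpha>] y[of r] show ?thesis by (simp add: distrib_left distrib_right)
   qed
   finally show ?thesis by (simp add: \<alpha>_def r_def m_def)
  qed
  have iQ: "integrable lborel (%x. rho x * Q x)" unfolding Q_def
   by (rule integrable_supported[OF K KOm]) (use zero in "auto intro!: continuous_intros ci crho")
  have iY: "integrable lborel (%x. rho x * Y x)" unfolding Y_def
   by (rule integrable_supported[OF K KOm]) (use zero in "auto intro!: continuous_intros ci crho")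
  have iN: "integrable lborel (%x. rho x * (norm (N x))^2)"
   by (rule integrable_supported[OF K KOm]) (use zero in "auto intro!: continuous_intros ci crho")
  have iB: "integrable lborel (%x. rho x * ((a x \<bullet> N x)^2 + (tau * norm (U x))^2))"
   by (rule integrable_supported[OF K KOm]) (use zero in "auto intro!: continuous_intros ci crho")
  have "cA * (LI x. rho x * (norm (N x))^2) = (LI x. cA * (rho x * (norm (N x))^2))" by simp
  also have "... <= (LI x. rho x * Q x)"
  proof (rule integral_mono)
   show "cA * (rho x * (norm (N x))^2) <= rho x * Q x" for x
    using mult_left_mono[OF low[of x] less_imp_le[OF rho0[of x]]] by (simp add: mult_ac)
  qed (use iN iQ in auto)
  also have "... = (LI x. rho x * Y x)" by (rule id)
  also have "... <= (LI x. cA / 2 * (rho x * (norm (N x))^2) + (D^2 / cA + D / 2) * (rho x * ((a x \<bullet> N x)^2 + (tau * norm (U x))^2)))"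
  proof (rule integral_mono)
   show "rho x * Y x <= cA / 2 * (rho x * (norm (N x))^2) + (D^2 / cA + D / 2) * (rho x * ((a x \<bullet> N x)^2 + (tau * norm (U x))^2))" for x
   proof (cases "x \<in> Om")
    case True
    from mult_left_mono[OF up[OF True] less_imp_le[OF rho0[of x]]] show ?thesis by (simp add: distrib_left mult.left_commute)
   next
    case False
    then have "x ~: K" using KOm by blast
    then show ?thesis using zero by (simp add: Y_def)
   qed
  qed (use iN iY iB in auto)
  also have "... = cA / 2 * (LI x. rho x * (norm (N x))^2) + (D^2 / cA + D / 2) * (LI x. rho x * ((a x \<bullet> N x)^2 + (tau * norm (U x))^2))"
   using iN iB by simp
  finally have fin: "cA * (LI x. rho x * (norm (N x))^2) <= ..." .
  show "(LI x. exp (2 * tau * phi x) * (norm (N x))^2) <= C * (LI x. exp (2 * tau * phi x) * ((a x \<bullet> N x)^2 + (tau * norm (U x))^2))"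
   unfolding rho_def[symmetric] by (rule alg[OF fin])
 qed
qed

end

section \<open>The estimate for smooth functions\<close>

definition moll_grad :: "real => (real^'n => real) => real^'n => real^'n"
 where "moll_grad eps b x = (\<chi> s. (1/eps) * moll (dbump (axis s 1)) eps b x)"

definition dbump_mass :: "'n::finite itself => real"
 where "dbump_mass _ = (\<Sum>s\<in>(UNIV::'n set). LI z::real^'n. \<bar>dbump (axis s 1) z\<bar>)"

lemma dbump_mass_nonneg: "dbump_mass TYPE('n::finite) >= 0"
 unfolding dbump_mass_def by (intro sum_nonneg lint_nonneg) simp

lemma moll_grad_properties:
 fixes b :: "real^'n => real"
 assumes b: "b \<in> borel_fun" "!!x. norm (b x) <= B" and eps: "eps > 0"
 shows "((%t. moll bump eps b (x + t *. axis s 1)) has_real_derivative moll_grad eps b x $ s) (at 0)"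
  and "continuous_on UNIV (moll_grad eps b)" and "norm (moll_grad eps b x) <= B * dbump_mass TYPE('n) / eps"
proof -
 show "((%t. moll bump eps b (x + t *. axis s 1)) has_real_derivative moll_grad eps b x $ s) (at 0)"
  using moll_bump_derivative[OF b eps, of "axis s 1" x] by (simp add: real_vector_deriv moll_grad_def norm_axis_1)
 show "continuous_on UNIV (moll_grad eps b)" unfolding moll_grad_def[abs_def]
  by (intro continuous_on_vec_lambda continuous_intros moll_continuous[OF kernel_dbump b eps])
 have "norm (moll_grad eps b x) <= (\<Sum>s\<in>UNIV. \<bar>moll_grad eps b x $ s\<bar>)" by (rule norm_le_l1_cart)
 also have "... <= (\<Sum>s\<in>UNIV. (1/eps) * (B * (LI z::real^'n. \<bar>dbump (axis s 1) z\<bar>)))"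
 proof (rule sum_mono)
  fix s :: 'n
  have "\<bar>moll_grad eps b x $ s\<bar> = (1/eps) * \<bar>moll (dbump (axis s 1)) eps b x\<bar>" using eps by (simp add: moll_grad_def abs_mult)
  also have "... <= (1/eps) * (B * (LI z::real^'n. \<bar>dbump (axis s 1) z\<bar>))"
   using moll_bound[OF kernel_dbump b, of "axis s 1" eps x] eps by (intro mult_left_mono) auto
  finally show "\<bar>moll_grad eps b x $ s\<bar> <= (1/eps) * (B * (LI z::real^'n. \<bar>dbump (axis s 1) z\<bar>))" .
 qed
 also have "... = B * dbump_mass TYPE('n) / eps" by (simp add: dbump_mass_def sum_distrib_left sum_divide_distrib)
 finally show "norm (moll_grad eps b x) <= B * dbump_mass TYPE('n) / eps" .
qed

context carleman_setting begin

definition Sop :: "real => (real^'n => real^'n^'n) => (real^'n => real) => (real^'n => real^'n^'n) => real^'n => real"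
 where "Sop tau a v Hv x = a x \<bullet> Hv x + tau^2 * (p x \<bullet> (a x *v p x)) * v x"
definition Top :: "real => (real^'n => real^'n^'n) => (real^'n => real^'n) => real^'n => real"
 where "Top tau a V x = - 2 * tau * (p x \<bullet> (a x *v V x))"
definition energy :: "real => (real^'n => real) => (real^'n => real^'n) => real^'n => real"
 where "energy tau v V x = (norm (V x))^2 + (tau * v x)^2"

lemma energy_nonneg: "energy tau v V x >= 0" by (simp add: energy_def)

lemma energy_integrals:
 assumes c2: "c2_compact_support v V Hv K" and KOm: "K <= Om" and ca: "continuous_on UNIV a"
 shows "integrable lborel (energy tau v V)" "integrable lborel (%x. (Sop tau a v Hv x)^2)" "integrable lborel (%x. (Top tau a V x)^2)"
  "integrable lborel (%x. (Sop tau a v Hv x + Top tau a V x)^2)" "integrable lborel (%x. (norm (Hv x))^2)"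
proof -
 interpret c2_compact_support v V Hv K by fact
 note ci = on_UNIV[OF ca] on_UNIV[OF cv] on_UNIV[OF cV]
   on_UNIV[OF cHv] continuous_on_subset[OF cp_on cl]
 show "integrable lborel (energy tau v V)" unfolding energy_def[abs_def]
  by (rule integrable_supported[OF K KOm]) (use zero in "auto intro!: continuous_intros ci")
 show "integrable lborel (%x. (Sop tau a v Hv x)^2)" unfolding Sop_def
  by (rule integrable_supported[OF K KOm]) (use zero in "auto intro!: continuous_intros ci")
 show "integrable lborel (%x. (Top tau a V x)^2)" unfolding Top_def
  by (rule integrable_supported[OF K KOm]) (use zero in "auto intro!: continuous_intros ci")
 show "integrable lborel (%x. (Sop tau a v Hv x + Top tau a V x)^2)" unfolding Sop_def Top_def
  by (rule integrable_supported[OF K KOm]) (use zero in "auto intro!: continuous_intros ci")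
 show "integrable lborel (%x. (norm (Hv x))^2)"
  by (rule integrable_supported[OF K KOm]) (use zero in "auto intro!: continuous_intros ci")
qed

lemma product_le_energy: "tau >= 0 ==> 2 * tau * (\<bar>v x\<bar> * norm (V x)) <= energy tau v V x"
 using sum_squares_bound[of "norm (V x)" "tau * \<bar>v x\<bar>"] by (simp add: energy_def power_mult_distrib mult_ac)

text \<open>Integration by parts replaces \<open>V . a V\<close> by \<open>- v (a : D^2 v)\<close>, and the zero order term
completes this to \<open>- v S v\<close>. The derivative of the averaged weight contributes the term with \<open>1 /
eps\<close>. Used for \<open>w\<close> itself and for the exterior density.\<close>

lemma weighted_virial_bound:
 assumes b: "b \<in> borel_fun" "!!x. norm (b x) <= B" and eps: "eps > 0" and tau: "tau >= 1" and sgm: "sgm >= 0"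
  and c2: "c2_compact_support v V Hv K" and KOm: "K <= Om"
 shows "integrable lborel (%x. moll bump eps b x * (V x \<bullet> (Am eps x *v V x) - (p x \<bullet> (Am eps x *v p x)) * (tau * v x)^2))"
  and "2 * tau * sgm * \<bar>LI x. moll bump eps b x * (V x \<bullet> (Am eps x *v V x) - (p x \<bullet> (Am eps x *v p x)) * (tau * v x)^2)\<bar>
   <= (sgm * (B * dbump_mass TYPE('n) * CA / eps + B * (real CARD('n) * CG)) + 8 * sgm^2 * B^2) * (LI x. energy tau v V x)
    + (1/8) * (LI x. (Sop tau (Am eps) v Hv x)^2)"
proof -
 interpret differentiable_coefficients "Am eps" "Gm eps" by (rule mollified_coefficients[OF eps])
 interpret c2_compact_support v V Hv K by fact
 define a where "a = Am eps"
 define w where "w = moll bump eps b"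
 define w' where "w' = moll_grad eps b"
 define q where "q x = p x \<bullet> (a x *v p x)" for x
 define S where "S = Sop tau a v Hv"
 define e where "e = energy tau v V"
 define kd where "kd = dbump_mass TYPE('n)"
 define n where "n = real CARD('n)"
 have kd0: "kd >= 0" unfolding kd_def by (rule dbump_mass_nonneg)
 have B0: "B >= 0" using order_trans[OF norm_ge_zero b(2)] .
 have cw: "continuous_on UNIV w" unfolding w_def by (rule moll_continuous[OF kernel_bump b eps])
 have cw': "continuous_on UNIV w'" unfolding w'_def by (rule moll_grad_properties(2)[OF b eps])
 have wB: "\<bar>w x\<bar> <= B" for x using moll_bump_norm_le[OF b, of eps x] by (simp add: w_def)
 have w'B: "norm (w' x) <= B * kd / eps" for x unfolding w'_def kd_def by (rule moll_grad_properties(3)[OF b eps])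
 note ci = on_UNIV[OF cont_a] on_UNIV[OF cont_G] on_UNIV[OF cv] on_UNIV[OF cV]
   on_UNIV[OF cHv] continuous_on_subset[OF cp_on cl] on_UNIV[OF cw] on_UNIV[OF cw']
 define I1 where "I1 x = w x * (V x \<bullet> (a x *v V x) + v x * (a x \<bullet> Hv x))" for x
 define I2 where "I2 x = v x * (w' x \<bullet> (a x *v V x) + w x * (beta (Gm eps x) \<bullet> V x))" for x
 have ibp: "(LI x. I1 x) = - (LI x. I2 x)" unfolding I1_def I2_def a_def
  by (rule weighted_integration_by_parts[OF mollified_coefficients[OF eps] cw cw'])
   (simp add: w_def w'_def moll_grad_properties(1)[OF b eps])
 have i1: "integrable lborel I1" unfolding I1_def[abs_def] a_def
  by (rule integrable_supported[OF K KOm]) (use zero in "auto intro!: continuous_intros ci")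
 have i2: "integrable lborel I2" unfolding I2_def[abs_def] a_def
  by (rule integrable_supported[OF K KOm]) (use zero in "auto intro!: continuous_intros ci")
 have i3: "integrable lborel (%x. w x * v x * S x)" unfolding S_def Sop_def a_def
  by (rule integrable_supported[OF K KOm]) (use zero in "auto intro!: continuous_intros ci")
 have split: "w x * (V x \<bullet> (a x *v V x) - q x * (tau * v x)^2) = I1 x - w x * v x * S x" for x
  unfolding I1_def S_def Sop_def q_def by (simp add: power2_eq_square algebra_simps)
 show "integrable lborel (%x. moll bump eps b x * (V x \<bullet> (Am eps x *v V x) - (p x \<bullet> (Am eps x *v p x)) * (tau * v x)^2))"
  unfolding w_def[symmetric] a_def[symmetric] q_def[symmetric] split using i1 i3 by simp
 have ie: "integrable lborel e" "integrable lborel (%x. (S x)^2)" unfolding e_def S_def a_def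
  using energy_integrals[OF c2 KOm cont_a] by auto
 define k where "k = sgm * (B * kd * CA / eps + B * (n * CG)) + 8 * sgm^2 * B^2"
 have pw: "2 * tau * sgm * \<bar>I2 x + w x * v x * S x\<bar> <= k * e x + (1/8) * (S x)^2" for x
 proof -
  define m where "m = \<bar>v x\<bar> * norm (V x)"
  have n0: "n >= 0" by (simp add: n_def)
  have 1: "\<bar>w' x \<bullet> (a x *v V x)\<bar> <= (B * kd * CA / eps) * norm (V x)"
  proof -
   have "\<bar>w' x \<bullet> (a x *v V x)\<bar> <= norm (a x) * norm (w' x) * norm (V x)" by (rule inner_matrix_le)
   also have "... <= CA * (B * kd / eps) * norm (V x)"
    using norm_Am[of eps x] w'B[of x] CA_nonneg by (intro mult_right_mono mult_mono) (auto simp: a_def)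
   finally show ?thesis by (simp add: mult_ac)
  qed
  have 2: "\<bar>w x * (beta (Gm eps x) \<bullet> V x)\<bar> <= B * (n * CG) * norm (V x)"
  proof -
   have "norm (beta (Gm eps x)) <= n * CG"
    using order_trans[OF norm_beta_le[of "Gm eps x"] mult_left_mono[OF norm_Gm[of eps x], of "real CARD('n)"]] n0 by (simp add: n_def)
   then have "\<bar>beta (Gm eps x) \<bullet> V x\<bar> <= n * CG * norm (V x)"
    using order_trans[OF cauchy_schwarz mult_right_mono[OF _ norm_ge_zero[of "V x"]]] by blast
   then show ?thesis unfolding abs_mult using mult_mono[OF wB[of x], of "\<bar>beta (Gm eps x) \<bullet> V x\<bar>" "n * CG * norm (V x)"] B0 by (simp add: mult_ac)
  qed
  have "\<bar>w' x \<bullet> (a x *v V x) + w x * (beta (Gm eps x) \<bullet> V x)\<bar> <= (B * kd * CA / eps + B * (n * CG)) * norm (V x)"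
   using 1 2 abs_triangle_ineq[of "w' x \<bullet> (a x *v V x)" "w x * (beta (Gm eps x) \<bullet> V x)"] unfolding distrib_right by linarith
  then have I2: "\<bar>I2 x\<bar> <= (B * kd * CA / eps + B * (n * CG)) * m"
   unfolding I2_def abs_mult m_def using mult_left_mono[OF _ abs_ge_zero[of "v x"]] by (metis mult.left_commute)
  have k0: "0 <= B * kd * CA / eps + B * (n * CG)" using B0 kd0 CA_nonneg CG_nonneg n0 eps by (intro add_nonneg_nonneg) auto
  have A: "2 * tau * sgm * \<bar>I2 x\<bar> <= sgm * (B * kd * CA / eps + B * (n * CG)) * e x"
  proof -
   have "2 * tau * sgm * \<bar>I2 x\<bar> <= 2 * tau * sgm * ((B * kd * CA / eps + B * (n * CG)) * m)" using I2 tau sgm by (intro mult_left_mono) auto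
   also have "... = sgm * (B * kd * CA / eps + B * (n * CG)) * (2 * tau * m)" by (simp only: mult_ac)
   also have "... <= sgm * (B * kd * CA / eps + B * (n * CG)) * e x"
    unfolding m_def e_def using product_le_energy[of tau v x V] tau sgm k0 by (intro mult_left_mono) auto
   finally show ?thesis .
  qed
  have Bb: "2 * tau * sgm * \<bar>w x * v x * S x\<bar> <= 8 * sgm^2 * B^2 * e x + (1/8) * (S x)^2"
  proof -
   have "\<bar>w x * v x * S x\<bar> <= B * \<bar>v x\<bar> * \<bar>S x\<bar>" unfolding abs_mult by (intro mult_right_mono wB) auto
   then have "2 * tau * sgm * \<bar>w x * v x * S x\<bar> <= 2 * tau * sgm * (B * \<bar>v x\<bar> * \<bar>S x\<bar>)" using tau sgm by (intro mult_left_mono) auto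
   also have "... = 2 * (sgm * B * (tau * \<bar>v x\<bar>)) * \<bar>S x\<bar>" by (simp only: mult_ac)
   also have "... <= 8 * (sgm * B * (tau * \<bar>v x\<bar>))^2 + (1/8) * (\<bar>S x\<bar>)^2"
   proof -
    have "0 <= (8 * y - s)^2" for y s :: real by simp
    then have "2 * y * s <= 8 * y^2 + (1/8) * s^2" for y s :: real
     using \<open>!!s y. 0 <= (8 * y - s)^2\<close>[of y s] by (simp add: power2_eq_square algebra_simps)
    then show ?thesis .
   qed
   also have "(sgm * B * (tau * \<bar>v x\<bar>))^2 = sgm^2 * B^2 * (tau * v x)^2" by (simp add: power_mult_distrib)
   also have "8 * (sgm^2 * B^2 * (tau * v x)^2) <= 8 * (sgm^2 * B^2 * e x)"
    by (intro mult_left_mono) (auto simp: e_def energy_def)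
   finally show ?thesis by (simp add: mult.assoc)
  qed
  have "2 * tau * sgm * \<bar>I2 x + w x * v x * S x\<bar> <= 2 * tau * sgm * (\<bar>I2 x\<bar> + \<bar>w x * v x * S x\<bar>)" using tau sgm by (intro mult_left_mono abs_triangle_ineq) auto
  also have "... <= k * e x + (1/8) * (S x)^2" using A Bb unfolding k_def by (simp add: distrib_left distrib_right)
  finally show ?thesis .
 qed
 have "(LI x. w x * (V x \<bullet> (a x *v V x) - q x * (tau * v x)^2)) = - (LI x. I2 x + w x * v x * S x)"
  unfolding split using i1 i2 i3 ibp by simp
 then have "2 * tau * sgm * \<bar>LI x. w x * (V x \<bullet> (a x *v V x) - q x * (tau * v x)^2)\<bar> = 2 * tau * sgm * \<bar>LI x. I2 x + w x * v x * S x\<bar>" by simp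
 also have "... <= 2 * tau * sgm * (LI x. \<bar>I2 x + w x * v x * S x\<bar>)" using tau sgm by (intro mult_left_mono integral_abs_bound) auto
 also have "... = (LI x. 2 * tau * sgm * \<bar>I2 x + w x * v x * S x\<bar>)" by simp
 also have "... <= (LI x. k * e x + (1/8) * (S x)^2)"
  by (rule integral_mono) (use i2 i3 ie pw in auto)
 also have "... = k * (LI x. e x) + (1/8) * (LI x. (S x)^2)" using ie by simp
 finally show "2 * tau * sgm * \<bar>LI x. moll bump eps b x * (V x \<bullet> (Am eps x *v V x) - (p x \<bullet> (Am eps x *v p x)) * (tau * v x)^2)\<bar>
   <= (sgm * (B * dbump_mass TYPE('n) * CA / eps + B * (real CARD('n) * CG)) + 8 * sgm^2 * B^2) * (LI x. energy tau v V x)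
    + (1/8) * (LI x. (Sop tau (Am eps) v Hv x)^2)"
  unfolding w_def a_def q_def S_def e_def k_def kd_def n_def .
qed

text \<open>Pointwise comparison of \<open>u\<close> with \<open>v\<close>. In the last inequality \<open>A\<close> is replaced by
its average, with error \<open>L eps |D^2 u|\<close>.\<close>

lemma conjugation_bounds:
 fixes u :: "real^'n => real" and U :: "real^'n => real^'n" and N :: "real^'n => real^'n^'n"
 assumes x: "x \<in> Om" and tau: "tau >= 1" and eps: "eps > 0"
 defines "v \<equiv> conj_fun tau u" and "V \<equiv> conj_grad tau u U" and "Hv \<equiv> conj_hess tau u U N" and "rho \<equiv> exp (2 * tau * phi x)"
  and "P \<equiv> \<bar>Cp\<bar>"
 defines "e \<equiv> energy tau v V x"
 shows "rho * (norm (U x))^2 <= 2 * (1 + P^2) * e"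
  and "rho * ((Am eps x \<bullet> N x)^2 + (tau * norm (U x))^2) <= 3 * (Sop tau (Am eps) v Hv x)^2 + (15 * (CA * P)^2 + 2 * (1 + P^2)) * (tau^2 * e)"
  and "(norm (Hv x))^2 <= 4 * (rho * (norm (N x))^2) + (32 * (P^2 * (1 + P^2)) + 4 * P^2 + 4 * P^4) * (tau^2 * e)"
  and "(Sop tau (Am eps) v Hv x + Top tau (Am eps) V x)^2 <= 2 * (rho * (A x \<bullet> N x + beta (G x) \<bullet> U x)^2)
    + 6 * L^2 * (eps^2 * (rho * (norm (N x))^2)) + (6 * (CA * P)^2 + 12 * (real CARD('n) * CG)^2 * (1 + P^2)) * e"
proof -
 have cl: "x \<in> closure Om" using x closure_subset by blast
 define E where "E = exp (tau * phi x)"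
 have E: "E > 0" "E^2 = rho" by (simp_all add: E_def rho_def power2_eq_square exp_add[symmetric])
 define a where "a = Am eps x"
 define UU where "UU = E *. U x"
 define NN where "NN = E *. N x"
 define S where "S = Sop tau (Am eps) v Hv x"
 define TT where "TT = Top tau (Am eps) V x"
 have P: "norm (p x) <= P" "norm (H x) <= P" "P >= 0" using pH_bound[OF cl] by (auto simp: P_def)
 have na: "norm a <= CA" unfolding a_def by (rule norm_Am)
 have sa: "transpose a = a" unfolding a_def using mollified_coefficients[OF eps] by (simp add: differentiable_coefficients_def)
 have tau2: "1 <= tau^2" using tau by (simp add: one_le_power)
 have vx: "v x = E * u x" by (simp add: v_def conj_fun_def E_def)
 have Vx: "V x = UU + (tau * v x) *. p x" by (simp add: V_def conj_grad_def UU_def vx E_def scaleR_add_right mult_ac)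
 have Hx: "Hv x = NN + tau *. (outer (p x) UU + outer UU (p x)) + (tau * v x) *. H x + (tau^2 * v x) *. outer (p x) (p x)"
  by (simp add: Hv_def conj_hess_def NN_def UU_def vx E_def scaleR_add_right outer_scaleR mult_ac)
 have e: "e = (norm (V x))^2 + (tau * v x)^2" by (simp add: e_def energy_def)
 have e0: "0 <= e" "(norm (V x))^2 <= e" "(tau * v x)^2 <= e" by (simp_all add: e)
 have taue: "e <= tau^2 * e" using mult_right_mono[OF tau2 e0(1)] by simp
 have nU: "(norm UU)^2 <= 2 * (1 + P^2) * e"
 proof -
  have "UU = V x - (tau * v x) *. p x" by (simp add: Vx)
  then have "norm UU <= norm (V x) + \<bar>tau * v x\<bar> * norm (p x)" using norm_triangle_ineq4[of "V x" "(tau * v x) *. p x"] by (simp add: abs_mult)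
  also have "... <= norm (V x) + \<bar>tau * v x\<bar> * P" using P by (intro add_mono mult_left_mono) auto
  finally have "(norm UU)^2 <= (norm (V x) + \<bar>tau * v x\<bar> * P)^2" by (intro power_mono) auto
  also have "... <= 2 * (norm (V x))^2 + 2 * (\<bar>tau * v x\<bar> * P)^2" by (rule square_sum_le)
  also have "... = 2 * (norm (V x))^2 + 2 * P^2 * (tau * v x)^2" by (simp only: power_mult_distrib power2_abs mult_ac)
  also have "... <= 2 * e + 2 * P^2 * e" using e0 by (intro add_mono mult_left_mono) auto
  finally show ?thesis by (simp add: algebra_simps)
 qed
 show 1: "rho * (norm (U x))^2 <= 2 * (1 + P^2) * e" using nU E by (simp add: UU_def power_mult_distrib)
 have aN: "E * (a \<bullet> N x) = S + TT - tau * v x * (a \<bullet> H x)"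
 proof -
  have c: "UU \<bullet> (a *v p x) = p x \<bullet> (a *v UU)" using sym_matrix_inner[OF sa, of UU "p x"] by (simp add: inner_commute)
  have "E * (a \<bullet> N x) = a \<bullet> NN" by (simp add: NN_def)
  moreover have "S = a \<bullet> NN + 2 * tau * (p x \<bullet> (a *v UU)) + tau * v x * (a \<bullet> H x) + 2 * (tau^2 * v x * (p x \<bullet> (a *v p x)))"
   unfolding S_def Sop_def a_def[symmetric] Hx by (simp add: inner_add_right inner_outer c algebra_simps)
  moreover have "TT = - 2 * tau * (p x \<bullet> (a *v UU)) - 2 * (tau^2 * v x * (p x \<bullet> (a *v p x)))"
   unfolding TT_def Top_def a_def[symmetric] Vx by (simp add: matrix_vector_right_distrib matrix_scaleR_right inner_add_right power2_eq_square algebra_simps)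
  ultimately show ?thesis by simp
 qed
 have aH: "(tau * v x * (a \<bullet> H x))^2 <= (CA * P)^2 * e"
 proof -
  have "\<bar>a \<bullet> H x\<bar> <= CA * P" using cauchy_schwarz[of a "H x"] mult_mono[OF na P(2)] CA_nonneg by fastforce
  then have "(a \<bullet> H x)^2 <= (CA * P)^2" using power_mono[of "\<bar>a \<bullet> H x\<bar>" "CA * P" 2] by simp
  then have "(tau * v x)^2 * (a \<bullet> H x)^2 <= e * (CA * P)^2" using e0 by (intro mult_mono) auto
  then show ?thesis by (simp only: power_mult_distrib mult_ac)
 qed
 have TTb: "TT^2 <= 4 * (CA * P)^2 * (tau^2 * e)"
 proof -
  have "\<bar>p x \<bullet> (a *v V x)\<bar> <= norm a * norm (p x) * norm (V x)" by (rule inner_matrix_le)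
  also have "... <= CA * P * norm (V x)" using na P CA_nonneg by (intro mult_right_mono mult_mono) auto
  finally have "\<bar>p x \<bullet> (a *v V x)\<bar>^2 <= (CA * P * norm (V x))^2" by (intro power_mono) auto
  then have "(p x \<bullet> (a *v V x))^2 <= (CA * P)^2 * (norm (V x))^2" by (simp add: power_mult_distrib)
  also have "... <= (CA * P)^2 * e" using e0 by (intro mult_left_mono) auto
  finally have "4 * tau^2 * (p x \<bullet> (a *v V x))^2 <= 4 * tau^2 * ((CA * P)^2 * e)" by (intro mult_left_mono) auto
  moreover have "TT^2 = 4 * tau^2 * (p x \<bullet> (a *v V x))^2" by (simp add: TT_def Top_def a_def power_mult_distrib)
  ultimately show ?thesis by (simp add: mult_ac)
 qed
 have cap: "0 <= (CA * P)^2" by simp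
 show "rho * ((Am eps x \<bullet> N x)^2 + (tau * norm (U x))^2) <= 3 * (Sop tau (Am eps) v Hv x)^2 + (15 * (CA * P)^2 + 2 * (1 + P^2)) * (tau^2 * e)"
 proof -
  have "(S + TT - tau * v x * (a \<bullet> H x))^2 <= (S + TT + (- (tau * v x * (a \<bullet> H x))))^2" by simp
  also have "... <= 3 * S^2 + 3 * TT^2 + 3 * (- (tau * v x * (a \<bullet> H x)))^2" by (rule square_sum_le)
  finally have h: "(S + TT - tau * v x * (a \<bullet> H x))^2 <= 3 * S^2 + 3 * TT^2 + 3 * (tau * v x * (a \<bullet> H x))^2" by simp
  have "rho * ((Am eps x \<bullet> N x)^2 + (tau * norm (U x))^2) = (E * (a \<bullet> N x))^2 + tau^2 * (rho * (norm (U x))^2)"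
   unfolding E(2)[symmetric] a_def by (simp add: power_mult_distrib algebra_simps)
  also have "... <= 3 * S^2 + 3 * TT^2 + 3 * (tau * v x * (a \<bullet> H x))^2 + tau^2 * (2 * (1 + P^2) * e)"
   unfolding aN using h mult_left_mono[OF 1, of "tau^2"] by simp
  finally have m: "rho * ((Am eps x \<bullet> N x)^2 + (tau * norm (U x))^2) <= ..." .
  have "(tau * v x * (a \<bullet> H x))^2 <= (CA * P)^2 * (tau^2 * e)" using aH mult_left_mono[OF taue cap] by linarith
  with m TTb have "rho * ((Am eps x \<bullet> N x)^2 + (tau * norm (U x))^2) <= 3 * S^2 + 3 * (4 * (CA * P)^2 * (tau^2 * e)) + 3 * ((CA * P)^2 * (tau^2 * e)) + tau^2 * (2 * (1 + P^2) * e)" by linarith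
  also have "... = 3 * S^2 + (15 * (CA * P)^2 + 2 * (1 + P^2)) * (tau^2 * e)" by algebra
  finally show ?thesis by (simp add: S_def)
 qed
 show "(norm (Hv x))^2 <= 4 * (rho * (norm (N x))^2) + (32 * (P^2 * (1 + P^2)) + 4 * P^2 + 4 * P^4) * (tau^2 * e)"
 proof -
  have "norm (Hv x) <= norm NN + norm (tau *. (outer (p x) UU + outer UU (p x))) + norm ((tau * v x) *. H x) + norm ((tau^2 * v x) *. outer (p x) (p x))"
   unfolding Hx by (intro order_trans[OF norm_triangle_ineq] add_right_mono order_refl)
  also have "norm (tau *. (outer (p x) UU + outer UU (p x))) <= 2 * tau * (P * norm UU)"
  proof -
   have "norm (outer (p x) UU + outer UU (p x)) <= P * norm UU + P * norm UU"
    by (rule order_trans[OF norm_triangle_ineq]) (auto intro!: add_mono mult_right_mono P simp: norm_outer mult.commute[of "norm UU"])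
   then have "tau * norm (outer (p x) UU + outer UU (p x)) <= tau * (P * norm UU + P * norm UU)" using tau by (intro mult_left_mono) auto
   then show ?thesis using tau by simp
  qed
  also have "norm ((tau * v x) *. H x) <= \<bar>tau * v x\<bar> * P" unfolding norm_scaleR by (intro mult_left_mono P) auto
  also have "norm ((tau^2 * v x) *. outer (p x) (p x)) <= (tau * \<bar>tau * v x\<bar>) * P^2"
  proof -
   have "norm (p x) * norm (p x) <= P^2" using mult_mono[OF P(1) P(1)] P by (simp add: power2_eq_square)
   then have "\<bar>tau^2 * v x\<bar> * (norm (p x) * norm (p x)) <= \<bar>tau^2 * v x\<bar> * P^2" by (intro mult_left_mono) auto
   moreover have "\<bar>tau^2 * v x\<bar> = tau * \<bar>tau * v x\<bar>" using tau by (simp add: abs_mult power2_eq_square)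
   ultimately show ?thesis by (simp add: norm_outer)
  qed
  finally have "norm (Hv x) <= norm NN + 2 * tau * (P * norm UU) + \<bar>tau * v x\<bar> * P + (tau * \<bar>tau * v x\<bar>) * P^2" by simp
  then have "(norm (Hv x))^2 <= (norm NN + 2 * tau * (P * norm UU) + \<bar>tau * v x\<bar> * P + (tau * \<bar>tau * v x\<bar>) * P^2)^2" by (intro power_mono) auto
  also have "... <= 4 * (norm NN)^2 + 4 * (2 * tau * (P * norm UU))^2 + 4 * (\<bar>tau * v x\<bar> * P)^2 + 4 * ((tau * \<bar>tau * v x\<bar>) * P^2)^2" by (rule square_sum_le)
  also have "(2 * tau * (P * norm UU))^2 = 4 * P^2 * tau^2 * (norm UU)^2" by (simp add: power_mult_distrib mult_ac)
  also have "(\<bar>tau * v x\<bar> * P)^2 = P^2 * (tau * v x)^2" by (simp only: power_mult_distrib power2_abs mult_ac)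
  also have "((tau * \<bar>tau * v x\<bar>) * P^2)^2 = P^4 * tau^2 * (tau * v x)^2" by (simp add: power_mult_distrib mult_ac abs_mult)
  also have "4 * P^2 * tau^2 * (norm UU)^2 <= 4 * P^2 * tau^2 * (2 * (1 + P^2) * e)" by (intro mult_left_mono nU) auto
  also have "P^2 * (tau * v x)^2 <= P^2 * (tau^2 * e)" using e0 taue by (intro mult_left_mono) auto
  also have "P^4 * tau^2 * (tau * v x)^2 <= P^4 * tau^2 * e" using e0 by (intro mult_left_mono) auto
  finally have "(norm (Hv x))^2 <= 4 * (norm NN)^2 + 4 * (4 * P^2 * tau^2 * (2 * (1 + P^2) * e)) + 4 * (P^2 * (tau^2 * e)) + 4 * (P^4 * tau^2 * e)" by simp
  moreover have "(norm NN)^2 = rho * (norm (N x))^2" using E by (simp add: NN_def power_mult_distrib)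
  moreover have "4 * (4 * P^2 * tau^2 * (2 * (1 + P^2) * e)) + 4 * (P^2 * (tau^2 * e)) + 4 * (P^4 * tau^2 * e) = (32 * (P^2 * (1 + P^2)) + 4 * P^2 + 4 * P^4) * (tau^2 * e)"
   by algebra
  ultimately show ?thesis by linarith
 qed
 show "(Sop tau (Am eps) v Hv x + Top tau (Am eps) V x)^2 <= 2 * (rho * (A x \<bullet> N x + beta (G x) \<bullet> U x)^2)
    + 6 * L^2 * (eps^2 * (rho * (norm (N x))^2)) + (6 * (CA * P)^2 + 12 * (real CARD('n) * CG)^2 * (1 + P^2)) * e"
 proof -
  define f where "f = E * (A x \<bullet> N x + beta (G x) \<bullet> U x)"
  define y1 where "y1 = tau * v x * (a \<bullet> H x)"
  define y2 where "y2 = (a - A x) \<bullet> NN"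
  define y3 where "y3 = - (beta (G x) \<bullet> UU)"
  have "S + TT = f + (y1 + y2 + y3)"
   using aN unfolding f_def y1_def y2_def y3_def NN_def UU_def by (simp add: inner_diff_left algebra_simps)
  then have "(S + TT)^2 <= 2 * f^2 + 2 * (y1 + y2 + y3)^2" using square_sum_le(1)[of f "y1 + y2 + y3"] by simp
  also have "(y1 + y2 + y3)^2 <= 3 * y1^2 + 3 * y2^2 + 3 * y3^2" by (rule square_sum_le)
  also have "y1^2 <= (CA * P)^2 * e" unfolding y1_def by (rule aH)
  also have "y2^2 <= L^2 * (eps^2 * (rho * (norm (N x))^2))"
  proof -
   have "\<bar>y2\<bar> <= norm (a - A x) * norm NN" unfolding y2_def by (rule cauchy_schwarz)
   also have "... <= L * eps * norm NN" using Am_close[OF eps, of x] by (intro mult_right_mono) (auto simp: a_def)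
   finally have "\<bar>y2\<bar>^2 <= (L * eps * norm NN)^2" by (intro power_mono) auto
   then show ?thesis using E by (simp add: NN_def power_mult_distrib mult_ac)
  qed
  also have "y3^2 <= (real CARD('n) * CG)^2 * (2 * (1 + P^2) * e)"
  proof -
   have "norm (beta (G x)) <= real CARD('n) * CG"
    using order_trans[OF norm_beta_le[of "G x"] mult_left_mono[OF normG[of x], of "real CARD('n)"]] by simp
   then have "\<bar>y3\<bar> <= real CARD('n) * CG * norm UU"
    unfolding y3_def abs_minus using order_trans[OF cauchy_schwarz mult_right_mono[OF _ norm_ge_zero[of UU]]] by blast
   then have "\<bar>y3\<bar>^2 <= (real CARD('n) * CG * norm UU)^2" by (intro power_mono) auto
   then have "y3^2 <= (real CARD('n) * CG)^2 * (norm UU)^2" by (simp add: power_mult_distrib)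
   also have "... <= (real CARD('n) * CG)^2 * (2 * (1 + P^2) * e)" by (intro mult_left_mono nU) auto
   finally show ?thesis .
  qed
  finally have r: "(S + TT)^2 <= 2 * f^2 + 2 * (3 * ((CA * P)^2 * e) + 3 * (L^2 * (eps^2 * (rho * (norm (N x))^2))) + 3 * ((real CARD('n) * CG)^2 * (2 * (1 + P^2) * e)))" by simp
  moreover have "f^2 = rho * (A x \<bullet> N x + beta (G x) \<bullet> U x)^2" unfolding f_def power_mult_distrib E(2) ..
  moreover have "2 * (3 * ((CA * P)^2 * e) + 3 * (L^2 * (eps^2 * (rho * (norm (N x))^2))) + 3 * ((real CARD('n) * CG)^2 * (2 * (1 + P^2) * e)))
    = 6 * L^2 * (eps^2 * (rho * (norm (N x))^2)) + (6 * (CA * P)^2 + 12 * (real CARD('n) * CG)^2 * (1 + P^2)) * e" by algebra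
  ultimately show ?thesis unfolding S_def TT_def by linarith
 qed
qed

abbreviation tot_energy :: "real => (real^'n => real) => (real^'n => real^'n) => real"
 where "tot_energy tau u U == LI x. energy tau (conj_fun tau u) (conj_grad tau u U) x"
abbreviation tot_sym :: "real => real => (real^'n => real) => (real^'n => real^'n) => (real^'n => real^'n^'n) => real"
 where "tot_sym eps tau u U N == LI x. (Sop tau (Am eps) (conj_fun tau u) (conj_hess tau u U N) x)^2"

lemma laplacian_square_integrable:
 assumes c3: "c3_compact_support u U N T K" and KOm: "K <= Om"
 shows "integrable lborel (%x. exp (2 * tau * phi x) * (A x \<bullet> N x + beta (G x) \<bullet> U x)^2)"
proof -
 interpret c3_compact_support u U N T K by fact
 note ci = on_UNIV[OF cU] on_UNIV[OF cN] cphi_dom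
 define rho where "rho x = exp (2 * tau * phi x)" for x
 define f where "f x = A x \<bullet> N x + beta (G x) \<bullet> U x" for x
 have iF: "integrable lborel (%x. rho x * (f x)^2)"
 proof (rule Bochner_Integration.integrable_bound)
  let ?b = "%x. 2 * (CA^2 * (rho x * (norm (N x))^2)) + 2 * ((real CARD('n) * CG)^2 * (rho x * (norm (U x))^2))"
  show "integrable lborel ?b" unfolding rho_def
   by (rule integrable_supported[OF K KOm]) (use zero in "auto intro!: continuous_intros ci")
  have cEN: "continuous_on UNIV (%x. exp (tau * phi x) *. N x)" "continuous_on UNIV (%x. exp (tau * phi x) *. U x)"
   by (rule continuous_extension_by_zero[OF open_dom K KOm]; use zero in "auto intro!: continuous_intros ci")+
  have [measurable]: "(%x. exp (tau * phi x) *. N x) \<in> borel_fun" "(%x. exp (tau * phi x) *. U x) \<in> borel_fun"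
   by (rule borel_cont[OF cEN(1)], rule borel_cont[OF cEN(2)])
  have cb: "continuous_on UNIV (beta :: real^'n^'n^'n => real^'n)" using continuous_on_beta[OF continuous_on_id, of UNIV] by simp
  have [measurable]: "(%x. beta (G x)) \<in> borel_fun"
   by (rule borel_measurable_continuous_on[OF cb G_borel])
  have eqf: "rho x * (f x)^2 = (A x \<bullet> (exp (tau * phi x) *. N x) + beta (G x) \<bullet> (exp (tau * phi x) *. U x))^2" for x
  proof -
   have "rho x = (exp (tau * phi x))^2" by (simp add: rho_def power2_eq_square exp_add[symmetric])
   then show ?thesis by (simp add: f_def power_mult_distrib[symmetric] distrib_left)
  qed
  show "(%x. rho x * (f x)^2) \<in> borel_measurable lborel" unfolding eqf by measurable
  show "AE x in lborel. norm (rho x * (f x)^2) <= norm (?b x)"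
  proof (rule AE_I2)
   fix x
   have "\<bar>A x \<bullet> N x\<bar> <= CA * norm (N x)" using order_trans[OF cauchy_schwarz mult_right_mono[OF normA norm_ge_zero]] .
   then have 1: "(A x \<bullet> N x)^2 <= CA^2 * (norm (N x))^2" using power_mono[of "\<bar>A x \<bullet> N x\<bar>" "CA * norm (N x)" 2] by (simp add: power_mult_distrib)
   have "norm (beta (G x)) <= real CARD('n) * CG"
    using order_trans[OF norm_beta_le[of "G x"] mult_left_mono[OF normG[of x], of "real CARD('n)"]] by simp
   then have "\<bar>beta (G x) \<bullet> U x\<bar> <= real CARD('n) * CG * norm (U x)"
    using order_trans[OF cauchy_schwarz mult_right_mono[OF _ norm_ge_zero[of "U x"]]] by blast
   then have 2: "(beta (G x) \<bullet> U x)^2 <= (real CARD('n) * CG)^2 * (norm (U x))^2" using power_mono[of "\<bar>beta (G x) \<bullet> U x\<bar>" "real CARD('n) * CG * norm (U x)" 2] by (simp add: power_mult_distrib)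
   have "(f x)^2 <= 2 * (CA^2 * (norm (N x))^2) + 2 * ((real CARD('n) * CG)^2 * (norm (U x))^2)"
    using square_sum_le(1)[of "A x \<bullet> N x" "beta (G x) \<bullet> U x"] 1 2 unfolding f_def by linarith
   then have "rho x * (f x)^2 <= rho x * (2 * (CA^2 * (norm (N x))^2) + 2 * ((real CARD('n) * CG)^2 * (norm (U x))^2))"
    by (intro mult_left_mono) (auto simp: rho_def)
   also have "... = ?b x" by (simp add: distrib_left mult_ac)
   finally have "rho x * (f x)^2 <= ?b x" .
   moreover have "0 <= rho x * (f x)^2" by (simp add: rho_def)
   ultimately show "norm (rho x * (f x)^2) <= norm (?b x)" by (simp only: real_norm_def)
  qed
 qed
 then show ?thesis by (simp add: rho_def f_def)
qed

lemma integrated_conjugation_bounds: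
 "\<exists>C\<ge>0. \<forall>eps tau u U N T K. eps > 0 --> tau >= 1 --> c3_compact_support u U N T K --> K <= Om -->
   (LI x. exp (2 * tau * phi x) * ((norm (U x))^2 + tau^2 * (u x)^2)) <= C * tot_energy tau u U &
   (LI x. (norm (conj_hess tau u U N x))^2) <= C * (tot_sym eps tau u U N
     + tau^2 * tot_energy tau u U) &
   (LI x. (Sop tau (Am eps) (conj_fun tau u) (conj_hess tau u U N) x + Top tau (Am eps) (conj_grad tau u U) x)^2)
    <= 2 * (LI x. exp (2 * tau * phi x) * (A x \<bullet> N x + beta (G x) \<bullet> U x)^2)
     + C * (eps^2 * (tot_sym eps tau u U N
     + tau^2 * tot_energy tau u U) + tot_energy tau u U)"
proof -
 obtain Ch where Ch: "Ch >= 0" "!!a G u U N T K tau. differentiable_coefficients a G ==> (\<forall>x xi. cA * (xi \<bullet> xi) <= xi \<bullet> (a x *v xi)) ==>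
   (\<forall>x. norm (a x) <= CA) ==> (\<forall>x. norm (G x) <= CG) ==> c3_compact_support u U N T K ==> K <= Om ==> tau >= 1 ==>
   (LI x. exp (2 * tau * phi x) * (norm (N x))^2) <= Ch * (LI x. exp (2 * tau * phi x) * ((a x \<bullet> N x)^2 + (tau * norm (U x))^2))"
  using hessian_estimate[of CG] by meson
 define P where "P = \<bar>Cp\<bar>"
 define k0 where "k0 = 2 * (1 + P^2)"
 define k1 where "k1 = 15 * (CA * P)^2 + 2 * (1 + P^2)"
 define k2 where "k2 = 32 * (P^2 * (1 + P^2)) + 4 * P^2 + 4 * P^4"
 define k3 where "k3 = 6 * (CA * P)^2 + 12 * (real CARD('n) * CG)^2 * (1 + P^2)"
 have kpos: "k0 >= 0" "k1 >= 0" "k2 >= 0" "k3 >= 0"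
  unfolding k0_def k1_def k2_def k3_def by (auto intro!: add_nonneg_nonneg mult_nonneg_nonneg simp: P_def)
 define Cn where "Cn = Ch * (3 + k1)"
 define C where "C = (k0 + 1) + (4 * Cn + k2) + (6 * L^2 * Cn + k3)"
 have Cn: "Cn >= 0" using Ch kpos by (simp add: Cn_def)
 have C: "C >= 0" "k0 + 1 <= C" "4 * Cn + k2 <= C" "6 * L^2 * Cn <= C" "k3 <= C"
  unfolding C_def using kpos Cn by (auto intro!: add_nonneg_nonneg mult_nonneg_nonneg)
 show ?thesis
 proof (intro exI[of _ C] conjI C(1) allI impI)
  fix eps tau :: real and u :: "real^'n => real" and U N T K
  assume eps: "eps > 0" and tau: "tau >= 1" and c3: "c3_compact_support u U N T K" and KOm: "K <= Om"
  define v where "v = conj_fun tau u"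
  define V where "V = conj_grad tau u U"
  define Hv where "Hv = conj_hess tau u U N"
  have c2: "c2_compact_support v V Hv K" unfolding v_def V_def Hv_def by (rule conjugated_compact_support[OF c3 KOm])
  interpret differentiable_coefficients "Am eps" "Gm eps" by (rule mollified_coefficients[OF eps])
  interpret c3_compact_support u U N T K by fact
  interpret c2: c2_compact_support v V Hv K by fact
  note ci = on_UNIV[OF cu] on_UNIV[OF cU] on_UNIV[OF cont_a]
   on_UNIV[OF cN] continuous_on_subset[OF cp_on cl] continuous_on_subset[OF cH_on cl] cphi_dom
  define rho where "rho x = exp (2 * tau * phi x)" for x
  define e where "e = energy tau v V"
  define S where "S = Sop tau (Am eps) v Hv"
  define X where "X x = S x + Top tau (Am eps) V x" for x
  define f where "f x = A x \<bullet> N x + beta (G x) \<bullet> U x" for x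
  have ie: "integrable lborel e" "integrable lborel (%x. (S x)^2)" "integrable lborel (%x. (X x)^2)" "integrable lborel (%x. (norm (Hv x))^2)"
   unfolding e_def S_def X_def using energy_integrals[OF c2 KOm cont_a] by auto
  have iU: "integrable lborel (%x. rho x * ((norm (U x))^2 + tau^2 * (u x)^2))" unfolding rho_def
   by (rule integrable_supported[OF K KOm]) (use zero in "auto intro!: continuous_intros ci")
  have iN: "integrable lborel (%x. rho x * (norm (N x))^2)" unfolding rho_def
   by (rule integrable_supported[OF K KOm]) (use zero in "auto intro!: continuous_intros ci")
  have iB: "integrable lborel (%x. rho x * ((Am eps x \<bullet> N x)^2 + (tau * norm (U x))^2))" unfolding rho_def
   by (rule integrable_supported[OF K KOm]) (use zero in "auto intro!: continuous_intros ci")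
  have iF: "integrable lborel (%x. rho x * (f x)^2)" unfolding rho_def f_def by (rule laplacian_square_integrable[OF c3 KOm])
  define En where "En = (LI x. e x)"
  define NS where "NS = (LI x. (S x)^2)"
  define IN where "IN = (LI x. rho x * (norm (N x))^2)"
  have En0: "En >= 0" unfolding En_def by (intro lint_nonneg) (simp add: e_def energy_nonneg)
  have NS0: "NS >= 0" unfolding NS_def by (intro lint_nonneg) simp
  have out: "u x = 0" "U x = 0" "N x = 0" "v x = 0" "V x = 0" "Hv x = 0" if "x ~: Om" for x
   using that KOm zero c2.zero by blast+
  note pw1 = conjugation_bounds(1)[OF _ tau eps, where u = u and U = U, folded v_def V_def P_def, folded e_def]
  note pw = conjugation_bounds(2-4)[OF _ tau eps, where u = u and U = U and N = N, folded v_def V_def Hv_def P_def, folded e_def]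
  have ZZ: "NS + tau^2 * En >= 0" using NS0 En0 by simp
  have IN: "IN <= Cn * (NS + tau^2 * En)"
  proof -
   have "IN <= Ch * (LI x. rho x * ((Am eps x \<bullet> N x)^2 + (tau * norm (U x))^2))" unfolding IN_def rho_def
    by (rule Ch(2)[OF mollified_coefficients[OF eps] _ _ _ c3 KOm tau]) (simp_all add: Am_elliptic norm_Am norm_Gm)
   also have "(LI x. rho x * ((Am eps x \<bullet> N x)^2 + (tau * norm (U x))^2)) <= (LI x. 3 * (S x)^2 + k1 * (tau^2 * e x))"
   proof (rule integral_mono)
    show "rho x * ((Am eps x \<bullet> N x)^2 + (tau * norm (U x))^2) <= 3 * (S x)^2 + k1 * (tau^2 * e x)" for x
    proof (cases "x \<in> Om")
     case True then show ?thesis using pw(1)[OF True] by (simp add: rho_def S_def k1_def e_def)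
    next
     case False then show ?thesis using out[OF False] kpos energy_nonneg by (simp add: e_def)
    qed
   qed (use iB ie in auto)
   also have "... = 3 * NS + k1 * (tau^2 * En)" using ie by (simp add: NS_def En_def)
   also have "... <= (3 + k1) * (NS + tau^2 * En)" using kpos NS0 En0 by (simp add: algebra_simps)
   finally show ?thesis using Ch(1) by (simp add: Cn_def mult.assoc mult_left_mono)
  qed
  show "(LI x. exp (2 * tau * phi x) * ((norm (U x))^2 + tau^2 * (u x)^2)) <= C * tot_energy tau u U"
  proof -
   have "(LI x. rho x * ((norm (U x))^2 + tau^2 * (u x)^2)) <= (LI x. (k0 + 1) * e x)"
   proof (rule integral_mono)
    show "rho x * ((norm (U x))^2 + tau^2 * (u x)^2) <= (k0 + 1) * e x" for x
    proof (cases "x \<in> Om")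
     case True
     have "rho x * (tau^2 * (u x)^2) = (tau * v x)^2"
      by (simp add: rho_def v_def conj_fun_def power_mult_distrib power2_eq_square exp_add[symmetric] mult_ac)
     then have "rho x * (tau^2 * (u x)^2) <= e x" by (simp add: e_def energy_def)
     with pw1[OF True] show ?thesis by (simp add: rho_def k0_def e_def distrib_left distrib_right)
    next
     case False then show ?thesis using out[OF False] kpos energy_nonneg by (simp add: e_def)
    qed
   qed (use iU ie in auto)
   also have "... = (k0 + 1) * En" by (simp add: En_def)
   also have "... <= C * En" using C En0 by (intro mult_right_mono) auto
   finally show ?thesis by (simp add: rho_def En_def e_def v_def V_def)
  qed
  have "(LI x. (norm (Hv x))^2) <= C * (NS + tau^2 * En)"
  proof -
   have "(LI x. (norm (Hv x))^2) <= (LI x. 4 * (rho x * (norm (N x))^2) + k2 * (tau^2 * e x))"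
   proof (rule integral_mono)
    show "(norm (Hv x))^2 <= 4 * (rho x * (norm (N x))^2) + k2 * (tau^2 * e x)" for x
    proof (cases "x \<in> Om")
     case True then show ?thesis using pw(2)[OF True] by (simp add: rho_def k2_def e_def)
    next
     case False then show ?thesis using out[OF False] kpos energy_nonneg by (simp add: e_def)
    qed
   qed (use iN ie in auto)
   also have "... = 4 * IN + k2 * (tau^2 * En)" using iN ie by (simp add: IN_def En_def)
   also have "... <= 4 * (Cn * (NS + tau^2 * En)) + k2 * (NS + tau^2 * En)"
    using IN kpos NS0 by (intro add_mono mult_left_mono) auto
   also have "... = (4 * Cn + k2) * (NS + tau^2 * En)" by (simp add: algebra_simps)
   also have "... <= C * (NS + tau^2 * En)" using C ZZ by (intro mult_right_mono) auto
   finally show ?thesis .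
  qed
  then show "(LI x. (norm (conj_hess tau u U N x))^2) <= C * (tot_sym eps tau u U N
     + tau^2 * tot_energy tau u U)"
   by (simp add: NS_def En_def S_def e_def v_def V_def Hv_def)
  have "(LI x. (X x)^2) <= 2 * (LI x. rho x * (f x)^2) + C * (eps^2 * (NS + tau^2 * En) + En)"
  proof -
   have "(LI x. (X x)^2) <= (LI x. 2 * (rho x * (f x)^2) + 6 * L^2 * (eps^2 * (rho x * (norm (N x))^2)) + k3 * e x)"
   proof (rule integral_mono)
    show "(X x)^2 <= 2 * (rho x * (f x)^2) + 6 * L^2 * (eps^2 * (rho x * (norm (N x))^2)) + k3 * e x" for x
    proof (cases "x \<in> Om")
     case True then show ?thesis using pw(3)[OF True] by (simp add: rho_def k3_def e_def X_def S_def f_def)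
    next
     case False then show ?thesis using out[OF False] kpos energy_nonneg by (simp add: e_def X_def S_def Sop_def Top_def f_def)
    qed
   qed (use iN ie iF in auto)
   also have "... = 2 * (LI x. rho x * (f x)^2) + 6 * L^2 * (eps^2 * IN) + k3 * En" using iN ie iF by (simp add: IN_def En_def)
   also have "... <= 2 * (LI x. rho x * (f x)^2) + (6 * L^2 * Cn) * (eps^2 * (NS + tau^2 * En)) + k3 * En"
   proof -
    have "6 * L^2 * (eps^2 * IN) <= 6 * L^2 * (eps^2 * (Cn * (NS + tau^2 * En)))" using IN by (intro mult_left_mono) auto
    also have "... = (6 * L^2 * Cn) * (eps^2 * (NS + tau^2 * En))" by (simp only: mult_ac)
    finally show ?thesis by simp
   qed
   also have "... <= 2 * (LI x. rho x * (f x)^2) + C * (eps^2 * (NS + tau^2 * En)) + C * En"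
    using C En0 ZZ by (intro add_mono mult_right_mono order_refl) auto
   finally show ?thesis by (simp only: distrib_left add.assoc)
  qed
  then show "(LI x. (Sop tau (Am eps) (conj_fun tau u) (conj_hess tau u U N) x + Top tau (Am eps) (conj_grad tau u U) x)^2)
    <= 2 * (LI x. exp (2 * tau * phi x) * (A x \<bullet> N x + beta (G x) \<bullet> U x)^2)
     + C * (eps^2 * (tot_sym eps tau u U N
     + tau^2 * tot_energy tau u U) + tot_energy tau u U)"
   unfolding X_def S_def NS_def En_def e_def v_def V_def Hv_def rho_def f_def .
 qed
qed

text \<open>The powers of \<open>M / tau\<close> in \<open>mass_near_exterior\<close> beat the factor \<open>tau^3\<close>, even
after the second derivatives are estimated by \<open>S v\<close> and \<open>tau\<close> times the energy.\<close>

lemma exterior_mass_bound: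
 assumes M: "M > 0" and dl: "dl > 0" and C: "C >= 0"
 shows "\<exists>K3\<ge>0. \<exists>tau1\<ge>1. \<forall>tau\<ge>tau1. \<forall>v V Hv K. c2_compact_support v V Hv K --> K <= Om -->
   (LI x. (norm (Hv x))^2) <= C * ((LI x. (Sop tau (Am (M/tau)) v Hv x)^2) + tau^2 * (LI x. energy tau v V x)) -->
   tau^3 * (LI x. ext_density (M/tau) x * (v x)^2) <= dl * tau * (LI x. energy tau v V x)
    + K3 / tau * ((LI x. (Sop tau (Am (M/tau)) v Hv x)^2) + (LI x. energy tau v V x))"
proof -
 obtain CU tau1 where CU: "CU >= 0" "tau1 > 0" and mass: "\<forall>tau\<ge>tau1. \<forall>v V Hv K. c2_compact_support v V Hv K --> K <= Om -->
  (LI x. ext_density (M/tau) x * (v x)^2) <= dl * (LI x. (v x)^2)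
   + CU * ((M/tau)^4 * (LI x. (A x \<bullet> Hv x + tau^2 * kz x * v x)^2) + (M/tau)^6 * (LI x. (norm (Hv x))^2))"
  using mass_near_exterior[OF M dl] by blast
 define P where "P = \<bar>Cp\<bar>"
 define K2 where "K2 = 2 + 4 * L^2 * M^2 * (C + P^4)"
 define K3 where "K3 = CU * (M^4 * K2 + M^6 * C)"
 have K2: "K2 >= 0" using C unfolding K2_def by (intro add_nonneg_nonneg mult_nonneg_nonneg) auto
 have K3: "K3 >= 0" using CU K2 C M unfolding K3_def by (intro add_nonneg_nonneg mult_nonneg_nonneg) auto
 show ?thesis
 proof (rule exI[of _ K3], rule conjI[OF K3], rule exI[of _ "max 1 tau1"], intro conjI allI impI)
  fix tau :: real and v :: "real^'n => real" and V Hv K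
  assume tau: "max 1 tau1 <= tau" and c2: "c2_compact_support v V Hv K" and KOm: "K <= Om"
   and HnC: "(LI x. (norm (Hv x))^2) <= C * ((LI x. (Sop tau (Am (M/tau)) v Hv x)^2) + tau^2 * (LI x. energy tau v V x))"
  have tau1: "tau >= 1" "tau >= tau1" using tau by auto
  define eps where "eps = M / tau"
  have eps: "eps > 0" using M tau1 by (simp add: eps_def)
  interpret differentiable_coefficients "Am eps" "Gm eps" by (rule mollified_coefficients[OF eps])
  interpret c2_compact_support v V Hv K by fact
  note ci = on_UNIV[OF cont_a] on_UNIV[OF cv] on_UNIV[OF cV]
   on_UNIV[OF cHv] continuous_on_subset[OF cp_on cl] on_UNIV[OF cA_on]
  define e where "e = energy tau v V"
  define S where "S = Sop tau (Am eps) v Hv"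
  define En where "En = (LI x. e x)"
  define NS where "NS = (LI x. (S x)^2)"
  define Hn where "Hn = (LI x. (norm (Hv x))^2)"
  define E0 where "E0 = (LI x. (v x)^2)"
  define F where "F = (LI x. (A x \<bullet> Hv x + tau^2 * kz x * v x)^2)"
  define Z where "Z = NS + En"
  have ie: "integrable lborel e" "integrable lborel (%x. (S x)^2)" "integrable lborel (%x. (norm (Hv x))^2)"
   unfolding e_def S_def using energy_integrals[OF c2 KOm cont_a] by auto
  have En0: "En >= 0" unfolding En_def by (intro lint_nonneg) (simp add: e_def energy_nonneg)
  have NS0: "NS >= 0" unfolding NS_def by (intro lint_nonneg) simp
  have tau2: "1 <= tau^2" using tau1 by (simp add: one_le_power)
  have ZB: "NS + tau^2 * En <= tau^2 * Z" "En <= Z" "NS <= Z" "Z >= 0"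
   using mult_right_mono[OF tau2 NS0] NS0 En0 by (auto simp: Z_def distrib_left)
  have Hn: "Hn <= C * (tau^2 * Z)"
   using HnC mult_left_mono[OF ZB(1) C] unfolding Hn_def NS_def En_def S_def e_def eps_def by linarith
  have E0: "tau^2 * E0 <= En"
  proof -
   have "(LI x. (tau * v x)^2) <= En" unfolding En_def
    by (rule integral_mono[OF _ ie(1)]) (use zero K KOm in "auto intro!: integrable_supported continuous_intros ci simp: e_def energy_def")
   then show ?thesis by (simp add: E0_def power_mult_distrib)
  qed
  have F: "F <= K2 * Z"
  proof -
   have "F <= (LI x. 2 * (S x)^2 + 4 * L^2 * eps^2 * ((norm (Hv x))^2 + P^4 * (tau^2 * e x)))" unfolding F_def
   proof (rule integral_mono)
    show "integrable lborel (%x. (A x \<bullet> Hv x + tau^2 * kz x * v x)^2)" unfolding kz_def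
     by (rule integrable_supported[OF K KOm]) (use zero in "auto intro!: continuous_intros ci")
    fix x
    show "(A x \<bullet> Hv x + tau^2 * kz x * v x)^2 <= 2 * (S x)^2 + 4 * L^2 * eps^2 * ((norm (Hv x))^2 + P^4 * (tau^2 * e x))"
    proof (cases "x \<in> Om")
     case True
     define d where "d = A x - Am eps x"
     have nd: "norm d <= L * eps" using Am_close[OF eps, of x] by (simp add: d_def norm_minus_commute)
     have px: "norm (p x) <= P" using pH_bound(1)[of x] True cl by (auto simp: P_def)
     have P0: "P >= 0" by (simp add: P_def)
     define y1 where "y1 = d \<bullet> Hv x"
     define y2 where "y2 = tau^2 * (p x \<bullet> (d *v p x)) * v x"
     have "A x \<bullet> Hv x + tau^2 * kz x * v x = S x + (y1 + y2)"
      unfolding S_def Sop_def kz_def y1_def y2_def d_def by (simp add: inner_diff_left inner_diff_right matrix_vector_mult_diff_rdistrib algebra_simps)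
     then have "(A x \<bullet> Hv x + tau^2 * kz x * v x)^2 <= 2 * (S x)^2 + 2 * (2 * y1^2 + 2 * y2^2)"
      using square_sum_le(1)[of "S x" "y1 + y2"] square_sum_le(1)[of y1 y2] by simp
     moreover have "y1^2 <= L^2 * eps^2 * (norm (Hv x))^2"
     proof -
      have "\<bar>y1\<bar> <= L * eps * norm (Hv x)" unfolding y1_def by (rule order_trans[OF cauchy_schwarz mult_right_mono[OF nd norm_ge_zero]])
      from power_mono[OF this abs_ge_zero, of 2] show ?thesis by (simp add: power_mult_distrib)
     qed
     moreover have "y2^2 <= L^2 * eps^2 * (P^4 * (tau^2 * e x))"
     proof -
      have "\<bar>p x \<bullet> (d *v p x)\<bar> <= norm d * norm (p x) * norm (p x)" by (rule inner_matrix_le)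
      also have "... <= L * eps * P * P" using nd px P0 L_nonneg eps by (intro mult_mono) auto
      finally have "\<bar>p x \<bullet> (d *v p x)\<bar>^2 <= (L * eps * P * P)^2" by (intro power_mono) auto
      moreover have "(L * eps * P * P)^2 = L^2 * eps^2 * P^4" by (simp add: power_mult_distrib mult.assoc power_add[symmetric])
      ultimately have "(p x \<bullet> (d *v p x))^2 <= L^2 * eps^2 * P^4" by simp
      moreover have "(tau * v x)^2 <= e x" by (simp add: e_def energy_def)
      ultimately have "tau^2 * ((p x \<bullet> (d *v p x))^2 * (tau * v x)^2) <= tau^2 * ((L^2 * eps^2 * P^4) * e x)" by (intro mult_left_mono mult_mono) auto
      moreover have "y2^2 = tau^2 * ((p x \<bullet> (d *v p x))^2 * (tau * v x)^2)" unfolding y2_def power_mult_distrib by (simp add: power2_eq_square mult_ac)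
      ultimately show ?thesis by (simp add: mult_ac)
     qed
     ultimately show ?thesis by (simp add: distrib_left)
    next
     case False
     then have "x ~: K" using KOm by blast
     then show ?thesis using zero by (simp add: S_def Sop_def e_def energy_def)
    qed
   qed (use ie in auto)
   also have "... = 2 * NS + 4 * L^2 * eps^2 * (Hn + P^4 * (tau^2 * En))" using ie by (simp add: NS_def Hn_def En_def)
   also have "... <= 2 * Z + 4 * L^2 * eps^2 * (C * (tau^2 * Z) + P^4 * (tau^2 * Z))"
    using Hn ZB by (intro add_mono mult_left_mono) auto
   also have "... = 2 * Z + 4 * L^2 * (eps^2 * tau^2) * (C + P^4) * Z" by (simp add: algebra_simps)
   also have "eps^2 * tau^2 = M^2" using tau1 by (simp add: eps_def power_divide)
   finally show ?thesis by (simp add: K2_def algebra_simps)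
  qed
  have "tau^3 * (LI x. ext_density eps x * (v x)^2) <= tau^3 * (dl * E0 + CU * (eps^4 * F + eps^6 * Hn))"
   using mass[rule_format, OF tau1(2) c2 KOm] tau1(1) unfolding eps_def[symmetric] E0_def F_def Hn_def by (intro mult_left_mono) auto
  also have "... = dl * tau * (tau^2 * E0) + CU * (tau^3 * eps^4 * F + tau^3 * eps^6 * Hn)" by (simp add: algebra_simps power2_eq_square power3_eq_cube)
  also have "tau^3 * eps^4 = M^4 / tau" using tau1 by (simp add: eps_def power_divide field_simps eval_nat_numeral)
  also have "tau^3 * eps^6 = M^6 / tau / tau^2" using tau1 by (simp add: eps_def power_divide field_simps eval_nat_numeral)
  also have "dl * tau * (tau^2 * E0) <= dl * tau * En" using dl tau1 E0 by (intro mult_left_mono) auto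
  also have "CU * (M^4 / tau * F + M^6 / tau / tau^2 * Hn) <= CU * (M^4 / tau * (K2 * Z) + M^6 / tau / tau^2 * (C * (tau^2 * Z)))"
   using CU M tau1 F Hn by (intro mult_left_mono add_mono) auto
  also have "... = K3 / tau * Z" using tau1 by (simp add: K3_def field_simps)
  finally have "tau^3 * (LI x. ext_density eps x * (v x)^2) <= dl * tau * En + K3 / tau * Z" by simp
  then show "tau^3 * (LI x. ext_density (M/tau) x * (v x)^2) <= dl * tau * (LI x. energy tau v V x)
    + K3 / tau * ((LI x. (Sop tau (Am (M/tau)) v Hv x)^2) + (LI x. energy tau v V x))"
   unfolding Z_def NS_def En_def S_def e_def eps_def .
 qed simp
qed

text \<open>Expand \<open>|S v + T v|^2\<close> and insert the commutator identity and the averaged lower bound. The term with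
\<open>Lm\<close> is absorbed by \<open>|T v|^2\<close> as soon as \<open>tau >= Lm\<close>; in the exterior term the
gradient is traded for \<open>tau v\<close> by a second use of \<open>weighted_virial_bound\<close>.\<close>

lemma virial_lower_bound:
 assumes k: "c > 0" "Lm >= 0" "Cw >= 0" "C1 >= 0" and wb: "!!x. norm (wt c1 x) <= Cw"
  and low: "!!x V r. x \<in> Om ==> (c - C1 * ext_density eps x) * ((norm V)^2 + r^2) <= Jw Lm (Am eps x) (p x) (H x) (Gm eps x) (moll bump eps (wt c1) x) V r"
  and eps: "eps > 0" and tau: "tau >= 1" "tau >= Lm" and c2: "c2_compact_support v V Hv K" and KOm: "K <= Om"
 defines "En \<equiv> LI x. energy tau v V x" and "NS \<equiv> LI x. (Sop tau (Am eps) v Hv x)^2"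
  and "kd \<equiv> dbump_mass TYPE('n)" and "n \<equiv> real CARD('n)" and "Kq \<equiv> CA * \<bar>Cp\<bar>^2 / cA + 1"
 shows "(3/4) * NS + (2 * c * tau - (Cw + C1 / cA) * kd * CA / eps - ((Cw + C1 / cA) * (n * CG) + 8 * Cw^2 + 8 * (C1 / cA)^2)) * En
   - 2 * C1 * Kq * (tau^3 * (LI x. ext_density eps x * (v x)^2))
   <= (LI x. (Sop tau (Am eps) v Hv x + Top tau (Am eps) V x)^2)"
proof -
 interpret differentiable_coefficients "Am eps" "Gm eps" by (rule mollified_coefficients[OF eps])
 interpret c2_compact_support v V Hv K by fact
 define S where "S = Sop tau (Am eps) v Hv"
 define T where "T = Top tau (Am eps) V"
 define e where "e = energy tau v V"
 define theta where "theta = ext_density eps"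
 define w where "w = moll bump eps (wt c1)"
 define q where "q x = p x \<bullet> (Am eps x *v p x)" for x
 define R where "R x = V x \<bullet> (Am eps x *v V x) - q x * (tau * v x)^2" for x
 define jj where "jj x = jf (Am eps x) (p x) (H x) (Gm eps x) (V x) (tau * v x)" for x
 define NT where "NT = (LI x. (T x)^2)"
 define J where "J = (LI x. jj x)"
 define W where "W = (LI x. w x * R x)"
 define Wt where "Wt = (LI x. theta x * R x)"
 define Ntheta where "Ntheta = (LI x. theta x * (v x)^2)"
 define TH where "TH = (LI x. theta x * e x)"
 have ie: "integrable lborel e" "integrable lborel (%x. (S x)^2)" "integrable lborel (%x. (T x)^2)"
  unfolding e_def S_def T_def using energy_integrals[OF c2 KOm cont_a] by auto
 have theta01: "0 <= theta x" "theta x <= 1" for x unfolding theta_def by (rule ext_density_range)+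
 have ctheta: "continuous_on UNIV theta" unfolding theta_def by (rule ext_density_continuous[OF eps])
 note ci = on_UNIV[OF cont_a] on_UNIV[OF cv] on_UNIV[OF cV]
   on_UNIV[OF cHv] continuous_on_subset[OF cp_on cl] continuous_on_subset[OF ctheta subset_UNIV]
 have iTH: "integrable lborel (%x. theta x * e x)" unfolding e_def energy_def
  by (rule integrable_supported[OF K KOm]) (use zero in "auto intro!: continuous_intros ci")
 have iNtheta: "integrable lborel (%x. theta x * (v x)^2)"
  by (rule integrable_supported[OF K KOm]) (use zero in "auto intro!: continuous_intros ci")
 note comm = commutator_identity[OF mollified_coefficients[OF eps] c2 KOm, of tau, folded jj_def]
 have ST: "S x * T x = (Am eps x \<bullet> Hv x + tau^2 * (p x \<bullet> (Am eps x *v p x)) * v x) * (- 2 * tau * (p x \<bullet> (Am eps x *v V x)))" for x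
  by (simp only: S_def T_def Sop_def Top_def)
 have iST: "integrable lborel (%x. S x * T x)" unfolding ST by (rule comm(2))
 have STJ: "(LI x. S x * T x) = tau * J" unfolding ST J_def by (rule comm(1))
 have X: "(LI x. (S x + T x)^2) = NS + NT + 2 * tau * J"
 proof -
  have "(LI x. (S x + T x)^2) = (LI x. (S x)^2 + (T x)^2 + 2 * (S x * T x))"
   by (rule Bochner_Integration.integral_cong) (auto simp: power2_sum)
  also have "... = NS + NT + 2 * (tau * J)" using ie iST STJ by (simp add: NS_def NT_def S_def)
  finally show ?thesis by simp
 qed
 note vb1 = weighted_virial_bound[OF wt_borel wb eps tau(1) _ c2 KOm, folded w_def q_def, folded R_def En_def NS_def kd_def n_def]
 note vb2 = weighted_virial_bound[OF exterior_indicator eps tau(1) _ c2 KOm, folded ext_density_def, folded theta_def q_def, folded R_def En_def NS_def kd_def n_def]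
 have iW: "integrable lborel (%x. w x * R x)" by (rule vb1(1)[of 1]) simp
 have iWt: "integrable lborel (%x. theta x * R x)" by (rule vb2(1)[of 1]) simp
 have W: "2 * tau * \<bar>W\<bar> <= (Cw * kd * CA / eps + Cw * (n * CG) + 8 * Cw^2) * En + (1/8) * NS"
  using vb1(2)[of 1] unfolding W_def by simp
 have sig: "C1 / cA >= 0" using k cA by simp
 have Wt: "2 * tau * (C1 / cA) * \<bar>Wt\<bar> <= ((C1 / cA) * (kd * CA / eps + n * CG) + 8 * (C1 / cA)^2) * En + (1/8) * NS"
  using vb2(2)[OF sig] unfolding Wt_def by simp
 have J: "c * En - C1 * TH - W - Lm / (4 * tau^2) * NT <= J"
 proof -
  have "(LI x. c * e x - C1 * (theta x * e x) - w x * R x - Lm / (4 * tau^2) * (T x)^2) <= J" unfolding J_def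
  proof (rule integral_mono)
   show "integrable lborel (%x. jj x)" by (rule comm(3))
   show "integrable lborel (%x. c * e x - C1 * (theta x * e x) - w x * R x - Lm / (4 * tau^2) * (T x)^2)"
    using ie iTH iW by simp
   show "c * e x - C1 * (theta x * e x) - w x * R x - Lm / (4 * tau^2) * (T x)^2 <= jj x" for x
   proof (cases "x \<in> Om")
    case True
    have T2: "Lm / (4 * tau^2) * (T x)^2 = Lm * (p x \<bullet> (Am eps x *v V x))^2" using tau by (simp add: T_def Top_def power_mult_distrib)
    have "(c - C1 * theta x) * e x <= jj x + w x * R x + Lm * (p x \<bullet> (Am eps x *v V x))^2"
     using low[OF True, of "V x" "tau * v x"] unfolding Jw_def jj_def R_def q_def w_def theta_def e_def energy_def .
    then show ?thesis unfolding T2 by (simp add: left_diff_distrib)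
   next
    case False
    then have "x ~: K" using KOm by blast
    then show ?thesis using zero by (simp add: e_def energy_def R_def T_def Top_def jj_def jf_def Bf_def)
   qed
  qed
  moreover have "(LI x. c * e x - C1 * (theta x * e x) - w x * R x - Lm / (4 * tau^2) * (T x)^2) = c * En - C1 * TH - W - Lm / (4 * tau^2) * NT"
   using ie iTH iW by (simp add: En_def e_def TH_def W_def NT_def)
  ultimately show ?thesis by simp
 qed
 have TH: "TH <= (1 / cA) * Wt + Kq * (tau^2 * Ntheta)"
 proof -
  have "TH <= (LI x. (1 / cA) * (theta x * R x) + Kq * (tau^2 * (theta x * (v x)^2)))" unfolding TH_def
  proof (rule integral_mono)
   show "theta x * e x <= (1 / cA) * (theta x * R x) + Kq * (tau^2 * (theta x * (v x)^2))" for x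
   proof (cases "x \<in> Om")
    case True
    have px: "norm (p x) <= \<bar>Cp\<bar>" using pH_bound(1)[of x] True cl by fastforce
    have "q x <= norm (Am eps x) * norm (p x) * norm (p x)" unfolding q_def using inner_matrix_le[of "p x" "Am eps x" "p x"] by linarith
    also have "... <= CA * \<bar>Cp\<bar> * \<bar>Cp\<bar>" using norm_Am[of eps x] px CA_nonneg by (intro mult_mono) auto
    finally have qx: "q x <= CA * \<bar>Cp\<bar>^2" by (simp add: power2_eq_square)
    have "cA * (norm (V x))^2 <= R x + q x * (tau * v x)^2" using Am_elliptic[of "V x" eps x] by (simp add: R_def dot_square_norm)
    also have "... <= R x + CA * \<bar>Cp\<bar>^2 * (tau * v x)^2" using mult_right_mono[OF qx zero_le_power2[of "tau * v x"]] by simp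
    finally have "(1 / cA) * (cA * (norm (V x))^2) <= (1 / cA) * (R x + CA * \<bar>Cp\<bar>^2 * (tau * v x)^2)" using cA by (intro mult_left_mono) auto
    then have "(norm (V x))^2 <= (1 / cA) * (R x + CA * \<bar>Cp\<bar>^2 * (tau * v x)^2)" using cA by simp
    then have "e x <= (1 / cA) * (R x + CA * \<bar>Cp\<bar>^2 * (tau * v x)^2) + (tau * v x)^2" by (simp add: e_def energy_def)
    also have "... = (1 / cA) * R x + Kq * (tau * v x)^2" unfolding Kq_def by (simp only: distrib_left distrib_right mult_1 times_divide_eq_left times_divide_eq_right add.assoc)
    finally have "theta x * e x <= theta x * ((1 / cA) * R x + Kq * (tau * v x)^2)" by (intro mult_left_mono theta01)
    also have "... = (1 / cA) * (theta x * R x) + Kq * (tau^2 * (theta x * (v x)^2))" by (simp only: distrib_left power_mult_distrib mult_ac)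
    finally show ?thesis .
   next
    case False
    then have "x ~: K" using KOm by blast
    then show ?thesis using zero by (simp add: e_def energy_def R_def)
   qed
  qed (use iTH iWt iNtheta in auto)
  also have "... = (1 / cA) * Wt + Kq * (tau^2 * Ntheta)" using iWt iNtheta by (simp add: Wt_def Ntheta_def)
  finally show ?thesis .
 qed
 have NT0: "NT >= 0" unfolding NT_def by (intro lint_nonneg) simp
 have LT: "2 * tau * (Lm / (4 * tau^2) * NT) <= NT"
 proof -
  have "2 * tau * (Lm / (4 * tau^2) * NT) = (Lm / (2 * tau)) * NT" using tau by (simp add: power2_eq_square field_simps)
  also have "... <= 1 * NT" using tau NT0 by (intro mult_right_mono) auto
  finally show ?thesis by simp
 qed
 have "2 * tau * (c * En - C1 * TH - W - Lm / (4 * tau^2) * NT) <= 2 * tau * J" using tau J by (intro mult_left_mono) auto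
 then have 1: "2 * c * tau * En - 2 * tau * C1 * TH - 2 * tau * W - 2 * tau * (Lm / (4 * tau^2) * NT) <= 2 * tau * J" by (simp only: right_diff_distrib mult_ac)
 have 2: "2 * tau * W <= 2 * tau * \<bar>W\<bar>" using tau by (intro mult_left_mono) auto
 have 3: "2 * tau * C1 * TH <= 2 * tau * (C1 / cA) * \<bar>Wt\<bar> + 2 * C1 * Kq * (tau^3 * Ntheta)"
 proof -
  have "2 * tau * C1 * TH <= 2 * tau * C1 * ((1 / cA) * Wt + Kq * (tau^2 * Ntheta))" using tau k TH by (intro mult_left_mono) auto
  also have "... = 2 * tau * (C1 / cA) * Wt + 2 * C1 * Kq * (tau^3 * Ntheta)" by (simp add: distrib_left power2_eq_square power3_eq_cube mult_ac)
  also have "2 * tau * (C1 / cA) * Wt <= 2 * tau * (C1 / cA) * \<bar>Wt\<bar>" using tau sig by (intro mult_left_mono mult_nonneg_nonneg) linarith+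
  finally show ?thesis by simp
 qed
 define U1 where "U1 = kd * CA / eps"
 have "(3/4) * NS + (2 * c * tau - (Cw + C1 / cA) * U1 - ((Cw + C1 / cA) * (n * CG) + 8 * Cw^2 + 8 * (C1 / cA)^2)) * En - 2 * C1 * Kq * (tau^3 * Ntheta)
  = NS + 2 * c * tau * En - ((Cw * U1 + Cw * (n * CG) + 8 * Cw^2) * En + (1/8) * NS)
   - (((C1 / cA) * (U1 + n * CG) + 8 * (C1 / cA)^2) * En + (1/8) * NS) - 2 * C1 * Kq * (tau^3 * Ntheta)"
  by (simp add: algebra_simps)
 also have "... <= NS + NT + 2 * tau * J"
  using 1 2 3 W Wt LT unfolding U1_def by (simp only: times_divide_eq_right mult.assoc)
 also have "... = (LI x. (S x + T x)^2)" by (rule X[symmetric])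
 finally show ?thesis unfolding U1_def S_def T_def Ntheta_def theta_def by (simp only: times_divide_eq_right mult.assoc)
qed

text \<open>Order of the constants: \<open>M\<close> is chosen to absorb the gradient of the averaged weight, then
\<open>dl\<close> to absorb the exterior mass, and finally \<open>tau0\<close>.\<close>

lemma carleman_estimate:
 "\<exists>C>0. \<exists>tau0>0. \<forall>u U N T K. \<forall>tau\<ge>tau0. c3_compact_support u U N T K --> K <= Om -->
   tau * (LI x. exp (2 * tau * phi x) * ((norm (U x))^2 + tau^2 * (u x)^2))
    <= C * (LI x. exp (2 * tau * phi x) * (A x \<bullet> N x + beta (G x) \<bullet> U x)^2)"
proof (rule averaged_lower_bound)
 fix c c1 Lm Cw C1 eps0 :: real
 assume k: "c > 0" "Lm >= 0" "Cw >= 0" "C1 >= 0" "eps0 > 0" and wb: "!!x. norm (wt c1 x) <= Cw"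
  and low: "!!eps x V r. [|0 < eps; eps < eps0; x \<in> Om|] ==>
    (c - C1 * ext_density eps x) * ((norm V)^2 + r^2) <= Jw Lm (Am eps x) (p x) (H x) (Gm eps x) (moll bump eps (wt c1) x) V r"
 obtain C where C: "C >= 0" and conjb: "\<forall>eps tau u U N T K. eps > 0 --> tau >= 1 --> c3_compact_support u U N T K --> K <= Om -->
   (LI x. exp (2 * tau * phi x) * ((norm (U x))^2 + tau^2 * (u x)^2)) <= C * tot_energy tau u U &
   (LI x. (norm (conj_hess tau u U N x))^2) <= C * (tot_sym eps tau u U N
     + tau^2 * tot_energy tau u U) &
   (LI x. (Sop tau (Am eps) (conj_fun tau u) (conj_hess tau u U N) x + Top tau (Am eps) (conj_grad tau u U) x)^2)
    <= 2 * (LI x. exp (2 * tau * phi x) * (A x \<bullet> N x + beta (G x) \<bullet> U x)^2)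
     + C * (eps^2 * (tot_sym eps tau u U N
     + tau^2 * tot_energy tau u U) + tot_energy tau u U)"
  using integrated_conjugation_bounds by (elim exE conjE)
 define kd where "kd = dbump_mass TYPE('n)"
 define n where "n = real CARD('n)"
 define Kq where "Kq = CA * \<bar>Cp\<bar>^2 / cA + 1"
 define sgm where "sgm = Cw + C1 / cA"
 define D where "D = sgm * kd * CA + 1"
 define K1 where "K1 = sgm * (n * CG) + 8 * Cw^2 + 8 * (C1 / cA)^2"
 have s0: "sgm >= 0" using k cA by (simp add: sgm_def)
 have D: "D > 0" using s0 CA_nonneg dbump_mass_nonneg[where 'n='n] by (auto simp: D_def kd_def intro!: add_nonneg_pos mult_nonneg_nonneg)
 have K1: "K1 >= 0" using s0 CG_nonneg by (auto simp: K1_def n_def intro!: add_nonneg_nonneg mult_nonneg_nonneg)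
 have Kq: "Kq > 0" using CA_nonneg cA by (auto simp: Kq_def intro!: add_nonneg_pos divide_nonneg_pos mult_nonneg_nonneg)
 (* With eps = M / tau the term with 1 / eps becomes at most a quarter of the gain 2 c tau. *)
 define M where "M = 2 * D / c"
 have M: "M > 0" using D k by (simp add: M_def)
 define z where "z = 1 / (C1 * Kq + 1)"
 (* The exterior term may use up another quarter of the gain. *)
 define dl where "dl = c / 4 * z"
 have C1K: "C1 * Kq >= 0" using k Kq by simp
 have dl: "dl > 0" using C1K k by (auto simp: dl_def z_def)
 have dl2: "2 * C1 * Kq * dl <= c / 2"
 proof -
  have "C1 * Kq * z <= 1" using C1K by (simp add: z_def)
  then have "(c / 2) * (C1 * Kq * z) <= (c / 2) * 1" using k by (intro mult_left_mono) auto
  moreover have "2 * C1 * Kq * dl = (c / 2) * (C1 * Kq * z)" by (simp add: dl_def)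
  ultimately show ?thesis by linarith
 qed
 obtain K3 tau1 where K3: "K3 >= 0" and tau1: "tau1 >= 1" and ext: "\<forall>tau\<ge>tau1. \<forall>v V Hv K. c2_compact_support v V Hv K --> K <= Om -->
   (LI x. (norm (Hv x))^2) <= C * ((LI x. (Sop tau (Am (M/tau)) v Hv x)^2) + tau^2 * (LI x. energy tau v V x)) -->
   tau^3 * (LI x. ext_density (M/tau) x * (v x)^2) <= dl * tau * (LI x. energy tau v V x)
    + K3 / tau * ((LI x. (Sop tau (Am (M/tau)) v Hv x)^2) + (LI x. energy tau v V x))"
  using exterior_mass_bound[OF M dl C] by (elim exE conjE)
 define K4 where "K4 = 2 * C1 * Kq * K3"
 have K4: "K4 >= 0" using k Kq K3 by (simp add: K4_def)
 define K5 where "K5 = C * (M^2 * 1)"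
 have K5: "K5 >= 0" using C by (simp add: K5_def)
 define K6 where "K6 = K1 + 1 + K5 + C"
 define tau0 where "tau0 = tau1 + Lm + (2 * M / eps0) + 4 * K4 + 4 * K5 + 2 * K6 / c"
 have K6: "K6 >= 0" using K1 K5 C by (simp add: K6_def)
 have Me: "2 * M / eps0 > 0" using M k by simp
 have Kc: "2 * K6 / c >= 0" using K6 k by simp
 have tau0: "tau0 > 0" using tau1 k Me K4 K5 Kc unfolding tau0_def by linarith
 show ?thesis
 proof (rule exI[of _ "4 * C / c + 1"], rule conjI, use C k in \<open>simp add: add_nonneg_pos\<close>, rule exI[of _ tau0], rule conjI[OF tau0], intro allI impI)
  fix u U N T K and tau :: real
  assume tau: "tau0 <= tau" and c3: "c3_compact_support u U N T K" and KOm: "K <= Om"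
  have t: "tau >= 1" "tau >= tau1" "tau >= Lm" "2 * M / eps0 <= tau" "4 * K4 <= tau" "4 * K5 <= tau" "2 * K6 / c <= tau"
   using tau tau1 k Me K4 K5 Kc unfolding tau0_def by linarith+
  have tp: "tau > 0" using t by linarith
  define eps where "eps = M / tau"
  have eps: "eps > 0" using M tp by (simp add: eps_def)
  have eps0: "eps < eps0"
  proof -
   have "2 * M <= tau * eps0" using t(4) k(5) by (simp add: pos_divide_le_eq)
   then have "M < tau * eps0" using M by linarith
   then show ?thesis using tp by (simp add: eps_def pos_divide_less_eq mult.commute)
  qed
  define v where "v = conj_fun tau u"
  define V where "V = conj_grad tau u U"
  define Hv where "Hv = conj_hess tau u U N"
  have c2: "c2_compact_support v V Hv K" unfolding v_def V_def Hv_def by (rule conjugated_compact_support[OF c3 KOm])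
  define En where "En = (LI x. energy tau v V x)"
  define NS where "NS = (LI x. (Sop tau (Am eps) v Hv x)^2)"
  define X where "X = (LI x. (Sop tau (Am eps) v Hv x + Top tau (Am eps) V x)^2)"
  define Y where "Y = (LI x. exp (2 * tau * phi x) * (A x \<bullet> N x + beta (G x) \<bullet> U x)^2)"
  define Ntheta where "Ntheta = (LI x. ext_density eps x * (v x)^2)"
  have En0: "En >= 0" unfolding En_def by (intro lint_nonneg) (simp add: energy_nonneg)
  have NS0: "NS >= 0" unfolding NS_def by (intro lint_nonneg) simp
  have Y0: "Y >= 0" unfolding Y_def by (intro lint_nonneg) simp
  note cb = conjb[rule_format, OF eps t(1) c3 KOm, folded v_def V_def Hv_def, folded En_def NS_def X_def Y_def]
  have Ntheta: "tau^3 * Ntheta <= dl * tau * En + K3 / tau * (NS + En)"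
   using ext[rule_format, OF t(2) c2 KOm] cb unfolding eps_def[symmetric] Ntheta_def[symmetric] NS_def[symmetric] En_def[symmetric] by blast
  have vir: "(3/4) * NS + (2 * c * tau - sgm * kd * CA / eps - K1) * En - 2 * C1 * Kq * (tau^3 * Ntheta) <= X"
   using virial_lower_bound[OF k(1-4) wb low[OF eps eps0] eps t(1) t(3) c2 KOm]
   unfolding sgm_def kd_def K1_def n_def Kq_def En_def NS_def X_def Ntheta_def by blast
  have De: "sgm * kd * CA / eps <= c * tau / 2"
  proof -
   have "sgm * kd * CA / eps <= D / eps" using eps by (intro divide_right_mono) (auto simp: D_def)
   also have "... = c * tau / 2" using D k tp by (simp add: eps_def M_def)
   finally show ?thesis .
  qed
  have m: "2 * C1 * Kq * (tau^3 * Ntheta) <= (c / 2) * (tau * En) + (1/4) * (NS + En)"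
  proof -
   have nn: "2 * C1 * Kq >= 0" using C1K by simp
   have "2 * C1 * Kq * (tau^3 * Ntheta) <= 2 * C1 * Kq * (dl * tau * En + K3 / tau * (NS + En))" using Ntheta nn by (intro mult_left_mono)
   also have "... = (2 * C1 * Kq * dl) * (tau * En) + (K4 / tau) * (NS + En)" by (simp add: K4_def distrib_left mult_ac)
   also have "... <= (c / 2) * (tau * En) + (1/4) * (NS + En)"
   proof (intro add_mono mult_right_mono)
    show "2 * C1 * Kq * dl <= c / 2" by (rule dl2)
    show "K4 / tau <= 1/4" using t(5) tp by (simp add: pos_divide_le_eq)
   qed (use En0 NS0 tp in auto)
   finally show ?thesis .
  qed
  define B where "B = (2 * c * tau - sgm * kd * CA / eps - K1) * En"
  define m1 where "m1 = 2 * C1 * Kq * (tau^3 * Ntheta)"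
  define te where "te = c * (tau * En)"
  define ke where "ke = K1 * En"
  have "(2 * c * tau - c * tau / 2 - K1) * En <= B"
   unfolding B_def using De En0 by (intro mult_right_mono) linarith+
  moreover have "(2 * c * tau - c * tau / 2 - K1) * En = 3 / 2 * te - ke" by (simp add: te_def ke_def algebra_simps)
  ultimately have "3 / 2 * te - ke <= B" by simp
  moreover have "m1 <= 1 / 2 * te + 1 / 4 * (NS + En)" using m by (simp add: m1_def te_def)
  moreover have "3 / 4 * NS + B - m1 <= X" using vir by (simp add: B_def m1_def)
  ultimately have "1 / 2 * NS + te - (ke + En) <= X" using En0 by argo
  then have X1: "(1/2) * NS + c * (tau * En) - (K1 + 1) * En <= X" by (simp add: te_def ke_def distrib_right)
  have X2: "X <= 2 * Y + (1/4) * NS + K5 * En + C * En"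
  proof -
   have e2: "eps^2 * tau^2 = M^2" using tp by (simp add: eps_def power_divide)
   have "X <= 2 * Y + C * (eps^2 * (NS + tau^2 * En) + En)" using cb by blast
   also have "C * (eps^2 * (NS + tau^2 * En) + En) = C * eps^2 * NS + C * (eps^2 * tau^2) * En + C * En" by (simp add: algebra_simps)
   also have "C * eps^2 * NS <= (1/4) * NS"
   proof (rule mult_right_mono[OF _ NS0])
    have "tau <= tau^2" using t(1) by (simp add: power2_eq_square)
    then have "4 * K5 <= tau^2" using t(6) by linarith
    then have "K5 / tau^2 <= 1/4" using tp by (simp add: pos_divide_le_eq)
    moreover have "C * eps^2 = K5 / tau^2" by (simp add: K5_def eps_def power_divide)
    ultimately show "C * eps^2 <= 1/4" by simp
   qed
   finally show ?thesis by (simp add: e2 K5_def)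
  qed
  have "c * (tau * En) - K6 * En <= 2 * Y" using X1 X2 NS0 by (simp add: K6_def algebra_simps)
  moreover have "K6 * En <= (c / 2) * (tau * En)"
  proof -
   have "K6 <= (c / 2) * tau" using t(7) k(1) by (simp add: pos_divide_le_eq mult.commute)
   from mult_right_mono[OF this En0] show ?thesis by (simp add: mult.assoc)
  qed
  ultimately have "(c / 2) * (tau * En) <= 2 * Y" by simp
  then have main: "tau * En <= 4 / c * Y" using k(1) by (simp add: field_simps)
  have "tau * (LI x. exp (2 * tau * phi x) * ((norm (U x))^2 + tau^2 * (u x)^2)) <= tau * (C * En)"
   using cb tp by (intro mult_left_mono) auto
  also have "... = C * (tau * En)" by simp
  also have "... <= C * (4 / c * Y)" using main C by (intro mult_left_mono)
  also have "... <= (4 * C / c + 1) * Y" using Y0 by (simp add: algebra_simps)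
  finally show "tau * (LI x. exp (2 * tau * phi x) * ((norm (U x))^2 + tau^2 * (u x)^2))
    <= (4 * C / c + 1) * (LI x. exp (2 * tau * phi x) * (A x \<bullet> N x + beta (G x) \<bullet> U x)^2)" unfolding Y_def .
 qed
qed

end

section \<open>From the metric and the symbol to the estimate\<close>

lemma inner_matrix_sum: "x \<bullet> (B *v y) = (\<Sum>j\<in>UNIV. \<Sum>k\<in>UNIV. B $ j $ k * x $ j * y $ k)"
 by (simp add: inner_vec_def matrix_vector_mult_def sum_distrib_left mult_ac)

lemma inner_g_eq: "inner_g g x xi eta = xi \<bullet> (g x *v eta)"
 by (simp add: inner_g_def inner_matrix_sum)

lemma vec_norm_le_sum: "norm x <= (\<Sum>i\<in>UNIV. norm (x $ i))" for x :: "'b::real_normed_vector^'m"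
 unfolding norm_vec_def by (rule L2_set_le_sum) simp

lemma symmetric_matrix_norm_le:
 fixes B :: "real^'n^'n"
 assumes "transpose B = B" "!!xi. norm (B *v xi) <= K * norm xi"
 shows "norm B <= real CARD('n) * K"
proof -
 have "B $ s = B *v axis s 1" for s
 proof -
  have "B $ s = transpose B $ s" by (simp add: assms(1))
  also have "... = column s B" by (simp add: transpose_def column_def)
  finally show ?thesis by (simp add: matrix_vector_mult_basis)
 qed
 then have "norm (B $ s) <= K" for s using assms(2)[of "axis s 1"] by simp
 then have "(\<Sum>s\<in>UNIV. norm (B $ s)) <= (\<Sum>s\<in>(UNIV::'n set). K)" by (intro sum_mono)
 then show ?thesis using vec_norm_le_sum[of B] by simp
qed

lemma transpose_norm: "norm (transpose B) = norm B" for B :: "real^'n^'m"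
proof -
 have "transpose B \<bullet> transpose B = B \<bullet> B"
  unfolding inner_vec_def transpose_def by (simp, rule sum.swap)
 then show ?thesis by (simp add: norm_eq_sqrt_inner)
qed

text \<open>The Lipschitz bound comes from \<open>A x - A y = A x (g y - g x) A y\<close>; the norm of \<open>g x\<close> is
bounded by testing the form with \<open>xi - g xi / lam\<close>.\<close>

lemma elliptic_inverse_metric:
 fixes g :: "real^'n => real^'n^'n"
 assumes lam: "lam >= 1" and sym: "!!x. transpose (g x) = g x"
  and low: "!!x xi. inverse lam * (norm xi)^2 <= inner_g g x xi xi"
  and up: "!!x xi. inner_g g x xi xi <= lam * (norm xi)^2"
  and lip: "!!x y. (\<Sum>i\<in>UNIV. \<Sum>j\<in>UNIV. \<bar>g x $ i $ j - g y $ i $ j\<bar>) <= Lam * norm (x - y)"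
 shows "elliptic_coefficients (g_inv g) g (inverse lam ^ 3) (real CARD('n) * lam) (real CARD('n) * (lam * Lam * lam))"
  and "!!x zeta. g x *v (g_inv g x *v zeta) = zeta"
proof -
 have lp: "lam > 0" using lam by linarith
 have low': "inverse lam * (norm xi)^2 <= xi \<bullet> (g x *v xi)" and up': "xi \<bullet> (g x *v xi) <= lam * (norm xi)^2" for x xi
  using low up by (simp_all add: inner_g_eq)
 have inj: "inj ((*v) (g x))" for x
 proof (rule injI)
  fix xi eta assume "g x *v xi = g x *v eta"
  then have "g x *v (xi - eta) = 0" by (simp add: matrix_vector_mult_diff_distrib)
  then have "inverse lam * (norm (xi - eta))^2 <= 0" using low'[of "xi - eta" x] by simp
  then have "(norm (xi - eta))^2 <= 0" using lp by (simp add: mult_le_0_iff)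
  then show "xi = eta" by simp
 qed
 have inv: "g x ** g_inv g x = mat 1 & g_inv g x ** g x = mat 1" for x
 proof -
  have "\<exists>B. B ** g x = mat 1" using inj matrix_left_invertible_injective by blast
  then have "\<exists>B. g x ** B = mat 1 & B ** g x = mat 1" using matrix_left_right_inverse by blast
  then show ?thesis unfolding g_inv_def matrix_inv_def by (rule someI_ex)
 qed
 have gA: "g x *v (g_inv g x *v zeta) = zeta" and Ag: "g_inv g x *v (g x *v zeta) = zeta" for x zeta
  using inv[of x] by (simp_all add: matrix_vector_mul_assoc)
 show "!!x zeta. g x *v (g_inv g x *v zeta) = zeta" by (rule gA)
 have symA: "transpose (g_inv g x) = g_inv g x" for x
 proof -
  have "transpose (g x ** g_inv g x) = mat 1" using inv[of x] by (simp add: transpose_mat)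
  then have "transpose (g_inv g x) ** g x = mat 1" by (simp add: matrix_transpose_mul sym)
  then have "transpose (g_inv g x) ** (g x ** g_inv g x) = g_inv g x" by (simp add: matrix_mul_assoc)
  then show ?thesis using inv[of x] by simp
 qed
 have normg: "norm (g x *v eta) <= lam * norm eta" for x eta
 proof -
  define zeta where "zeta = g x *v eta"
  have s: "zeta \<bullet> (g x *v eta) = eta \<bullet> (g x *v zeta)" using sym_matrix_inner[OF sym, of zeta x eta] by (simp add: inner_commute)
  have "0 <= inverse lam * (norm (eta - inverse lam *. zeta))^2" using lp by simp
  also have "... <= (eta - inverse lam *. zeta) \<bullet> (g x *v (eta - inverse lam *. zeta))" by (rule low')
  also have "... = eta \<bullet> (g x *v eta) - 2 * inverse lam * (zeta \<bullet> zeta) + inverse lam * inverse lam * (zeta \<bullet> (g x *v zeta))"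
   using s by (simp add: matrix_vector_mult_diff_distrib matrix_scaleR_right inner_diff_left inner_diff_right zeta_def[symmetric] algebra_simps)
  also have "... <= lam * (norm eta)^2 - 2 * inverse lam * (norm zeta)^2 + inverse lam * inverse lam * (lam * (norm zeta)^2)"
   using lp by (intro add_mono diff_mono up' mult_left_mono) (auto simp: dot_square_norm)
  also have "inverse lam * inverse lam * (lam * (norm zeta)^2) = inverse lam * (norm zeta)^2" using lp by simp
  finally have "inverse lam * (norm zeta)^2 <= lam * (norm eta)^2" by linarith
  then have "lam * (inverse lam * (norm zeta)^2) <= lam * (lam * (norm eta)^2)" using lp by (intro mult_left_mono) auto
  moreover have "lam * (inverse lam * (norm zeta)^2) = (norm zeta)^2" using lp by simp
  moreover have "lam * (lam * (norm eta)^2) = (lam * norm eta)^2" by (simp add: power_mult_distrib power2_eq_square)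
  ultimately have "(norm zeta)^2 <= (lam * norm eta)^2" by simp
  then show ?thesis unfolding zeta_def by (rule power2_le_imp_le) (use lp in auto)
 qed
 have normAv: "norm (g_inv g x *v xi) <= lam * norm xi" for x xi
 proof -
  define eta where "eta = g_inv g x *v xi"
  have "inverse lam * (norm eta)^2 <= eta \<bullet> xi" using low'[of eta x] by (simp add: eta_def gA)
  also have "... <= norm eta * norm xi" by (rule norm_cauchy_schwarz)
  finally have "lam * (inverse lam * (norm eta)^2) <= lam * (norm eta * norm xi)" using lp by (intro mult_left_mono) auto
  moreover have "lam * (inverse lam * (norm eta)^2) = norm eta * norm eta" using lp by (simp add: power2_eq_square)
  ultimately have "norm eta * norm eta <= norm eta * (lam * norm xi)" by (simp only: mult_ac)
  then show ?thesis unfolding eta_def[symmetric] using lp by (cases "norm eta = 0") auto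
 qed
 have i3: "inverse lam ^ 3 <= inverse lam"
 proof -
  have "inverse lam <= 1" using lam by (simp add: inverse_le_1_iff)
  then show ?thesis using power_decreasing[of 1 3 "inverse lam"] lp by simp
 qed
 have lipg: "norm (g x - g y) <= Lam * norm (x - y)" for x y
 proof -
  have "norm (g x - g y) <= (\<Sum>i\<in>UNIV. norm ((g x - g y) $ i))" by (rule vec_norm_le_sum)
  also have "... <= (\<Sum>i\<in>UNIV. \<Sum>j\<in>UNIV. \<bar>g x $ i $ j - g y $ i $ j\<bar>)"
   by (intro sum_mono order_trans[OF norm_le_l1_cart]) simp
  finally show ?thesis using lip[of x y] by linarith
 qed
 show "elliptic_coefficients (g_inv g) g (inverse lam ^ 3) (real CARD('n) * lam) (real CARD('n) * (lam * Lam * lam))"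
 proof
  show "transpose (g_inv g x) = g_inv g x" for x by (rule symA)
  show "transpose (g x) = g x" for x by (rule sym)
  show "g_inv g x *v (g x *v zeta) = zeta" for x zeta by (rule Ag)
  show "inverse lam ^ 3 > 0" using lp by simp
  show "inverse lam ^ 3 * (xi \<bullet> xi) <= xi \<bullet> (g_inv g x *v xi)" for x xi
  proof -
   define eta where "eta = g_inv g x *v xi"
   have xi: "xi = g x *v eta" by (simp add: eta_def gA)
   have "(norm xi)^2 <= (lam * norm eta)^2" unfolding xi by (intro power_mono normg) auto
   then have "inverse lam ^ 3 * (norm xi)^2 <= inverse lam ^ 3 * (lam * norm eta)^2" using lp by (intro mult_left_mono) auto
   also have "... = inverse lam * (norm eta)^2"
   proof -
    have "inverse lam ^ 3 * lam^2 = inverse lam" using lp by (simp add: field_simps power3_eq_cube power2_eq_square)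
    then show ?thesis by (simp add: power_mult_distrib mult.assoc[symmetric])
   qed
   also have "... <= eta \<bullet> xi" unfolding xi by (rule low')
   finally show ?thesis by (simp add: eta_def dot_square_norm inner_commute)
  qed
  show "inverse lam ^ 3 * (xi \<bullet> xi) <= xi \<bullet> (g x *v xi)" for x xi
   using order_trans[OF mult_right_mono[OF i3 inner_ge_zero[of xi]]] low'[of xi x] by (simp add: dot_square_norm)
  show "norm (g_inv g x) <= real CARD('n) * lam" for x by (rule symmetric_matrix_norm_le[OF symA normAv])
  have n1: "1 <= real CARD('n)" by (simp add: Suc_le_eq)
  show "norm (g x *v xi) <= real CARD('n) * lam * norm xi" for x xi
  proof -
   have "1 * (lam * norm xi) <= real CARD('n) * (lam * norm xi)" using n1 lp by (intro mult_right_mono) auto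
   then show ?thesis using normg[of x xi] by (simp add: mult.assoc)
  qed
  show "norm (g_inv g x - g_inv g y) <= real CARD('n) * (lam * Lam * lam) * norm (x - y)" for x y
  proof -
   have st: "transpose (g_inv g x - g_inv g y) = g_inv g x - g_inv g y"
    using linear_diff[OF bounded_linear.linear[OF bounded_linear_transpose], of "g_inv g x" "g_inv g y"] by (simp add: symA)
   have "norm ((g_inv g x - g_inv g y) *v xi) <= (lam * Lam * lam * norm (x - y)) * norm xi" for xi
   proof -
    define eta where "eta = g_inv g y *v xi"
    have "(g_inv g x - g_inv g y) *v xi = g_inv g x *v ((g y - g x) *v eta)"
     by (simp add: matrix_vector_mult_diff_rdistrib matrix_vector_mult_diff_distrib eta_def gA Ag)
    then have "norm ((g_inv g x - g_inv g y) *v xi) <= lam * norm ((g y - g x) *v eta)" using normAv by simp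
    also have "... <= lam * (norm (g y - g x) * norm eta)" using lp by (intro mult_left_mono norm_matrix_vector_le) auto
    also have "... <= lam * ((Lam * norm (y - x)) * (lam * norm xi))"
     using lp lipg[of y x] normAv[of y xi] order_trans[OF norm_ge_zero lipg[of y x]] by (intro mult_left_mono mult_mono) (auto simp: eta_def)
    finally show ?thesis by (simp add: norm_minus_commute mult_ac)
   qed
   from symmetric_matrix_norm_le[OF st this] show ?thesis by (simp add: mult_ac)
  qed
 qed
qed

lemma has_derivative_vec_lambda:
 fixes F :: "'a::real_normed_vector => 'b::euclidean_space^'m"
 assumes "!!i. ((%x. F x $ i) has_derivative D i) (at x)"
 shows "(F has_derivative (%h. \<chi> i. D i h)) (at x)"
proof -
 have bl: "bounded_linear (axis i :: 'b => 'b^'m)" for i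
  by (intro linear_conv_bounded_linear[THEN iffD1] linearI) (simp_all add: axis_def vec_eq_iff)
 have e: "y = (\<Sum>i\<in>UNIV. axis i (y $ i))" for y :: "'b^'m"
  by (simp add: vec_eq_iff axis_def cong: if_cong)
 have "((%x. \<Sum>i\<in>UNIV. axis i (F x $ i)) has_derivative (%h. \<Sum>i\<in>UNIV. axis i (D i h))) (at x)"
  by (intro has_derivative_sum bounded_linear.has_derivative[OF bl] assms)
 moreover have "(%x. \<Sum>i\<in>UNIV. axis i (F x $ i)) = F" by (rule ext) (simp add: e[symmetric])
 moreover have "(%h. \<Sum>i\<in>UNIV. axis i (D i h)) = (%h. \<chi> i. D i h)"
  by (auto simp: fun_eq_iff vec_eq_iff axis_def cong: if_cong)
 ultimately show ?thesis by simp
qed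

lemma has_derivative_grad:
 fixes f :: "real^'n => real"
 assumes "f differentiable at x"
 shows "(f has_derivative (%h. grad f x \<bullet> h)) (at x)"
proof -
 obtain f' where f': "(f has_derivative f') (at x)" using assms unfolding differentiable_def by blast
 have "((%t. f (x + t *. axis i 1)) has_vector_derivative f' (axis i 1)) (at 0)" for i
  by (rule deriv_along_line[OF f'])
 then have p: "pdiff i f x = f' (axis i 1)" for i
  unfolding pdiff_def by (simp add: real_vector_deriv[symmetric] DERIV_imp_deriv)
 have "f' h = grad f x \<bullet> h" for h
  using sum_components_linear[OF has_derivative_linear[OF f'], of h] by (simp add: grad_def inner_vec_def p)
 then have "f' = (%h. grad f x \<bullet> h)" by (rule ext)
 then show ?thesis using f' by simp
qed

lemma pdiff_zero_on_open:
 fixes f :: "real^'n => real"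
 assumes O: "open O'" "x \<in> O'" and z: "!!y. y \<in> O' ==> f y = 0"
 shows "pdiff i f x = 0"
proof -
 let ?S = "(%t. x + t *. axis i 1) -` O'"
 have op: "open ?S" by (intro open_vimage O continuous_intros)
 have "((%t. 0::real) has_field_derivative 0) (at (0::real))" by simp
 then have "((%t. f (x + t *. axis i 1)) has_field_derivative 0) (at 0)"
  by (rule has_field_derivative_transform_within_open[OF _ op]) (use O z in auto)
 then show ?thesis unfolding pdiff_def by (rule DERIV_imp_deriv)
qed

definition hess :: "(real^'n => real) => real^'n => real^'n^'n"
 where "hess u x = (\<chi> i j. pdiff j (pdiff i u) x)"
definition third_derivatives :: "(real^'n => real) => real^'n => real^'n^'n^'n"
 where "third_derivatives u x = (\<chi> s i j. pdiff s (pdiff j (pdiff i u)) x)"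

lemma test_function_c3:
 fixes u :: "real^'n => real"
 assumes t: "test_function Om u"
 shows "c3_compact_support u (grad u) (hess u) (third_derivatives u) (closure {x. u x ~= 0})"
proof -
 let ?K = "closure {x. u x ~= 0}"
 have sm: "foldr pdiff is u differentiable at x" for "is" x
  using t unfolding test_function_def smooth_def differentiable_on_def by simp
 have d0: "u differentiable at x" for x using sm[of "[]"] by simp
 have d1: "pdiff i u differentiable at x" for i x using sm[of "[i]"] by simp
 have d2: "pdiff j (pdiff i u) differentiable at x" for i j x using sm[of "[j,i]"] by simp
 have d3: "pdiff s (pdiff j (pdiff i u)) differentiable at x" for s i j x using sm[of "[s,j,i]"] by simp
 have op: "open (- ?K)" by (simp add: open_Compl)
 have z0: "u x = 0" if "x \<in> - ?K" for x using that closure_subset[of "{x. u x ~= 0}"] by blast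
 have z1: "pdiff i u x = 0" if "x \<in> - ?K" for x i using that by (rule pdiff_zero_on_open[OF op _ z0])
 have z2: "pdiff j (pdiff i u) x = 0" if "x \<in> - ?K" for x i j using that by (rule pdiff_zero_on_open[OF op _ z1])
 have z3: "pdiff s (pdiff j (pdiff i u)) x = 0" if "x \<in> - ?K" for x s i j using that by (rule pdiff_zero_on_open[OF op _ z2])
 show ?thesis
 proof
  show "(u has_derivative (%h. grad u x \<bullet> h)) (at x)" for x by (rule has_derivative_grad[OF d0])
  show dU: "(grad u has_derivative (%h. hess u x *v h)) (at x)" for x
  proof -
   have "(grad u has_derivative (%h. \<chi> i. grad (pdiff i u) x \<bullet> h)) (at x)"
    by (rule has_derivative_vec_lambda) (simp add: grad_def has_derivative_grad[OF d1, unfolded grad_def])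
   then show ?thesis by (rule has_derivative_eq_rhs) (simp add: fun_eq_iff vec_eq_iff hess_def grad_def matrix_vector_mult_def inner_vec_def)
  qed
  show "(hess u has_derivative (%h. dirG (third_derivatives u x) h)) (at x)" for x
  proof -
   have "(hess u has_derivative (%h. \<chi> i. \<chi> j. grad (pdiff j (pdiff i u)) x \<bullet> h)) (at x)"
    by (intro has_derivative_vec_lambda) (simp add: hess_def has_derivative_grad[OF d2])
   then show ?thesis by (rule has_derivative_eq_rhs) (simp add: fun_eq_iff vec_eq_iff third_derivatives_def grad_def dirG_def inner_vec_def mult.commute)
  qed
  show "continuous_on UNIV (third_derivatives u)" unfolding third_derivatives_def[abs_def]
   by (intro continuous_on_vec_lambda continuous_at_imp_continuous_on ballI differentiable_imp_continuous_within d3)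
  show "(third_derivatives u x $ s) *v axis k 1 = (third_derivatives u x $ k) *v axis s 1" for x s k
  proof -
   have "pdiff s (pdiff k (pdiff i u)) x = pdiff k (pdiff s (pdiff i u)) x" for i
   proof -
    have du: "(pdiff i u has_derivative (%h. grad (pdiff i u) x \<bullet> h)) (at x)" for x by (rule has_derivative_grad[OF d1])
    have "(grad (pdiff i u) has_derivative (%h. \<chi> j. grad (pdiff j (pdiff i u)) x \<bullet> h)) (at x)"
     by (rule has_derivative_vec_lambda) (simp add: grad_def has_derivative_grad[OF d2, unfolded grad_def])
    then have "(grad (pdiff i u) has_derivative (%h. hess (pdiff i u) x *v h)) (at x)"
     by (rule has_derivative_eq_rhs) (simp add: fun_eq_iff vec_eq_iff hess_def grad_def matrix_vector_mult_def inner_vec_def)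
    from hessian_symmetric[OF open_UNIV UNIV_I du this] have "transpose (hess (pdiff i u) x) $ k $ s = hess (pdiff i u) x $ k $ s" by simp
    then show ?thesis by (simp add: transpose_def hess_def)
   qed
   then show ?thesis by (simp add: matrix_vector_mult_basis column_def vec_eq_iff third_derivatives_def)
  qed
  show "compact ?K" using t unfolding test_function_def by simp
  show "u x = 0" "grad u x = 0" "hess u x = 0" "third_derivatives u x = 0" if "x ~: ?K" for x
   using that z0[of x] z1[of x] z2[of x] z3[of x] by (simp_all add: grad_def hess_def third_derivatives_def vec_eq_iff)
 qed
qed

lemma borel_measurable_lebesgue_AE:
 fixes f h :: "'a::euclidean_space => real"
 assumes h: "h \<in> borel_measurable lebesgue" and ae: "AE x in lebesgue. f x = h x"
 shows "f \<in> borel_measurable lebesgue"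
proof (rule measurableI)
 fix B :: "real set" assume B: "B \<in> sets borel"
 have hB: "h -` B \<inter> space lebesgue \<in> sets lebesgue" by (rule measurable_sets[OF h B])
 show "f -` B \<inter> space lebesgue \<in> sets lebesgue"
 proof (rule completion.in_sets_AE[OF _ hB])
  show "AE x in lebesgue. (x \<in> h -` B \<inter> space lebesgue) = (x \<in> f -` B \<inter> space lebesgue)"
   using ae by eventually_elim auto
 qed simp
qed simp

text \<open>The directional derivatives are symmetrised, because they are symmetric only where they are the true derivatives.\<close>

lemma lipschitz_coefficients_derivative:
 fixes A :: "real^'n => real^'n^'n"
 assumes lip: "!!x y. norm (A x - A y) <= L * norm (x - y)" and sym: "!!x. transpose (A x) = A x"
 obtains G where "G \<in> borel_fun" "!!x. norm (G x) <= real CARD('n) * L" "!!x s. transpose (G x $ s) = G x $ s"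
  "AE x in lborel. \<forall>s. ((%t. A (x + t *. axis s 1)) has_vector_derivative G x $ s) (at 0)"
proof -
 have "\<exists>Gs. Gs \<in> borel_fun & (\<forall>x. norm (Gs x) <= L) & (AE x in lborel. ((%t. A (x + t *. axis s 1)) has_vector_derivative Gs x) (at 0))" for s
 proof (rule lipschitz_directional_derivative_borel[OF lip, where e = "axis s 1"])
  fix B :: "real^'n => real^'n^'n"
  assume B: "B \<in> borel_fun" "!!x. norm (B x) <= L" "AE x in lborel. ((%t. A (x + t *. axis s 1)) has_vector_derivative B x) (at 0)"
  show ?thesis by (intro exI[of _ B] conjI allI B)
 qed simp
 from choice[OF allI[OF this]] obtain Gs where Gs': "\<forall>s. Gs s \<in> borel_fun & (\<forall>x. norm (Gs s x) <= L) & (AE x in lborel. ((%t. A (x + t *. axis s 1)) has_vector_derivative Gs s x) (at 0))" ..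
 then have Gs: "!!s. Gs s \<in> borel_fun" "!!s x. norm (Gs s x) <= L"
  "!!s. AE x in lborel. ((%t. A (x + t *. axis s 1)) has_vector_derivative Gs s x) (at 0)" by simp_all
 define S where "S s x = (1/2) *. (Gs s x + transpose (Gs s x))" for s x
 define G where "G x = (\<Sum>s\<in>UNIV. axis s (S s x))" for x
 have Gc: "G x $ s = S s x" for x s by (simp add: G_def axis_def cong: if_cong)
 have bl: "bounded_linear (axis i :: real^'n^'n => real^'n^'n^'n)" for i
  by (intro linear_conv_bounded_linear[THEN iffD1] linearI) (simp_all add: axis_def vec_eq_iff)
 show thesis
 proof (rule that[of G])
  show "G \<in> borel_fun" unfolding G_def[abs_def]
  proof (rule borel_measurable_sum)
   fix s :: 'n
   have c: "continuous_on UNIV (%B. axis s ((1/2) *. (B + transpose B)) :: real^'n^'n^'n)"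
    by (intro bounded_linear.continuous_on[OF bl] continuous_intros bounded_linear.continuous_on[OF bounded_linear_transpose])
   show "(%x. axis s (S s x)) \<in> borel_fun" unfolding S_def
    by (rule borel_measurable_continuous_on[OF c Gs(1)])
  qed
  have nS: "norm (S s x) <= L" for s x
  proof -
   have "norm (Gs s x + transpose (Gs s x)) <= L + L"
    using norm_triangle_ineq[of "Gs s x" "transpose (Gs s x)"] Gs(2)[of s x] by (simp add: transpose_norm)
   then show ?thesis by (simp add: S_def)
  qed
  show "norm (G x) <= real CARD('n) * L" for x
  proof -
   have "norm (G x) <= (\<Sum>s\<in>UNIV. norm (G x $ s))" by (rule vec_norm_le_sum)
   also have "... <= (\<Sum>s\<in>(UNIV::'n set). L)" by (intro sum_mono) (simp add: Gc nS)
   finally show ?thesis by simp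
  qed
  show "transpose (G x $ s) = G x $ s" for x s
   by (simp add: Gc S_def linear_cmul[OF bounded_linear.linear[OF bounded_linear_transpose]] linear_add[OF bounded_linear.linear[OF bounded_linear_transpose]] add.commute)
  show "AE x in lborel. \<forall>s. ((%t. A (x + t *. axis s 1)) has_vector_derivative G x $ s) (at 0)"
  proof (rule eventually_all_finite)
   fix s :: 'n
   show "AE x in lborel. ((%t. A (x + t *. axis s 1)) has_vector_derivative G x $ s) (at 0)"
    using Gs(3)[of s]
   proof eventually_elim
    case (elim x)
    have "((%t. transpose (A (x + t *. axis s 1))) has_vector_derivative transpose (Gs s x)) (at 0)"
     by (rule linear_vector_deriv[OF bounded_linear_transpose elim])
    then have "transpose (Gs s x) = Gs s x" unfolding sym by (rule vector_derivative_unique_at[OF _ elim])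
    then have "S s x = Gs s x" by (simp add: S_def scaleR_add_right[symmetric] scaleR_2[symmetric])
    then show ?case using elim by (simp add: Gc)
   qed
  qed
 qed
qed

lemma zeta_vec_components: "zeta_vec d\<phi> x xi 1 $ j = Complex (xi $ j) (d\<phi> x $ j)"
 by (simp add: zeta_vec_def)

lemma symbol_zero:
 assumes sym: "transpose (g_inv g x) = g_inv g x" and 0: "d\<phi> x \<bullet> (g_inv g x *v xi) = 0"
  and 1: "xi \<bullet> (g_inv g x *v xi) = d\<phi> x \<bullet> (g_inv g x *v d\<phi> x)"
 shows "P_symb g x (zeta_vec d\<phi> x xi 1) = 0"
proof (rule complex_eqI)
 let ?p = "d\<phi> x" and ?A = "g_inv g x"
 have "Re (P_symb g x (zeta_vec d\<phi> x xi 1)) = xi \<bullet> (?A *v xi) - ?p \<bullet> (?A *v ?p)"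
  unfolding P_symb_def zeta_vec_components inner_matrix_sum sum_subtractf[symmetric]
  by (simp add: algebra_simps)
 then show "Re (P_symb g x (zeta_vec d\<phi> x xi 1)) = Re 0" using 1 by simp
 have "Im (P_symb g x (zeta_vec d\<phi> x xi 1)) = xi \<bullet> (?A *v ?p) + ?p \<bullet> (?A *v xi)"
  unfolding P_symb_def zeta_vec_components inner_matrix_sum sum.distrib[symmetric]
  by (simp add: algebra_simps)
 also have "xi \<bullet> (?A *v ?p) = ?p \<bullet> (?A *v xi)" using sym_matrix_inner[OF sym, of xi ?p] by (simp add: inner_commute)
 finally show "Im (P_symb g x (zeta_vec d\<phi> x xi 1)) = Im 0" using 0 by simp
qed

text \<open>Evaluation at \<open>tau = 1\<close>, which by homogeneity represents all nonzero values of \<open>tau\<close>.\<close>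

lemma Q_form_eq:
 fixes g :: "real^'n => real^'n^'n"
 assumes G: "!!s j k. pdiff s (%y. g_inv g y $ j $ k) x = G $ s $ j $ k" and sG: "!!s. transpose (G $ s) = G $ s"
 shows "Q_form g d\<phi> d2\<phi> x xi 1 = 2 * (Bf (g_inv g x) (d\<phi> x) (d2\<phi> x) G xi + Bf (g_inv g x) (d\<phi> x) (d2\<phi> x) G (d\<phi> x))"
proof -
 define A where "A = g_inv g x"
 define p where "p = d\<phi> x"
 define H where "H = d2\<phi> x"
 define a where "a = A *v xi"
 define b where "b = A *v p"
 define zeta where "zeta = zeta_vec d\<phi> x xi 1"
 have zeta: "zeta $ j = Complex (xi $ j) (p $ j)" for j by (simp add: zeta_def p_def zeta_vec_components)
 have up: "P_up g j x zeta = 2 * Complex (a $ j) (b $ j)" for j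
  by (rule complex_eqI) (simp_all add: P_up_def zeta A_def[symmetric] a_def b_def matrix_vector_mult_def)
 have low: "P_low g k x zeta = Complex (xi \<bullet> (G $ k *v xi) - p \<bullet> (G $ k *v p)) (2 * (p \<bullet> (G $ k *v xi)))" for k
 proof (rule complex_eqI)
  show "Re (P_low g k x zeta) = Re (Complex (xi \<bullet> (G $ k *v xi) - p \<bullet> (G $ k *v p)) (2 * (p \<bullet> (G $ k *v xi))))"
   unfolding P_low_def zeta G complex.sel inner_matrix_sum sum_subtractf[symmetric] by (simp add: algebra_simps)
  have "xi \<bullet> (G $ k *v p) = p \<bullet> (G $ k *v xi)" using sym_matrix_inner[OF sG, of xi k p] by (simp add: inner_commute)
  moreover have "Im (P_low g k x zeta) = xi \<bullet> (G $ k *v p) + p \<bullet> (G $ k *v xi)"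
   unfolding P_low_def zeta G inner_matrix_sum sum.distrib[symmetric] by (simp add: algebra_simps)
  ultimately show "Im (P_low g k x zeta) = Im (Complex (xi \<bullet> (G $ k *v xi) - p \<bullet> (G $ k *v p)) (2 * (p \<bullet> (G $ k *v xi))))" by simp
 qed
 have t1: "Re (\<Sum>j\<in>UNIV. \<Sum>k\<in>UNIV. of_real (H $ j $ k) * P_up g j x zeta * cnj (P_up g k x zeta)) = 4 * (a \<bullet> (H *v a)) + 4 * (b \<bullet> (H *v b))"
  unfolding up inner_matrix_sum sum_distrib_left sum.distrib[symmetric] by (simp add: algebra_simps)
 have dG: "(\<Sum>k\<in>UNIV. h $ k * (y \<bullet> (G $ k *v z))) = y \<bullet> (dirG G h *v z)" for h y z
  by (simp add: dirG_def inner_sum_right bounded_bilinear.sum_left[OF bounded_bilinear_matrix_vector] scaleR_matrix_vector_assoc[symmetric])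
 have t2: "Im (\<Sum>k\<in>UNIV. P_low g k x zeta * cnj (P_up g k x zeta)) = 4 * (p \<bullet> (dirG G a *v xi)) - 2 * (xi \<bullet> (dirG G b *v xi)) + 2 * (p \<bullet> (dirG G b *v p))"
  unfolding up low dG[symmetric] sum_distrib_left sum.distrib[symmetric] sum_subtractf[symmetric] by (simp add: algebra_simps)
 have "Q_form g d\<phi> d2\<phi> x xi 1 = (4 * (a \<bullet> (H *v a)) + 4 * (b \<bullet> (H *v b))) + (4 * (p \<bullet> (dirG G a *v xi)) - 2 * (xi \<bullet> (dirG G b *v xi)) + 2 * (p \<bullet> (dirG G b *v p)))"
  unfolding Q_form_def Q_nz_def Let_def zeta_def[symmetric] H_def[symmetric] t1 t2 by simp
 also have "... = 2 * (Bf A p H G xi + Bf A p H G p)"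
  unfolding Bf_def a_def[symmetric] b_def[symmetric] by (simp add: inner_commute algebra_simps)
 finally show ?thesis unfolding A_def p_def H_def .
qed

theorem theorem3p1:
  fixes g :: "real^'n \<Rightarrow> real^'n^'n"
    and lam Lam c\<^sub>0 :: real
    and \<Omega> :: "(real^'n) set"
    and \<phi> :: "real^'n \<Rightarrow> real"
    and d\<phi> :: "real^'n \<Rightarrow> real^'n"
    and d2\<phi> :: "real^'n \<Rightarrow> real^'n^'n"
  assumes "CARD('n) \<ge> 2"
    and "lam \<ge> 1" and "Lam > 0"
    and "\<And>x. transpose (g x) = g x"
    and "\<And>x \<xi>. inverse lam * (norm \<xi>)\<^sup>2 \<le> inner_g g x \<xi> \<xi>"
    and "\<And>x \<xi>. inner_g g x \<xi> \<xi> \<le> lam * (norm \<xi>)\<^sup>2"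
    and "\<And>x y. (\<Sum>i\<in>UNIV. \<Sum>j\<in>UNIV. \<bar>g x $ i $ j - g y $ i $ j\<bar>) \<le> Lam * norm (x - y)"
    and "open \<Omega>" and "bounded \<Omega>"
    and "C2_closure \<Omega> \<phi> d\<phi> d2\<phi>"
    and "\<And>x. x \<in> closure \<Omega> \<Longrightarrow> d\<phi> x \<noteq> 0"
    and "c\<^sub>0 > 0"
    and "AE x in lebesgue. x \<in> \<Omega> \<longrightarrow> (\<forall>\<xi> \<tau>.
           P_symb g x (zeta_vec d\<phi> x \<xi> \<tau>) = 0 \<and> zeta_vec d\<phi> x \<xi> \<tau> \<noteq> 0 \<longrightarrow>
           Q_form g d\<phi> d2\<phi> x \<xi> \<tau> \<ge> c\<^sub>0 * cnorm_sq_g g x (zeta_vec d\<phi> x \<xi> \<tau>))"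
  shows "\<exists>C>0. \<exists>\<tau>\<^sub>0>0. \<forall>u. test_function \<Omega> u \<longrightarrow> (\<forall>\<tau>\<ge>\<tau>\<^sub>0.
           \<tau> * (LINT x:\<Omega>|lebesgue.
                 (inner_g g x (grad_g g u x) (grad_g g u x) + \<tau>\<^sup>2 * (u x)\<^sup>2) * exp (2 * \<tau> * \<phi> x))
           \<le> C * (LINT x:\<Omega>|lebesgue. \<bar>laplace_g g u x\<bar>\<^sup>2 * exp (2 * \<tau> * \<phi> x)))"
proof -
 note lam = assms(2) and sym = assms(4) and low = assms(5) and up = assms(6) and lip = assms(7) and open_dom = assms(8) and bdd = assms(9)
  and C2 = assms(10) and nz = assms(11) and c0 = assms(12) and pc = assms(13)
 define A where "A = g_inv g"
 define cA where "cA = inverse lam ^ 3"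
 define CA where "CA = real CARD('n) * lam"
 define L where "L = real CARD('n) * (lam * Lam * lam)"
 have ell: "elliptic_coefficients A g cA CA L" unfolding A_def cA_def CA_def L_def by (rule elliptic_inverse_metric[OF lam sym low up lip])
 have gA: "g x *v (A x *v zeta) = zeta" for x zeta unfolding A_def by (rule elliptic_inverse_metric(2)[OF lam sym low up lip])
 interpret elliptic_coefficients A g cA CA L by (rule ell)
 have cp_on: "continuous_on (closure \<Omega>) d\<phi>" and cH_on: "continuous_on (closure \<Omega>) d2\<phi>"
  and d\<phi>: "!!x. x \<in> \<Omega> ==> (\<phi> has_derivative (%h. d\<phi> x \<bullet> h)) (at x)" and dp: "!!x. x \<in> \<Omega> ==> (d\<phi> has_derivative (%h. d2\<phi> x *v h)) (at x)"
  using C2 unfolding C2_closure_def gderiv_def by (auto simp: inner_commute)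
 have comp: "compact (closure \<Omega>)" using bdd by (simp add: compact_closure)
 obtain B1 where B1: "!!x. x \<in> closure \<Omega> ==> norm (d\<phi> x) <= B1"
  using compact_continuous_image[OF cp_on comp] by (meson bounded_iff compact_imp_bounded imageI)
 obtain B2 where B2: "!!x. x \<in> closure \<Omega> ==> norm (d2\<phi> x) <= B2"
  using compact_continuous_image[OF cH_on comp] by (meson bounded_iff compact_imp_bounded imageI)
 define Cp where "Cp = max B1 B2"
 obtain cp where cp: "cp > 0" "!!x. x \<in> closure \<Omega> ==> cp <= norm (d\<phi> x)"
 proof (cases "closure \<Omega> = {}")
  case True
  show thesis by (rule that[of 1]) (use True in auto)
 next
  case False
  obtain x0 where x0: "x0 \<in> closure \<Omega>" "!!x. x \<in> closure \<Omega> ==> norm (d\<phi> x0) <= norm (d\<phi> x)"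
   using continuous_attains_inf[OF comp False continuous_on_norm[OF cp_on]] by blast
  show thesis by (rule that[of "norm (d\<phi> x0)"]) (use x0 nz in auto)
 qed
 obtain G where G: "G \<in> borel_fun" "!!x. norm (G x) <= real CARD('n) * L" "!!x s. transpose (G x $ s) = G x $ s"
  "AE x in lborel. \<forall>s. ((%t. A (x + t *. axis s 1)) has_vector_derivative G x $ s) (at 0)"
  by (rule lipschitz_coefficients_derivative[OF lipA symA]) (rule that, assumption+)
 define c2 where "c2 = c\<^sub>0 * (inverse lam * cp^2) / 2"
 have c2: "c2 > 0" using c0 cp lam by (simp add: c2_def)
 have psc: "AE x in lborel. x \<in> \<Omega> --> (\<forall>xi. d\<phi> x \<bullet> (A x *v xi) = 0 & xi \<bullet> (A x *v xi) = d\<phi> x \<bullet> (A x *v d\<phi> x)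
    --> c2 <= Bf (A x) (d\<phi> x) (d2\<phi> x) (G x) xi + Bf (A x) (d\<phi> x) (d2\<phi> x) (G x) (d\<phi> x))"
  using pc[unfolded AE_completion_iff] G(4)
 proof eventually_elim
  case (elim x)
  show ?case
  proof (intro impI allI, elim conjE)
   fix xi assume x: "x \<in> \<Omega>" and o: "d\<phi> x \<bullet> (A x *v xi) = 0" and n: "xi \<bullet> (A x *v xi) = d\<phi> x \<bullet> (A x *v d\<phi> x)"
   have cl: "x \<in> closure \<Omega>" using x closure_subset by blast
   have Pz: "P_symb g x (zeta_vec d\<phi> x xi 1) = 0" by (rule symbol_zero) (use symA o n in "auto simp: A_def")
   have Z: "zeta_vec d\<phi> x xi 1 ~= 0"
   proof
    assume "zeta_vec d\<phi> x xi 1 = 0"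
    then have "Im (zeta_vec d\<phi> x xi 1 $ j) = 0" for j by simp
    then have "d\<phi> x = 0" by (simp add: zeta_vec_components vec_eq_iff)
    then show False using nz[OF cl] by simp
   qed
   have pd: "pdiff s (%y. g_inv g y $ j $ k) x = G x $ s $ j $ k" for s j k
   proof -
    have "((%t. A (x + t *. axis s 1) $ j $ k) has_vector_derivative G x $ s $ j $ k) (at 0)"
     using linear_vector_deriv[OF bounded_linear_vec_nth linear_vector_deriv[OF bounded_linear_vec_nth elim(2)[rule_format]]] .
    then show ?thesis unfolding pdiff_def A_def by (simp add: real_vector_deriv[symmetric] DERIV_imp_deriv)
   qed
   have "c\<^sub>0 * cnorm_sq_g g x (zeta_vec d\<phi> x xi 1) <= Q_form g d\<phi> d2\<phi> x xi 1" using elim(1) x Pz Z by blast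
   also have "... = 2 * (Bf (A x) (d\<phi> x) (d2\<phi> x) (G x) xi + Bf (A x) (d\<phi> x) (d2\<phi> x) (G x) (d\<phi> x))"
    unfolding A_def by (rule Q_form_eq[OF pd G(3)])
   finally have q: "c\<^sub>0 * cnorm_sq_g g x (zeta_vec d\<phi> x xi 1) <= ..." .
   have "inverse lam * cp^2 <= cnorm_sq_g g x (zeta_vec d\<phi> x xi 1)"
   proof -
    have c: "cnorm_sq_g g x (zeta_vec d\<phi> x xi 1) = inner_g g x xi xi + inner_g g x (d\<phi> x) (d\<phi> x)"
     by (simp add: cnorm_sq_g_def zeta_vec_components)
    have "inverse lam * cp^2 <= inverse lam * (norm (d\<phi> x))^2" using cp cl lam by (intro mult_left_mono power_mono) auto
    moreover have "0 <= inverse lam * (norm xi)^2" using lam by simp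
    ultimately show ?thesis unfolding c using low[of "d\<phi> x" x] low[of xi x] by linarith
   qed
   from order_trans[OF mult_left_mono[OF this less_imp_le[OF c0]] q]
   show "c2 <= Bf (A x) (d\<phi> x) (d2\<phi> x) (G x) xi + Bf (A x) (d\<phi> x) (d2\<phi> x) (G x) (d\<phi> x)" by (simp add: c2_def)
  qed
 qed
 interpret carleman_setting A g cA CA L \<Omega> \<phi> d\<phi> d2\<phi> Cp cp G "real CARD('n) * L" c2
  by unfold_locales (use open_dom bdd cp_on cH_on cp d\<phi> dp G c2 psc in "auto simp: Cp_def intro: order_trans[OF B1] order_trans[OF B2]")
 obtain C tau0 where C: "C > 0" and tau0: "tau0 > 0" and est: "\<forall>u U N T K. \<forall>tau\<ge>tau0. c3_compact_support u U N T K --> K <= \<Omega> -->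
   tau * (LI x. exp (2 * tau * \<phi> x) * ((norm (U x))^2 + tau^2 * (u x)^2))
    <= C * (LI x. exp (2 * tau * \<phi> x) * (A x \<bullet> N x + beta (G x) \<bullet> U x)^2)"
  using carleman_estimate by (elim exE conjE)
 show ?thesis
 proof (rule exI[of _ "(CA + 1) * C"], rule conjI, use C CA_nonneg in \<open>simp add: add_nonneg_pos\<close>, rule exI[of _ tau0], rule conjI[OF tau0], intro allI impI)
  fix u and tau :: real assume tu: "test_function \<Omega> u" and tau: "tau >= tau0"
  define K where "K = closure {x. u x ~= 0}"
  have K\<Omega>: "K <= \<Omega>" using tu by (simp add: test_function_def K_def)
  have c3: "c3_compact_support u (grad u) (hess u) (third_derivatives u) K" unfolding K_def by (rule test_function_c3[OF tu])
  interpret c3_compact_support u "grad u" "hess u" "third_derivatives u" K by (rule c3)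
  note ci = on_UNIV[OF cu] on_UNIV[OF cU] on_UNIV[OF cN]
   on_UNIV[OF cA_on] cphi_dom
  have out: "u x = 0" "grad u x = 0" "hess u x = 0" if "x ~: \<Omega>" for x using that K\<Omega> zero by blast+
  define F where "F x = exp (2 * tau * \<phi> x) * (grad u x \<bullet> (A x *v grad u x) + tau^2 * (u x)^2)" for x
  define F1 where "F1 x = exp (2 * tau * \<phi> x) * ((norm (grad u x))^2 + tau^2 * (u x)^2)" for x
  define Y where "Y x = exp (2 * tau * \<phi> x) * (A x \<bullet> hess u x + beta (G x) \<bullet> grad u x)^2" for x
  have iF: "integrable lborel F" "integrable lborel F1" unfolding F_def[abs_def] F1_def[abs_def]
   by (rule integrable_supported[OF K K\<Omega>]; use zero in "auto intro!: continuous_intros ci")+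
  have iY: "integrable lborel Y" unfolding Y_def[abs_def] by (rule laplacian_square_integrable[OF c3 K\<Omega>])
  have lhs: "(LINT x:\<Omega>|lebesgue. (inner_g g x (grad_g g u x) (grad_g g u x) + tau^2 * (u x)^2) * exp (2 * tau * \<phi> x)) = (LI x. F x)"
  proof -
   have "indicator \<Omega> x *. ((inner_g g x (grad_g g u x) (grad_g g u x) + tau^2 * (u x)^2) * exp (2 * tau * \<phi> x)) = F x" for x
    using out[of x] by (cases "x \<in> \<Omega>") (simp_all add: F_def inner_g_eq grad_g_def A_def[symmetric] gA inner_commute mult.commute)
   then show ?thesis unfolding set_lebesgue_integral_def using borel_measurable_integrable[OF iF(1)] by (simp add: integral_completion)
  qed
  have rhs: "(LINT x:\<Omega>|lebesgue. \<bar>laplace_g g u x\<bar>^2 * exp (2 * tau * \<phi> x)) = (LI x. Y x)"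
  proof -
   define f where "f x = indicator \<Omega> x *. (\<bar>laplace_g g u x\<bar>^2 * exp (2 * tau * \<phi> x))" for x
   have "AE x in lborel. f x = Y x" using G(4)
   proof eventually_elim
    case (elim x)
    have "laplace_g g u x = A x \<bullet> hess u x + beta (G x) \<bullet> grad u x"
    proof -
     have "pdiff i (%y. grad_g g u y $ i) x = (A x *v (hess u x *v axis i 1)) $ i + (G x $ i *v grad u x) $ i" for i
     proof -
      have "((%t. grad u (x + t *. axis i 1)) has_vector_derivative hess u x *v axis i 1) (at 0)"
       by (rule deriv_along_line[OF dU])
      from linear_vector_deriv[OF bounded_linear_vec_nth has_vector_derivative_matrix_vector[OF elim[rule_format, of i] this], of i]
      have "((%t. grad_g g u (x + t *. axis i 1) $ i) has_vector_derivative (A x *v (hess u x *v axis i 1)) $ i + (G x $ i *v grad u x) $ i) (at 0)"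
       by (simp add: grad_g_def A_def)
      then show ?thesis unfolding pdiff_def by (simp add: real_vector_deriv[symmetric] DERIV_imp_deriv)
     qed
     then show ?thesis unfolding laplace_g_def divergence_def
      by (simp add: sum.distrib symmetric_trace_product[OF symA] beta_inner[OF G(3)])
    qed
    then show ?case using out[of x] by (cases "x \<in> \<Omega>") (simp_all add: f_def Y_def mult.commute)
   qed
   then have ae: "AE x in lebesgue. f x = Y x" by (rule AE_completion)
   have mY: "Y \<in> borel_measurable lborel" using iY by (rule borel_measurable_integrable)
   have mY': "Y \<in> borel_measurable lebesgue" by (rule measurable_completion[OF mY])
   have "(\<integral>x. f x \<partial>lebesgue) = (\<integral>x. Y x \<partial>lebesgue)"
    by (rule integral_cong_AE[OF borel_measurable_lebesgue_AE[OF mY' ae] mY' ae])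
   then show ?thesis unfolding set_lebesgue_integral_def f_def using integral_completion[OF mY] by simp
  qed
  have FF: "(LI x. F x) <= (CA + 1) * (LI x. F1 x)"
  proof -
   have "(LI x. F x) <= (LI x. (CA + 1) * F1 x)"
   proof (rule integral_mono)
    show "F x <= (CA + 1) * F1 x" for x
    proof -
     have "grad u x \<bullet> (A x *v grad u x) <= norm (A x) * norm (grad u x) * norm (grad u x)" using inner_matrix_le[of "grad u x" "A x" "grad u x"] by linarith
     also have "... <= CA * (norm (grad u x))^2" using normA[of x] by (simp add: power2_eq_square mult.assoc mult_right_mono)
     finally have "grad u x \<bullet> (A x *v grad u x) + tau^2 * (u x)^2 <= (CA + 1) * ((norm (grad u x))^2 + tau^2 * (u x)^2)"
      using CA_nonneg by (simp add: algebra_simps) (smt (verit) mult_nonneg_nonneg zero_le_power2)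
     then have "exp (2 * tau * \<phi> x) * (grad u x \<bullet> (A x *v grad u x) + tau^2 * (u x)^2) <= exp (2 * tau * \<phi> x) * ((CA + 1) * ((norm (grad u x))^2 + tau^2 * (u x)^2))"
      by (intro mult_left_mono) auto
     then show ?thesis unfolding F_def F1_def by (simp only: mult.left_commute)
    qed
   qed (use iF in auto)
   then show ?thesis by simp
  qed
  have "tau * (LI x. F x) <= tau * ((CA + 1) * (LI x. F1 x))" using FF tau tau0 by (intro mult_left_mono) auto
  also have "... = (CA + 1) * (tau * (LI x. F1 x))" by simp
  also have "... <= (CA + 1) * (C * (LI x. Y x))"
   using est[rule_format, OF tau c3 K\<Omega>] CA_nonneg unfolding F1_def Y_def by (intro mult_left_mono) auto
  finally show "tau * (LINT x:\<Omega>|lebesgue. (inner_g g x (grad_g g u x) (grad_g g u x) + tau^2 * (u x)^2) * exp (2 * tau * \<phi> x))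
      <= (CA + 1) * C * (LINT x:\<Omega>|lebesgue. \<bar>laplace_g g u x\<bar>^2 * exp (2 * tau * \<phi> x))"
   unfolding lhs rhs by (simp add: mult.assoc)
 qed
qed

end
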